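(* Any pure S-ring over a CG-ring of odd characteristic is the tensor product of a dense pure S-ring and S-rings of rank $2$ over non-fields.
   Context: All rings are finite, commutative, with identity; the one-element ring is allowed. For a ring $R$, $R^+$ is the additive group, $R^\times$ the group of units, $\mathcal P(R)$ the set of primes dividing $|R|$; $R_p$ is the $p$-component of $R$ (the subring whose additive group is the Sylow $p$-subgroup of $R^+$), and $R_Q=\prod_{p\in Q}R_p$ for $Q\subset\mathcal P(R)$. $R$ is a CG-ring if for every $p\in\mathcal P(R)$ the ring $R_p$ is a Galois ring, i.e. a local ring with radical $pR_p$. S-ring over a finite group $G$: a subring $\mathcal A$ of $\mathbb Z G$ having a $\mathbb Z$-basis consisting of the elements $\sum_{x\in X}x$, where $X$ runs over a partition $\mathcal S(\mathcal A)$ of $G$ into non-empty sets (basic sets) such that $\{1\}\in\mathcal S(\mathcal A)$ and $X\in\mathcal S(\mathcal A)\Rightarrow X^{-1}\in\mathcal S(\mathcal A)$. Its rank is $|\mathcal S(\mathcal A)|$. S-ring over the ring $R$: an S-ring $\mathcal A$ over $R^+$ such that $uX\in\mathcal S(\mathcal A)$ for all $X\in\mathcal S(\mathcal A)$, $u\in R^\times$. $\mathcal A$ is dense if every ideal of $R$ is a union of basic sets of $\mathcal A$. For $X\subset R$, $I_{\rm L}(X)$ is the largest ideal $I$ of $R$ with $X+I=X$. $\mathcal A$ is pure if $I_{\rm L}(X)=0$ for some (equivalently, every) $X\in\mathcal S(\mathcal A)$ with $X\cap R^\times\ne\emptyset$. The tensor product of S-rings $\mathcal A_i$ over groups $G_i$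 is the S-ring over $\prod_iG_i$ with basic sets $\prod_iX_i$, $X_i\in\mathcal S(\mathcal A_i)$. The assertion means: there is a partition $\mathcal P(R)=Q_0\sqcup Q_1\sqcup\dots\sqcup Q_k$ ($k\ge 0$, $Q_0$ possibly empty) such that $\mathcal A=\mathcal A_0\otimes\mathcal A_1\otimes\dots\otimes\mathcal A_k$, where $\mathcal A_0$ is a dense pure S-ring over $R_{Q_0}$ and, for $i\ge1$, $R_{Q_i}$ is not a field and $\mathcal A_i$ is the S-ring of rank $2$ over $R_{Q_i}$. *)

theory Defs
  imports "HOL-Algebra.Product_Groups" "HOL-Algebra.Subrings" "HOL-Algebra.Sylow" "HOL-Library.Disjoint_Sets" "HOL-Library.Indicator_Function"
begin

section \<open>Integral group rings and S-rings over finite groups\<close>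

text \<open>
  For a finite group \<open>G\<close> an element of \<open>\<int>G\<close> is an integer-valued function vanishing outside
  \<open>carrier G\<close>; the element \<open>\<Sum>x\<in>X. x\<close> attached to a subset \<open>X\<close> of \<open>G\<close> is then \<open>indicator X\<close>.
\<close>

definition group_ring :: "('a, 'b) monoid_scheme \<Rightarrow> ('a \<Rightarrow> int) ring" where
  "group_ring G =
     \<lparr>carrier = {f. \<forall>x. x \<notin> carrier G \<longrightarrow> f x = 0},
      monoid.mult = (\<lambda>f g x. if x \<in> carrier G
                       then (\<Sum>y\<in>carrier G. f y * g (inv\<^bsub>G\<^esub> y \<otimes>\<^bsub>G\<^esub> x)) else 0),
      one = indicator {\<one>\<^bsub>G\<^esub>},
      ring.zero = (\<lambda>x. 0),
      ring.add = (\<lambda>f g x. f x + g x)\<rparr>"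

text \<open>The map \<open>\<int>G \<rightarrow> \<int>H\<close> induced by a map \<open>\<phi>\<close> from \<open>G\<close> to \<open>H\<close>.\<close>

definition group_ring_map ::
    "('a, 'c) monoid_scheme \<Rightarrow> ('a \<Rightarrow> 'b) \<Rightarrow> ('a \<Rightarrow> int) \<Rightarrow> ('b \<Rightarrow> int)" where
  "group_ring_map G \<phi> f = (\<lambda>y. \<Sum>x\<in>{x \<in> carrier G. \<phi> x = y}. f x)"

definition int_lincomb :: "('a \<Rightarrow> int) set \<Rightarrow> (('a \<Rightarrow> int) \<Rightarrow> int) \<Rightarrow> 'a \<Rightarrow> int" where
  "int_lincomb B c = (\<lambda>x. \<Sum>b\<in>B. c b * b x)"

definition int_span :: "('a \<Rightarrow> int) set \<Rightarrow> ('a \<Rightarrow> int) set" where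
  "int_span B = int_lincomb B ` (B \<rightarrow>\<^sub>E UNIV)"

definition int_basis :: "('a \<Rightarrow> int) set \<Rightarrow> ('a \<Rightarrow> int) set \<Rightarrow> bool" where
  "int_basis A B \<longleftrightarrow> finite B \<and> inj_on (int_lincomb B) (B \<rightarrow>\<^sub>E UNIV) \<and> int_span B = A"

definition is_basic_partition ::
    "('a, 'b) monoid_scheme \<Rightarrow> ('a \<Rightarrow> int) set \<Rightarrow> 'a set set \<Rightarrow> bool" where
  "is_basic_partition G A S \<longleftrightarrow>
     partition_on (carrier G) S \<and>
     int_basis A (indicator ` S) \<and>
     {\<one>\<^bsub>G\<^esub>} \<in> S \<and>
     (\<forall>X\<in>S. set_inv\<^bsub>G\<^esub> X \<in> S)"

definition S_ring :: "('a, 'b) monoid_scheme \<Rightarrow> ('a \<Rightarrow> int) set \<Rightarrow> bool" where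
  "S_ring G A \<longleftrightarrow>
     group G \<and> finite (carrier G) \<and> subring A (group_ring G) \<and> (\<exists>S. is_basic_partition G A S)"

text \<open>The partition is determined by the S-ring; see \<open>basic_sets_eq\<close> below.\<close>

definition basic_sets :: "('a, 'b) monoid_scheme \<Rightarrow> ('a \<Rightarrow> int) set \<Rightarrow> 'a set set" where
  "basic_sets G A = (THE S. is_basic_partition G A S)"

definition S_ring_rank :: "('a, 'b) monoid_scheme \<Rightarrow> ('a \<Rightarrow> int) set \<Rightarrow> nat" where
  "S_ring_rank G A = card (basic_sets G A)"

text \<open>
  An S-ring over \<open>product_group I G\<close>, whose elements are extensional functions on \<open>I\<close>: the basic
  sets are the boxes \<open>\<Prod>i\<in>I. X i\<close> of basic sets of the factors.
\<close>

definition S_ring_tensor ::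
    "'i set \<Rightarrow> ('i \<Rightarrow> ('a, 'b) monoid_scheme) \<Rightarrow> ('i \<Rightarrow> ('a \<Rightarrow> int) set) \<Rightarrow> (('i \<Rightarrow> 'a) \<Rightarrow> int) set"
  where
  "S_ring_tensor I G A =
     int_span (indicator ` {Pi\<^sub>E I X | X. \<forall>i\<in>I. X i \<in> basic_sets (G i) (A i)})"

lemma int_span_indicator_const:
  assumes "f \<in> int_span (indicator ` S)" and "disjoint S"
    and "Y \<in> S" "x \<in> Y" "y \<in> Y"
  shows "f x = f y"
proof -
  from assms(1) obtain c where f: "f = int_lincomb (indicator ` S) c"
    by (auto simp: int_span_def)
  have "b x = b y" if "b \<in> indicator ` S" for b :: "'a \<Rightarrow> int"
  proof -
    from that obtain Z where Z: "Z \<in> S" "b = indicator Z" by blast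
    then have "Z = Y \<or> Z \<inter> Y = {}" using assms(2,3) by (auto simp: disjoint_def)
    with Z(2) assms(4,5) show ?thesis by (auto simp: indicator_def)
  qed
  then show ?thesis
    unfolding f int_lincomb_def by (intro sum.cong) auto
qed

lemma is_basic_partition_mono:
  assumes "is_basic_partition G A S" "is_basic_partition G A T" "X \<in> S" "Y \<in> T" "x \<in> X" "x \<in> Y"
  shows "Y \<subseteq> X"
proof
  fix y assume "y \<in> Y"
  have "(indicator X :: 'a \<Rightarrow> int) \<in> int_span (indicator ` S)"
  proof -
    let ?B = "indicator ` S :: ('a \<Rightarrow> int) set"
    let ?c = "restrict (\<lambda>b. if b = indicator X then 1 else 0 :: int) ?B"
    have fin: "finite ?B"
      using assms(1) by (simp add: is_basic_partition_def int_basis_def)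
    have "int_lincomb ?B ?c = indicator X"
    proof
      fix z
      have "int_lincomb ?B ?c z = (\<Sum>b\<in>?B. if b = indicator X then b z else 0)"
        unfolding int_lincomb_def by (intro sum.cong) auto
      also have "\<dots> = indicator X z"
        using fin assms(3) by (simp add: sum.delta)
      finally show "int_lincomb ?B ?c z = indicator X z" .
    qed
    moreover have "?c \<in> ?B \<rightarrow>\<^sub>E UNIV" by auto
    ultimately show ?thesis unfolding int_span_def by (metis image_eqI)
  qed
  also have "int_span (indicator ` S) = int_span (indicator ` T :: ('a \<Rightarrow> int) set)"
    using assms(1,2) by (simp add: is_basic_partition_def int_basis_def)
  finally have "(indicator X x :: int) = indicator X y"
    using int_span_indicator_const[of _ T Y x y] assms(2,4,6) \<open>y \<in> Y\<close>
    by (auto simp: is_basic_partition_def partition_on_def)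
  with \<open>x \<in> X\<close> show "y \<in> X" by (auto simp: indicator_def split: if_splits)
qed

lemma is_basic_partition_unique:
  assumes "is_basic_partition G A S" "is_basic_partition G A T"
  shows "S = T"
proof -
  have "S \<subseteq> T" if S: "is_basic_partition G A S" and T: "is_basic_partition G A T" for S T
  proof
    fix X assume X: "X \<in> S"
    have p: "\<Union>S = carrier G" "{} \<notin> S"
      using S by (auto simp: is_basic_partition_def partition_on_def)
    with X have "X \<noteq> {}" by blast
    with X p(1) obtain x where x: "x \<in> X" "x \<in> carrier G" by blast
    then obtain Y where Y: "Y \<in> T" "x \<in> Y"
      using T by (auto simp: is_basic_partition_def partition_on_def)
    have "X = Y"
      using is_basic_partition_mono[OF S T X Y(1) x(1) Y(2)]
        is_basic_partition_mono[OF T S Y(1) X Y(2) x(1)] by blast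
    with Y show "X \<in> T" by simp
  qed
  with assms show ?thesis by blast
qed

lemma basic_sets_eq: "is_basic_partition G A S \<Longrightarrow> basic_sets G A = S"
  unfolding basic_sets_def by (rule the_equality) (assumption, rule is_basic_partition_unique)


section \<open>Components of finite commutative rings; CG-rings\<close>

definition ring_primes :: "('a, 'm) ring_scheme \<Rightarrow> nat set" where
  "ring_primes R = {p. Factorial_Ring.prime p \<and> p dvd card (carrier R)}"

definition ring_characteristic :: "('a, 'm) ring_scheme \<Rightarrow> nat" where
  "ring_characteristic R = group.ord (add_monoid R) \<one>\<^bsub>R\<^esub>"

definition sylow_part :: "('a, 'm) ring_scheme \<Rightarrow> nat \<Rightarrow> 'a set" where
  "sylow_part R p =
     (THE H. subgroup H (add_monoid R) \<and> card H = p ^ multiplicity p (card (carrier R)))"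

text \<open>
  The components below do not contain \<open>\<one>\<^bsub>R\<^esub>\<close> in general, so a component is not a subring in the
  sense of \<^locale>\<open>subring\<close>: it carries the operations of \<open>R\<close> but its own identity element.
\<close>

definition component_ring :: "('a, 'm) ring_scheme \<Rightarrow> 'a set \<Rightarrow> ('a, 'm) ring_scheme" where
  "component_ring R C =
     R\<lparr>carrier := C, one := (THE e. e \<in> C \<and> (\<forall>x\<in>C. e \<otimes>\<^bsub>R\<^esub> x = x))\<rparr>"

definition ring_component :: "('a, 'm) ring_scheme \<Rightarrow> nat \<Rightarrow> ('a, 'm) ring_scheme" where
  "ring_component R p = component_ring R (sylow_part R p)"

text \<open>
  The product of the rings \<open>ring_component R p\<close> for \<open>p\<close> in \<open>Q\<close>, as an internal direct product in \<open>R\<close>.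
\<close>

definition ring_components :: "('a, 'm) ring_scheme \<Rightarrow> nat set \<Rightarrow> ('a, 'm) ring_scheme" where
  "ring_components R Q =
     component_ring R {(\<Oplus>\<^bsub>R\<^esub>p\<in>Q. x p) | x. \<forall>p\<in>Q. x p \<in> carrier (ring_component R p)}"

definition local_ring :: "('a, 'm) ring_scheme \<Rightarrow> bool" where
  "local_ring R \<longleftrightarrow> cring R \<and> (\<exists>!M. maximalideal M R)"

definition jacobson_radical :: "('a, 'm) ring_scheme \<Rightarrow> 'a set" where
  "jacobson_radical R = carrier R \<inter> \<Inter>{M. maximalideal M R}"

definition galois_ring :: "nat \<Rightarrow> ('a, 'm) ring_scheme \<Rightarrow> bool" where
  "galois_ring p R \<longleftrightarrow>
     local_ring R \<and> jacobson_radical R = (\<lambda>x. [p] \<cdot>\<^bsub>R\<^esub> x) ` carrier R"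

definition CG_ring :: "('a, 'm) ring_scheme \<Rightarrow> bool" where
  "CG_ring R \<longleftrightarrow>
     cring R \<and> finite (carrier R) \<and> (\<forall>p\<in>ring_primes R. galois_ring p (ring_component R p))"


section \<open>S-rings over rings\<close>

definition ring_S_ring :: "('a, 'm) ring_scheme \<Rightarrow> ('a \<Rightarrow> int) set \<Rightarrow> bool" where
  "ring_S_ring R A \<longleftrightarrow>
     cring R \<and> S_ring (add_monoid R) A \<and>
     (\<forall>X\<in>basic_sets (add_monoid R) A. \<forall>u\<in>Units R. u <#\<^bsub>R\<^esub> X \<in> basic_sets (add_monoid R) A)"

definition dense_S_ring :: "('a, 'm) ring_scheme \<Rightarrow> ('a \<Rightarrow> int) set \<Rightarrow> bool" where
  "dense_S_ring R A \<longleftrightarrow> (\<forall>I. ideal I R \<longrightarrow> (\<exists>T\<subseteq>basic_sets (add_monoid R) A. I = \<Union>T))"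

definition ideal_stabilizer :: "('a, 'm) ring_scheme \<Rightarrow> 'a set \<Rightarrow> 'a set" where
  "ideal_stabilizer R X = (GREATEST I. ideal I R \<and> X <+>\<^bsub>R\<^esub> I = X)"

definition pure_S_ring :: "('a, 'm) ring_scheme \<Rightarrow> ('a \<Rightarrow> int) set \<Rightarrow> bool" where
  "pure_S_ring R A \<longleftrightarrow>
     (\<exists>X\<in>basic_sets (add_monoid R) A. X \<inter> Units R \<noteq> {} \<and> ideal_stabilizer R X = {\<zero>\<^bsub>R\<^esub>})"

end

theory Submission
  imports Defs "HOL-Number_Theory.Cong"
begin

text \<open>
  Let \<open>X\<close> be the basic set of the identity. Counting \<open>p\<close>-tuples of elements of a union of basic sets
  \<open>S\<close> with a given sum modulo \<open>p\<close>, where rotation of tuples leaves only the constant ones, shows that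
  for suitable \<open>S\<close> the points at which \<open>S\<close> is not invariant under translation by the multiples of
  \<open>p\<^sup>a\<^sup>-\<^sup>1\<close> in the \<open>p\<close>-component lie, up to their \<open>p\<close>-components, in a union of basic sets. Applied to
  \<open>X\<close> and to the orbit of \<open>X\<close> under the units, and combined with purity, this attaches to every prime
  \<open>p\<close> such that \<open>X\<close> meets the maximal ideal at \<open>p\<close> a set \<open>D p\<close> of primes for which the part of \<open>R\<close> on
  \<open>D p\<close> and its complement are both unions of basic sets, every basic set is a product along
  this decomposition, and the factor on \<open>D p\<close> has rank \<open>2\<close>. On the remaining primes the basic set of
  the identity consists of units; there the ideals generated by \<open>p\<^sup>i\<close> in a single component are shown to
  be unions of basic sets by downward induction on \<open>i\<close>, which is density.
\<close>

section \<open>Products of local rings inside a commutative ring\<close>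

text \<open>An S-ring over \<open>R\<close> respects only multiplication by units. Two devices
  bridge the gap to ideals. Since 2 is invertible, every element is a difference of two units, so a
  subset of \<open>C\<close> containing 0 and closed under sums and units is an ideal. And for a
  union \<open>B\<close> of basic sets the loss at \<open>g\<close>, the number of \<open>x\<close>
  in \<open>B\<close> with \<open>x + g\<close> outside \<open>B\<close>, depends only on the basic
  set of \<open>g\<close>. The obstacle is mixing of primes: the least A-ideal containing the
  generator \<open>hh p\<close> of the minimal ideal at \<open>p\<close> might reach another prime
  \<open>t\<close>. Two incompatible estimates exclude this. The loss of the basic set of the
  identity at \<open>hh p\<close> is at most one half when that set meets the maximal ideal at
  \<open>p\<close>; but where it consists of units at \<open>t\<close>, and the component at
  \<open>t\<close> is no field, it meets each coset of the minimal ideal at \<open>t\<close> in at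
  most a third of the points, as a proper subgroup of a group of odd exponent has index at least 3.
  The set \<open>D p\<close> is read off from a maximal proper A-ideal \<open>Mp p\<close>, which
  avoids the unit orbit of that basic set.\<close>

text \<open>
  The ring under study is the ideal \<open>e * T\<close> of an ambient ring \<open>T\<close>, where \<open>e\<close> is the sum of the orthogonal
  idempotents \<open>ep p\<close>; \<open>RS S\<close> is the component on a set \<open>S\<close> of primes and \<open>E S\<close> its identity element,
  and \<open>hh p\<close> generates the minimal ideal of the \<open>p\<close>-component.
\<close>

locale cg_data =
  fixes P :: "nat set" and ep :: "nat \<Rightarrow> 'a::comm_ring_1" and nn :: "nat \<Rightarrow> nat"
  assumes finP: "finite P"
    and prime_P: "p \<in> P \<Longrightarrow> prime p"
    and odd_P: "p \<in> P \<Longrightarrow> odd p"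
    and idem: "p \<in> P \<Longrightarrow> ep p * ep p = ep p"
    and orth: "p \<in> P \<Longrightarrow> q \<in> P \<Longrightarrow> p \<noteq> q \<Longrightarrow> ep p * ep q = 0"
    and nn_pos: "p \<in> P \<Longrightarrow> 0 < nn p"
    and nil: "p \<in> P \<Longrightarrow> of_nat p ^ nn p * ep p = 0"
    and not_nil: "p \<in> P \<Longrightarrow> of_nat p ^ (nn p - 1) * ep p \<noteq> 0"
    and loc: "p \<in> P \<Longrightarrow> (\<exists>y. ep p * x * y = ep p) \<or> (\<exists>y. ep p * x = of_nat p * ep p * y)"
    and finC: "finite {x. (\<Sum>p\<in>P. ep p) * x = x}"
begin

definition E :: "nat set \<Rightarrow> 'a" where "E S = (\<Sum>p\<in>S. ep p)"
definition C :: "'a set" where "C = {x. E P * x = x}"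
abbreviation e :: 'a where "e \<equiv> E P"
definition Us :: "'a set" where "Us = {u\<in>C. \<exists>v\<in>C. u * v = e}"
definition un :: "nat \<Rightarrow> 'a \<Rightarrow> bool" where "un p x \<longleftrightarrow> (\<exists>y. ep p * x * y = ep p)"
text \<open>Only the \<open>p\<close>-component is restricted: this is the preimage of the
  \<open>i\<close>-th power of the maximal ideal at \<open>p\<close>. In particular
  \<open>Lv p 1\<close> is the maximal ideal of the whole ring belonging to
  \<open>p\<close>.\<close>

definition Lv :: "nat \<Rightarrow> nat \<Rightarrow> 'a set" where
  "Lv p i = {x\<in>C. \<exists>y. ep p * x = of_nat p ^ i * ep p * y}"
definition hh :: "nat \<Rightarrow> 'a" where "hh p = of_nat p ^ (nn p - 1) * ep p"
definition is_ideal :: "'a set \<Rightarrow> bool" where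
  "is_ideal I \<longleftrightarrow> I \<subseteq> C \<and> 0 \<in> I \<and> (\<forall>x\<in>I. \<forall>y\<in>I. x + y \<in> I) \<and> (\<forall>r. \<forall>x\<in>I. r * x \<in> I)"
definition RS :: "nat set \<Rightarrow> 'a set" where "RS S = {x. E S * x = x}"
text \<open>Multiplication by \<open>lift p v\<close> acts as \<open>v\<close> at \<open>p\<close>
  and as the identity at all other primes. These are the elements that vary a single
  component.\<close>

definition lift :: "nat \<Rightarrow> 'a \<Rightarrow> 'a" where "lift p v = ep p * v + (e - ep p)"

lemma finite_C [simp]: "finite C" using finC by (simp add: C_def E_def)

lemma ep_E: assumes "p \<in> P" "S \<subseteq> P" shows "ep p * E S = (if p \<in> S then ep p else 0)"
proof -
  have "finite S" using assms finP by (metis finite_subset)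
  have "ep p * E S = (\<Sum>q\<in>S. if q = p then ep p else 0)"
    unfolding E_def sum_distrib_left using assms idem orth by (intro sum.cong) auto
  then show ?thesis using \<open>finite S\<close> by (simp add: sum.delta)
qed

lemma E_E: assumes "S \<subseteq> P" "T \<subseteq> P" shows "E S * E T = E (S \<inter> T)"
proof -
  have fin: "finite S" "finite T" using assms finP finite_subset by auto
  have "E S * E T = (\<Sum>p\<in>S. ep p * E T)" by (simp add: E_def sum_distrib_right)
  also have "\<dots> = (\<Sum>p\<in>S. if p \<in> T then ep p else 0)" using assms ep_E by (intro sum.cong) auto
  also have "\<dots> = E (S \<inter> T)" unfolding E_def using fin by (simp add: sum.inter_restrict)
  finally show ?thesis .
qed

lemma ep_e [simp]: "p \<in> P \<Longrightarrow> ep p * e = ep p" by (simp add: ep_E)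
lemma e_ep [simp]: "p \<in> P \<Longrightarrow> e * ep p = ep p" by (simp add: ep_E mult.commute)
lemma e_e [simp]: "e * e = e" by (simp add: E_E)
lemma e_C [simp]: "e \<in> C" by (simp add: C_def)
lemma ep_C [simp]: "p \<in> P \<Longrightarrow> ep p \<in> C" by (simp add: C_def)
lemma zero_C [simp]: "0 \<in> C" by (simp add: C_def)
lemma add_C [simp]: "x \<in> C \<Longrightarrow> y \<in> C \<Longrightarrow> x + y \<in> C" by (simp add: C_def algebra_simps)
lemma minus_C [simp]: "x \<in> C \<Longrightarrow> y \<in> C \<Longrightarrow> x - y \<in> C" by (simp add: C_def algebra_simps)
lemma uminus_C [simp]: "x \<in> C \<Longrightarrow> - x \<in> C" by (simp add: C_def algebra_simps)
lemma multr_C [simp]: "x \<in> C \<Longrightarrow> r * x \<in> C" by (simp add: C_def mult.left_commute)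
lemma multl_C [simp]: "x \<in> C \<Longrightarrow> x * r \<in> C" using multr_C[of x r] by (simp add: mult.commute)
lemma e_mult [simp]: "x \<in> C \<Longrightarrow> e * x = x" by (simp add: C_def)
lemma mult_e [simp]: "x \<in> C \<Longrightarrow> x * e = x" by (simp add: C_def mult.commute)
lemma sum_C: "(\<And>x. x \<in> A \<Longrightarrow> f x \<in> C) \<Longrightarrow> sum f A \<in> C"
  by (induction A rule: infinite_finite_induct) auto

lemma idem_left [simp]: "p \<in> P \<Longrightarrow> ep p * (ep p * x) = ep p * x"
  by (metis idem mult.assoc)
lemma orth_left: "p \<in> P \<Longrightarrow> q \<in> P \<Longrightarrow> p \<noteq> q \<Longrightarrow> ep p * (ep q * x) = 0"
  by (metis orth mult.assoc mult_zero_left)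
lemma e_left [simp]: "p \<in> P \<Longrightarrow> ep p * (e * x) = ep p * x"
  by (metis ep_e mult.assoc)

lemma sum_ep: "x \<in> C \<Longrightarrow> (\<Sum>p\<in>P. ep p * x) = x"
  by (metis E_def e_mult sum_distrib_right)

lemma C_eqI: assumes "x \<in> C" "y \<in> C" "\<And>p. p \<in> P \<Longrightarrow> ep p * x = ep p * y" shows "x = y"
  using sum_ep[OF assms(1)] sum_ep[OF assms(2)] assms(3) by (metis (mono_tags, lifting) sum.cong)

lemma ep_sum: assumes "p \<in> P" shows "ep p * (\<Sum>q\<in>P. ep q * f q) = ep p * f p"
proof -
  have "ep p * (\<Sum>q\<in>P. ep q * f q) = (\<Sum>q\<in>P. if q = p then ep p * f p else 0)"
    unfolding sum_distrib_left using assms orth_left by (intro sum.cong) auto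
  then show ?thesis using assms finP by (simp add: sum.delta)
qed

lemma E_C [simp]: "S \<subseteq> P \<Longrightarrow> E S \<in> C" using E_E[of P S] by (simp add: C_def Int_absorb1 del: e_mult mult_e)

lemma ep_E_left: "p \<in> P \<Longrightarrow> S \<subseteq> P \<Longrightarrow> ep p * (E S * x) = (if p \<in> S then ep p * x else 0)"
  by (metis ep_E mult.assoc mult_zero_left)

lemma RS_iff: assumes "S \<subseteq> P"
  shows "x \<in> RS S \<longleftrightarrow> x \<in> C \<and> (\<forall>p\<in>P - S. ep p * x = 0)"
proof
  assume "x \<in> RS S"
  then have x: "E S * x = x" by (simp add: RS_def)
  then have "e * x = x" using E_E[of P S] assms by (metis Int_absorb1 mult.assoc order_refl)
  moreover have "ep p * x = 0" if "p \<in> P - S" for p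
    using ep_E_left[of p S x] that assms x by auto
  ultimately show "x \<in> C \<and> (\<forall>p\<in>P - S. ep p * x = 0)" unfolding C_def by blast
next
  assume x: "x \<in> C \<and> (\<forall>p\<in>P - S. ep p * x = 0)"
  have "E S * x = x"
  proof (rule C_eqI)
    fix p assume "p \<in> P"
    then show "ep p * (E S * x) = ep p * x" using ep_E_left[of p S x] assms x by auto
  qed (use x in auto)
  then show "x \<in> RS S" by (simp add: RS_def)
qed

subsection \<open>Units\<close>

lemma un_unit: "u \<in> Us \<Longrightarrow> p \<in> P \<Longrightarrow> un p u"
proof -
  assume "u \<in> Us" and p: "p \<in> P"
  then obtain v where v: "u * v = e" unfolding Us_def by blast
  have "ep p * u * v = ep p * (u * v)" by (rule mult.assoc)
  then have "ep p * u * v = ep p" unfolding v using p by simp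
  then show "un p u" unfolding un_def by blast
qed

lemma Us_iff: "u \<in> Us \<longleftrightarrow> u \<in> C \<and> (\<forall>p\<in>P. un p u)"
proof
  show "u \<in> Us \<Longrightarrow> u \<in> C \<and> (\<forall>p\<in>P. un p u)" using un_unit by (auto simp: Us_def)
next
  assume u: "u \<in> C \<and> (\<forall>p\<in>P. un p u)"
  then obtain y where y: "\<And>p. p \<in> P \<Longrightarrow> ep p * u * y p = ep p" unfolding un_def by metis
  define v where "v = (\<Sum>p\<in>P. ep p * y p)"
  have v: "v \<in> C" unfolding v_def by (intro sum_C) auto
  have "u * v = e"
  proof (rule C_eqI)
    fix p assume p: "p \<in> P"
    have "ep p * (u * v) = u * (ep p * v)" by (simp add: algebra_simps)
    also have "\<dots> = ep p * u * y p" unfolding v_def ep_sum[OF p] by (simp add: algebra_simps)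
    finally show "ep p * (u * v) = ep p * e" using y p by simp
  qed (use u v in auto)
  then show "u \<in> Us" using u v by (auto simp: Us_def)
qed

lemma pow_ep: "p \<in> P \<Longrightarrow> nn p \<le> i \<Longrightarrow> of_nat p ^ i * ep p = 0"
  by (metis le_add_diff_inverse2 mult.assoc mult_zero_right nil power_add)

lemma ep_nz: "p \<in> P \<Longrightarrow> ep p \<noteq> 0" using not_nil by fastforce

text \<open>If a multiple of \<open>p\<close> were invertible at \<open>p\<close>, then
  \<open>ep p\<close> would equal a nilpotent multiple of itself and vanish. So the two alternatives
  of \<open>loc\<close> exclude each other.\<close>

lemma not_un_iff: assumes p: "p \<in> P"
  shows "\<not> un p x \<longleftrightarrow> (\<exists>y. ep p * x = of_nat p * ep p * y)"
proof
  show "\<not> un p x \<Longrightarrow> \<exists>y. ep p * x = of_nat p * ep p * y" using loc[OF p, of x] by (auto simp: un_def)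
next
  assume "\<exists>y. ep p * x = of_nat p * ep p * y"
  then obtain y where y: "ep p * x = of_nat p * ep p * y" by blast
  show "\<not> un p x"
  proof
    assume "un p x"
    then obtain z where z: "ep p * x * z = ep p" by (auto simp: un_def)
    have "ep p = (ep p * x) * z" using z by simp
    then have *: "ep p = of_nat p * (y * z) * ep p" unfolding y by (simp add: algebra_simps)
    have "ep p = (of_nat p * (y * z)) ^ k * ep p" for k
    proof (induction k)
      case (Suc k)
      have "(of_nat p * (y * z)) ^ Suc k * ep p = (of_nat p * (y * z)) * ((of_nat p * (y * z)) ^ k * ep p)"
        by (simp add: algebra_simps)
      then show ?case using Suc * by simp
    qed simp
    from this[of "nn p"] have "ep p = (y * z) ^ nn p * (of_nat p ^ nn p * ep p)"
      by (simp add: power_mult_distrib algebra_simps)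
    then show False using nil[OF p] ep_nz[OF p] by simp
  qed
qed

lemma not_un_Lv: "p \<in> P \<Longrightarrow> x \<in> C \<Longrightarrow> \<not> un p x \<longleftrightarrow> x \<in> Lv p 1"
  by (simp add: not_un_iff Lv_def)

lemma un_add: assumes p: "p \<in> P" and "un p x" "\<not> un p y" shows "un p (x + y)"
proof (rule ccontr)
  assume "\<not> un p (x + y)"
  then obtain a b where "ep p * (x + y) = of_nat p * ep p * a" "ep p * y = of_nat p * ep p * b"
    using assms not_un_iff by metis
  then have "ep p * x = of_nat p * ep p * (a - b)" by (simp add: algebra_simps)
  then show False using assms not_un_iff by blast
qed

lemma un_mult: "p \<in> P \<Longrightarrow> un p (x * y) \<longleftrightarrow> un p x \<and> un p y"
proof
  assume p: "p \<in> P"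
  show "un p (x * y)" if "un p x \<and> un p y"
  proof -
    obtain a b where a: "ep p * x * a = ep p" and b: "ep p * y * b = ep p" using \<open>un p x \<and> un p y\<close> by (auto simp: un_def)
    have "ep p * (x * y) * (a * b) = (ep p * x * a) * (y * b)" by (simp add: algebra_simps)
    also have "\<dots> = ep p" using b a by (simp add: mult.assoc)
    finally show ?thesis by (auto simp: un_def)
  qed
  show "un p x \<and> un p y" if "un p (x * y)"
  proof -
    obtain a where "ep p * (x * y) * a = ep p" using \<open>un p (x*y)\<close> by (auto simp: un_def)
    then have "ep p * x * (y * a) = ep p" "ep p * y * (x * a) = ep p" by (simp_all add: algebra_simps)
    then show ?thesis unfolding un_def by blast
  qed
qed

lemma un_ep_cong: "ep p * x = ep p * y \<Longrightarrow> un p x \<longleftrightarrow> un p y" by (simp add: un_def)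
lemma un_e [simp]: "p \<in> P \<Longrightarrow> un p e" by (simp add: un_def) (metis ep_e)
lemma un_one [simp]: "un p 1" by (simp add: un_def) (metis mult.right_neutral)
lemma un_uminus: "un p (- x) \<longleftrightarrow> un p x" unfolding un_def by (metis minus_mult_commute minus_mult_minus mult_minus_right)

text \<open>Bezout makes \<open>k\<close> invertible modulo \<open>p^nn p\<close>, and that power
  annihilates the component at \<open>p\<close>.\<close>

lemma un_of_nat: assumes "p \<in> P" "\<not> p dvd k" shows "un p (of_nat k)"
proof -
  have "coprime k (p ^ nn p)" using assms prime_P
    by (metis coprime_commute coprime_power_right_iff prime_imp_coprime)
  then obtain a b :: int where ab: "a * int k + b * int (p ^ nn p) = 1"
    by (metis bezout_int coprime_imp_gcd_eq_1 coprime_int_iff)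
  have "of_int (a * int k + b * int (p ^ nn p)) * ep p = ep p" unfolding ab by simp
  then have "ep p * of_nat k * of_int a + of_int b * (of_nat p ^ nn p * ep p) = ep p"
    by (simp add: distrib_right mult.assoc) (simp add: algebra_simps)
  then show ?thesis using nil[OF assms(1)] by (auto simp: un_def)
qed

lemma un_two: "p \<in> P \<Longrightarrow> un p 2"
proof -
  assume p: "p \<in> P"
  have "\<not> p dvd 2" using prime_P[OF p] odd_P[OF p]
    by (metis even_numeral dvd_triv_left prime_nat_iff primes_dvd_imp_eq two_is_prime_nat even_Suc_Suc_iff numeral_2_eq_2 odd_one)
  from un_of_nat[OF p this] show ?thesis by simp
qed

lemma e_Un [simp]: "e \<in> Us" by (simp add: Us_iff)
lemma Us_C [simp]: "u \<in> Us \<Longrightarrow> u \<in> C" by (simp add: Us_def)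
lemma Us_mult [simp]: "u \<in> Us \<Longrightarrow> v \<in> Us \<Longrightarrow> u * v \<in> Us" by (simp add: Us_iff un_mult)
lemma Us_uminus [simp]: "u \<in> Us \<Longrightarrow> - u \<in> Us" by (simp add: Us_iff un_uminus)
definition uinv :: "'a \<Rightarrow> 'a" where "uinv u = (SOME v. v \<in> Us \<and> u * v = e)"
lemma uinv: assumes "u \<in> Us" shows "uinv u \<in> Us" "u * uinv u = e" "uinv u * u = e"
proof -
  obtain v where v: "v \<in> C" "u * v = e" using assms unfolding Us_def by blast
  have "v * u = e" using v(2) by (metis mult.commute)
  then have "v \<in> Us" using v(1) Us_C[OF assms] unfolding Us_def by blast
  then have "\<exists>v. v \<in> Us \<and> u * v = e" using v(2) by blast
  from someI_ex[OF this] have "uinv u \<in> Us \<and> u * uinv u = e" by (simp add: uinv_def)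
  then show "uinv u \<in> Us" "u * uinv u = e" "uinv u * u = e" by (auto simp: mult.commute[of "uinv u"])
qed
lemma inv_cancel: assumes "u \<in> Us" "x \<in> C" shows "u * (uinv u * x) = x" "uinv u * (u * x) = x"
  unfolding mult.assoc[symmetric] uinv(2,3)[OF assms(1)] using assms(2) by simp_all
lemma lift_C [simp]: "p \<in> P \<Longrightarrow> lift p v \<in> C" by (simp add: lift_def)
lemma lift_ep [simp]: "p \<in> P \<Longrightarrow> ep p * lift p v = ep p * v"
  unfolding lift_def distrib_left right_diff_distrib by (simp add: idem)
lemma lift_other: "p \<in> P \<Longrightarrow> q \<in> P \<Longrightarrow> q \<noteq> p \<Longrightarrow> ep q * lift p v = ep q"
  unfolding lift_def distrib_left right_diff_distrib by (simp add: orth_left orth)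

lemma un_lift: assumes "p \<in> P" "q \<in> P" shows "un q (lift p v) \<longleftrightarrow> (if q = p then un p v else True)"
proof (cases "q = p")
  case True
  then show ?thesis using un_ep_cong[OF lift_ep[OF assms(1)]] by simp
next
  case False
  have "ep q * lift p v = ep q * e" using lift_other[OF assms False] assms by simp
  from un_ep_cong[OF this] show ?thesis using False assms by simp
qed

lemma lift_Us: "p \<in> P \<Longrightarrow> un p v \<Longrightarrow> lift p v \<in> Us" by (simp add: Us_iff un_lift)
lemma lift_mult: "p \<in> P \<Longrightarrow> x \<in> C \<Longrightarrow> lift p v * x = ep p * v * x + (x - ep p * x)"
  by (simp add: lift_def algebra_simps)

text \<open>Prime by prime, \<open>r = 2 r - r\<close> where \<open>r\<close> is a unit and
  \<open>r = (e + r) - e\<close> where it is not. The first identity needs 2 to be a unit, hence odd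
  primes.\<close>

lemma unit_diff: assumes "r \<in> C" shows "\<exists>u\<in>Us. \<exists>v\<in>Us. r = u - v"
proof -
  define f where "f p = (if un p r then r else e)" for p
  define v where "v = (\<Sum>p\<in>P. ep p * f p)"
  have v: "ep p * v = ep p * f p" if "p \<in> P" for p unfolding v_def using ep_sum that by blast
  have vC: "v \<in> C" unfolding v_def by (intro sum_C) auto
  have "un p v" if p: "p \<in> P" for p using un_ep_cong[OF v[OF p]] p by (auto simp: f_def)
  then have "v \<in> Us" using vC by (auto simp: Us_iff)
  moreover have "un p (r + v)" if p: "p \<in> P" for p
  proof (cases "un p r")
    case True
    have "ep p * (r + v) = ep p * (2 * r)" using v[OF p] True by (simp add: f_def algebra_simps)
    then show ?thesis using un_ep_cong un_mult un_two p True by metis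
  next
    case False
    have "ep p * (r + v) = ep p * (e + r)" using v[OF p] False by (simp add: f_def algebra_simps)
    then show ?thesis using un_ep_cong un_add False p un_e by metis
  qed
  then have "r + v \<in> Us" using vC assms by (auto simp: Us_iff)
  ultimately show ?thesis by (metis add_diff_cancel_right')
qed

text \<open>Each component is a chain ring: after division by the largest possible power of
  \<open>p\<close> the cofactor is no longer divisible by \<open>p\<close>, hence invertible at
  \<open>p\<close>, and \<open>lift\<close> makes it a unit at every prime.\<close>

lemma level: assumes p: "p \<in> P" and x: "ep p * x \<noteq> 0"
  shows "\<exists>i<nn p. \<exists>v\<in>Us. ep p * x = of_nat p ^ i * ep p * v"
proof -
  define Q where "Q i \<longleftrightarrow> (\<exists>y. ep p * x = of_nat p ^ i * ep p * y)" for i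
  have bound: "i < nn p" if "Q i" for i
  proof (rule ccontr)
    assume "\<not> i < nn p"
    then have "of_nat p ^ i * ep p = 0" using pow_ep p by simp
    then show False using that x by (auto simp: Q_def)
  qed
  have "Q 0" by (auto simp: Q_def)
  then obtain i where i: "Q i" "\<And>j. Q j \<Longrightarrow> j \<le> i"
    using GreatestI_ex_nat[of Q "nn p"] Greatest_le_nat[of Q _ "nn p"] bound by (metis less_imp_le)
  then obtain y where y: "ep p * x = of_nat p ^ i * ep p * y" by (auto simp: Q_def)
  have "un p y"
  proof (rule ccontr)
    assume "\<not> un p y"
    then obtain z where z: "ep p * y = of_nat p * ep p * z" using not_un_iff p by blast
    have "ep p * x = of_nat p ^ i * (ep p * y)" using y by (simp add: algebra_simps)
    then have "ep p * x = of_nat p ^ Suc i * ep p * z" unfolding z by (simp add: algebra_simps)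
    then have "Q (Suc i)" by (auto simp: Q_def)
    then show False using i(2) by fastforce
  qed
  then have "lift p y \<in> Us" using lift_Us p by blast
  moreover have "ep p * x = of_nat p ^ i * ep p * lift p y" using y lift_ep[OF p, of y] by (simp add: mult.assoc)
  ultimately show ?thesis using bound[OF i(1)] by blast
qed

text \<open>Units of this shape move a point only by a multiple of \<open>p^i\<close> times its
  \<open>p\<close>-component. With \<open>r\<close> and \<open>i\<close> adapted to that component
  they produce a prescribed translation.\<close>

lemma Us_add_nil: assumes "p \<in> P" "1 \<le> i" shows "e + of_nat p ^ i * ep p * r \<in> Us"
proof -
  have "un q (e + of_nat p ^ i * ep p * r)" if q: "q \<in> P" for q
  proof (cases "q = p")
    case True
    have "of_nat p ^ i * ep p * r = of_nat p * ep p * (of_nat p ^ (i - 1) * r)"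
      using assms by (cases i) (auto simp: algebra_simps)
    moreover have "ep p * (of_nat p * ep p * (of_nat p ^ (i - 1) * r)) = of_nat p * ep p * (of_nat p ^ (i - 1) * r)"
      using idem_left[OF assms(1), of "of_nat p * (of_nat p ^ (i - 1) * r)"] by (simp add: mult.left_commute mult.assoc)
    ultimately have "\<not> un p (of_nat p ^ i * ep p * r)" using not_un_iff[OF assms(1)] by metis
    then show ?thesis using un_add assms un_e True by blast
  next
    case False
    have "ep q * (e + of_nat p ^ i * ep p * r) = ep q * (e + of_nat p ^ i * r * (ep p * 0))"
      using orth_left[OF q assms(1) False, of "of_nat p ^ i * r"] q by (simp add: algebra_simps)
    then show ?thesis using un_ep_cong un_e q by (metis add.right_neutral mult_zero_right)
  qed
  then show ?thesis using assms by (auto simp: Us_iff)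
qed

subsection \<open>Ideals\<close>

lemma is_idealD: assumes "is_ideal I" shows "I \<subseteq> C" "0 \<in> I" "x \<in> I \<Longrightarrow> y \<in> I \<Longrightarrow> x + y \<in> I" "x \<in> I \<Longrightarrow> r * x \<in> I"
   "x \<in> I \<Longrightarrow> x * r \<in> I" "x \<in> I \<Longrightarrow> - x \<in> I" "x \<in> I \<Longrightarrow> y \<in> I \<Longrightarrow> x - y \<in> I" "x \<in> I \<Longrightarrow> x \<in> C" "finite I"
proof -
  show 1: "I \<subseteq> C" "0 \<in> I" "x \<in> I \<Longrightarrow> y \<in> I \<Longrightarrow> x + y \<in> I" "x \<in> I \<Longrightarrow> r * x \<in> I" for x y r
    using assms by (auto simp: is_ideal_def)
  show "x \<in> I \<Longrightarrow> x * r \<in> I" using 1 by (metis mult.commute)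
  show 2: "x \<in> I \<Longrightarrow> - x \<in> I" for x using 1(4)[of x "-1"] by simp
  show "x \<in> I \<Longrightarrow> y \<in> I \<Longrightarrow> x - y \<in> I" using 1(3)[OF _ 2, of x y] by simp
  show "x \<in> I \<Longrightarrow> x \<in> C" using 1 by blast
  show "finite I" using 1(1) finite_C finite_subset by blast
qed

lemma ideal_C: "is_ideal C" by (simp add: is_ideal_def)
lemma ideal_zero: "is_ideal {0}" by (simp add: is_ideal_def)
lemma ideal_Lv: assumes "p \<in> P" shows "is_ideal (Lv p i)"
  unfolding is_ideal_def
proof (intro conjI ballI allI)
  show "0 \<in> Lv p i" by (auto simp: Lv_def intro: exI[of _ 0])
  fix x y r assume "x \<in> Lv p i" "y \<in> Lv p i"
  then obtain a b where a: "x \<in> C" "ep p * x = of_nat p ^ i * ep p * a"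
    and b: "y \<in> C" "ep p * y = of_nat p ^ i * ep p * b" by (auto simp: Lv_def)
  have "ep p * (x + y) = of_nat p ^ i * ep p * (a + b)" using a b by (simp add: distrib_left)
  then show "x + y \<in> Lv p i" using a b unfolding Lv_def by auto
next
  fix x r assume "x \<in> Lv p i"
  then obtain a where a: "x \<in> C" "ep p * x = of_nat p ^ i * ep p * a" by (auto simp: Lv_def)
  have "ep p * (r * x) = r * (ep p * x)" by (simp add: mult.left_commute)
  also have "\<dots> = of_nat p ^ i * ep p * (r * a)" unfolding a(2) by (simp add: algebra_simps)
  finally show "r * x \<in> Lv p i" using a unfolding Lv_def by auto
qed (auto simp: Lv_def)
lemma ideal_Int: "is_ideal I \<Longrightarrow> is_ideal J \<Longrightarrow> is_ideal (I \<inter> J)" unfolding is_ideal_def by auto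
lemma ideal_vanish: "p \<in> P \<Longrightarrow> is_ideal {x\<in>C. ep p * x = 0}"
  unfolding is_ideal_def by (auto simp: distrib_left mult.left_commute)
lemma ideal_ep: "is_ideal J \<Longrightarrow> p \<in> P \<Longrightarrow> is_ideal {x\<in>C. ep p * x \<in> J}"
  unfolding is_ideal_def by (auto simp: distrib_left mult.left_commute)
lemma ideal_sum: assumes I: "is_ideal I" and J: "is_ideal J" shows "is_ideal {x + y | x y. x \<in> I \<and> y \<in> J}"
  unfolding is_ideal_def
proof (intro conjI ballI allI)
  show "{x + y | x y. x \<in> I \<and> y \<in> J} \<subseteq> C" using is_idealD(8)[OF I] is_idealD(8)[OF J] by auto
  show "0 \<in> {x + y | x y. x \<in> I \<and> y \<in> J}" using is_idealD(2)[OF I] is_idealD(2)[OF J] by force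
next
  fix a b assume "a \<in> {x + y | x y. x \<in> I \<and> y \<in> J}" "b \<in> {x + y | x y. x \<in> I \<and> y \<in> J}"
  then obtain x y x' y' where *: "a = x + y" "b = x' + y'" "x \<in> I" "y \<in> J" "x' \<in> I" "y' \<in> J" by blast
  then have "a + b = (x + x') + (y + y')" by simp
  then show "a + b \<in> {x + y | x y. x \<in> I \<and> y \<in> J}"
    using is_idealD(3)[OF I *(3,5)] is_idealD(3)[OF J *(4,6)] by blast
next
  fix r a assume "a \<in> {x + y | x y. x \<in> I \<and> y \<in> J}"
  then obtain x y where *: "a = x + y" "x \<in> I" "y \<in> J" by blast
  then have "r * a = r * x + r * y" by (simp add: distrib_left)
  then show "r * a \<in> {x + y | x y. x \<in> I \<and> y \<in> J}"
    using is_idealD(4)[OF I *(2)] is_idealD(4)[OF J *(3)] by blast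
qed
text \<open>By \<open>unit_diff\<close> every multiple \<open>r * x\<close> is a difference of two
  unit multiples of \<open>x\<close>. This turns closure under units, all that the S-ring provides,
  into the ideal property.\<close>

lemma ideal_unitsI: assumes "I \<subseteq> C" "0 \<in> I" "\<And>x y. x \<in> I \<Longrightarrow> y \<in> I \<Longrightarrow> x + y \<in> I"
  "\<And>u x. u \<in> Us \<Longrightarrow> x \<in> I \<Longrightarrow> u * x \<in> I" shows "is_ideal I"
  unfolding is_ideal_def
proof (intro conjI allI ballI)
  fix r x assume x: "x \<in> I"
  then have xC: "x \<in> C" using assms(1) by auto
  obtain u v where uv: "u \<in> Us" "v \<in> Us" "r * e = u - v" using unit_diff[of "r * e"] by auto
  have "r * x = r * e * x" using xC by (simp add: mult.assoc)
  also have "\<dots> = u * x + (- v) * x" by (simp add: uv algebra_simps)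
  also have "\<dots> \<in> I" using assms(3)[OF assms(4)[OF uv(1) x] assms(4)[OF Us_uminus[OF uv(2)] x]] .
  finally show "r * x \<in> I" .
qed (use assms in auto)

lemma ideal_level: assumes I: "is_ideal I" and p: "p \<in> P" and x: "of_nat p ^ i * ep p * v \<in> I" "un p v"
  shows "of_nat p ^ i * ep p * r \<in> I"
proof -
  obtain y where y: "ep p * v * y = ep p" using x(2) by (auto simp: un_def)
  have "of_nat p ^ i * ep p * v * (y * r) \<in> I" using I x(1) is_idealD(5) by blast
  moreover have "of_nat p ^ i * ep p * v * (y * r) = of_nat p ^ i * (ep p * v * y) * r" by (simp add: mult.assoc)
  ultimately show ?thesis using y by simp
qed

text \<open>A nonzero \<open>p\<close>-component is a unit times \<open>p^i\<close>; multiplying by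
  the missing power of \<open>p\<close> reaches the minimal ideal at \<open>p\<close>.\<close>

lemma ideal_has_hh: assumes I: "is_ideal I" and p: "p \<in> P" and x: "x \<in> I" "ep p * x \<noteq> 0" shows "hh p \<in> I"
proof -
  obtain i v where iv: "i < nn p" "v \<in> Us" "ep p * x = of_nat p ^ i * ep p * v" using level[OF p x(2)] by blast
  have "of_nat p ^ i * ep p * v \<in> I" using I x(1) is_idealD(4) iv by metis
  then have "of_nat p ^ i * ep p * (of_nat p ^ (nn p - 1 - i)) \<in> I" using ideal_level[OF I p] un_unit[OF iv(2) p] by blast
  moreover have "of_nat p ^ i * ep p * (of_nat p ^ (nn p - 1 - i)) = hh p"
  proof -
    have "of_nat p ^ i * ep p * (of_nat p ^ (nn p - 1 - i)) = of_nat p ^ (i + (nn p - 1 - i)) * ep p"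
      by (simp add: power_add mult.assoc mult.commute)
    then show ?thesis using iv(1) by (simp add: hh_def)
  qed
  ultimately show ?thesis by simp
qed

lemma ideal_nonzero_hh: assumes "is_ideal I" "x \<in> I" "x \<noteq> 0" shows "\<exists>p\<in>P. hh p \<in> I"
  using assms ideal_has_hh by (metis C_eqI is_idealD(8) mult_zero_right zero_C)

lemma hh_nz: "p \<in> P \<Longrightarrow> hh p \<noteq> 0" using not_nil by (simp add: hh_def)
lemma hh_C [simp]: "p \<in> P \<Longrightarrow> hh p \<in> C" by (simp add: hh_def)
lemma ep_hh [simp]: "p \<in> P \<Longrightarrow> ep p * hh p = hh p"
  unfolding hh_def mult.left_commute[of "ep p"] by (simp add: idem)
lemma ep_hh_other: "p \<in> P \<Longrightarrow> q \<in> P \<Longrightarrow> p \<noteq> q \<Longrightarrow> ep q * hh p = 0"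
  unfolding hh_def mult.left_commute[of "ep q"] by (simp add: orth)
lemma p_hh: "p \<in> P \<Longrightarrow> of_nat p * hh p = 0"
  using nil[of p] nn_pos[of p] by (cases "nn p") (auto simp: hh_def mult.assoc[symmetric])

end

section \<open>Basic sets and A-ideals\<close>

text \<open>
  The S-ring enters through the map \<open>bl\<close> sending a point to its basic set; \<open>conv\<close> is the closure of the
  S-ring under the multiplication of the group ring.
\<close>

locale sr_data = cg_data P ep nn
  for P :: "nat set" and ep :: "nat \<Rightarrow> 'a::comm_ring_1" and nn +
  fixes bl :: "'a \<Rightarrow> 'a set"
  assumes bl_in: "x \<in> C \<Longrightarrow> x \<in> bl x"
    and bl_sub: "x \<in> C \<Longrightarrow> bl x \<subseteq> C"
    and bl_same: "x \<in> C \<Longrightarrow> y \<in> bl x \<Longrightarrow> bl y = bl x"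
    and bl_zero: "bl 0 = {0}"
    and bl_unit: "u \<in> Us \<Longrightarrow> x \<in> C \<Longrightarrow> bl (u * x) = (*) u ` bl x"
    and conv: "\<And>(f :: 'a \<Rightarrow> int) g x y. (\<And>x y. x \<in> C \<Longrightarrow> y \<in> bl x \<Longrightarrow> f x = f y) \<Longrightarrow>
       (\<And>x y. x \<in> C \<Longrightarrow> y \<in> bl x \<Longrightarrow> g x = g y) \<Longrightarrow> x \<in> C \<Longrightarrow> y \<in> bl x \<Longrightarrow>
       (\<Sum>s\<in>C. f s * g (x - s)) = (\<Sum>s\<in>C. f s * g (y - s))"
begin

definition aset :: "'a set \<Rightarrow> bool" where "aset S \<longleftrightarrow> S \<subseteq> C \<and> (\<forall>x\<in>S. bl x \<subseteq> S)"
definition aideal :: "'a set \<Rightarrow> bool" where "aideal I \<longleftrightarrow> is_ideal I \<and> aset I"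
text \<open>The union of all basic sets contained in \<open>L\<close>, hence the largest union of
  basic sets there.\<close>

definition core :: "'a set \<Rightarrow> 'a set" where "core L = {x\<in>C. bl x \<subseteq> L}"
definition ahull :: "'a \<Rightarrow> 'a set" where "ahull x = \<Inter>{I. aideal I \<and> x \<in> I}"
text \<open>\<open>ac\<close> counts the points that translation by \<open>g\<close> keeps inside
  the target, \<open>ls\<close> those that it loses. Both are coefficients of group ring products
  and therefore constant on basic sets.\<close>

definition ac :: "'a set \<Rightarrow> 'a set \<Rightarrow> 'a \<Rightarrow> nat" where "ac B B' g = card {x\<in>B. x + g \<in> B'}"
definition ls :: "'a set \<Rightarrow> 'a \<Rightarrow> nat" where "ls B g = card {x\<in>B. x + g \<notin> B}"

lemma aset_C: "aset C" using bl_sub by (auto simp: aset_def)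
lemma asetD: "aset S \<Longrightarrow> x \<in> S \<Longrightarrow> bl x \<subseteq> S" by (auto simp: aset_def)
lemma aset_sub: "aset S \<Longrightarrow> S \<subseteq> C" by (auto simp: aset_def)
lemma aset_finite: "aset S \<Longrightarrow> finite S" using aset_sub finite_C finite_subset by blast
lemma aset_bl: "x \<in> C \<Longrightarrow> aset (bl x)" unfolding aset_def using bl_sub[of x] bl_same[of x] by blast
lemma aset_Int: "aset S \<Longrightarrow> aset T \<Longrightarrow> aset (S \<inter> T)" by (auto simp: aset_def)
lemma aset_Union: "(\<And>S. S \<in> F \<Longrightarrow> aset S) \<Longrightarrow> aset (\<Union>F)" unfolding aset_def by blast
lemma aset_zero: "aset {0}" by (simp add: aset_def bl_zero)
lemma aset_iff: assumes "aset S" "x \<in> C" "y \<in> bl x" shows "x \<in> S \<longleftrightarrow> y \<in> S"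
  using assms(1) asetD[OF assms(1)] bl_same[OF assms(2,3)] bl_in[OF assms(2)] assms(3) by blast
lemma aset_level: assumes "\<And>x y. x \<in> C \<Longrightarrow> y \<in> bl x \<Longrightarrow> f x = f y" shows "aset {x\<in>C. Q (f x)}"
  unfolding aset_def
proof (intro conjI ballI subsetI)
  fix x y assume "x \<in> {x\<in>C. Q (f x)}" "y \<in> bl x"
  then show "y \<in> {x\<in>C. Q (f x)}" using assms[of x y] bl_sub[of x] by auto
qed auto
lemma bl_C: "x \<in> C \<Longrightarrow> y \<in> bl x \<Longrightarrow> y \<in> C" using bl_sub by blast
lemma bl_sym: "x \<in> C \<Longrightarrow> y \<in> bl x \<Longrightarrow> x \<in> bl y" using bl_same bl_in by blast
lemma finite_bl: "x \<in> C \<Longrightarrow> finite (bl x)" using aset_bl aset_finite by blast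
lemma bl_meet: "x \<in> C \<Longrightarrow> y \<in> C \<Longrightarrow> z \<in> bl x \<Longrightarrow> z \<in> bl y \<Longrightarrow> bl x = bl y" using bl_same by metis
lemma aset_img: assumes "u \<in> Us" "aset S" shows "aset ((*) u ` S)"
  unfolding aset_def
proof (intro conjI ballI)
  show "(*) u ` S \<subseteq> C" using aset_sub assms by auto
  fix y assume "y \<in> (*) u ` S"
  then obtain x where "x \<in> S" "y = u * x" by blast
  then show "bl y \<subseteq> (*) u ` S" using bl_unit[OF assms(1)] asetD[OF assms(2)] aset_sub[OF assms(2)] by blast
qed

lemma aset_uminus: assumes "aset S" shows "aset (uminus ` S)"
proof -
  have "(*) (- e) ` S = uminus ` S" using aset_sub[OF assms] by (intro image_cong) auto
  then show ?thesis using aset_img[OF Us_uminus[OF e_Un] assms] by simp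
qed

text \<open>The two cardinalities are the coefficients at \<open>x\<close> and at \<open>y\<close>
  of the product of the indicators of \<open>S\<close> and \<open>T\<close>.\<close>

lemma conv_card: assumes "aset S" "aset T" "x \<in> C" "y \<in> bl x"
  shows "card {s\<in>S. x - s \<in> T} = card {s\<in>S. y - s \<in> T}"
proof -
  define f :: "'a set \<Rightarrow> 'a \<Rightarrow> int" where "f S x = of_bool (x \<in> S)" for S x
  have f: "f S x = f S y" if "aset S" "x \<in> C" "y \<in> bl x" for S x y using aset_iff[OF that] by (simp add: f_def)
  have c: "(\<Sum>s\<in>C. f S s * f T (x - s)) = int (card {s\<in>S. x - s \<in> T})" for x
  proof -
    have "(\<Sum>s\<in>C. f S s * f T (x - s)) = (\<Sum>s\<in>C. of_bool (s \<in> S \<and> x - s \<in> T))"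
      by (intro sum.cong) (auto simp: f_def)
    also have "\<dots> = (\<Sum>s\<in>{s\<in>S. x - s \<in> T}. 1)"
      using aset_sub[OF assms(1)] by (intro sum.mono_neutral_cong_right) auto
    finally show ?thesis by simp
  qed
  show ?thesis using conv[of "f S" "f T" x y] f assms c by simp
qed

text \<open>An element is a sum from \<open>S\<close> and \<open>T\<close> iff its coefficient in
  the product of the indicators is nonzero, and by \<open>conv_card\<close> this coefficient is
  constant on basic sets.\<close>

lemma aset_sum: assumes "aset S" "aset T" shows "aset {x + y | x y. x \<in> S \<and> y \<in> T}"
  unfolding aset_def
proof (intro conjI ballI subsetI)
  fix z assume "z \<in> {x + y | x y. x \<in> S \<and> y \<in> T}"
  then obtain x y where "z = x + y" "x \<in> S" "y \<in> T" by blast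
  then show "z \<in> C" using aset_sub[OF assms(1)] aset_sub[OF assms(2)] by (auto intro!: add_C)
next
  fix z w assume "z \<in> {x + y | x y. x \<in> S \<and> y \<in> T}" and w: "w \<in> bl z"
  then obtain x y where z: "z = x + y" "x \<in> S" "y \<in> T" by blast
  then have "x \<in> {s\<in>S. z - s \<in> T}" by simp
  then have "card {s\<in>S. z - s \<in> T} \<noteq> 0" using aset_finite[OF assms(1)] by (auto simp: card_eq_0_iff)
  moreover have "z \<in> C" using z assms aset_sub by (metis add_C subsetD)
  ultimately have "card {s\<in>S. w - s \<in> T} \<noteq> 0" using conv_card[OF assms _ w] by simp
  then obtain s where "s \<in> S" "w - s \<in> T" by (metis (mono_tags, lifting) card.empty empty_Collect_eq)
  then have "w = s + (w - s) \<and> s \<in> S \<and> w - s \<in> T" by simp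
  then show "w \<in> {x + y | x y. x \<in> S \<and> y \<in> T}" by blast
qed

lemma aidealD: assumes "aideal I" shows "is_ideal I" "aset I" using assms by (auto simp: aideal_def)
lemma aideal_C: "aideal C" by (simp add: aideal_def ideal_C aset_C)
lemma aideal_zero: "aideal {0}" by (simp add: aideal_def ideal_zero aset_zero)
lemma aideal_Int: "aideal I \<Longrightarrow> aideal J \<Longrightarrow> aideal (I \<inter> J)" by (simp add: aideal_def ideal_Int aset_Int)
lemma aideal_sum: "aideal I \<Longrightarrow> aideal J \<Longrightarrow> aideal {x + y | x y. x \<in> I \<and> y \<in> J}"
  by (simp add: aideal_def ideal_sum aset_sum)

text \<open>The basic set of \<open>x + y\<close> lies in the sum of the basic sets of
  \<open>x\<close> and \<open>y\<close>, so closure of \<open>L\<close> under sums passes to the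
  core; units permute basic sets, and \<open>ideal_unitsI\<close> does the rest.\<close>

lemma core_aideal: assumes L: "is_ideal L" shows "aideal (core L)"
  unfolding aideal_def
proof
  show "is_ideal (core L)"
  proof (rule ideal_unitsI)
    show "core L \<subseteq> C" by (auto simp: core_def)
    show "0 \<in> core L" using is_idealD(2)[OF L] by (auto simp: core_def bl_zero)
  next
    fix x y assume xy: "x \<in> core L" "y \<in> core L"
    then have C: "x \<in> C" "y \<in> C" by (auto simp: core_def)
    have "bl (x + y) \<subseteq> {a + b | a b. a \<in> bl x \<and> b \<in> bl y}"
      using asetD[OF aset_sum[OF aset_bl[OF C(1)] aset_bl[OF C(2)]], of "x + y"] bl_in[OF C(1)] bl_in[OF C(2)] by blast
    also have "\<dots> \<subseteq> L" using xy is_idealD(3)[OF L] by (auto simp: core_def)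
    finally show "x + y \<in> core L" using C by (simp add: core_def)
  next
    fix u x assume "u \<in> Us" "x \<in> core L"
    then show "u * x \<in> core L" using is_idealD(4)[OF L] by (auto simp: core_def bl_unit)
  qed
  show "aset (core L)" unfolding aset_def
  proof (intro conjI ballI subsetI)
    fix x y assume "x \<in> core L" "y \<in> bl x"
    then show "y \<in> core L" using bl_same[of x y] bl_C[of x y] by (auto simp: core_def)
  qed (auto simp: core_def)
qed
lemma core_sub: "core L \<subseteq> L" using bl_in by (auto simp: core_def)
lemma core_max: "aset S \<Longrightarrow> S \<subseteq> L \<Longrightarrow> S \<subseteq> core L" by (auto simp: core_def aset_def)

lemma ahull_aideal: assumes "x \<in> C" shows "aideal (ahull x)"
  unfolding aideal_def
proof
  show "is_ideal (ahull x)" unfolding is_ideal_def ahull_def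
    using assms aideal_C by (auto dest: aidealD(1) is_idealD)
  show "aset (ahull x)" unfolding aset_def
  proof (intro conjI ballI)
    show "ahull x \<subseteq> C" using assms aideal_C unfolding ahull_def by blast
    fix y assume y: "y \<in> ahull x"
    have "bl y \<subseteq> I" if "aideal I" "x \<in> I" for I
      using asetD[OF aidealD(2)[OF that(1)], of y] y that by (auto simp: ahull_def)
    then show "bl y \<subseteq> ahull x" unfolding ahull_def by blast
  qed
qed
lemma ahull_in: "x \<in> ahull x" by (auto simp: ahull_def)
lemma ahull_min: "aideal I \<Longrightarrow> x \<in> I \<Longrightarrow> ahull x \<subseteq> I" by (auto simp: ahull_def)

lemma stab: assumes "u \<in> Us" "x \<in> C" "u * x \<in> bl x" shows "(*) u ` bl x = bl x"
  using bl_unit[OF assms(1,2)] bl_same[OF assms(2,3)] by simp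

text \<open>Units permute the basic sets. A unit that keeps a single point of a basic set inside it
  therefore preserves the whole set; every later use of units to move points rests on this.\<close>

lemma stab_mem: assumes "u \<in> Us" "x \<in> C" "y \<in> bl x" "u * y \<in> bl x" "z \<in> bl x" shows "u * z \<in> bl x"
proof -
  have y: "bl y = bl x" "y \<in> C" using bl_same[OF assms(2,3)] bl_C[OF assms(2,3)] by blast+
  then have "(*) u ` bl x = bl x" using stab[OF assms(1) y(2)] assms(4) by simp
  then show ?thesis using assms(5) by blast
qed

section \<open>Translation counts on basic sets and on cosets of A-ideals\<close>

lemma unit_img_card: assumes "u \<in> Us" "S \<subseteq> C" shows "card ((*) u ` S) = card S"
proof (rule card_image)
  show "inj_on ((*) u) S"
  proof (rule inj_onI)
    fix x y assume "x \<in> S" "y \<in> S" "u * x = u * y"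
    then show "x = y" using inv_cancel(2)[OF assms(1), of x] inv_cancel(2)[OF assms(1), of y] assms(2) by auto
  qed
qed

lemma unit_img_iff: assumes "u \<in> Us" "S \<subseteq> C" "x \<in> C" shows "u * x \<in> (*) u ` S \<longleftrightarrow> x \<in> S"
proof
  assume "u * x \<in> (*) u ` S"
  then obtain y where y: "y \<in> S" "u * x = u * y" by blast
  then have "x = y" using inv_cancel(2)[OF assms(1,3)] inv_cancel(2)[OF assms(1), of y] assms(2) by auto
  then show "x \<in> S" using y by simp
qed blast

lemma ac_const: assumes "aset B" "aset B'" "g \<in> C" "g' \<in> bl g" shows "ac B B' g' = ac B B' g"
proof -
  have "card {s\<in>uminus ` B. g - s \<in> B'} = ac B B' g" for g
  proof -
    have "{s\<in>uminus ` B. g - s \<in> B'} = uminus ` {x\<in>B. x + g \<in> B'}" by (auto simp: add.commute)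
    then show ?thesis unfolding ac_def by (simp add: card_image)
  qed
  then show ?thesis using conv_card[OF aset_uminus[OF assms(1)] assms(2-4)] by simp
qed

lemma ac_ls: assumes "finite B" shows "ac B B g + ls B g = card B"
proof -
  have "B = {x\<in>B. x + g \<in> B} \<union> {x\<in>B. x + g \<notin> B}" by blast
  then have "card B = card ({x\<in>B. x + g \<in> B} \<union> {x\<in>B. x + g \<notin> B})" by simp
  also have "\<dots> = ac B B g + ls B g" unfolding ac_def ls_def using assms by (intro card_Un_disjoint) auto
  finally show ?thesis by simp
qed

lemma ls_const: assumes "aset B" "g \<in> C" "g' \<in> bl g" shows "ls B g' = ls B g"
  using ac_const[OF assms(1) assms] ac_ls[OF aset_finite[OF assms(1)]] by (metis add_left_cancel)

lemma ac_unit: assumes "u \<in> Us" "B \<subseteq> C" "B' \<subseteq> C" "g \<in> C"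
  shows "ac ((*) u ` B) ((*) u ` B') (u * g) = ac B B' g"
proof -
  have "{x\<in>(*) u ` B. x + u * g \<in> (*) u ` B'} = (*) u ` {x\<in>B. x + g \<in> B'}"
  proof (intro equalityI subsetI)
    fix z assume "z \<in> {x\<in>(*) u ` B. x + u * g \<in> (*) u ` B'}"
    then obtain x where x: "x \<in> B" "z = u * x" "u * (x + g) \<in> (*) u ` B'" by (auto simp: distrib_left)
    then have "x + g \<in> B'" using unit_img_iff[OF assms(1,3), of "x + g"] assms(2,4) by auto
    then show "z \<in> (*) u ` {x\<in>B. x + g \<in> B'}" using x by blast
  next
    fix z assume "z \<in> (*) u ` {x\<in>B. x + g \<in> B'}"
    then obtain x where x: "x \<in> B" "z = u * x" "x + g \<in> B'" by blast
    then have "u * x + u * g \<in> (*) u ` B'" by (metis distrib_left imageI)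
    then show "z \<in> {x\<in>(*) u ` B. x + u * g \<in> (*) u ` B'}" using x by blast
  qed
  then show ?thesis unfolding ac_def using unit_img_card[OF assms(1), of "{x\<in>B. x + g \<in> B'}"] assms(2) by auto
qed

lemma ac_zero: "ac B B 0 = card B" by (simp add: ac_def)

text \<open>Double counting. When \<open>I\<close> is an ideal, the right-hand side counts points of
  \<open>B'\<close> in cosets of \<open>I\<close>, so a bound on average losses becomes a statement
  about cosets.\<close>

lemma ac_sum: assumes "finite B" "finite I" shows "(\<Sum>g\<in>I. ac B B' g) = (\<Sum>x\<in>B. card {g\<in>I. x + g \<in> B'})"
proof -
  have c: "card {x\<in>A. Q x} = (\<Sum>x\<in>A. of_bool (Q x))" if "finite A" for A and Q :: "'a \<Rightarrow> bool"
    unfolding card_eq_sum using that by (intro sum.mono_neutral_cong_left) auto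
  have "(\<Sum>g\<in>I. ac B B' g) = (\<Sum>g\<in>I. \<Sum>x\<in>B. of_bool (x + g \<in> B'))"
    unfolding ac_def using c[OF assms(1)] by simp
  also have "\<dots> = (\<Sum>x\<in>B. \<Sum>g\<in>I. of_bool (x + g \<in> B'))" by (rule sum.swap)
  also have "\<dots> = (\<Sum>x\<in>B. card {g\<in>I. x + g \<in> B'})"
    using c[OF assms(2)] by simp
  finally show ?thesis .
qed

text \<open>The number of points of \<open>S\<close> in \<open>x + I\<close> is the coefficient at
  \<open>x\<close> of the product of the indicators of \<open>I\<close> and
  \<open>S\<close>.\<close>

lemma coset_const: assumes "aset S" "aideal I" "x \<in> C" "y \<in> bl x"
  shows "card {g\<in>I. x + g \<in> S} = card {g\<in>I. y + g \<in> S}"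
proof -
  have "card {g\<in>I. x + g \<in> S} = card {s\<in>I. x - s \<in> S}" for x
  proof -
    have "bij_betw uminus {g\<in>I. x + g \<in> S} {s\<in>I. x - s \<in> S}"
      by (rule bij_betw_byWitness[of _ uminus]) (use is_idealD(6)[OF aidealD(1)[OF assms(2)]] in auto)
    then show ?thesis by (rule bij_betw_same_card)
  qed
  then show ?thesis using conv_card[OF aidealD(2)[OF assms(2)] assms(1,3,4)] by simp
qed

text \<open>Units, translation by \<open>M\<close> and passage within \<open>bl b\<close> preserve
  the loss of \<open>O'\<close>, so it is the same at all points of \<open>O'\<close>. At
  \<open>h\<close> it is at most \<open>card M\<close>: nothing is lost outside \<open>H\<close>,
  and a point lost inside \<open>H\<close> lands in \<open>M\<close>. At any \<open>y\<close> in
  \<open>O'\<close> the points of \<open>M - y\<close> are lost, which is \<open>card M\<close>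
  many. Hence these are all the points lost at \<open>y\<close>: a sum of two elements of
  \<open>O'\<close> can leave \<open>O'\<close> only into \<open>M\<close>. This is the step by
  which \<open>O' \<union> M\<close> is later recognised as an ideal.\<close>

lemma orbit_union_closed:
  assumes O: "aset O'" "\<And>u x. u \<in> Us \<Longrightarrow> x \<in> O' \<Longrightarrow> u * x \<in> O'"
    and M: "aideal M" "\<And>x m. x \<in> O' \<Longrightarrow> m \<in> M \<Longrightarrow> x + m \<in> O'" "O' \<inter> M = {}"
    and b: "b \<in> C" "\<And>x. x \<in> O' \<Longrightarrow> \<exists>u\<in>Us. \<exists>m\<in>M. \<exists>y\<in>bl b. x = u * y + m"
    and H: "is_ideal H" "M \<subseteq> H" "h \<in> H" "h \<in> O'" "\<And>x k. x \<in> O' \<Longrightarrow> x \<notin> H \<Longrightarrow> k \<in> H \<Longrightarrow> x + k \<in> O'"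
      "H - M \<subseteq> O'"
    and xy: "x \<in> O'" "y \<in> O'"
  shows "x + y \<in> O' \<union> M"
proof (cases "x + y \<in> O'")
  case False
  have OC: "O' \<subseteq> C" using aset_sub O(1) .
  have finO: "finite O'" using aset_finite O(1) .
  have MI: "is_ideal M" using aidealD M(1) by blast
  have b1: "ls O' z = ls O' b" if "z \<in> bl b" for z using ls_const[OF O(1) b(1) that] .
  have b2: "ls O' (u * z) = ls O' z" if "u \<in> Us" "z \<in> C" for u z
  proof -
    have "(*) u ` O' = O'"
    proof
      show "(*) u ` O' \<subseteq> O'" using O(2) that by auto
      show "O' \<subseteq> (*) u ` O'"
      proof
        fix w assume "w \<in> O'"
        then have "uinv u * w \<in> O'" "w = u * (uinv u * w)"
          using O(2) uinv(1) inv_cancel(1)[OF that(1)] that OC by auto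
        then show "w \<in> (*) u ` O'" by blast
      qed
    qed
    then have "ac O' O' (u * z) = ac O' O' z" using ac_unit[OF that(1) OC OC that(2)] by simp
    then show ?thesis using ac_ls[OF finO] by (metis add_left_cancel)
  qed
  have b3: "ls O' (z + m) = ls O' z" if "m \<in> M" for z m
  proof -
    have "w + (z + m) \<in> O' \<longleftrightarrow> w + z \<in> O'" for w
      using M(2)[of "w + z" m] M(2)[of "w + (z + m)" "- m"] that is_idealD(6)[OF MI] by (auto simp: algebra_simps)
    then show ?thesis by (simp add: ls_def)
  qed
  have const: "ls O' g = ls O' b" if g: "g \<in> O'" for g
  proof -
    obtain u m z where "u \<in> Us" "m \<in> M" "z \<in> bl b" "g = u * z + m" using b(2)[OF g] by blast
    then show ?thesis using b1 b2 b3 bl_C[OF b(1)] by simp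
  qed
  have "{w\<in>O'. w + h \<notin> O'} \<subseteq> (\<lambda>m. m - h) ` M"
  proof
    fix w assume w: "w \<in> {w\<in>O'. w + h \<notin> O'}"
    then have "w \<in> H" using H(3,5) by blast
    then have "w + h \<in> H" using H(1,3) is_idealD(3) by blast
    then have "w + h \<in> M" using w H(6) by blast
    then show "w \<in> (\<lambda>m. m - h) ` M" by force
  qed
  then have "ls O' h \<le> card M" unfolding ls_def
    using card_image_le[OF is_idealD(9)[OF MI]] card_mono[OF finite_imageI[OF is_idealD(9)[OF MI]]] order_trans by blast
  then have le: "ls O' y \<le> card M" using const H(4) xy(2) by simp
  \<comment> \<open>\<open>- y\<close> lies in \<open>O'\<close> because \<open>- e\<close> is a
    unit, so \<open>M - y\<close> lies in \<open>O'\<close>; translation by \<open>y\<close> takes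
    it to \<open>M\<close>, which is disjoint from \<open>O'\<close>.\<close>
  have sub: "(\<lambda>m. m - y) ` M \<subseteq> {w\<in>O'. w + y \<notin> O'}"
  proof
    fix w assume "w \<in> (\<lambda>m. m - y) ` M"
    then obtain m where m: "m \<in> M" "w = m - y" by blast
    have "(- e) * y + m \<in> O'" using O(2)[OF Us_uminus[OF e_Un] xy(2)] M(2) m by blast
    then have "w \<in> O'" using m xy OC by auto
    then show "w \<in> {w\<in>O'. w + y \<notin> O'}" using m M(3) by auto
  qed
  have "(\<lambda>m. m - y) ` M = {w\<in>O'. w + y \<notin> O'}"
  proof (rule card_seteq[OF _ sub])
    show "finite {w \<in> O'. w + y \<notin> O'}" using finO by simp
    have "card ((\<lambda>m. m - y) ` M) = card M" by (intro card_image) (auto simp: inj_on_def)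
    then show "card {w\<in>O'. w + y \<notin> O'} \<le> card ((\<lambda>m. m - y) ` M)" using le by (simp add: ls_def)
  qed
  then have "x \<in> (\<lambda>m. m - y) ` M" using False xy by blast
  then show ?thesis by auto
qed simp

end

section \<open>Counting tuples modulo a prime\<close>

text \<open>All orbits have exactly \<open>p\<close> elements: if the \<open>d\<close>-th iterate
  fixed \<open>s\<close> with \<open>0 < d < p\<close>, then Bezout for \<open>d\<close> and
  \<open>p\<close> would make \<open>f\<close> itself fix \<open>s\<close>.\<close>

lemma dvd_card_if_cyclic_action:
  assumes fin: "finite F" and p: "prime (p::nat)" and cl: "\<And>s. s \<in> F \<Longrightarrow> f s \<in> F"
    and per: "\<And>s. s \<in> F \<Longrightarrow> (f ^^ p) s = s" and nofix: "\<And>s. s \<in> F \<Longrightarrow> f s \<noteq> s"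
  shows "p dvd card F"
proof -
  define orb where "orb s = range (\<lambda>i. (f ^^ i) s)" for s
  have clk: "(f ^^ k) s \<in> F" if "s \<in> F" for s k using that cl by (induction k) auto
  have perk: "(f ^^ (p * k)) s = s" if "s \<in> F" for s k
  proof (induction k)
    case (Suc k)
    have "(f ^^ (p * Suc k)) s = (f ^^ p) ((f ^^ (p * k)) s)" by (simp add: funpow_add)
    then show ?case using Suc per[OF that] by simp
  qed simp
  have orb_eq: "orb t = orb s" if "s \<in> F" "t \<in> orb s" for s t
  proof -
    obtain i where i: "t = (f ^^ i) s" using \<open>t \<in> orb s\<close> by (auto simp: orb_def)
    have 1: "(f ^^ k) t = (f ^^ (k + i)) s" for k by (simp add: i funpow_add)
    have "p * i - i + i = p * i" using prime_gt_0_nat[OF p] by (cases p) auto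
    then have "s = (f ^^ (p * i - i)) t" using 1[of "p * i - i"] perk[OF \<open>s \<in> F\<close>, of i] by simp
    then have 2: "(f ^^ k) s = (f ^^ (k + (p * i - i))) t" for k by (metis funpow_add o_apply)
    show ?thesis unfolding orb_def using 1 2 by auto
  qed
  have dist: "s = f s" if s: "s \<in> F" and d: "0 < d" "d < p" "(f ^^ d) s = s" for s d
  proof -
    have "coprime d p" using p d by (metis coprime_commute nat_dvd_not_less prime_imp_coprime)
    then obtain x y where xy: "d * x = p * y + 1" using bezout_nat[of d p] d by (auto simp: coprime_iff_gcd_eq_1)
    have "(f ^^ (d * k)) s = s" for k
    proof (induction k)
      case (Suc k)
      have "(f ^^ (d * Suc k)) s = (f ^^ d) ((f ^^ (d * k)) s)" by (simp add: funpow_add)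
      then show ?case using Suc d by simp
    qed simp
    from this[of x] have "s = f ((f ^^ (p * y)) s)" by (simp add: xy)
    then show ?thesis using perk[OF s] by simp
  qed
  have card_orb: "card (orb s) = p" if s: "s \<in> F" for s
  proof -
    have "orb s = (\<lambda>i. (f ^^ i) s) ` {..<p}"
    proof
      show "orb s \<subseteq> (\<lambda>i. (f ^^ i) s) ` {..<p}" unfolding orb_def
      proof
        fix t assume "t \<in> range (\<lambda>i. (f ^^ i) s)"
        then obtain i where "t = (f ^^ i) s" by blast
        also have "\<dots> = (f ^^ (i mod p + p * (i div p))) s" by simp
        also have "\<dots> = (f ^^ (i mod p)) s" using perk[OF s] by (simp only: funpow_add o_apply)
        finally show "t \<in> (\<lambda>i. (f ^^ i) s) ` {..<p}" using prime_gt_0_nat[OF p] by auto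
      qed
    qed (auto simp: orb_def)
    moreover have "inj_on (\<lambda>i. (f ^^ i) s) {..<p}"
    proof (rule linorder_inj_onI')
      fix i j assume ij: "i \<in> {..<p}" "j \<in> {..<p}" "i < j"
      show "(f ^^ i) s \<noteq> (f ^^ j) s"
      proof
        assume eq: "(f ^^ i) s = (f ^^ j) s"
        have "(f ^^ (j - i)) ((f ^^ i) s) = (f ^^ (j - i + i)) s" by (simp only: funpow_add o_apply)
        then have "(f ^^ (j - i)) ((f ^^ i) s) = (f ^^ i) s" using eq ij by simp
        then have "(f ^^ i) s = f ((f ^^ i) s)" using dist[OF clk[OF s]] ij by (metis lessThan_iff less_imp_diff_less zero_less_diff)
        then show False using nofix clk[OF s] by metis
      qed
    qed
    ultimately show ?thesis by (simp add: card_image)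
  qed
  have U: "\<Union>(orb ` F) = F"
  proof -
    have "orb s \<subseteq> F" if "s \<in> F" for s using clk that by (auto simp: orb_def)
    moreover have "s \<in> orb s" for s using rangeI[of "\<lambda>i. (f ^^ i) s" 0] by (simp add: orb_def)
    ultimately show ?thesis by blast
  qed
  have "p dvd card (\<Union>(orb ` F))"
  proof (rule dvd_partition)
    show "finite (\<Union>(orb ` F))" using fin U by simp
    show "\<forall>c\<in>orb ` F. p dvd card c" using card_orb by auto
    show "\<forall>c1\<in>orb ` F. \<forall>c2\<in>orb ` F. c1 \<noteq> c2 \<longrightarrow> c1 \<inter> c2 = {}" using orb_eq by blast
  qed
  then show ?thesis using U by simp
qed

lemma rotate1_fixed: assumes "rotate1 xs = xs" "x \<in> set xs" "y \<in> set xs" shows "x = y"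
proof -
  have *: "\<forall>z\<in>set ys. z = a" if "ys @ [a] = a # ys" for ys and a :: 'a using that
  proof (induction ys)
    case (Cons b ys) then show ?case by auto
  qed simp
  show ?thesis
  proof (cases xs)
    case (Cons b ys)
    then have "\<forall>z\<in>set ys. z = b" using *[of ys b] assms(1) by simp
    then have "\<forall>z\<in>set xs. z = b" using Cons by simp
    then show ?thesis using assms(2,3) by metis
  qed (use assms in simp)
qed

lemma rotate1_fixed_iff: "rotate1 xs = xs \<longleftrightarrow> (\<exists>x. xs = replicate (length xs) x)"
proof
  assume *: "rotate1 xs = xs"
  show "\<exists>x. xs = replicate (length xs) x"
  proof (cases xs)
    case (Cons b ys)
    have "xs = replicate (length xs) b" using rotate1_fixed[OF *, of _ b] Cons by (intro replicate_eqI) auto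
    then show ?thesis by blast
  qed simp
next
  assume "\<exists>x. xs = replicate (length xs) x"
  then obtain x where "xs = replicate (length xs) x" by blast
  then have "set xs \<subseteq> {x}" by (metis set_replicate_conv_if subset_insertI empty_subsetI order_refl)
  then have "rotate1 xs = replicate (length (rotate1 xs)) x" "xs = replicate (length xs) x"
    by (intro replicate_eqI; auto)+
  then show "rotate1 xs = xs" by simp
qed

text \<open>
  Modulo \<open>p\<close>, the number \<open>cnt p x\<close> of \<open>p\<close>-tuples from the transversal \<open>TT\<close> with sum \<open>x\<close> equals the number \<open>GG x\<close>
  of constant ones, and \<open>cnt\<close> is constant on basic sets. Hence the points where \<open>p\<close> does not divide
  \<open>GG\<close> form a union of basic sets, which up to a unit is \<open>YY\<close>.
\<close>

locale sr_tt = sr_data +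
  fixes J S :: "'a set" and p a :: nat
  assumes J: "aideal J" and S: "aset S" and SJ: "\<And>s j. s \<in> S \<Longrightarrow> j \<in> J \<Longrightarrow> s + j \<in> S"
    and p: "p \<in> P" and a: "1 \<le> a" "of_nat p ^ a * ep p \<in> J" "of_nat p ^ (a - 1) * ep p \<notin> J"
    and st: "\<And>u s. u \<in> Us \<Longrightarrow> (\<And>q. q \<in> P \<Longrightarrow> q \<noteq> p \<Longrightarrow> ep q * u = ep q) \<Longrightarrow> s \<in> S \<Longrightarrow> u * s \<in> S"
begin

text \<open>A parametrisation of the layer directly above \<open>J\<close> in the component at
  \<open>p\<close>: \<open>hz 1\<close> is not in \<open>J\<close>, but \<open>p * hz z\<close>
  always is.\<close>

definition hz :: "'a \<Rightarrow> 'a" where "hz z = of_nat p ^ (a - 1) * ep p * z"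
text \<open>The boundary of \<open>S\<close> along the layer, recorded at points whose
  \<open>p\<close>-component is trivial modulo \<open>J\<close>.\<close>

definition YY :: "'a set" where "YY = {x\<in>C. ep p * x \<in> J \<and> (x \<in> S) \<noteq> (x + hz 1 \<in> S)}"
text \<open>The predicate under the choice depends only on the class of \<open>x\<close> modulo
  \<open>J\<close>, so congruent elements receive the same representative.\<close>

definition rep :: "'a \<Rightarrow> 'a" where "rep x = (SOME y. y \<in> {z. z - x \<in> J})"
definition TT :: "'a set" where "TT = rep ` S"
definition cnt :: "nat \<Rightarrow> 'a \<Rightarrow> nat" where
  "cnt m x = card {xs. length xs = m \<and> set xs \<subseteq> TT \<and> sum_list xs - x \<in> J}"
definition GG :: "'a \<Rightarrow> nat" where "GG x = card {s\<in>TT. of_nat p * s - x \<in> J}"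

lemma JI: "is_ideal J" using aidealD J by blast
lemmas Jadd = is_idealD(3)[OF JI] and Jdiff = is_idealD(7)[OF JI] and Jmult = is_idealD(4)[OF JI]
  and Jmult2 = is_idealD(5)[OF JI] and Jzero = is_idealD(2)[OF JI] and Jum = is_idealD(6)[OF JI]

lemma SJ_iff: "x - y \<in> J \<Longrightarrow> x \<in> S \<longleftrightarrow> y \<in> S"
  using SJ[of y "x - y"] SJ[of x "- (x - y)"] Jum[of "x - y"] by auto

lemma rep_in: "rep x - x \<in> J"
proof -
  have "\<exists>y. y \<in> {z. z - x \<in> J}" using Jzero by (intro exI[of _ x]) simp
  from someI_ex[OF this] show ?thesis by (simp add: rep_def)
qed
lemma rep_cong: assumes "x - y \<in> J" shows "rep x = rep y"
proof -
  have "z - x \<in> J \<longleftrightarrow> z - y \<in> J" for z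
    using Jadd[of "z - x" "x - y"] Jdiff[of "z - y" "x - y"] assms by auto
  then show ?thesis by (simp add: rep_def)
qed
lemma rep_eqD: assumes "rep x = rep y" shows "x - y \<in> J"
  using Jdiff[OF rep_in[of y] rep_in[of x]] assms by simp
lemma rep_rep: "rep (rep x) = rep x" using rep_cong rep_in by blast
lemma TT_sub: "TT \<subseteq> S" using SJ_iff rep_in by (auto simp: TT_def)
lemma TT_fin: "finite TT" using aset_finite[OF S] by (simp add: TT_def)
lemma TT_rep: "s \<in> TT \<Longrightarrow> rep s = s" using rep_rep by (auto simp: TT_def)
lemma rep_TT: "s \<in> S \<Longrightarrow> rep s \<in> TT" by (auto simp: TT_def)
lemma rep_add: "rep (rep x + y) = rep (x + y)" by (rule rep_cong) (use rep_in[of x] in \<open>simp add: algebra_simps\<close>)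

lemma cnt_lists_fin: "finite {xs. length xs = m \<and> set xs \<subseteq> TT \<and> sum_list xs - x \<in> J}"
  by (rule finite_subset[OF _ finite_lists_length_eq[OF TT_fin, of m]]) auto

lemma cnt_Suc: "cnt (Suc m) x = (\<Sum>s\<in>TT. cnt m (x - s))"
proof -
  have "{xs. length xs = Suc m \<and> set xs \<subseteq> TT \<and> sum_list xs - x \<in> J} =
    (\<Union>s\<in>TT. (#) s ` {xs. length xs = m \<and> set xs \<subseteq> TT \<and> sum_list xs - (x - s) \<in> J})"
    by (auto simp: length_Suc_conv algebra_simps image_iff)
  then have "cnt (Suc m) x = (\<Sum>s\<in>TT. card ((#) s ` {xs. length xs = m \<and> set xs \<subseteq> TT \<and> sum_list xs - (x - s) \<in> J}))"
    unfolding cnt_def using TT_fin cnt_lists_fin by (simp only:) (intro card_UN_disjoint; auto)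
  also have "\<dots> = (\<Sum>s\<in>TT. cnt m (x - s))" unfolding cnt_def by (intro sum.cong refl card_image) simp
  finally show ?thesis .
qed

text \<open>Every element of \<open>S\<close> is \<open>t + j\<close> with unique \<open>t\<close>
  in \<open>TT\<close> and \<open>j\<close> in \<open>J\<close>. So counts over the transversal,
  which need not be a union of basic sets, become convolutions with the indicator of
  \<open>S\<close> after multiplication by \<open>card J\<close>.\<close>

lemma sum_TT: assumes "\<And>x j. j \<in> J \<Longrightarrow> f (x - j) = (f x :: int)"
  shows "int (card J) * (\<Sum>s\<in>TT. f (x - s)) = (\<Sum>s\<in>S. f (x - s))"
proof -
  have bij: "bij_betw (\<lambda>(t, j). t + j) (TT \<times> J) S"
  proof (rule bij_betw_imageI)
    show "inj_on (\<lambda>(t, j). t + j) (TT \<times> J)"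
    proof (rule inj_onI, clarify)
      fix t j t' j' assume *: "t \<in> TT" "j \<in> J" "t' \<in> TT" "j' \<in> J" "t + j = t' + j'"
      have "t - t' = j' - j" using *(5) by (simp add: algebra_simps)
      then have "t - t' \<in> J" using Jdiff * by metis
      then have "t = t'" using rep_cong TT_rep * by metis
      then show "t = t' \<and> j = j'" using *(5) by simp
    qed
    show "(\<lambda>(t, j). t + j) ` (TT \<times> J) = S"
    proof (intro equalityI subsetI)
      show "x \<in> S" if "x \<in> (\<lambda>(t, j). t + j) ` (TT \<times> J)" for x using that TT_sub SJ by auto
      fix x assume "x \<in> S"
      moreover have "x = rep x + (x - rep x)" by simp
      moreover have "x - rep x \<in> J" using Jum[OF rep_in[of x]] by simp
      ultimately show "x \<in> (\<lambda>(t, j). t + j) ` (TT \<times> J)" using rep_TT by (intro image_eqI[of _ _ "(rep x, x - rep x)"]) auto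
    qed
  qed
  have "(\<Sum>s\<in>S. f (x - s)) = (\<Sum>(t,j)\<in>TT \<times> J. f (x - (t + j)))"
    using sum.reindex_bij_betw[OF bij, of "\<lambda>s. f (x - s)"] by (simp add: case_prod_unfold)
  also have "\<dots> = (\<Sum>(t,j)\<in>TT \<times> J. f (x - t))"
    using assms by (intro sum.cong) (auto simp: diff_diff_eq[symmetric])
  also have "\<dots> = (\<Sum>t\<in>TT. \<Sum>j\<in>J. f (x - t))" by (rule sum.cartesian_product[symmetric])
  also have "\<dots> = int (card J) * (\<Sum>s\<in>TT. f (x - s))" by (simp add: sum_distrib_left)
  finally show ?thesis by simp
qed

lemma cnt_J: assumes "j \<in> J" shows "cnt m (x - j) = cnt m x"
proof -
  have "z - (x - j) \<in> J \<longleftrightarrow> z - x \<in> J" for z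
    using Jadd[of "z - x" j] Jdiff[of "z - (x - j)" j] assms by (auto simp: algebra_simps)
  then show ?thesis by (simp add: cnt_def)
qed

text \<open>Induction on the length of the tuples: \<open>card J * cnt (Suc m)\<close> is the
  convolution of the indicator of \<open>S\<close> with \<open>cnt m\<close>, so \<open>conv\<close>
  applies, and the nonzero factor \<open>card J\<close> cancels.\<close>

lemma cnt_const: "x \<in> C \<Longrightarrow> y \<in> bl x \<Longrightarrow> cnt m x = cnt m y"
proof (induction m arbitrary: x y)
  case 0
  have "cnt 0 x = of_bool (x \<in> J)" for x
  proof -
    have "{xs. length xs = 0 \<and> set xs \<subseteq> TT \<and> sum_list xs - x \<in> J} = (if x \<in> J then {[]} else {})"
      using Jum[of x] Jum[of "- x"] by auto
    then show ?thesis unfolding cnt_def by (simp only:) simp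
  qed
  then show ?case using aset_iff[OF aidealD(2)[OF J] 0] by simp
next
  case (Suc m)
  have eq: "int (card J) * int (cnt (Suc m) x) = (\<Sum>s\<in>C. of_bool (s \<in> S) * int (cnt m (x - s)))" for x
  proof -
    have "int (card J) * int (cnt (Suc m) x) = (\<Sum>s\<in>S. int (cnt m (x - s)))"
      using sum_TT[of "\<lambda>x. int (cnt m x)" x] cnt_J by (simp add: cnt_Suc)
    also have "\<dots> = (\<Sum>s\<in>C. of_bool (s \<in> S) * int (cnt m (x - s)))"
      using aset_sub[OF S] by (intro sum.mono_neutral_cong_left) auto
    finally show ?thesis .
  qed
  have "(\<Sum>s\<in>C. of_bool (s \<in> S) * int (cnt m (x - s))) = (\<Sum>s\<in>C. of_bool (s \<in> S) * int (cnt m (y - s)))"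
    using Suc aset_iff[OF S] by (intro conv) auto
  moreover have "card J \<noteq> 0" using Jzero is_idealD(9)[OF JI] by auto
  moreover have "int (card J) * int (cnt (Suc m) x) = int (card J) * int (cnt (Suc m) y)"
    unfolding eq by fact
  ultimately show ?case by simp
qed

lemma cnt_GG: "int (cnt p x) mod int p = int (GG x) mod int p"
proof -
  define L where "L = {xs. length xs = p \<and> set xs \<subseteq> TT \<and> sum_list xs - x \<in> J}"
  have fin: "finite L" using cnt_lists_fin by (simp add: L_def)
  have sl: "sum_list (rotate1 xs) = sum_list xs" for xs :: "'a list" by (cases xs) (auto simp: add.commute)
  have p0: "p > 0" using prime_P[OF p] prime_gt_0_nat by blast
  have "p dvd card {xs\<in>L. rotate1 xs \<noteq> xs}"
  proof (rule dvd_card_if_cyclic_action[of _ _ rotate1])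
    fix xs assume xs: "xs \<in> {xs \<in> L. rotate1 xs \<noteq> xs}"
    \<comment> \<open>A tuple with a constant rotation is itself constant, so rotation does not
      leave the set of nonconstant tuples.\<close>
    have "rotate1 (rotate1 xs) \<noteq> rotate1 xs"
    proof
      assume eq: "rotate1 (rotate1 xs) = rotate1 xs"
      then obtain x where x: "rotate1 xs = replicate (length xs) x" using rotate1_fixed_iff[of "rotate1 xs"] by auto
      have "set xs = set (replicate (length xs) x)" using x by (metis set_rotate1)
      then have "xs = replicate (length xs) x" by (intro replicate_eqI) auto
      then show False using xs rotate1_fixed_iff by blast
    qed
    then show "rotate1 xs \<in> {xs \<in> L. rotate1 xs \<noteq> xs}" using xs sl by (auto simp: L_def)
    show "(rotate1 ^^ p) xs = xs" using rotate_id[of p xs] xs by (auto simp: L_def rotate_def)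
  qed (use fin prime_P[OF p] in auto)
  moreover have "card {xs\<in>L. rotate1 xs = xs} = GG x"
  proof -
    have "bij_betw (replicate p) {s\<in>TT. of_nat p * s - x \<in> J} {xs\<in>L. rotate1 xs = xs}"
    proof (rule bij_betw_imageI)
      show "inj_on (replicate p) {s \<in> TT. of_nat p * s - x \<in> J}" using p0 by (auto simp: inj_on_def)
      show "replicate p ` {s \<in> TT. of_nat p * s - x \<in> J} = {xs \<in> L. rotate1 xs = xs}"
      proof (intro equalityI subsetI)
        fix xs assume "xs \<in> replicate p ` {s \<in> TT. of_nat p * s - x \<in> J}"
        then obtain s where s: "s \<in> TT" "of_nat p * s - x \<in> J" "xs = replicate p s" by blast
        have "rotate1 xs = xs" unfolding rotate1_fixed_iff s(3) by auto
        then show "xs \<in> {xs \<in> L. rotate1 xs = xs}" using s p0 by (auto simp: L_def sum_list_replicate)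
      next
        fix xs assume xs: "xs \<in> {xs \<in> L. rotate1 xs = xs}"
        then obtain z where z: "xs = replicate p z" unfolding rotate1_fixed_iff by (auto simp: L_def)
        moreover have "z \<in> TT" using xs p0 unfolding z by (auto simp: L_def)
        moreover have "of_nat p * z - x \<in> J" using xs unfolding z by (auto simp: L_def sum_list_replicate)
        ultimately show "xs \<in> replicate p ` {s \<in> TT. of_nat p * s - x \<in> J}" by blast
      qed
    qed
    then show ?thesis unfolding GG_def by (rule bij_betw_same_card[symmetric])
  qed
  moreover have "card L = card {xs\<in>L. rotate1 xs = xs} + card {xs\<in>L. rotate1 xs \<noteq> xs}"
  proof -
    have "card ({xs\<in>L. rotate1 xs = xs} \<union> {xs\<in>L. rotate1 xs \<noteq> xs}) = card {xs\<in>L. rotate1 xs = xs} + card {xs\<in>L. rotate1 xs \<noteq> xs}"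
      using fin by (intro card_Un_disjoint) auto
    moreover have "{xs\<in>L. rotate1 xs = xs} \<union> {xs\<in>L. rotate1 xs \<noteq> xs} = L" by blast
    ultimately show ?thesis by simp
  qed
  ultimately have "cnt p x mod p = GG x mod p" by (auto simp: cnt_def L_def elim!: dvdE)
  then show ?thesis by (metis of_nat_mod)
qed

lemma GG_aset: "aset {x\<in>C. \<not> p dvd GG x}"
proof -
  have "int (GG x) mod int p = int (GG y) mod int p" if "x \<in> C" "y \<in> bl x" for x y
    using cnt_GG[of x] cnt_GG[of y] cnt_const[OF that, of p] by simp
  then have "aset {x\<in>C. (\<lambda>m. \<not> m = 0) (int (GG x) mod int p)}" by (rule aset_level)
  moreover have "(int (GG x) mod int p = 0) = (p dvd GG x)" for x by presburger
  ultimately show ?thesis by simp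
qed

section \<open>The boundary along a layer, and solutions of \<open>p * s = x\<close> modulo
  \<open>J\<close>\<close>

lemma hz_add: "hz (x + y) = hz x + hz y" by (simp add: hz_def distrib_left)
lemma hz_zero: "hz 0 = 0" by (simp add: hz_def)
lemma hz_C: "hz z \<in> C" using p by (simp add: hz_def)
lemma pa: "of_nat p * of_nat p ^ (a - 1) = (of_nat p ^ a :: 'a)"
  using a(1) by (cases a) auto
lemma p_hz: "of_nat p * hz z \<in> J"
proof -
  have "of_nat p * hz z = of_nat p ^ a * ep p * z" unfolding hz_def pa[symmetric] by (simp add: mult.assoc)
  then show ?thesis using Jmult2[OF a(2)] by simp
qed
lemma hz_not_un: assumes "\<not> un p z" shows "hz z \<in> J"
proof -
  obtain w where w: "ep p * z = of_nat p * ep p * w" using assms not_un_iff p by blast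
  have "hz z = of_nat p ^ (a - 1) * (ep p * z)" by (simp add: hz_def mult.assoc)
  also have "\<dots> = of_nat p * of_nat p ^ (a - 1) * ep p * w" unfolding w by (simp add: mult_ac)
  also have "\<dots> = of_nat p ^ a * ep p * w" by (simp only: pa)
  finally show ?thesis using Jmult2[OF a(2)] by simp
qed
lemma hz_one_J: "hz 1 \<notin> J" using a(3) by (simp add: hz_def)

text \<open>A unit of the form \<open>lift p w\<close> fixes \<open>y\<close>, whose
  \<open>p\<close>-component vanishes, and permutes the layer. It preserves \<open>S\<close>, so all
  \<open>hz z\<close> with \<open>z\<close> a unit at \<open>p\<close> behave like
  \<open>hz 1\<close>.\<close>

lemma hz_unit: assumes "ep p * y = 0" "y \<in> C" "un p z" shows "y + hz z \<in> S \<longleftrightarrow> y + hz 1 \<in> S"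
proof -
  obtain w where w: "ep p * z * w = ep p" using assms(3) by (auto simp: un_def)
  have "ep p * w * z = ep p" using w by (simp add: mult_ac)
  then have uw: "un p w" unfolding un_def by blast
  have l: "lift p v * (y + hz x) = y + hz (v * x)" for v x
  proof -
    have "lift p v * (y + hz x) = ep p * v * (y + hz x) + ((y + hz x) - ep p * (y + hz x))"
      using lift_mult[OF p, of "y + hz x"] assms(2) hz_C by simp
    also have "ep p * v * (y + hz x) = hz (v * x)"
    proof -
      have "ep p * v * (y + hz x) = v * (ep p * y) + of_nat p ^ (a - 1) * (ep p * ep p) * (v * x)"
        by (simp add: hz_def algebra_simps)
      then show ?thesis using assms(1) p by (simp add: idem hz_def)
    qed
    also have "ep p * (y + hz x) = hz x"
    proof -
      have "ep p * (y + hz x) = ep p * y + of_nat p ^ (a - 1) * (ep p * ep p) * x"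
        by (simp add: hz_def algebra_simps)
      then show ?thesis using assms(1) p by (simp add: idem hz_def)
    qed
    finally show ?thesis by simp
  qed
  have st': "un p v \<Longrightarrow> s \<in> S \<Longrightarrow> lift p v * s \<in> S" for v s
    using st[OF lift_Us[OF p]] lift_other[OF p] by blast
  have "hz (w * z) = hz 1" unfolding hz_def mult.assoc using w by (simp add: mult_ac)
  then show ?thesis using st'[OF uw, of "y + hz z"] st'[OF assms(3), of "y + hz 1"] l[of w z] l[of z 1] by auto
qed

lemma YY_J: assumes "y \<in> YY" "z - y \<in> J" shows "z \<in> YY"
proof -
  have "z = y + (z - y)" by simp
  then have zC: "z \<in> C" using assms is_idealD(8)[OF JI assms(2)] by (metis (no_types, lifting) YY_def add_C mem_Collect_eq)
  have "ep p * z = ep p * y + ep p * (z - y)" by (simp add: right_diff_distrib)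
  then have "ep p * z \<in> J" using Jadd Jmult assms by (auto simp: YY_def)
  moreover have "z \<in> S \<longleftrightarrow> y \<in> S" using SJ_iff assms(2) .
  moreover have "z + hz 1 \<in> S \<longleftrightarrow> y + hz 1 \<in> S" by (rule SJ_iff) (use assms(2) in simp)
  ultimately show ?thesis using assms zC by (auto simp: YY_def)
qed

text \<open>If the \<open>p\<close>-component of \<open>s\<close> lay at a lower level than the
  layer, a unit trivial off \<open>p\<close> would carry \<open>s\<close> to \<open>s + hz r\<close>
  inside \<open>S\<close>. Once it lies in the layer, membership of \<open>y0 + hz z\<close> in
  \<open>S\<close> depends only on whether \<open>z\<close> is a unit at \<open>p\<close>, so the
  change from \<open>s\<close> to \<open>s + hz r\<close> forces one between \<open>y0\<close> and
  \<open>y0 + hz 1\<close>.\<close>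

lemma SL: assumes s: "s \<in> S" "s + hz r \<notin> S" shows "(\<exists>y. ep p * s = hz y) \<and> s - ep p * s \<in> YY"
proof -
  have sC: "s \<in> C" using s aset_sub[OF S] by blast
  have ex: "\<exists>y. ep p * s = hz y"
  proof (cases "ep p * s = 0")
    case True then show ?thesis using hz_zero by metis
  next
    case False
    obtain i v where iv: "i < nn p" "v \<in> Us" "ep p * s = of_nat p ^ i * ep p * v" using level[OF p False] by blast
    show ?thesis
    proof (cases "a - 1 \<le> i")
      case True
      then have "ep p * s = hz (of_nat p ^ (i - (a - 1)) * v)" unfolding iv(3) hz_def
        by (metis (no_types, lifting) le_add_diff_inverse mult.assoc mult.left_commute power_add)
      then show ?thesis by blast
    next
      case False
      \<comment> \<open>The exponent and the factor \<open>uinv v * r\<close> are chosen so that the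
        \<open>p\<close>-component \<open>p^i * v\<close> of \<open>s\<close> is changed by exactly
        \<open>hz r\<close>.\<close>
      define u where "u = e + of_nat p ^ (a - 1 - i) * ep p * (uinv v * r)"
      have u: "u \<in> Us" unfolding u_def using False p by (intro Us_add_nil) auto
      have uq: "ep q * u = ep q" if q: "q \<in> P" "q \<noteq> p" for q
      proof -
        have "ep q * u = ep q * e + of_nat p ^ (a - 1 - i) * (ep q * ep p) * (uinv v * r)"
          by (simp add: u_def algebra_simps)
        then show ?thesis using q p orth by simp
      qed
      have "u * s = s + of_nat p ^ (a - 1 - i) * (uinv v * r) * (ep p * s)"
        using sC by (simp add: u_def algebra_simps)
      also have "\<dots> = s + of_nat p ^ (a - 1 - i) * of_nat p ^ i * ep p * (v * uinv v) * r"
        unfolding iv(3) by (simp add: mult_ac)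
      also have "\<dots> = s + hz r" using uinv(2)[OF iv(2)] False p
        by (simp add: hz_def power_add[symmetric] mult.assoc)
      finally have "u * s = s + hz r" .
      then show ?thesis using st[OF u uq s(1)] s(2) by simp
    qed
  qed
  then obtain y where y: "ep p * s = hz y" by blast
  define y0 where "y0 = s - ep p * s"
  have y0: "ep p * y0 = 0" "y0 \<in> C" using p sC by (simp_all add: y0_def right_diff_distrib)
  have s_eq: "s = y0 + hz y" by (simp add: y0_def y)
  have "(y0 \<in> S) \<noteq> (y0 + hz 1 \<in> S)"
  proof
    assume eq: "(y0 \<in> S) = (y0 + hz 1 \<in> S)"
    have "y0 + hz z \<in> S \<longleftrightarrow> y0 \<in> S" for z
    proof (cases "un p z")
      case True then show ?thesis using hz_unit y0 eq by blast
    next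
      case False then show ?thesis using hz_not_un SJ_iff[of "y0 + hz z" y0] by simp
    qed
    from this[of y] this[of "y + r"] show False using s s_eq by (simp add: hz_add add.assoc)
  qed
  then have "y0 \<in> YY" using y0 Jzero by (auto simp: YY_def)
  then show ?thesis using ex by (simp add: y0_def)
qed

text \<open>Multiplication by \<open>p\<close> is invertible at every prime except \<open>p\<close>.
  On elements whose \<open>p\<close>-component lies in \<open>J\<close>, \<open>om\<close> agrees
  with it modulo \<open>J\<close>, and \<open>om\<close> is a unit, so it maps unions of basic sets
  to unions of basic sets.\<close>

definition om :: 'a where "om = ep p + of_nat p * (e - ep p)"

lemma om_ep: "ep p * om = ep p" unfolding om_def distrib_left right_diff_distrib mult.left_commute[of "ep p" "of_nat p"]
  using p by (simp add: idem)
lemma om_Us: "om \<in> Us"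
proof -
  have "un q om" if q: "q \<in> P" for q
  proof (cases "q = p")
    case True then show ?thesis using om_ep p un_ep_cong[of p om 1] by simp
  next
    case False
    have "ep q * om = ep q * of_nat p" unfolding om_def distrib_left right_diff_distrib mult.left_commute[of "ep q" "of_nat p"]
      using p q False by (simp add: orth mult.commute)
    moreover have "un q (of_nat p)" using un_of_nat[OF q] prime_P p q False by (metis primes_dvd_imp_eq)
    ultimately show ?thesis using un_ep_cong by metis
  qed
  moreover have "om \<in> C" using p by (simp add: om_def)
  ultimately show ?thesis by (simp add: Us_iff)
qed
lemma om_J: assumes "ep p * y \<in> J" "y \<in> C" shows "om * y - of_nat p * y \<in> J"
proof -
  have "om * y - of_nat p * (e * y) = (1 - of_nat p) * (ep p * y)"
    by (simp add: om_def algebra_simps)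
  then have "om * y - of_nat p * y = (1 - of_nat p) * (ep p * y)" using assms(2) by simp
  then show ?thesis using Jmult assms by simp
qed
lemma om_cancel: assumes "om * y \<in> J" "y \<in> C" shows "y \<in> J"
  using Jmult[OF assms(1), of "uinv om"] inv_cancel(2)[OF om_Us assms(2)] by simp

text \<open>Modulo \<open>J\<close>, translation by \<open>hz 1\<close> has order \<open>p\<close>
  and no fixed point. Were it to preserve the solution set \<open>F\<close>, then \<open>p\<close>
  would divide \<open>GG x\<close>. So some solution leaves \<open>S\<close> under it, and
  \<open>SL\<close> turns this solution into a boundary point whose image under \<open>om\<close> is
  \<open>x\<close> modulo \<open>J\<close>.\<close>

lemma GG_imp_YY: assumes x: "x \<in> C" "\<not> p dvd GG x" shows "uinv om * x \<in> YY"
proof -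
  define F where "F = {s\<in>TT. of_nat p * s - x \<in> J}"
  have "\<exists>s\<in>F. s + hz 1 \<notin> S"
  proof (rule ccontr)
    assume "\<not> ?thesis"
    then have cl: "s + hz 1 \<in> S" if "s \<in> F" for s using that by blast
    define f where "f s = rep (s + hz 1)" for s
    have fF: "f s \<in> F" if s: "s \<in> F" for s
    proof -
      have eq: "of_nat p * rep (s + hz 1) - x = of_nat p * (rep (s + hz 1) - (s + hz 1)) + of_nat p * hz 1 + (of_nat p * s - x)"
        by (simp add: algebra_simps)
      have "of_nat p * s - x \<in> J" using s by (simp add: F_def)
      then have "of_nat p * rep (s + hz 1) - x \<in> J"
        unfolding eq by (rule Jadd[OF Jadd[OF Jmult[OF rep_in[of "s + hz 1"]] p_hz[of 1]]])
      then show ?thesis using rep_TT[OF cl[OF s]] by (simp add: F_def f_def)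
    qed
    have fk: "(f ^^ k) s = rep (s + hz (of_nat k))" if "s \<in> F" for s k
    proof (induction k)
      case 0 then show ?case using TT_rep that by (simp add: F_def hz_zero)
    next
      case (Suc k)
      then show ?case using rep_add[of "s + hz (of_nat k)" "hz 1"]
        by (simp add: f_def hz_add add_ac)
    qed
    have "p dvd card F"
    proof (rule dvd_card_if_cyclic_action[of _ _ f])
      fix s assume s: "s \<in> F"
      have sT: "rep s = s" using s TT_rep by (simp add: F_def)
      show "f s \<in> F" using fF s .
      have "rep (s + hz (of_nat p)) = rep s" by (rule rep_cong) (use p_hz[of 1] in \<open>simp add: hz_def mult_ac\<close>)
      then show "(f ^^ p) s = s" using fk[OF s] sT by simp
      show "f s \<noteq> s"
      proof
        assume "f s = s"
        then have "rep (s + hz 1) = rep s" using sT by (simp add: f_def)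
        then show False using rep_eqD hz_one_J by fastforce
      qed
    qed (use prime_P[OF p] TT_fin F_def in auto)
    then show False using x by (simp add: F_def GG_def)
  qed
  then obtain s where s: "s \<in> TT" "of_nat p * s - x \<in> J" "s + hz 1 \<notin> S" by (auto simp: F_def)
  then have sS: "s \<in> S" using TT_sub by blast
  obtain y where y: "ep p * s = hz y" and Y: "s - ep p * s \<in> YY" using SL[OF sS s(3)] by blast
  define y0 where "y0 = s - ep p * s"
  have sC: "s \<in> C" using sS aset_sub[OF S] by blast
  have "om * y0 = of_nat p * s - of_nat p * hz y"
  proof -
    have "om * y0 = of_nat p * (e * y0) - of_nat p * (ep p * y0) + ep p * y0" by (simp add: om_def algebra_simps)
    moreover have "ep p * y0 = 0" using p sC by (simp add: y0_def right_diff_distrib)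
    moreover have "e * y0 = y0" using sC p by (simp add: y0_def)
    ultimately have "om * y0 = of_nat p * y0" by simp
    then show ?thesis by (simp add: y0_def y right_diff_distrib)
  qed
  then have "om * (uinv om * x - y0) = - (of_nat p * s - x) + of_nat p * hz y"
    using inv_cancel(1)[OF om_Us x(1)] by (simp add: right_diff_distrib)
  then have "om * (uinv om * x - y0) \<in> J" using Jadd Jum s(2) p_hz by metis
  moreover have "uinv om * x - y0 \<in> C" using x sC p by (simp add: y0_def)
  ultimately have "uinv om * x - y0 \<in> J" by (rule om_cancel)
  then show ?thesis using YY_J Y by (simp add: y0_def)
qed

text \<open>Off \<open>p\<close>, multiplication by \<open>p\<close> is invertible, which is
  expressed through \<open>om\<close>; at \<open>p\<close>, a level below \<open>a - 1\<close> would
  put \<open>p^(a-1) * ep p\<close> into \<open>J\<close>.\<close>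

lemma p_div_J: assumes d: "d \<in> C" "of_nat p * d \<in> J" shows "\<exists>z. d - hz z \<in> J"
proof -
  have "om * (d - ep p * d) = of_nat p * d - ep p * (of_nat p * d)"
  proof -
    have "om * (d - ep p * d) = of_nat p * (e * d) - of_nat p * (ep p * d) - of_nat p * ((e * ep p) * d)
       + of_nat p * ((ep p * ep p) * d) + ep p * d - (ep p * ep p) * d" by (simp add: om_def algebra_simps)
    also have "\<dots> = of_nat p * d - of_nat p * (ep p * d)" using d(1) p by (simp add: idem)
    finally show ?thesis by (simp add: mult.left_commute)
  qed
  then have "om * (d - ep p * d) \<in> J" using Jdiff Jmult d(2) by metis
  then have 1: "d - ep p * d \<in> J" using om_cancel d(1) p by simp
  have "\<exists>z. ep p * d = hz z"
  proof (cases "ep p * d = 0")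
    case True then show ?thesis using hz_zero by metis
  next
    case False
    obtain i v where iv: "i < nn p" "v \<in> Us" "ep p * d = of_nat p ^ i * ep p * v" using level[OF p False] by blast
    have "ep p * (of_nat p * d) = of_nat p * (ep p * d)" by (rule mult.left_commute)
    then have "of_nat p ^ (i + 1) * ep p * v = ep p * (of_nat p * d)"
      unfolding iv(3) by (simp add: mult_ac)
    then have J1: "of_nat p ^ (i + 1) * ep p * v \<in> J" using Jmult d(2) by metis
    have "a - 1 \<le> i"
    proof (rule ccontr)
      assume lt: "\<not> a - 1 \<le> i"
      have "of_nat p ^ (i + 1) * ep p * of_nat p ^ (a - 1 - (i + 1)) \<in> J"
        using ideal_level[OF JI p J1 un_unit[OF iv(2) p]] .
      moreover have "of_nat p ^ (i + 1) * ep p * of_nat p ^ (a - 1 - (i + 1)) = of_nat p ^ (i + 1 + (a - 1 - (i + 1))) * ep p"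
        by (simp only: power_add mult_ac)
      moreover have "i + 1 + (a - 1 - (i + 1)) = a - 1" using lt by simp
      ultimately show False using a(3) by metis
    qed
    then have "ep p * d = hz (of_nat p ^ (i - (a - 1)) * v)" unfolding iv(3) hz_def
      by (metis (no_types, lifting) le_add_diff_inverse mult.assoc mult.left_commute power_add)
    then show ?thesis by blast
  qed
  then show ?thesis using 1 by metis
qed

text \<open>By \<open>p_div_J\<close> the solutions are the representatives of those
  \<open>y + hz z\<close> that lie in \<open>S\<close>; nonunits \<open>z\<close> give the class of
  \<open>y\<close>, and all units behave alike. If \<open>y\<close> is in \<open>S\<close>, only
  \<open>rep y\<close> remains and the count is 1. If not, \<open>rep y\<close> is the only class
  missing from a full coset of the layer, whose size is a multiple of \<open>p\<close>, so the count
  is -1 modulo \<open>p\<close>.\<close>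

lemma YY_imp_GG: assumes y: "y \<in> YY" shows "\<not> p dvd GG (om * y)"
proof -
  have yC: "y \<in> C" and yJ: "ep p * y \<in> J" and yS: "(y \<in> S) \<noteq> (y + hz 1 \<in> S)" using y by (auto simp: YY_def)
  define F where "F = {s\<in>TT. of_nat p * s - om * y \<in> J}"
  have F_iff: "s \<in> F \<longleftrightarrow> s \<in> TT \<and> of_nat p * (s - y) \<in> J" for s
    using Jadd[OF _ om_J[OF yJ yC], of "of_nat p * s - om * y"] Jdiff[OF _ om_J[OF yJ yC], of "of_nat p * s - of_nat p * y"]
    by (auto simp: F_def right_diff_distrib)
  have unit: "y + hz z \<in> S \<longleftrightarrow> y + hz 1 \<in> S" if "un p z" for z
  proof -
    define y0 where "y0 = y - ep p * y"
    have "ep p * y0 = 0" "y0 \<in> C" using yC p by (simp_all add: y0_def right_diff_distrib)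
    from hz_unit[OF this that] have "y0 + hz z \<in> S \<longleftrightarrow> y0 + hz 1 \<in> S" .
    moreover have "y + hz x \<in> S \<longleftrightarrow> y0 + hz x \<in> S" for x by (rule SJ_iff) (use yJ in \<open>simp add: y0_def\<close>)
    ultimately show ?thesis by simp
  qed
  have nun: "y + hz z \<in> S \<longleftrightarrow> y \<in> S" if "\<not> un p z" for z
    by (rule SJ_iff) (use hz_not_un[OF that] in simp)
  have F_form: "\<exists>z. s = rep (y + hz z) \<and> y + hz z \<in> S" if "s \<in> F" for s
  proof -
    have sS: "s \<in> S" "s \<in> TT" using that TT_sub F_iff by auto
    then have "s \<in> C" using aset_sub[OF S] by blast
    then have "s - y \<in> C" using yC by simp
    moreover have "of_nat p * (s - y) \<in> J" using that F_iff by simp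
    ultimately obtain z where z: "s - y - hz z \<in> J" using p_div_J by meson
    then have *: "s - (y + hz z) \<in> J" by (simp add: algebra_simps)
    have "rep s = rep (y + hz z)" using * by (rule rep_cong)
    moreover have "y + hz z \<in> S" using SJ_iff[OF *] sS(1) by simp
    ultimately show ?thesis using TT_rep[OF sS(2)] by (intro exI[of _ z]) simp
  qed
  have form_F: "rep (y + hz z) \<in> F" if "y + hz z \<in> S" for z
  proof -
    have "of_nat p * (rep (y + hz z) - y) = of_nat p * (rep (y + hz z) - (y + hz z)) + of_nat p * hz z"
      by (simp add: algebra_simps)
    then have "of_nat p * (rep (y + hz z) - y) \<in> J" using Jadd Jmult rep_in p_hz by metis
    then show ?thesis using F_iff rep_TT that by simp
  qed
  show ?thesis
  proof (cases "y \<in> S")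
    case True
    have "F = {rep y}"
    proof
      show "{rep y} \<subseteq> F" using form_F[of 0] True by (simp add: hz_zero)
      show "F \<subseteq> {rep y}"
      proof
        fix s assume "s \<in> F"
        then obtain z where z: "s = rep (y + hz z)" "y + hz z \<in> S" using F_form by blast
        then have "\<not> un p z" using unit yS True by blast
        then have "rep (y + hz z) = rep y" using hz_not_un by (intro rep_cong) simp
        then show "s \<in> {rep y}" using z by simp
      qed
    qed
    then have "GG (om * y) = 1" by (simp add: GG_def F_def)
    then show ?thesis using prime_P[OF p] by (auto dest: prime_gt_1_nat)
  next
    case False
    define F' where "F' = range (\<lambda>z. rep (y + hz z))"
    define f where "f s = rep (s + hz 1)" for s
    have F'_eq: "F' = insert (rep y) F"
    proof
      show "insert (rep y) F \<subseteq> F'" using F_form hz_zero unfolding F'_def by (auto intro: image_eqI[of _ _ 0])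
      show "F' \<subseteq> insert (rep y) F"
      proof
        fix s assume "s \<in> F'"
        then obtain z where z: "s = rep (y + hz z)" by (auto simp: F'_def)
        show "s \<in> insert (rep y) F"
        proof (cases "un p z")
          case True
          then show ?thesis using unit yS False form_F z by blast
        next
          case nz: False
          then have "rep (y + hz z) = rep y" using hz_not_un by (intro rep_cong) simp
          then show ?thesis using z by simp
        qed
      qed
    qed
    have notin: "rep y \<notin> F" using F_iff TT_sub SJ_iff[OF rep_in] False by blast
    have finF: "finite F" using TT_fin by (simp add: F_def)
    have f1: "f (rep (y + hz z)) = rep (y + hz (z + 1))" for z
      using rep_add[of "y + hz z" "hz 1"] by (simp add: f_def hz_add add_ac)
    have fk: "(f ^^ k) (rep (y + hz z)) = rep (y + hz (z + of_nat k))" for k z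
      by (induction k) (auto simp: f1 add_ac)
    have "p dvd card F'"
    proof (rule dvd_card_if_cyclic_action[of _ _ f])
      fix s assume "s \<in> F'"
      then obtain z where z: "s = rep (y + hz z)" by (auto simp: F'_def)
      show "f s \<in> F'" unfolding z f1 F'_def by blast
      have "rep (y + hz (z + of_nat p)) = rep (y + hz z)"
      proof (rule rep_cong)
        have "hz (of_nat p) = of_nat p * hz 1" by (simp add: hz_def mult_ac)
        then show "y + hz (z + of_nat p) - (y + hz z) \<in> J" using p_hz[of 1] by (simp add: hz_add)
      qed
      then show "(f ^^ p) s = s" unfolding z fk .
      show "f s \<noteq> s"
      proof
        assume "f s = s"
        then have "rep (y + hz (z + 1)) = rep (y + hz z)" unfolding z f1 .
        then have "y + hz (z + 1) - (y + hz z) \<in> J" by (rule rep_eqD)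
        then show False using hz_one_J by (simp add: hz_add)
      qed
    qed (use prime_P[OF p] finF F'_eq in auto)
    then have "p dvd Suc (card F)" using F'_eq notin finF by simp
    then have "\<not> p dvd card F" using prime_P[OF p] by (metis dvd_add_right_iff not_prime_unit nat_dvd_1_iff_1 plus_1_eq_Suc add.commute)
    then show ?thesis by (simp add: GG_def F_def)
  qed
qed

text \<open>The set where \<open>p\<close> does not divide \<open>GG\<close> is the image of
  \<open>YY\<close> under the unit \<open>om\<close>, so applying \<open>uinv om\<close> transfers
  \<open>GG_aset\<close> to \<open>YY\<close>.\<close>

lemma aset_YY: "aset YY"
proof -
  have "{x\<in>C. \<not> p dvd GG x} = (*) om ` YY"
  proof (intro equalityI subsetI)
    fix x assume "x \<in> {x\<in>C. \<not> p dvd GG x}"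
    then show "x \<in> (*) om ` YY" using GG_imp_YY[of x] inv_cancel(1)[OF om_Us, of x] by (metis (no_types, lifting) image_eqI mem_Collect_eq)
  next
    fix x assume "x \<in> (*) om ` YY"
    then show "x \<in> {x\<in>C. \<not> p dvd GG x}" using YY_imp_GG om_Us by (auto simp: YY_def)
  qed
  then have "aset ((*) om ` YY)" using GG_aset by simp
  then have "aset ((*) (uinv om) ` ((*) om ` YY))" using aset_img uinv(1)[OF om_Us] by blast
  moreover have "(*) (uinv om) ` ((*) om ` YY) = YY"
  proof -
    have "(\<lambda>x. uinv om * (om * x)) ` YY = (\<lambda>x. x) ` YY" using inv_cancel(2)[OF om_Us] by (intro image_cong) (auto simp: YY_def)
    then show ?thesis by (simp add: image_image)
  qed
  ultimately show ?thesis by simp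
qed

end

context sr_data begin

text \<open>Closure under the units that differ from the identity only at \<open>p\<close>. It holds
  for unit-invariant sets and for basic sets containing a point with vanishing
  \<open>p\<close>-component.\<close>

definition stable :: "nat \<Rightarrow> 'a set \<Rightarrow> bool" where
  "stable p S \<longleftrightarrow> (\<forall>u\<in>Us. (\<forall>q\<in>P. q \<noteq> p \<longrightarrow> ep q * u = ep q) \<longrightarrow> (\<forall>s\<in>S. u * s \<in> S))"

lemma boundary_aset:
  assumes "aideal J" "aset S" "\<forall>s\<in>S. \<forall>j\<in>J. s + j \<in> S"
    "p \<in> P" "1 \<le> a" "of_nat p ^ a * ep p \<in> J" "of_nat p ^ (a - 1) * ep p \<notin> J"
    "stable p S"
  defines "Y \<equiv> {x\<in>C. ep p * x \<in> J \<and> (x \<in> S) \<noteq> (x + of_nat p ^ (a - 1) * ep p \<in> S)}"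
  shows "aset Y"
    and "s \<in> S \<Longrightarrow> s + of_nat p ^ (a - 1) * ep p * r \<notin> S \<Longrightarrow> \<exists>y. ep p * s = of_nat p ^ (a - 1) * ep p * y"
    and "s \<in> S \<Longrightarrow> s + of_nat p ^ (a - 1) * ep p * r \<notin> S \<Longrightarrow> s - ep p * s \<in> Y"
proof -
  interpret tt: sr_tt P ep nn bl J S p a
    by unfold_locales (use assms in \<open>auto simp: stable_def\<close>)
  have Y: "Y = tt.YY" by (simp only: Y_def tt.YY_def tt.hz_def mult_1_right)
  show "aset Y" using tt.aset_YY Y by simp
  show "s \<in> S \<Longrightarrow> s + of_nat p ^ (a - 1) * ep p * r \<notin> S \<Longrightarrow> \<exists>y. ep p * s = of_nat p ^ (a - 1) * ep p * y"
    "s \<in> S \<Longrightarrow> s + of_nat p ^ (a - 1) * ep p * r \<notin> S \<Longrightarrow> s - ep p * s \<in> Y"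
    using tt.SL[of s r] unfolding Y tt.hz_def by blast+
qed

section \<open>The basic set of the identity\<close>

definition X0 :: "'a set" where "X0 = bl e"
definition U0 :: "'a set" where "U0 = {u * x | u x. u \<in> Us \<and> x \<in> X0}"
text \<open>The translation stabiliser of the unit orbit \<open>U0\<close>. It is also the zero set
  of the loss of \<open>U0\<close>, which makes it a union of basic sets.\<close>

definition J0 :: "'a set" where "J0 = {g\<in>C. \<forall>x\<in>U0. x + g \<in> U0}"
text \<open>The largest A-ideal whose \<open>p\<close>-components lie in \<open>J0\<close>. If
  \<open>ep p\<close> is not in \<open>J0\<close>, its complement will turn out to be
  \<open>U0 + Mp p\<close>, so that it is a maximal proper A-ideal.\<close>

definition Mp :: "nat \<Rightarrow> 'a set" where "Mp p = core {x\<in>C. ep p * x \<in> J0}"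
definition It :: "nat \<Rightarrow> 'a set" where "It t = range (\<lambda>r. hh t * r)"

lemma It_ideal: assumes "t \<in> P" shows "is_ideal (It t)"
  unfolding is_ideal_def
proof (intro conjI ballI allI)
  show "It t \<subseteq> C" using assms by (auto simp: It_def)
  show "0 \<in> It t" unfolding It_def by (metis mult_zero_right rangeI)
  show "x + y \<in> It t" if "x \<in> It t" "y \<in> It t" for x y using that unfolding It_def by (auto simp: distrib_left[symmetric])
  show "r * x \<in> It t" if "x \<in> It t" for x r
  proof -
    obtain w where "x = hh t * w" using \<open>x \<in> It t\<close> by (auto simp: It_def)
    then have "r * x = hh t * (r * w)" by (simp add: mult.left_commute)
    then show ?thesis by (auto simp: It_def)
  qed
qed
lemma It_ep: "t \<in> P \<Longrightarrow> g \<in> It t \<Longrightarrow> ep t * g = g"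
  by (auto simp: It_def mult.assoc[symmetric])
lemma It_p: "t \<in> P \<Longrightarrow> g \<in> It t \<Longrightarrow> of_nat t * g = 0"
  using p_hh by (auto simp: It_def mult.assoc[symmetric])

lemma X0_C: "X0 \<subseteq> C" using bl_sub by (simp add: X0_def)
lemma aset_X0: "aset X0" by (simp add: X0_def aset_bl)
lemma e_X0: "e \<in> X0" by (simp add: X0_def bl_in)
lemma U0_Us: "u \<in> Us \<Longrightarrow> x \<in> U0 \<Longrightarrow> u * x \<in> U0"
  unfolding U0_def by clarify (metis Us_mult mult.assoc)
lemma X0_U0: "X0 \<subseteq> U0"
proof
  fix x assume x: "x \<in> X0"
  then have "x = e * x" using X0_C by auto
  then show "x \<in> U0" unfolding U0_def using x e_Un by blast
qed
lemma aset_U0: "aset U0"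
proof -
  have "U0 = \<Union>((\<lambda>u. (*) u ` X0) ` Us)" by (auto simp: U0_def)
  moreover have "aset (\<Union>((\<lambda>u. (*) u ` X0) ` Us))" by (rule aset_Union) (use aset_img aset_X0 in auto)
  ultimately show ?thesis by simp
qed
lemma U0_C: "U0 \<subseteq> C" using aset_sub aset_U0 .

text \<open>The basic set of a point of \<open>U0\<close> is a unit multiple of \<open>X0\<close>,
  and \<open>X0\<close> contains the identity.\<close>

lemma U0_meets: assumes "aset S" "x \<in> S" "x \<in> U0" shows "\<exists>u\<in>Us. u \<in> S"
proof -
  obtain u y where u: "u \<in> Us" "y \<in> X0" "x = u * y" using assms(3) by (auto simp: U0_def)
  have "bl y = X0" using u(2) bl_same[of e y] by (simp add: X0_def)
  then have "bl x = (*) u ` X0" using u bl_unit X0_C by auto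
  then have "u * e \<in> bl x" using e_X0 by blast
  then show ?thesis using asetD[OF assms(1,2)] u(1) by auto
qed

lemma ideal_unit: assumes "is_ideal I" "u \<in> Us" "u \<in> I" shows "e \<in> I"
  using is_idealD(4)[OF assms(1,3), of "uinv u"] uinv(3)[OF assms(2)] by simp

lemma ideal_all: assumes "is_ideal I" "e \<in> I" shows "I = C"
proof
  show "C \<subseteq> I"
  proof
    fix x assume "x \<in> C"
    then show "x \<in> I" using is_idealD(4)[OF assms, of x] by simp
  qed
qed (use is_idealD(1)[OF assms(1)] in simp)

lemma aideal_U0: assumes "aideal I" "x \<in> I" "x \<in> U0" shows "e \<in> I"
  using U0_meets[OF aidealD(2)[OF assms(1)] assms(2,3)] ideal_unit[OF aidealD(1)[OF assms(1)]] by blast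

lemma unit_off: assumes "p \<in> P" "u \<in> Us" "\<And>q. q \<in> P \<Longrightarrow> q \<noteq> p \<Longrightarrow> ep q * u = ep q" "z \<in> C" "ep p * z = 0"
  shows "u * z = z"
proof (rule C_eqI)
  fix q assume q: "q \<in> P"
  have "ep q * (u * z) = (ep q * u) * z" by (simp add: mult.assoc)
  moreover have "ep q * (u * z) = u * (ep q * z)" by (rule mult.left_commute)
  ultimately show "ep q * (u * z) = ep q * z" using assms(3)[OF q] assms(5) by (cases "q = p") auto
qed (use assms in auto)

lemma nil_zero: "p \<in> P \<Longrightarrow> of_nat p ^ nn p * ep p \<in> {0}" using nil by simp
lemma not_nil_zero: "p \<in> P \<Longrightarrow> of_nat p ^ (nn p - 1) * ep p \<notin> {0}" using not_nil by simp
lemma nn1: "p \<in> P \<Longrightarrow> 1 \<le> nn p" using nn_pos[of p] by simp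

text \<open>The boundary results for \<open>J = 0\<close>; then \<open>a\<close> is the nilpotency
  exponent \<open>nn p\<close> and the layer is the minimal ideal at \<open>p\<close>.\<close>

lemma TT_zero:
  assumes S: "aset S" and p: "p \<in> P" and st: "stable p S"
  shows "aset {x\<in>C. ep p * x = 0 \<and> (x \<in> S) \<noteq> (x + hh p \<in> S)}"
    and "s \<in> S \<Longrightarrow> s + hh p * r \<notin> S \<Longrightarrow> \<exists>y. ep p * s = hh p * y"
    and "s \<in> S \<Longrightarrow> s + hh p * r \<notin> S \<Longrightarrow> (s - ep p * s \<in> S) \<noteq> (s - ep p * s + hh p \<in> S)"
proof -
  have z: "\<forall>s\<in>S. \<forall>j\<in>{0}. s + j \<in> S" by simp
  note * = boundary_aset[OF aideal_zero S z p nn1[OF p] nil_zero[OF p] not_nil_zero[OF p] st]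
  show "aset {x\<in>C. ep p * x = 0 \<and> (x \<in> S) \<noteq> (x + hh p \<in> S)}"
    using *(1) unfolding hh_def by simp
  show "s \<in> S \<Longrightarrow> s + hh p * r \<notin> S \<Longrightarrow> \<exists>y. ep p * s = hh p * y"
    using *(2)[of s r] unfolding hh_def by blast
  show "s \<in> S \<Longrightarrow> s + hh p * r \<notin> S \<Longrightarrow> (s - ep p * s \<in> S) \<noteq> (s - ep p * s + hh p \<in> S)"
    using *(3)[of s r] unfolding hh_def by blast
qed

text \<open>A unit that is trivial off \<open>p\<close> fixes \<open>y\<close>, hence preserves the
  basic set of \<open>y\<close>.\<close>

lemma stable_bl: assumes p: "p \<in> P" and x: "x \<in> C" and y: "y \<in> bl x" "ep p * y = 0" shows "stable p (bl x)"
  unfolding stable_def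
proof (intro ballI impI)
  fix u s assume u: "u \<in> Us" "\<forall>q\<in>P. q \<noteq> p \<longrightarrow> ep q * u = ep q" and s: "s \<in> bl x"
  have "u * y = y" using unit_off[OF p u(1) _ bl_C[OF x y(1)] y(2)] u(2) by blast
  then have "u * y \<in> bl x" using y(1) by simp
  then show "u * s \<in> bl x" by (rule stab_mem[OF u(1) x y(1) _ s])
qed

text \<open>If the translate left \<open>bl z\<close>, then \<open>z\<close> would be a boundary
  point. The boundary is a union of basic sets and all its points vanish at \<open>t\<close>, so all
  of \<open>bl z\<close> would vanish at \<open>t\<close>.\<close>

lemma translate_bl:
  assumes t: "t \<in> P" and z: "z \<in> C" "ep t * z = 0" and b: "\<not> bl z \<subseteq> {x\<in>C. ep t * x = 0}"
  shows "z + hh t * r \<in> bl z"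
proof (rule ccontr)
  assume n: "z + hh t * r \<notin> bl z"
  note * = TT_zero[OF aset_bl[OF z(1)] t stable_bl[OF t z(1) bl_in[OF z(1)] z(2)]]
  have "(z \<in> bl z) \<noteq> (z + hh t \<in> bl z)" using *(3)[OF bl_in[OF z(1)] n] z(2) by simp
  then have "z \<in> {x\<in>C. ep t * x = 0 \<and> (x \<in> bl z) \<noteq> (x + hh t \<in> bl z)}" using z by simp
  then have "bl z \<subseteq> {x\<in>C. ep t * x = 0 \<and> (x \<in> bl z) \<noteq> (x + hh t \<in> bl z)}" using *(1) asetD by blast
  then show False using b by blast
qed

subsection \<open>The maximal A-ideals\<close>

lemma J0_aideal: "aideal J0"
  unfolding aideal_def
proof
  show "is_ideal J0"
  proof (rule ideal_unitsI)
    show "J0 \<subseteq> C" "0 \<in> J0" by (auto simp: J0_def)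
    show "x + y \<in> J0" if "x \<in> J0" "y \<in> J0" for x y
      using that by (auto simp: J0_def add.assoc[symmetric])
    fix u g assume u: "u \<in> Us" and g: "g \<in> J0"
    have "x + u * g \<in> U0" if "x \<in> U0" for x
    proof -
      have "uinv u * x + g \<in> U0" using g U0_Us[OF uinv(1)[OF u] that] by (auto simp: J0_def)
      then have "u * (uinv u * x + g) \<in> U0" using U0_Us u by blast
      then show ?thesis using inv_cancel(1)[OF u, of x] that U0_C by (auto simp: distrib_left)
    qed
    then show "u * g \<in> J0" using g by (auto simp: J0_def)
  qed
  have "J0 = {g\<in>C. ls U0 g = 0}"
    using aset_finite[OF aset_U0] by (auto simp: J0_def ls_def)
  then show "aset J0" using aset_level[of "ls U0" "\<lambda>n. n = 0"] ls_const[OF aset_U0] by metis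
qed
lemma J0_ideal: "is_ideal J0" using J0_aideal aidealD by blast

lemma Mp_aideal: "p \<in> P \<Longrightarrow> aideal (Mp p)" unfolding Mp_def by (intro core_aideal ideal_ep J0_ideal)
lemma Mp_ep: "x \<in> Mp p \<Longrightarrow> ep p * x \<in> J0" using core_sub[of "{x\<in>C. ep p * x \<in> J0}"] by (auto simp: Mp_def)

lemma U0_Mp: assumes "p \<in> P" "ep p \<notin> J0" shows "U0 \<inter> Mp p = {}"
proof (rule ccontr)
  assume "U0 \<inter> Mp p \<noteq> {}"
  then have "e \<in> Mp p" using aideal_U0[OF Mp_aideal[OF assms(1)]] by blast
  then show False using Mp_ep[of e p] assms by simp
qed

lemma J0_Mp: "p \<in> P \<Longrightarrow> J0 \<subseteq> Mp p"
  unfolding Mp_def by (rule core_max[OF aidealD(2)[OF J0_aideal]])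
    (use is_idealD(4)[OF J0_ideal] is_idealD(8)[OF J0_ideal] in auto)

text \<open>Let \<open>a\<close> be least with \<open>p^a * ep p\<close> in \<open>J0\<close>. The
  boundary of \<open>U0\<close> along the layer \<open>p^(a-1)\<close> is a union of basic sets with
  \<open>p\<close>-components in \<open>J0\<close>, so it lies in \<open>Mp p\<close>. Thus
  \<open>U0\<close>, modulo \<open>Mp p\<close>, fails to be invariant under the layer only inside
  the layer. With \<open>O' = U0 + Mp p\<close> and \<open>H\<close> the sum of \<open>Mp p\<close>
  and the layer, \<open>orbit_union_closed\<close> makes \<open>O' \<union> Mp p\<close> an ideal,
  and it contains \<open>e\<close>.\<close>

lemma Mp_cover:
  assumes p: "p \<in> P" and nJ: "ep p \<notin> J0" and y: "y \<in> C" "y \<notin> Mp p"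
  shows "\<exists>x\<in>U0. \<exists>m\<in>Mp p. y = x + m"
proof -
  define Q where "Q k \<longleftrightarrow> of_nat p ^ k * ep p \<in> J0" for k
  define a where "a = (LEAST k. Q k)"
  have "Q (nn p)" using nil[OF p] is_idealD(2)[OF J0_ideal] by (simp add: Q_def)
  then have Qa: "Q a" and least: "\<And>k. k < a \<Longrightarrow> \<not> Q k" unfolding a_def using LeastI not_less_Least by blast+
  have a1: "1 \<le> a" using Qa nJ by (cases a) (auto simp: Q_def)
  then have Qa1: "\<not> Q (a - 1)" using least by simp
  define hz where "hz z = of_nat p ^ (a - 1) * ep p * z" for z
  define M where "M = Mp p"
  have MI: "is_ideal M" using Mp_aideal aidealD p by (auto simp: M_def)
  note M = is_idealD[OF MI]
  have JM: "J0 \<subseteq> M" using J0_Mp p by (simp add: M_def)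
  have UM: "U0 \<inter> M = {}" using U0_Mp p nJ by (simp add: M_def)
  define Y where "Y = {x\<in>C. ep p * x \<in> J0 \<and> (x \<in> U0) \<noteq> (x + of_nat p ^ (a - 1) * ep p \<in> U0)}"
  have SJ: "\<forall>s\<in>U0. \<forall>j\<in>J0. s + j \<in> U0" by (simp add: J0_def)
  have st: "stable p U0" using U0_Us by (simp add: stable_def)
  note TT = boundary_aset[OF J0_aideal aset_U0 SJ p a1 Qa[unfolded Q_def] Qa1[unfolded Q_def] st, folded Y_def hz_def]
  have "Y \<subseteq> M" unfolding M_def Mp_def by (rule core_max[OF TT(1)]) (auto simp: Y_def)
  then have SLM: "\<exists>y. ep p * s = hz y \<and> s - hz y \<in> M" if "s \<in> U0" "s + hz r \<notin> U0" for s r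
    using TT(2)[OF that] TT(3)[OF that] by (metis subsetD)
  have hz_add: "hz (x + y) = hz x + hz y" for x y by (simp add: hz_def distrib_left)
  have hzC: "hz z \<in> C" for z using p by (simp add: hz_def)
  have hz_nun: "hz z \<in> M" if nz: "\<not> un p z" for z
  proof -
    obtain w where w: "ep p * z = of_nat p * ep p * w" using nz not_un_iff[OF p] by blast
    have "hz z = of_nat p ^ (a - 1) * (ep p * z)" by (simp add: hz_def mult.assoc)
    also have "\<dots> = of_nat p ^ Suc (a - 1) * ep p * w" unfolding w by (simp add: mult_ac)
    also have "\<dots> = of_nat p ^ a * ep p * w" using a1 by (metis Suc_pred' less_eq_Suc_le One_nat_def)
    finally show ?thesis using is_idealD(5)[OF J0_ideal Qa[unfolded Q_def]] JM by auto
  qed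
  have hz_unit: "\<exists>u\<in>Us. hz z' = u * hz z" if z: "un p z" "un p z'" for z z'
  proof -
    obtain w where w: "ep p * z * w = ep p" using z(1) by (auto simp: un_def)
    then have "ep p * w * z = ep p" by (simp add: mult_ac)
    then have "un p w" by (auto simp: un_def)
    then have "lift p (w * z') \<in> Us" using lift_Us p un_mult z(2) by blast
    moreover have "lift p (w * z') * hz z = hz z'"
    proof -
      have "ep p * hz x = of_nat p ^ (a - 1) * (ep p * ep p) * x" for x by (simp only: hz_def mult_ac)
      then have ephz: "ep p * hz x = hz x" for x by (simp only: idem[OF p] hz_def)
      have "lift p (w * z') * hz z = ep p * (w * z') * hz z"
        using lift_mult[OF p hzC, of "w * z'"] ephz by simp
      also have "\<dots> = of_nat p ^ (a - 1) * ep p * z' * (ep p * z * w)" by (simp only: hz_def mult_ac)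
      also have "\<dots> = ep p * hz z'" unfolding w by (simp only: hz_def mult_ac)
      finally have "lift p (w * z') * hz z = ep p * hz z'" .
      also have "\<dots> = hz z'" by (rule ephz)
      finally show ?thesis .
    qed
    ultimately show ?thesis by metis
  qed
  define O' where "O' = {x + m | x m. x \<in> U0 \<and> m \<in> M}"
  have O'I: "x + m \<in> O'" if "x \<in> U0" "m \<in> M" for x m using that by (auto simp: O'_def)
  have UO: "x \<in> O'" if "x \<in> U0" for x using O'I[OF that M(2)] by simp
  have OUs: "u * x \<in> O'" if "u \<in> Us" "x \<in> O'" for u x
  proof -
    obtain y m where y: "y \<in> U0" "m \<in> M" "x = y + m" using \<open>x \<in> O'\<close> by (auto simp: O'_def)
    then have "u * x = u * y + u * m" by (simp add: distrib_left)
    then show ?thesis using O'I[OF U0_Us[OF that(1) y(1)] M(4)[OF y(2)]] by simp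
  qed
  have OM: "x + m \<in> O'" if "x \<in> O'" "m \<in> M" for x m
  proof -
    obtain y m' where y: "y \<in> U0" "m' \<in> M" "x = y + m'" using \<open>x \<in> O'\<close> by (auto simp: O'_def)
    then have eq: "x + m = y + (m' + m)" by (simp add: add.assoc)
    show ?thesis unfolding eq using O'I[OF y(1) M(3)[OF y(2) that(2)]] .
  qed
  have OMe: "O' \<inter> M = {}"
  proof -
    have False if "x \<in> U0" "m \<in> M" "x + m \<in> M" for x m
      using M(7)[OF that(3,2)] that(1) UM by auto
    then show ?thesis by (auto simp: O'_def)
  qed
  \<comment> \<open>By minimality of \<open>a\<close>, some point of \<open>U0\<close> leaves
    \<open>U0\<close> under \<open>hz 1\<close>; it differs from its \<open>p\<close>-component, a
    point of the layer, by an element of \<open>Mp p\<close>.\<close>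
  obtain z where hz: "hz z \<in> O'"
  proof -
    have "hz 1 \<notin> J0" using Qa1 by (simp add: Q_def hz_def)
    then obtain x where x: "x \<in> U0" "x + hz 1 \<notin> U0" using hzC by (auto simp: J0_def)
    then obtain y where y: "ep p * x = hz y" "x - hz y \<in> M" using SLM by blast
    have "hz y = x + - (x - hz y)" by simp
    then have "hz y \<in> O'" using O'I[OF x(1) M(6)[OF y(2)]] by metis
    then show ?thesis using that by blast
  qed
  have unz: "un p z" using hz hz_nun OMe by blast
  have hzO: "hz z' \<in> O'" if "un p z'" for z' using hz_unit[OF unz that] OUs hz by auto
  define H where "H = {m + k | m k. m \<in> M \<and> k \<in> range hz}"
  have "is_ideal (range hz)" unfolding is_ideal_def
  proof (intro conjI ballI allI)
    show "range hz \<subseteq> C" using hzC by auto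
    show "0 \<in> range hz" using rangeI[of hz 0] by (simp add: hz_def)
    show "x + y \<in> range hz" if "x \<in> range hz" "y \<in> range hz" for x y using that hz_add by (auto simp: hz_add[symmetric])
    show "r * x \<in> range hz" if "x \<in> range hz" for x r
    proof -
      obtain w where "x = hz w" using \<open>x \<in> range hz\<close> by blast
      then have "r * x = hz (r * w)" by (simp add: hz_def mult_ac)
      then show ?thesis by blast
    qed
  qed
  then have HI: "is_ideal H" unfolding H_def by (rule ideal_sum[OF MI])
  have closed: "x + y \<in> O' \<union> M" if "x \<in> O'" "y \<in> O'" for x y
  proof (rule orbit_union_closed[where b = e and H = H and h = "hz z"])
    show "aset O'" unfolding O'_def M_def by (rule aset_sum[OF aset_U0 aidealD(2)[OF Mp_aideal[OF p]]])
    show "aideal M" using Mp_aideal p by (simp add: M_def)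
    show "\<exists>u\<in>Us. \<exists>m\<in>M. \<exists>y\<in>bl e. x = u * y + m" if "x \<in> O'" for x
      using that unfolding O'_def U0_def X0_def by blast
    show "M \<subseteq> H" using rangeI[of hz 0] by (force simp: H_def hz_def)
    show "hz z \<in> H" using M(2) by (force simp: H_def)
    show "H - M \<subseteq> O'"
    proof
      fix k assume k: "k \<in> H - M"
      then obtain m w where mw: "m \<in> M" "k = m + hz w" by (auto simp: H_def)
      then have "un p w" using k hz_nun M(3) by blast
      then show "k \<in> O'" using hzO OM mw by (metis add.commute)
    qed
    show "x + k \<in> O'" if "x \<in> O'" "x \<notin> H" "k \<in> H" for x k
    proof -
      obtain x0 m where x: "x0 \<in> U0" "m \<in> M" "x = x0 + m" using \<open>x \<in> O'\<close> by (auto simp: O'_def)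
      obtain m' w where k: "m' \<in> M" "k = m' + hz w" using \<open>k \<in> H\<close> by (auto simp: H_def)
      have "x0 + hz w \<in> U0"
      proof (rule ccontr)
        assume "x0 + hz w \<notin> U0"
        then obtain y where y: "x0 - hz y \<in> M" using SLM x(1) by blast
        have "x = ((x0 - hz y) + m) + hz y" by (simp add: x)
        then have "x \<in> H" unfolding H_def using M(3)[OF y x(2)] by blast
        then show False using that by simp
      qed
      moreover have "x + k = (x0 + hz w) + (m + m')" by (simp add: x k)
      ultimately show ?thesis using O'I M(3)[OF x(2) k(1)] by metis
    qed
  qed (use OUs OM OMe HI hz that in auto)
  have "is_ideal (O' \<union> M)"
  proof (rule ideal_unitsI)
    show "O' \<union> M \<subseteq> C" using U0_C M(8) by (auto simp: O'_def)
    show "0 \<in> O' \<union> M" using M(2) by simp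
    show "x + y \<in> O' \<union> M" if "x \<in> O' \<union> M" "y \<in> O' \<union> M" for x y
      using that closed OM M(3) by (metis Un_iff add.commute)
    show "u * x \<in> O' \<union> M" if "u \<in> Us" "x \<in> O' \<union> M" for u x using that OUs M(4) by blast
  qed
  moreover have "e \<in> O' \<union> M" using UO e_X0 X0_U0 by blast
  ultimately have "O' \<union> M = C" by (rule ideal_all)
  then have "y \<in> O'" using y unfolding M_def[symmetric] by blast
  then show ?thesis unfolding M_def[symmetric] O'_def by blast
qed

lemma U0_Lv: assumes "p \<in> P" "X0 \<inter> Lv p i = {}" shows "U0 \<inter> Lv p i = {}"
proof (rule ccontr)
  assume "U0 \<inter> Lv p i \<noteq> {}"
  then obtain u x where u: "u \<in> Us" "x \<in> X0" "u * x \<in> Lv p i" by (auto simp: U0_def)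
  then have "uinv u * (u * x) \<in> Lv p i" using is_idealD(4)[OF ideal_Lv[OF assms(1)]] by blast
  then have "x \<in> Lv p i" using inv_cancel(2)[OF u(1)] u(2) X0_C by auto
  then show False using assms u by blast
qed

lemma ep_not_Lv1: "p \<in> P \<Longrightarrow> ep p \<notin> Lv p 1"
proof
  assume "p \<in> P" "ep p \<in> Lv p 1"
  then have "\<not> un p (ep p)" using not_un_Lv[of p "ep p"] by simp
  moreover have "un p (ep p)" using \<open>p \<in> P\<close> by (auto simp: un_def idem intro: exI[of _ 1])
  ultimately show False by simp
qed

text \<open>Since \<open>ep p\<close> is not in \<open>J0\<close>, no element of \<open>Mp p\<close>
  is a unit at \<open>p\<close>. Conversely, a nonunit at \<open>p\<close> outside
  \<open>Mp p\<close> would by \<open>Mp_cover\<close> produce a nonunit at \<open>p\<close> in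
  \<open>U0\<close>.\<close>

lemma Mp_Lv1: assumes p: "p \<in> P" and X: "X0 \<inter> Lv p 1 = {}" shows "Mp p = Lv p 1" "ep p \<notin> J0"
proof -
  have UL: "U0 \<inter> Lv p 1 = {}" using U0_Lv[OF assms] .
  show nJ: "ep p \<notin> J0"
  proof
    assume "ep p \<in> J0"
    then have "e + - ep p \<in> U0" using is_idealD(6)[OF J0_ideal, of "ep p"] e_X0 X0_U0 by (auto simp: J0_def)
    moreover have "e + - ep p \<in> Lv p 1" using p by (auto simp: Lv_def right_diff_distrib idem intro!: exI[of _ 0])
    ultimately show False using UL by blast
  qed
  show "Mp p = Lv p 1"
  proof
    show "Mp p \<subseteq> Lv p 1"
    proof
      fix x assume x: "x \<in> Mp p"
      have xC: "x \<in> C" using is_idealD(8)[OF aidealD(1)[OF Mp_aideal[OF p]] x] .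
      have "\<not> un p x"
      proof
        assume "un p x"
        then obtain y where "ep p * x * y = ep p" by (auto simp: un_def)
        then show False using nJ is_idealD(5)[OF J0_ideal Mp_ep[OF x], of y] by simp
      qed
      then show "x \<in> Lv p 1" using not_un_Lv p xC by blast
    qed
    show "Lv p 1 \<subseteq> Mp p"
    proof
      fix y assume y: "y \<in> Lv p 1"
      show "y \<in> Mp p"
      proof (rule ccontr)
        assume "y \<notin> Mp p"
        then obtain x m where xm: "x \<in> U0" "m \<in> Mp p" "y = x + m"
          using Mp_cover[OF p nJ] y is_idealD(8)[OF ideal_Lv[OF p]] by blast
        then have "x \<in> Lv p 1" using is_idealD(7)[OF ideal_Lv[OF p] y, of m] \<open>Mp p \<subseteq> Lv p 1\<close> by auto
        then show False using UL xm(1) by blast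
      qed
    qed
  qed
qed

section \<open>The basic set of the identity on cosets of a minimal ideal\<close>

lemma X0_un: "X0 \<inter> Lv t 1 = {} \<Longrightarrow> t \<in> P \<Longrightarrow> x \<in> X0 \<Longrightarrow> un t x"
  using not_un_Lv[of t x] X0_C by blast

text \<open>The units in \<open>X0\<close> form the stabiliser of \<open>X0\<close> in the unit
  group, because \<open>X0\<close> contains the identity.\<close>

lemma X0_unit_iff: assumes "u \<in> Us" "x \<in> X0" shows "u * x \<in> X0 \<longleftrightarrow> u \<in> X0"
proof
  assume "u * x \<in> X0"
  then have "u * e \<in> bl e" using stab_mem[OF assms(1) e_C _ _ bl_in[OF e_C], of x] assms(2) by (simp add: X0_def)
  then show "u \<in> X0" using assms(1) by (simp add: X0_def)
next
  assume "u \<in> X0"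
  then have "u * e \<in> bl e" using assms(1) by (simp add: X0_def)
  then show "u * x \<in> X0" using stab_mem[OF assms(1) e_C bl_in[OF e_C] _, of x] assms(2) by (simp add: X0_def)
qed

text \<open>For \<open>g\<close> outside \<open>V\<close> the element \<open>g + g\<close> is
  outside \<open>V\<close> too, as \<open>t\<close> is odd; so \<open>V\<close>,
  \<open>g + V\<close> and \<open>2 g + V\<close> are disjoint. The constant 3 is what beats the
  bound one half proved for losses.\<close>

lemma subgroup_third:
  assumes I: "finite I" "0 \<in> I" "\<And>x y. x \<in> I \<Longrightarrow> y \<in> I \<Longrightarrow> x + y \<in> I"
    and V: "V \<subseteq> I" "V \<noteq> I" "0 \<in> V" "\<And>x y. x \<in> V \<Longrightarrow> y \<in> V \<Longrightarrow> x + y \<in> V"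
    and t: "odd t" "\<And>x. x \<in> I \<Longrightarrow> of_nat t * (x::'a) = 0"
  shows "3 * card V \<le> card I"
proof -
  have mult: "of_nat k * x \<in> V" if "x \<in> V" for k x
    by (induction k) (use V that in \<open>auto simp: distrib_right\<close>)
  have neg: "- x \<in> V" if x: "x \<in> V" for x
  proof -
    have "t = Suc (t - 1)" using t(1) by (cases t) auto
    then have "of_nat t * x = of_nat (t - 1) * x + x" by (metis of_nat_Suc distrib_right mult_1 add.commute)
    moreover have "of_nat t * x = 0" using t(2) x V(1) by blast
    ultimately have "of_nat (t - 1) * x + x = 0" by simp
    then have "- x = of_nat (t - 1) * x" by (metis eq_neg_iff_add_eq_0)
    then show ?thesis using mult[OF x] by metis
  qed
  have diff: "x - y \<in> V" if "x \<in> V" "y \<in> V" for x y using V(4)[OF that(1) neg[OF that(2)]] by simp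
  obtain g where g: "g \<in> I" "g \<notin> V" using V by blast
  have g2: "g + g \<notin> V"
  proof
    assume a: "g + g \<in> V"
    have "t = (t div 2) + (t div 2) + 1" using t(1) by presburger
    then have "(of_nat t :: 'a) = of_nat (t div 2) + of_nat (t div 2) + 1" by (metis of_nat_1 of_nat_add)
    then have "of_nat t * g = (of_nat (t div 2) + of_nat (t div 2) + 1) * g" by simp
    then have "of_nat t * g = of_nat (t div 2) * (g + g) + g" by (simp only: distrib_left distrib_right mult_1)
    then have "g = - (of_nat (t div 2) * (g + g))" using t(2)[OF g(1)] by (simp add: eq_neg_iff_add_eq_0 add.commute)
    then show False using neg[OF mult[OF a]] g(2) by metis
  qed
  have fin: "finite V" using I(1) V(1) finite_subset by blast
  define A where "A = (\<lambda>v. g + v) ` V"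
  define B where "B = (\<lambda>v. g + g + v) ` V"
  have c: "card A = card V" "card B = card V" by (auto simp: A_def B_def card_image)
  have d1: "V \<inter> A = {}"
  proof -
    have False if "g + v \<in> V" "v \<in> V" for v using diff[OF that] g(2) by simp
    then show ?thesis by (auto simp: A_def)
  qed
  have d2: "(V \<union> A) \<inter> B = {}"
  proof -
    have False if "g + g + v \<in> V" "v \<in> V" for v using diff[OF that] g2 by simp
    moreover have False if "g + v' = g + g + v" "v \<in> V" "v' \<in> V" for v v'
    proof -
      have "v' - v = g" using that(1) by (simp add: algebra_simps)
      then show False using diff[OF that(3,2)] g(2) by simp
    qed
    ultimately show ?thesis unfolding A_def B_def by blast
  qed
  have "card (V \<union> A \<union> B) = card V + card A + card B"
    using d1 d2 fin by (simp add: card_Un_disjoint A_def B_def)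
  moreover have "g + v \<in> I" "g + g + v \<in> I" if "v \<in> V" for v using V(1) I(3) g(1) that by blast+
  then have "V \<union> A \<union> B \<subseteq> I" using V(1) unfolding A_def B_def by blast
  ultimately show ?thesis using card_mono[OF I(1)] c by (metis add.assoc mult_2 mult.commute mult_Suc_right numeral_3_eq_3 numeral_2_eq_2 mult_0_right add_0_right add_Suc_right One_nat_def)
qed

text \<open>With at least two levels the minimal ideal has square zero, so the elements
  \<open>e + g\<close> multiply as the \<open>g\<close> add.\<close>

lemma It_sq: assumes "t \<in> P" "2 \<le> nn t" "g \<in> It t" "g' \<in> It t" shows "g * g' = 0"
proof -
  obtain r r' where r: "g = hh t * r" "g' = hh t * r'" using assms by (auto simp: It_def)
  have "g * g' = of_nat t ^ ((nn t - 1) + (nn t - 1)) * ep t * (ep t * r * r')" unfolding r hh_def power_add by (simp only: mult_ac)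
  also have "\<dots> = 0" using pow_ep[of t "(nn t - 1) + (nn t - 1)"] assms(1,2) by simp
  finally show ?thesis .
qed

lemma It_Us: assumes "t \<in> P" "2 \<le> nn t" "g \<in> It t" shows "e + g \<in> Us"
  using Us_add_nil[of t "nn t - 1"] assms by (auto simp: It_def hh_def)

lemma nn_ge_2: assumes t: "t \<in> P" and h: "hh t \<in> Lv t 1" shows "2 \<le> nn t"
proof (rule ccontr)
  assume "\<not> 2 \<le> nn t"
  then have "nn t = 1" using nn_pos[OF t] by simp
  then have "hh t = ep t" by (simp add: hh_def)
  then show False using h ep_not_Lv1[OF t] by simp
qed

lemma Lv_aideal: assumes "t \<in> P" "X0 \<inter> Lv t 1 = {}" shows "aideal (Lv t 1)"
  using Mp_aideal[OF assms(1)] Mp_Lv1(1)[OF assms] by simp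

text \<open>The elements of \<open>X0\<close> are units at \<open>t\<close>, so
  \<open>x + g = (e + g') * x\<close> with \<open>g'\<close> in \<open>It t\<close>, and this lies
  in \<open>X0\<close> iff \<open>g'\<close> lies in the subgroup \<open>V\<close>. A nonempty
  intersection of \<open>X0\<close> with a coset is thus no larger than \<open>V\<close>, and
  \<open>V\<close> is proper because \<open>X0\<close> is not invariant under
  \<open>It t\<close>.\<close>

lemma fiber_third:
  assumes t: "t \<in> P" and tX: "X0 \<inter> Lv t 1 = {}" and n2: "2 \<le> nn t"
    and pure: "\<exists>x\<in>X0. \<exists>r. x + hh t * r \<notin> X0"
  shows "3 * card {g\<in>It t. w + g \<in> X0} \<le> card (It t)"
proof (cases "\<exists>g\<in>It t. w + g \<in> X0")
  case True
  note I = is_idealD[OF It_ideal[OF t]]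
  define V where "V = {g\<in>It t. e + g \<in> X0}"
  have Vadd: "x + y \<in> V" if "x \<in> V" "y \<in> V" for x y
  proof -
    have xy: "x \<in> It t" "y \<in> It t" "e + x \<in> X0" "e + y \<in> X0" using that by (auto simp: V_def)
    have "(e + x) * (e + y) = e + (x + y)" using It_sq[OF t n2 xy(1,2)] I(8)[OF xy(1)] I(8)[OF xy(2)] by (simp add: algebra_simps)
    moreover have "(e + x) * (e + y) \<in> X0" using X0_unit_iff[OF It_Us[OF t n2 xy(1)] xy(4)] xy(3) by simp
    ultimately show ?thesis using I(3)[OF xy(1,2)] by (simp add: V_def)
  qed
  have key: "\<exists>g'\<in>It t. g = x * g' \<and> (x + g \<in> X0 \<longleftrightarrow> g' \<in> V)" if x: "x \<in> X0" and g: "g \<in> It t" for x g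
  proof -
    obtain y where y: "ep t * x * y = ep t" using X0_un[OF tX t x] by (auto simp: un_def)
    define g' where "g' = y * g"
    have g': "g' \<in> It t" using I(4) g by (simp add: g'_def)
    have "ep t * x * y * g = x * y * (ep t * g)" by (simp only: mult_ac)
    then have "x * g' = ep t * x * y * g" unfolding It_ep[OF t g] by (simp only: g'_def mult_ac)
    then have xg: "x * g' = g" using y It_ep[OF t g] by simp
    have "x \<in> C" using X0_C x by blast
    then have "(e + g') * x = x + x * g'" by (simp add: distrib_right mult.commute[of x])
    then have "(e + g') * x = x + g" using xg by simp
    then have "x + g \<in> X0 \<longleftrightarrow> g' \<in> V" using X0_unit_iff[OF It_Us[OF t n2 g'] x] g' by (simp add: V_def)
    then show ?thesis using g' xg by auto
  qed
  have VI: "V \<noteq> It t"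
  proof
    assume VI: "V = It t"
    obtain x r where x: "x \<in> X0" "x + hh t * r \<notin> X0" using pure by blast
    have "hh t * r \<in> It t" by (auto simp: It_def)
    then show False using key[OF x(1)] x(2) VI by blast
  qed
  have "3 * card V \<le> card (It t)"
    by (rule subgroup_third[of _ _ t]) (use I VI Vadd It_p t odd_P e_X0 in \<open>auto simp: V_def\<close>)
  moreover have "card {g\<in>It t. w + g \<in> X0} \<le> card V"
  proof -
    obtain g0 where g0: "g0 \<in> It t" "w + g0 \<in> X0" using True by blast
    have "{g\<in>It t. w + g \<in> X0} \<subseteq> (\<lambda>g'. g0 + (w + g0) * g') ` V"
    proof
      fix g assume "g \<in> {g\<in>It t. w + g \<in> X0}"
      then have g: "g - g0 \<in> It t" "w + g0 + (g - g0) \<in> X0" using I(7) g0 by auto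
      then obtain g' where "g - g0 = (w + g0) * g'" "g' \<in> V" using key[OF g0(2) g(1)] by blast
      moreover from this have "g = g0 + (w + g0) * g'" by (simp add: diff_eq_eq add.commute)
      ultimately show "g \<in> (\<lambda>g'. g0 + (w + g0) * g') ` V" by blast
    qed
    then have "card {g\<in>It t. w + g \<in> X0} \<le> card ((\<lambda>g'. g0 + (w + g0) * g') ` V)"
      using I(9) by (intro card_mono) (auto simp: V_def)
    also have "\<dots> \<le> card V" using I(9) by (intro card_image_le) (auto simp: V_def)
    finally show ?thesis .
  qed
  ultimately show ?thesis by simp
next
  case False
  then have *: "{g\<in>It t. w + g \<in> X0} = {}" by blast
  show ?thesis unfolding * by simp
qed

text \<open>Otherwise \<open>translate_bl\<close> puts every \<open>hh p + g\<close> with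
  \<open>g\<close> in \<open>It t\<close> into the basic set of \<open>hh p\<close>, so at each of
  them at least half of \<open>X0\<close> stays in \<open>X0\<close>. Averaged over
  \<open>g\<close>, this counts points of \<open>X0\<close> in cosets of \<open>It t\<close>, where
  \<open>fiber_third\<close> allows only a third.\<close>

lemma hull_avoids:
  assumes p: "p \<in> P" and l: "2 * ls X0 (hh p) \<le> card X0"
    and t: "t \<in> P" "t \<noteq> p" and tX: "X0 \<inter> Lv t 1 = {}"
    and pure: "\<exists>x\<in>X0. \<exists>r. x + hh t * r \<notin> X0"
  shows "hh t \<notin> ahull (hh p)"
proof
  assume h: "hh t \<in> ahull (hh p)"
  have hpL: "hh p \<in> Lv t 1" using ep_hh_other[OF p t(1)] t p by (auto simp: Lv_def intro!: exI[of _ 0])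
  \<comment> \<open>The maximal ideal at \<open>t\<close> is an A-ideal containing
    \<open>hh p\<close>, so it contains the whole hull; this excludes that the component at
    \<open>t\<close> is a field.\<close>
  have "hh t \<in> Lv t 1" using ahull_min[OF Lv_aideal[OF t(1) tX] hpL] h by blast
  then have n2: "2 \<le> nn t" using nn_ge_2 t by blast
  have nb: "\<not> bl (hh p) \<subseteq> {x\<in>C. ep t * x = 0}"
  proof
    assume "bl (hh p) \<subseteq> {x\<in>C. ep t * x = 0}"
    then have "hh p \<in> core {x\<in>C. ep t * x = 0}" using p by (simp add: core_def)
    then have "hh t \<in> core {x\<in>C. ep t * x = 0}" using ahull_min[OF core_aideal[OF ideal_vanish[OF t(1)]]] h by blast
    then have "ep t * hh t = 0" using core_sub by blast
    then show False using hh_nz t by simp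
  qed
  note I = is_idealD[OF It_ideal[OF t(1)]]
  have fX: "finite X0" using aset_finite[OF aset_X0] .
  have acg: "card X0 \<le> 2 * ac X0 X0 (hh p + g)" if gI: "g \<in> It t" for g
  proof -
    obtain r where "g = hh t * r" using gI by (auto simp: It_def)
    then have "hh p + g \<in> bl (hh p)" using translate_bl[OF t(1) hh_C[OF p] ep_hh_other[OF p t(1)] nb] t p by auto
    then have "ls X0 (hh p + g) = ls X0 (hh p)" using ls_const[OF aset_X0 hh_C[OF p]] by blast
    then show ?thesis using ac_ls[OF fX, of "hh p + g"] l by simp
  qed
  have "(\<Sum>g\<in>It t. ac X0 X0 (hh p + g)) = (\<Sum>x\<in>X0. card {g\<in>It t. x + hh p + g \<in> X0})"
  proof -
    have "(\<Sum>g\<in>It t. ac X0 X0 (hh p + g)) = (\<Sum>g\<in>(\<lambda>g. hh p + g) ` It t. ac X0 X0 g)"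
      by (subst sum.reindex) auto
    also have "\<dots> = (\<Sum>x\<in>X0. card {g\<in>(\<lambda>g. hh p + g) ` It t. x + g \<in> X0})" by (rule ac_sum) (use fX I(9) in auto)
    also have "\<dots> = (\<Sum>x\<in>X0. card {g\<in>It t. x + hh p + g \<in> X0})"
    proof (rule sum.cong[OF refl])
      fix x
      have "{g\<in>(\<lambda>g. hh p + g) ` It t. x + g \<in> X0} = (\<lambda>g. hh p + g) ` {g\<in>It t. x + hh p + g \<in> X0}" by (auto simp: add.assoc)
      then show "card {g\<in>(\<lambda>g. hh p + g) ` It t. x + g \<in> X0} = card {g\<in>It t. x + hh p + g \<in> X0}" by (simp add: card_image)
    qed
    finally show ?thesis .
  qed
  moreover have "card (It t) * card X0 \<le> 2 * (\<Sum>g\<in>It t. ac X0 X0 (hh p + g))"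
    unfolding sum_distrib_left using sum_mono[of "It t" "\<lambda>_. card X0", OF acg] by simp
  moreover have "3 * (\<Sum>x\<in>X0. card {g\<in>It t. x + hh p + g \<in> X0}) \<le> card X0 * card (It t)"
    unfolding sum_distrib_left using sum_mono[of X0 _ "\<lambda>_. card (It t)", OF fiber_third[OF t(1) tX n2 pure]] by simp
  ultimately have "card (It t) * card X0 = 0" unfolding mult.commute[of "card X0"] by linarith
  then show False using fX e_X0 I(2,9) by auto
qed

section \<open>An upper bound of one half for the loss\<close>

text \<open>Only points in \<open>H = Lv p (a-1)\<close> are lost: any other point is moved by
  \<open>hh p * r\<close> through a unit that stabilises \<open>bl b\<close>. And at most half of
  \<open>bl b\<close> lies in \<open>H\<close>, because the unit multiples of \<open>bl b\<close>
  cover the classes outside \<open>N = Lv p a\<close> evenly and \<open>H - N\<close> is no larger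
  than \<open>C - H\<close>.\<close>

lemma loss_le_half:
  assumes p: "p \<in> P" and a: "2 \<le> a" "a \<le> nn p" and M: "aideal (Lv p a)"
    and b: "b \<in> C" "bl b \<inter> Lv p a = {}"
    and cov: "\<And>y. y \<in> C \<Longrightarrow> y \<notin> Lv p a \<Longrightarrow> \<exists>u\<in>Us. \<exists>x\<in>bl b. \<exists>m\<in>Lv p a. y = u * x + m"
  shows "2 * ls (bl b) (hh p * r) \<le> card (bl b)"
proof -
  define B where "B = bl b"
  define N where "N = Lv p a"
  define H where "H = Lv p (a - 1)"
  note MI = is_idealD[OF aidealD(1)[OF M], folded N_def]
  note HI = is_idealD[OF ideal_Lv[OF p, of "a - 1"], folded H_def]
  have BC: "B \<subseteq> C" and fB: "finite B" using bl_sub b finite_bl by (auto simp: B_def)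
  have asB: "aset B" using aset_bl b by (simp add: B_def)
  have NH: "N \<subseteq> H"
  proof
    fix x assume "x \<in> N"
    then obtain y where y: "x \<in> C" "ep p * x = of_nat p ^ a * ep p * y" by (auto simp: N_def Lv_def)
    have "of_nat p ^ a * ep p * y = of_nat p ^ (a - 1) * ep p * (of_nat p * y)"
      using a(1) by (cases a) (auto simp: mult_ac)
    then show "x \<in> H" unfolding H_def Lv_def using y by auto
  qed
  have inH: "x \<in> H" if x: "x \<in> B" "x + hh p * r \<notin> B" for x
  proof (cases "ep p * x = 0")
    case True then show ?thesis using x BC by (auto simp: H_def Lv_def intro!: exI[of _ 0])
  next
    case False
    obtain i v where iv: "i < nn p" "v \<in> Us" "ep p * x = of_nat p ^ i * ep p * v" using level[OF p False] by blast
    show ?thesis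
    proof (cases "a - 1 \<le> i")
      case True
      have "of_nat p ^ i * ep p * v = of_nat p ^ (a - 1) * ep p * (of_nat p ^ (i - (a - 1)) * v)"
      proof -
        have "of_nat p ^ i = (of_nat p ^ (a - 1) * of_nat p ^ (i - (a - 1)) :: 'a)" using True by (simp add: power_add[symmetric])
        then show ?thesis by (simp only: mult_ac)
      qed
      then show ?thesis using x BC iv unfolding H_def Lv_def by auto
    next
      case lt: False
      \<comment> \<open>The covering of \<open>p^(a-1)\<close> supplies a point \<open>x1\<close> of
        \<open>B\<close> at level \<open>a - 1\<close>. For \<open>k = nn p - 1 - i\<close> the unit
        \<open>c\<close> below adds exactly \<open>hh p * r\<close> to \<open>x\<close>; it fixes
        \<open>x1\<close> because \<open>k + (a - 1)\<close> is at least \<open>nn p\<close>, and so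
        it stabilises \<open>B\<close>.\<close>
      define h where "h = of_nat p ^ (a - 1) * ep p"
      have "h \<in> C" using p by (simp add: h_def)
      moreover have "h \<notin> N"
      proof
        assume "h \<in> N"
        then obtain y where "ep p * h = of_nat p ^ a * ep p * y" by (auto simp: N_def Lv_def)
        moreover have "ep p * h = h"
        proof -
          have "ep p * h = of_nat p ^ (a - 1) * (ep p * ep p)" by (simp only: h_def mult_ac)
          then show ?thesis by (simp only: idem[OF p] h_def)
        qed
        ultimately have "of_nat p ^ (nn p - a) * h = of_nat p ^ (nn p - a) * (of_nat p ^ a * ep p * y)" by simp
        also have "\<dots> = of_nat p ^ (nn p - a + a) * ep p * y" by (simp only: power_add mult_ac)
        also have "\<dots> = 0" using nil[OF p] a(2) by simp
        finally have "of_nat p ^ (nn p - a + (a - 1)) * ep p = 0" unfolding h_def power_add by (simp only: mult_ac)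
        moreover have "nn p - a + (a - 1) = nn p - 1" using a by simp
        ultimately show False using not_nil[OF p] by simp
      qed
      ultimately obtain u x1 m where um: "u \<in> Us" "x1 \<in> B" "m \<in> N" "h = u * x1 + m" using cov unfolding N_def B_def by blast
      obtain w where w: "ep p * m = of_nat p ^ a * ep p * w" using um(3) by (auto simp: N_def Lv_def)
      define k where "k = nn p - 1 - i"
      have k1: "1 \<le> k" "i + k = nn p - 1" using lt a iv(1) by (auto simp: k_def)
      have kz: "of_nat p ^ k * ep p * (u * x1) = 0"
      proof -
        have "of_nat p ^ k * ep p * (u * x1) = of_nat p ^ k * (ep p * h - ep p * m)" unfolding um(4) by (simp add: algebra_simps)
        also have "\<dots> = of_nat p ^ k * of_nat p ^ (a - 1) * (ep p * ep p) - of_nat p ^ k * of_nat p ^ a * ep p * w"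
          unfolding w h_def by (simp add: algebra_simps)
        also have "\<dots> = of_nat p ^ (k + (a - 1)) * ep p - of_nat p ^ (k + a) * ep p * w" by (simp only: idem[OF p] power_add)
        also have "\<dots> = 0" using pow_ep[OF p, of "k + (a - 1)"] pow_ep[OF p, of "k + a"] k1 lt by simp
        finally show ?thesis .
      qed
      have x1C: "x1 \<in> C" using um(2) BC by blast
      have kz1: "of_nat p ^ k * ep p * x1 = 0"
      proof -
        have "of_nat p ^ k * ep p * x1 = uinv u * (of_nat p ^ k * ep p * (u * x1))"
          using inv_cancel(2)[OF um(1), of "of_nat p ^ k * ep p * x1"] x1C by (simp add: mult_ac)
        then show ?thesis using kz by simp
      qed
      define c where "c = e + of_nat p ^ k * ep p * (uinv v * r)"
      have c: "c \<in> Us" unfolding c_def by (rule Us_add_nil[OF p k1(1)])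
      have "c * x1 = x1 + (of_nat p ^ k * ep p * x1) * (uinv v * r)" using x1C by (simp add: c_def algebra_simps)
      then have "c * x1 = x1" using kz1 by simp
      then have "c * x1 \<in> B" using um(2) by simp
      then have cx: "c * x \<in> B" using stab_mem[OF c b(1) _ _ x(1)[unfolded B_def]] um(2) by (simp add: B_def)
      have xC: "x \<in> C" using x BC by blast
      have "c * x = x + of_nat p ^ k * (ep p * x) * (uinv v * r)" using xC by (simp add: c_def algebra_simps)
      also have "\<dots> = x + of_nat p ^ (i + k) * ep p * (v * uinv v) * r" unfolding iv(3) power_add by (simp only: mult_ac)
      also have "\<dots> = x + hh p * r" using uinv(2)[OF iv(2)] p unfolding k1(2) by (simp add: hh_def mult.assoc)
      finally show ?thesis using cx x by simp
    qed
  qed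
  \<comment> \<open>The multiplicity with which the unit multiples of \<open>B\<close> hit the class
    of \<open>y\<close> modulo \<open>N\<close>.\<close>
  define f where "f y = (\<Sum>u\<in>Us. card {x\<in>B. u * x - y \<in> N})" for y
  have f_alt: "card {x\<in>B. u * x - y \<in> N} = card {m\<in>N. y + m \<in> (*) u ` B}" if u: "u \<in> Us" for u y
  proof (rule bij_betw_same_card)
    show "bij_betw (\<lambda>x. u * x - y) {x\<in>B. u * x - y \<in> N} {m\<in>N. y + m \<in> (*) u ` B}"
    proof (rule bij_betw_imageI)
      show "inj_on (\<lambda>x. u * x - y) {x\<in>B. u * x - y \<in> N}"
      proof (rule inj_onI)
        fix x x' assume *: "x \<in> {x\<in>B. u * x - y \<in> N}" "x' \<in> {x\<in>B. u * x - y \<in> N}" "u * x - y = u * x' - y"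
        then have "u * x = u * x'" by simp
        then show "x = x'" using inv_cancel(2)[OF u, of x] inv_cancel(2)[OF u, of x'] * BC by auto
      qed
      show "(\<lambda>x. u * x - y) ` {x\<in>B. u * x - y \<in> N} = {m\<in>N. y + m \<in> (*) u ` B}"
      proof (intro equalityI subsetI)
        fix m assume m: "m \<in> {m\<in>N. y + m \<in> (*) u ` B}"
        then obtain x where x: "x \<in> B" "y + m = u * x" by blast
        have "m = u * x - y" using x(2) by (metis add_diff_cancel_left')
        then show "m \<in> (\<lambda>x. u * x - y) ` {x\<in>B. u * x - y \<in> N}" using x(1) m by blast
      qed auto
    qed
  qed
  have "Us \<subseteq> C" by (intro subsetI Us_C)
  then have finUs: "finite Us" by (rule finite_subset) simp
  \<comment> \<open>Reindexing the units by \<open>u0\<close> replaces \<open>y\<close> by a point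
    \<open>x0\<close> of \<open>B\<close>, and \<open>coset_const\<close> replaces \<open>x0\<close>
    by \<open>b\<close>.\<close>
  have f_const: "f y = f b" if y: "y \<in> C" "y \<notin> N" for y
  proof -
    obtain u0 x0 m0 where u0: "u0 \<in> Us" "x0 \<in> B" "m0 \<in> N" "y = u0 * x0 + m0" using cov y unfolding N_def B_def by blast
    have x0C: "x0 \<in> C" using u0 BC by blast
    have bij: "bij_betw (\<lambda>u. u0 * u) Us Us"
    proof (rule bij_betw_imageI)
      show "inj_on ((*) u0) Us"
      proof (rule inj_onI)
        fix x x' assume x: "x \<in> Us" "x' \<in> Us" "u0 * x = u0 * x'"
        have "x = uinv u0 * (u0 * x)" using inv_cancel(2)[OF u0(1) Us_C[OF x(1)]] by (rule sym)
        also have "\<dots> = x'" unfolding x(3) by (rule inv_cancel(2)[OF u0(1) Us_C[OF x(2)]])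
        finally show "x = x'" .
      qed
      show "(*) u0 ` Us = Us"
      proof (intro equalityI subsetI)
        fix u assume u: "u \<in> Us"
        then have "u = u0 * (uinv u0 * u)" "uinv u0 * u \<in> Us" using inv_cancel(1)[OF u0(1), of u] uinv(1)[OF u0(1)] by auto
        then show "u \<in> (*) u0 ` Us" by blast
      qed (use u0 in auto)
    qed
    have "f y = (\<Sum>u\<in>Us. card {x\<in>B. u0 * u * x - y \<in> N})"
      unfolding f_def using sum.reindex_bij_betw[OF bij, of "\<lambda>u. card {x\<in>B. u * x - y \<in> N}"] by simp
    also have "\<dots> = (\<Sum>u\<in>Us. card {x\<in>B. u * x - x0 \<in> N})"
    proof (rule sum.cong[OF refl])
      fix u assume u: "u \<in> Us"
      have "u0 * u * x - y \<in> N \<longleftrightarrow> u * x - x0 \<in> N" if "x \<in> B" for x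
      proof
        assume "u * x - x0 \<in> N"
        then have "u0 * (u * x - x0) - m0 \<in> N" using MI(4,7) u0(3) by blast
        then show "u0 * u * x - y \<in> N" by (simp add: u0(4) algebra_simps)
      next
        assume *: "u0 * u * x - y \<in> N"
        have "uinv u0 * (u0 * u * x - y + m0) = uinv u0 * (u0 * (u * x - x0))" by (simp add: u0(4) algebra_simps)
        also have "\<dots> = u * x - x0" using inv_cancel(2)[OF u0(1), of "u * x - x0"] that BC x0C u by auto
        finally show "u * x - x0 \<in> N" using MI(4)[OF MI(3)[OF * u0(3)], of "uinv u0"] by simp
      qed
      then show "card {x\<in>B. u0 * u * x - y \<in> N} = card {x\<in>B. u * x - x0 \<in> N}" by (metis (mono_tags, lifting) Collect_cong)
    qed
    also have "\<dots> = (\<Sum>u\<in>Us. card {x\<in>B. u * x - b \<in> N})"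
    proof (rule sum.cong[OF refl])
      fix u assume u: "u \<in> Us"
      show "card {x\<in>B. u * x - x0 \<in> N} = card {x\<in>B. u * x - b \<in> N}"
        using f_alt[OF u, of x0] f_alt[OF u, of b] coset_const[OF aset_img[OF u asB] M b(1), of x0] u0(2) unfolding B_def N_def by metis
    qed
    finally show ?thesis by (simp add: f_def)
  qed
  \<comment> \<open>On a set closed under units and under \<open>N\<close>, the sum of
    \<open>f\<close> counts the points of \<open>B\<close> there with the fixed weight
    \<open>card Us * card N\<close>. So the evenness of \<open>f\<close> compares \<open>B\<close>
    on \<open>H - N\<close> with \<open>B\<close> on \<open>C - H\<close>.\<close>
  have f_sum: "(\<Sum>y\<in>D. f y) = card Us * (card (B \<inter> D) * card N)"
    if D: "D \<subseteq> C" "\<And>u x. u \<in> Us \<Longrightarrow> x \<in> D \<Longrightarrow> u * x \<in> D" "\<And>x m. x \<in> D \<Longrightarrow> m \<in> N \<Longrightarrow> x + m \<in> D" for D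
  proof -
    have fD: "finite D" using D(1) finite_C finite_subset by blast
    have c: "card {x\<in>A. Q x} = (\<Sum>x\<in>A. of_bool (Q x))" if "finite A" for A and Q :: "'a \<Rightarrow> bool"
      unfolding card_eq_sum using that by (intro sum.mono_neutral_cong_left) auto
    have "(\<Sum>y\<in>D. card {x\<in>B. u * x - y \<in> N}) = card (B \<inter> D) * card N" if u: "u \<in> Us" for u
    proof -
      have "(\<Sum>y\<in>D. card {x\<in>B. u * x - y \<in> N}) = (\<Sum>y\<in>D. \<Sum>x\<in>B. of_bool (u * x - y \<in> N))" using c[OF fB] by simp
      also have "\<dots> = (\<Sum>x\<in>B. \<Sum>y\<in>D. of_bool (u * x - y \<in> N))" by (rule sum.swap)
      also have "\<dots> = (\<Sum>x\<in>B. card {y\<in>D. u * x - y \<in> N})" using c[OF fD] by simp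
      also have "\<dots> = (\<Sum>x\<in>B. if x \<in> D then card N else 0)"
      proof (rule sum.cong[OF refl])
        fix x assume x: "x \<in> B"
        have inD: "u * x \<in> D \<longleftrightarrow> x \<in> D"
          using D(2)[OF u, of x] D(2)[OF uinv(1)[OF u], of "u * x"] inv_cancel(2)[OF u, of x] x BC by auto
        have yD: "y \<in> D \<longleftrightarrow> x \<in> D" if "u * x - y \<in> N" for y
          using D(3)[of y "u * x - y"] D(3)[of "u * x" "- (u * x - y)"] that MI(6)[OF that] inD by auto
        show "card {y\<in>D. u * x - y \<in> N} = (if x \<in> D then card N else 0)"
        proof (cases "x \<in> D")
          case True
          then have "{y\<in>D. u * x - y \<in> N} = {y. u * x - y \<in> N}" using yD by blast
          also have "\<dots> = (\<lambda>m. u * x - m) ` N"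
          proof (intro equalityI subsetI)
            fix y assume "y \<in> {y. u * x - y \<in> N}"
            moreover have "y = u * x - (u * x - y)" by simp
            ultimately show "y \<in> (\<lambda>m. u * x - m) ` N" by blast
          qed auto
          finally have "card {y\<in>D. u * x - y \<in> N} = card ((\<lambda>m. u * x - m) ` N)" by simp
          also have "\<dots> = card N" by (rule card_image) (auto simp: inj_on_def)
          finally show ?thesis using True by simp
        next
          case False
          then have *: "{y\<in>D. u * x - y \<in> N} = {}" using yD by blast
          show ?thesis unfolding * using False by simp
        qed
      qed
      also have "\<dots> = card (B \<inter> D) * card N" using fB by (simp add: sum.If_cases)
      finally show ?thesis .
    qed
    then show ?thesis unfolding f_def using sum.swap[of "\<lambda>y u. card {x\<in>B. u * x - y \<in> N}" Us D] by simp
  qed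
  have "(\<Sum>y\<in>H - N. f y) \<le> (\<Sum>y\<in>C - H. f y)"
  proof -
    \<comment> \<open>Translation by \<open>ep p\<close> sends \<open>H\<close> into its complement;
      \<open>a \<ge> 2\<close> is what keeps \<open>ep p\<close> outside \<open>H\<close>.\<close>
    have "card (H - N) \<le> card (C - H)"
    proof (rule card_inj_on_le[of "\<lambda>y. y + ep p"])
      have "ep p \<notin> H"
      proof
        assume "ep p \<in> H"
        then obtain y where "ep p * ep p = of_nat p ^ (a - 1) * ep p * y" by (auto simp: H_def Lv_def)
        moreover have "of_nat p ^ (a - 1) * ep p * y = of_nat p ^ 1 * ep p * (of_nat p ^ (a - 2) * y)"
        proof -
          have "a - 1 = 1 + (a - 2)" using a(1) by simp
          then have "of_nat p ^ (a - 1) = (of_nat p ^ 1 * of_nat p ^ (a - 2) :: 'a)" by (metis power_add)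
          then show ?thesis by (simp only: mult_ac)
        qed
        ultimately have "ep p \<in> Lv p 1" using p unfolding Lv_def by auto
        then show False using ep_not_Lv1 p by blast
      qed
      then have "y + ep p \<notin> H" if "y \<in> H" for y using HI(7)[of "y + ep p" y] that by auto
      then show "(\<lambda>y. y + ep p) ` (H - N) \<subseteq> C - H" using HI(8) p by auto
    qed auto
    moreover have "(\<Sum>y\<in>H - N. f y) = card (H - N) * f b" using f_const HI(8) by simp
    moreover have "f y = f b" if "y \<in> C - H" for y using f_const that NH by blast
    then have "(\<Sum>y\<in>C - H. f y) = card (C - H) * f b" by simp
    ultimately show ?thesis by simp
  qed
  moreover have "(\<Sum>y\<in>H - N. f y) = card Us * (card (B \<inter> (H - N)) * card N)"
  proof (rule f_sum)
    fix u x assume u: "u \<in> Us" and x: "x \<in> H - N"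
    have "u * x \<notin> N" using MI(4)[of "u * x" "uinv u"] inv_cancel(2)[OF u, of x] x HI(8) by auto
    then show "u * x \<in> H - N" using x HI(4) by blast
  next
    fix x m assume "x \<in> H - N" "m \<in> N"
    then show "x + m \<in> H - N" using HI(3) NH MI(7)[of "x + m" m] by auto
  qed (use HI in auto)
  moreover have "(\<Sum>y\<in>C - H. f y) = card Us * (card (B \<inter> (C - H)) * card N)"
  proof (rule f_sum)
    fix u x assume u: "u \<in> Us" and x: "x \<in> C - H"
    have "u * x \<notin> H" using HI(4)[of "u * x" "uinv u"] inv_cancel(2)[OF u, of x] x by auto
    then show "u * x \<in> C - H" using x by auto
  next
    fix x m assume "x \<in> C - H" "m \<in> N"
    then show "x + m \<in> C - H" using MI(8) NH HI(7)[of "x + m" m] by auto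
  qed auto
  moreover have "Us \<noteq> {}" using e_Un by blast
  then have "card Us > 0" "card N > 0" using finUs MI(2,9) by (auto simp: card_gt_0_iff)
  ultimately have le: "card (B \<inter> (H - N)) \<le> card (B \<inter> (C - H))" by simp
  have "B \<inter> (H - N) = B \<inter> H" using b(2) by (auto simp: B_def N_def)
  then have "ls B (hh p * r) \<le> card (B \<inter> (H - N))" unfolding ls_def using inH fB by (intro card_mono) auto
  moreover have "card (B \<inter> (H - N)) + card (B \<inter> (C - H)) = card B"
  proof -
    have "card ((B \<inter> (H - N)) \<union> (B \<inter> (C - H))) = card (B \<inter> (H - N)) + card (B \<inter> (C - H))"
      using fB by (intro card_Un_disjoint) auto
    moreover have "(B \<inter> (H - N)) \<union> (B \<inter> (C - H)) = B" using BC b(2) by (auto simp: B_def N_def)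
    ultimately show ?thesis by simp
  qed
  ultimately show ?thesis using le by (simp add: B_def)
qed

end

section \<open>Pure S-rings\<close>

locale sr_pure = sr_data +
  assumes pure: "p \<in> P \<Longrightarrow> \<exists>x\<in>X0. \<exists>r. x + hh p * r \<notin> X0"
begin

text \<open>The primes at which every element of \<open>X0\<close> is a unit; they will carry the
  dense factor.\<close>

definition Q0 :: "nat set" where "Q0 = {p\<in>P. X0 \<inter> Lv p 1 = {}}"
text \<open>The primes whose component is not contained in \<open>Mp p\<close>. For \<open>p\<close>
  outside \<open>Q0\<close> this will be the block of primes of the rank 2 factor to which
  \<open>p\<close> belongs.\<close>

definition D :: "nat \<Rightarrow> nat set" where "D p = {t\<in>P. ep t \<notin> Mp p}"

lemma Q0_P: "Q0 \<subseteq> P" by (auto simp: Q0_def)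

lemma no_unit_zero: assumes "p \<in> P" "ep p * u = 0" shows "u \<notin> Us"
  using un_unit[of u p] assms ep_nz[of p] by (auto simp: un_def)

lemma ideal_comps: assumes I: "is_ideal I" and x: "x \<in> C" "\<And>t. t \<in> P \<Longrightarrow> ep t * x \<in> I" shows "x \<in> I"
proof -
  have "sum (\<lambda>t. ep t * x) A \<in> I" if "A \<subseteq> P" for A
    using that by (induction A rule: infinite_finite_induct) (use is_idealD[OF I] x in auto)
  from this[of P] show ?thesis using sum_ep[OF x(1)] by simp
qed

lemma It_unit: assumes s: "s \<in> P" and g: "g \<in> It s" "g \<noteq> 0" shows "\<exists>u\<in>Us. g = u * hh s"
proof -
  obtain r where r: "g = hh s * r" using g by (auto simp: It_def)
  have "un s r"
  proof (rule ccontr)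
    assume "\<not> un s r"
    then obtain y where y: "ep s * r = of_nat s * ep s * y" using not_un_iff s by blast
    have "hh s * r = of_nat s ^ (nn s - 1) * (ep s * r)" by (simp only: hh_def mult_ac)
    also have "\<dots> = (of_nat s * hh s) * y" unfolding y by (simp only: hh_def mult_ac)
    finally show False using p_hh[OF s] g r by simp
  qed
  moreover have "lift s r * hh s = hh s * r"
    using lift_mult[OF s hh_C[OF s], of r] s ep_hh[OF s] by (simp add: mult_ac)
  ultimately show ?thesis using lift_Us[OF s] r by metis
qed

lemma hh_not_un: assumes s: "s \<in> P" "\<not> un s r" shows "hh s * r = 0"
proof (rule ccontr)
  assume n: "hh s * r \<noteq> 0"
  obtain y where y: "ep s * r = of_nat s * ep s * y" using assms not_un_iff by blast
  have "hh s * r = of_nat s ^ (nn s - 1) * (ep s * r)" by (simp only: hh_def mult_ac)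
  also have "\<dots> = (of_nat s * hh s) * y" unfolding y by (simp only: hh_def mult_ac)
  finally show False using p_hh[OF s(1)] n by simp
qed

lemma U0_ep_zero: assumes "x \<in> U0" "ep p * x = 0" shows "\<exists>y\<in>X0. ep p * y = 0"
proof -
  obtain u y where u: "u \<in> Us" "y \<in> X0" "x = u * y" using assms by (auto simp: U0_def)
  have "ep p * y = uinv u * (ep p * x)"
    using inv_cancel(2)[OF u(1), of y] u X0_C by (metis mult.left_commute subsetD)
  then show ?thesis using assms u by auto
qed

text \<open>A point of \<open>X0\<close> vanishing at \<open>p\<close> makes \<open>X0\<close>
  stable at \<open>p\<close>, and impurity of \<open>X0\<close> under \<open>hh p\<close> is
  excluded, so the boundary at \<open>p\<close> is not empty. As \<open>hh p\<close> is in
  \<open>J0\<close>, a boundary point lies in \<open>U0\<close>; the boundary then contains a unit,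
  although its points vanish at \<open>p\<close>.\<close>

lemma no_zero_comp:
  assumes p: "p \<in> P" and h: "hh p \<in> J0" and x: "x \<in> X0" "ep p * x = 0"
  shows False
proof -
  have st: "stable p X0" unfolding X0_def by (rule stable_bl[OF p e_C x(1)[unfolded X0_def] x(2)])
  note * = TT_zero[OF aset_X0 p st]
  obtain s r where s: "s \<in> X0" "s + hh p * r \<notin> X0" using pure[OF p] by blast
  define s' where "s' = s - ep p * s"
  have n: "(s' \<in> X0) \<noteq> (s' + hh p \<in> X0)" using *(3)[OF s] by (simp add: s'_def)
  have "s \<in> C" using s(1) X0_C by blast
  then have s'C: "s' \<in> C" "ep p * s' = 0" using p by (auto simp: s'_def right_diff_distrib)
  have "s' \<in> U0"
  proof (cases "s' \<in> X0")
    case False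
    then have "s' + hh p \<in> U0" using n X0_U0 by blast
    then have "s' + hh p + - hh p \<in> U0" using is_idealD(6)[OF J0_ideal h] unfolding J0_def by blast
    then show ?thesis by simp
  qed (use X0_U0 in blast)
  then obtain u where "u \<in> Us" "ep p * u = 0" using U0_meets[OF *(1), of s'] n s'C by blast
  then show False using no_unit_zero p by blast
qed

text \<open>Otherwise \<open>e - ep p\<close> lies in \<open>U0\<close>, so \<open>X0\<close> has a
  point vanishing at \<open>p\<close>.\<close>

lemma ep_not_J0: assumes p: "p \<in> P" shows "ep p \<notin> J0"
proof
  assume a: "ep p \<in> J0"
  then have h: "hh p \<in> J0" using is_idealD(4)[OF J0_ideal] by (simp add: hh_def)
  have "e + - ep p \<in> U0" using is_idealD(6)[OF J0_ideal a] e_X0 X0_U0 unfolding J0_def by blast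
  moreover have "ep p * (e + - ep p) = 0" using p by (simp add: right_diff_distrib idem)
  ultimately show False using U0_ep_zero no_zero_comp[OF p h] by blast
qed

lemma ideal_Lv_level:
  assumes J: "is_ideal J" and p: "p \<in> P"
  shows "\<exists>a\<le>nn p. {x\<in>C. ep p * x \<in> J} = Lv p a"
proof -
  define Q where "Q k \<longleftrightarrow> of_nat p ^ k * ep p \<in> J" for k
  define a where "a = (LEAST k. Q k)"
  have Qn: "Q (nn p)" using nil[OF p] is_idealD(2)[OF J] by (simp add: Q_def)
  then have Qa: "Q a" and least: "\<And>k. Q k \<Longrightarrow> a \<le> k" unfolding a_def using LeastI Least_le by blast+
  have "{x\<in>C. ep p * x \<in> J} = Lv p a"
  proof (intro equalityI subsetI)
    fix x assume "x \<in> Lv p a"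
    then show "x \<in> {x\<in>C. ep p * x \<in> J}" using is_idealD(5)[OF J Qa[unfolded Q_def]] by (auto simp: Lv_def)
  next
    fix x assume x: "x \<in> {x\<in>C. ep p * x \<in> J}"
    show "x \<in> Lv p a"
    proof (cases "ep p * x = 0")
      case True then show ?thesis using x by (auto simp: Lv_def intro!: exI[of _ 0])
    next
      case False
      obtain i v where iv: "i < nn p" "v \<in> Us" "ep p * x = of_nat p ^ i * ep p * v" using level[OF p False] by blast
      have "of_nat p ^ i * ep p * v \<in> J" using x iv(3) by simp
      then have "of_nat p ^ i * ep p * 1 \<in> J" by (rule ideal_level[OF J p _ un_unit[OF iv(2) p]])
      then have "a \<le> i" using least by (simp add: Q_def)
      then have "of_nat p ^ i = (of_nat p ^ a * of_nat p ^ (i - a) :: 'a)" by (simp add: power_add[symmetric])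
      then have "ep p * x = of_nat p ^ a * ep p * (of_nat p ^ (i - a) * v)" unfolding iv(3) by (simp only: mult_ac)
      then show ?thesis using x unfolding Lv_def by blast
    qed
  qed
  then show ?thesis using least[OF Qn] by blast
qed

text \<open>The case \<open>loss_le_half\<close> for \<open>X0\<close>. The exponent is at least 2:
  \<open>a = 0\<close> would put \<open>e\<close> into \<open>Mp p\<close>, and \<open>a = 1\<close>
  is impossible because \<open>X0\<close> meets \<open>Lv p 1\<close> but not
  \<open>Mp p\<close>.\<close>

lemma X0_loss:
  assumes p: "p \<in> P" "p \<notin> Q0" and a: "a \<le> nn p" and M: "Mp p = Lv p a"
  shows "2 * ls X0 (hh p * r) \<le> card X0"
proof -
  have UM: "U0 \<inter> Mp p = {}" using U0_Mp[OF p(1) ep_not_J0[OF p(1)]] .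
  have "a \<noteq> 0"
  proof
    assume "a = 0"
    then have "e \<in> Mp p" unfolding M by (auto simp: Lv_def p intro: exI[of _ 1])
    then show False using UM e_X0 X0_U0 by blast
  qed
  moreover have "a \<noteq> 1" using UM X0_U0 p M by (auto simp: Q0_def)
  ultimately have "2 \<le> a" by simp
  then show ?thesis unfolding X0_def
  proof (rule loss_le_half[OF p(1) _ a])
    show "aideal (Lv p a)" using Mp_aideal[OF p(1)] M by simp
    show "bl e \<inter> Lv p a = {}" using UM X0_U0 M X0_def by blast
    fix y assume "y \<in> C" "y \<notin> Lv p a"
    then show "\<exists>u\<in>Us. \<exists>x\<in>bl e. \<exists>m\<in>Lv p a. y = u * x + m"
      using Mp_cover[OF p(1) ep_not_J0[OF p(1)], of y] unfolding M U0_def X0_def by blast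
  qed simp
qed

text \<open>Under this hypothesis \<open>Mp p\<close> already contains every element with
  \<open>p\<close>-component in \<open>J0\<close>. Otherwise \<open>Mp_cover\<close> gives such an
  element in \<open>U0\<close>; subtracting its \<open>p\<close>-component stays in
  \<open>U0\<close> and produces a point vanishing at \<open>p\<close>. So \<open>Mp p\<close> is
  some \<open>Lv p a\<close> and \<open>X0_loss\<close> applies.\<close>

lemma loss_if_J0:
  assumes p: "p \<in> P" "p \<notin> Q0" and h: "hh p \<in> J0"
  shows "2 * ls X0 (hh p * r) \<le> card X0"
proof -
  have "Mp p = {x\<in>C. ep p * x \<in> J0}"
  proof
    show "Mp p \<subseteq> {x\<in>C. ep p * x \<in> J0}" unfolding Mp_def by (rule core_sub)
    show "{x\<in>C. ep p * x \<in> J0} \<subseteq> Mp p"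
    proof (rule ccontr)
      assume "\<not> ?thesis"
      then obtain y where y: "y \<in> C" "ep p * y \<in> J0" "y \<notin> Mp p" by blast
      then obtain x m where x: "x \<in> U0" "m \<in> Mp p" "y = x + m" using Mp_cover[OF p(1) ep_not_J0[OF p(1)]] by blast
      have "ep p * y = ep p * x + ep p * m" by (simp add: x(3) distrib_left)
      then have "ep p * x \<in> J0" using is_idealD(7)[OF J0_ideal y(2) Mp_ep[OF x(2)]] by simp
      then have "x + - (ep p * x) \<in> U0" using is_idealD(6)[OF J0_ideal] x(1) unfolding J0_def by blast
      moreover have "ep p * (x + - (ep p * x)) = 0" using p by (simp add: right_diff_distrib)
      ultimately show False using U0_ep_zero no_zero_comp[OF p(1) h] by blast
    qed
  qed
  then obtain a where "a \<le> nn p" "Mp p = Lv p a" using ideal_Lv_level[OF J0_ideal p(1)] by auto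
  then show ?thesis using X0_loss[OF p] by blast
qed

text \<open>The unit orbit \<open>O'\<close> of \<open>bl (hh s)\<close> satisfies
  \<open>orbit_union_closed\<close> with \<open>M = 0\<close> and \<open>H = It s\<close>. Hence
  \<open>O' \<union> {0}\<close> is a nonzero A-ideal inside \<open>N\<close>, so it is
  \<open>N\<close>, and every nonzero \<open>g\<close> lies in the orbit.\<close>

lemma minimal_block:
  assumes N: "aideal N" and mini: "\<And>I. aideal I \<Longrightarrow> I \<subseteq> N \<Longrightarrow> I \<noteq> {0} \<Longrightarrow> I = N"
    and s: "s \<in> P" "hh s \<in> N" and g: "g \<in> N" "g \<noteq> 0"
  shows "\<exists>u\<in>Us. u * hh s \<in> bl g"
proof -
  note NI = is_idealD[OF aidealD(1)[OF N]]
  have sC: "hh s \<in> C" using s by simp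
  define O' where "O' = {u * x | u x. u \<in> Us \<and> x \<in> bl (hh s)}"
  have asO: "aset O'"
  proof -
    have "O' = \<Union>((\<lambda>u. (*) u ` bl (hh s)) ` Us)" by (auto simp: O'_def)
    moreover have "aset (\<Union>((\<lambda>u. (*) u ` bl (hh s)) ` Us))" by (rule aset_Union) (use aset_img aset_bl[OF sC] in auto)
    ultimately show ?thesis by simp
  qed
  have OUs: "u * x \<in> O'" if "u \<in> Us" "x \<in> O'" for u x
  proof -
    obtain v y where "v \<in> Us" "y \<in> bl (hh s)" "x = v * y" using \<open>x \<in> O'\<close> by (auto simp: O'_def)
    then show ?thesis using that(1) unfolding O'_def by (metis (mono_tags, lifting) Us_mult mem_Collect_eq mult.assoc)
  qed
  have hO: "hh s \<in> O'"
  proof -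
    have "hh s = e * hh s" using sC by simp
    then show ?thesis unfolding O'_def using bl_in[OF sC] e_Un by blast
  qed
  have blN: "bl (hh s) \<subseteq> N" using asetD[OF aidealD(2)[OF N] s(2)] .
  have ON: "O' \<subseteq> N" using blN NI(4) by (auto simp: O'_def)
  have O0: "0 \<notin> O'"
  proof
    assume "0 \<in> O'"
    then have "bl 0 \<subseteq> O'" by (rule asetD[OF asO])
    from \<open>0 \<in> O'\<close> obtain u x where ux: "u \<in> Us" "x \<in> bl (hh s)" "u * x = 0" by (auto simp: O'_def)
    have "x = 0" using inv_cancel(2)[OF ux(1), of x] ux bl_C[OF sC] by simp
    then have "bl (hh s) = {0}" using bl_same[OF sC ux(2)] bl_zero by simp
    then show False using bl_in[OF sC] hh_nz[OF s(1)] by simp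
  qed
  have st: "stable s O'" using OUs by (simp add: stable_def)
  have inv: "x + k \<in> O'" if x: "x \<in> O'" "x \<notin> It s" and k: "k \<in> It s" for x k
  proof (rule ccontr)
    assume n: "x + k \<notin> O'"
    obtain r where r: "k = hh s * r" using k by (auto simp: It_def)
    note * = TT_zero[OF asO s(1) st]
    define Y where "Y = {x\<in>C. ep s * x = 0 \<and> (x \<in> O') \<noteq> (x + hh s \<in> O')}"
    \<comment> \<open>All boundary points of \<open>O'\<close> at \<open>s\<close> lie in
      \<open>L\<close>. The core of \<open>L\<close> is an A-ideal inside \<open>N\<close> that
      misses \<open>hh s\<close>, so by minimality it is zero and the only possible boundary point
      is 0.\<close>
    define L where "L = N \<inter> {x\<in>C. ep s * x = 0}"
    have LI: "is_ideal L" unfolding L_def by (rule ideal_Int[OF aidealD(1)[OF N] ideal_vanish[OF s(1)]])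
    have "Y \<subseteq> L"
    proof
      fix y assume y: "y \<in> Y"
      have "y \<in> N"
      proof (cases "y \<in> O'")
        case False
        then have "y + hh s \<in> N" using y ON by (auto simp: Y_def)
        then show ?thesis using NI(7)[OF _ s(2)] by fastforce
      qed (use ON in blast)
      then show "y \<in> L" using y by (auto simp: L_def Y_def)
    qed
    then have YL: "Y \<subseteq> core L" using core_max *(1) by (simp add: Y_def)
    have "core L = {0}"
    proof (rule ccontr)
      assume "core L \<noteq> {0}"
      then have "core L = N" using mini[OF core_aideal[OF LI]] core_sub[of L] by (auto simp: L_def)
      then have "ep s * hh s = 0" using s(2) core_sub[of L] by (auto simp: L_def)
      then show False using hh_nz s(1) by simp
    qed
    moreover have "x - ep s * x \<in> Y"
      using *(3)[OF x(1) n[unfolded r]] NI(8) ON x(1) s(1) by (auto simp: Y_def right_diff_distrib)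
    ultimately have "x = ep s * x" using YL by auto
    moreover obtain y where "ep s * x = hh s * y" using *(2)[OF x(1) n[unfolded r]] by blast
    ultimately show False using x(2) by (auto simp: It_def)
  qed
  have closed: "x + y \<in> O' \<union> {0}" if "x \<in> O'" "y \<in> O'" for x y
  proof (rule orbit_union_closed[where b = "hh s" and H = "It s" and h = "hh s"])
    show "is_ideal (It s)" by (rule It_ideal[OF s(1)])
    show "{0} \<subseteq> It s" using is_idealD(2)[OF It_ideal[OF s(1)]] by simp
    show "hh s \<in> It s" unfolding It_def by (metis mult.right_neutral rangeI)
    show "It s - {0} \<subseteq> O'" using It_unit[OF s(1)] OUs hO by blast
    show "\<exists>u\<in>Us. \<exists>m\<in>{0}. \<exists>y\<in>bl (hh s). x = u * y + m" if "x \<in> O'" for x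
      using that unfolding O'_def by auto
    show "x + k \<in> O'" if "x \<in> O'" "x \<notin> It s" "k \<in> It s" for x k by (rule inv[OF that])
  qed (use asO OUs O0 aideal_zero sC hO that in auto)
  have "is_ideal (O' \<union> {0})"
  proof (rule ideal_unitsI)
    show "O' \<union> {0} \<subseteq> C" using aset_sub[OF asO] by simp
    show "0 \<in> O' \<union> {0}" by simp
    show "x + y \<in> O' \<union> {0}" if "x \<in> O' \<union> {0}" "y \<in> O' \<union> {0}" for x y using that closed by (cases "x = 0"; cases "y = 0") auto
    show "u * x \<in> O' \<union> {0}" if "u \<in> Us" "x \<in> O' \<union> {0}" for u x using that OUs by auto
  qed
  moreover have "aset (O' \<union> {0})" using asO aset_zero unfolding aset_def by blast
  ultimately have "O' \<union> {0} = N"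
    by (intro mini) (use ON NI(2) hO hh_nz s(1) in \<open>auto simp: aideal_def\<close>)
  then have "g \<in> O'" using g by blast
  then obtain u x where ux: "u \<in> Us" "x \<in> bl (hh s)" "g = u * x" by (auto simp: O'_def)
  have "bl g = (*) u ` bl (hh s)" using bl_unit[OF ux(1) bl_C[OF sC ux(2)]] bl_same[OF sC ux(2)] ux(3) by simp
  then have "u * hh s \<in> bl g" using bl_in[OF sC] by blast
  then show ?thesis using ux(1) by blast
qed

lemma minimal_aideal:
  assumes A: "aideal A" "A \<noteq> {0}"
  shows "\<exists>N. aideal N \<and> N \<subseteq> A \<and> N \<noteq> {0} \<and> (\<forall>I. aideal I \<longrightarrow> I \<subseteq> N \<longrightarrow> I \<noteq> {0} \<longrightarrow> I = N)"
proof -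
  define F where "F N \<longleftrightarrow> aideal N \<and> N \<subseteq> A \<and> N \<noteq> {0}" for N
  obtain N where N: "F N" "\<And>I. F I \<Longrightarrow> card N \<le> card I"
    using ex_has_least_nat[of F A card] A by (auto simp: F_def)
  have "I = N" if "aideal I" "I \<subseteq> N" "I \<noteq> {0}" for I
    using N(2)[of I] that N(1) is_idealD(9)[OF aidealD(1), of N] card_seteq[of N I] by (auto simp: F_def)
  then show ?thesis using N(1) by (auto simp: F_def)
qed

text \<open>Otherwise the hull of \<open>hh p\<close> contains a minimal A-ideal \<open>N\<close>
  inside \<open>J0\<close>, and \<open>N\<close> contains some \<open>hh s\<close> with
  \<open>s\<close> outside \<open>Q0\<close>. By \<open>minimal_block\<close> the loss of
  \<open>X0\<close> is at most one half on all of \<open>N\<close>, so more than half of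
  \<open>e + N\<close> lies in \<open>X0\<close>. Since \<open>e + N\<close> consists of units and
  the units in \<open>X0\<close> form a group, all of \<open>e + N\<close> lies in
  \<open>X0\<close>. Then \<open>X0\<close> is invariant under \<open>N\<close>, against purity at
  \<open>s\<close>.\<close>

lemma hh_not_J0: assumes p: "p \<in> P" "p \<notin> Q0" shows "hh p \<notin> J0"
proof
  assume h: "hh p \<in> J0"
  define A where "A = ahull (hh p)"
  have AI: "aideal A" using ahull_aideal p by (simp add: A_def)
  have AJ: "A \<subseteq> J0" using ahull_min[OF J0_aideal h] by (simp add: A_def)
  have "A \<noteq> {0}" using ahull_in[of "hh p"] hh_nz[OF p(1)] by (auto simp: A_def)
  then obtain N where N: "aideal N" "N \<subseteq> A" "N \<noteq> {0}" "\<And>I. aideal I \<Longrightarrow> I \<subseteq> N \<Longrightarrow> I \<noteq> {0} \<Longrightarrow> I = N"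
    using minimal_aideal[OF AI] by blast
  note NI = is_idealD[OF aidealD(1)[OF N(1)]]
  obtain x where "x \<in> N" "x \<noteq> 0" using N(3) NI(2) by blast
  then obtain s where s: "s \<in> P" "hh s \<in> N" using ideal_nonzero_hh[OF aidealD(1)[OF N(1)]] by blast
  have sQ: "s \<notin> Q0"
  proof
    assume sQ: "s \<in> Q0"
    then have "s \<noteq> p" using p by blast
    moreover have "2 * ls X0 (hh p) \<le> card X0" using loss_if_J0[OF p h, of 1] by simp
    ultimately have "hh s \<notin> ahull (hh p)" using hull_avoids[OF p(1) _ s(1)] pure[OF s(1)] sQ by (simp add: Q0_def)
    then show False using s N(2) by (auto simp: A_def)
  qed
  have fX: "finite X0" using aset_finite[OF aset_X0] .
  have ac2: "card X0 \<le> 2 * ac X0 X0 g" if g: "g \<in> N" for g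
  proof (cases "g = 0")
    case False
    obtain u where u: "u \<in> Us" "u * hh s \<in> bl g" using minimal_block[OF N(1,4) s g False] by blast
    have "ls X0 g = ls X0 (hh s * u)" using ls_const[OF aset_X0 NI(8)[OF g] u(2)] by (simp add: mult.commute)
    then have "2 * ls X0 g \<le> card X0" using loss_if_J0[OF s(1) sQ, of u] s N(2) AJ by auto
    then show ?thesis using ac_ls[OF fX, of g] by simp
  qed (simp add: ac_zero)
  define V where "V = {g\<in>N. e + g \<in> X0}"
  have sum: "(\<Sum>g\<in>N. ac X0 X0 g) = card X0 * card V"
  proof -
    have "(\<Sum>g\<in>N. ac X0 X0 g) = (\<Sum>x\<in>X0. card {g\<in>N. x + g \<in> X0})" by (rule ac_sum[OF fX NI(9)])
    also have "\<dots> = (\<Sum>x\<in>X0. card V)"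
      unfolding V_def using coset_const[OF aset_X0 N(1) e_C] by (intro sum.cong) (auto simp: X0_def)
    finally show ?thesis by simp
  qed
  have "card X0 * card N < 2 * (card X0 * card V)"
  proof -
    \<comment> \<open>The inequality is strict because nothing is lost at
      \<open>g = 0\<close>.\<close>
    have "(\<Sum>g\<in>N. card X0) < (\<Sum>g\<in>N. 2 * ac X0 X0 g)"
    proof (rule sum_strict_mono_ex1)
      have "card X0 > 0" using fX e_X0 by (auto simp: card_gt_0_iff)
      then show "\<exists>a\<in>N. card X0 < 2 * ac X0 X0 a" using NI(2) by (intro bexI[of _ 0]) (auto simp: ac_zero)
    qed (use ac2 NI(9) in auto)
    then show ?thesis using sum by (simp add: sum_distrib_left[symmetric] mult.commute)
  qed
  then have gt: "card N < 2 * card V" by (metis mult.left_commute mult_less_cancel1)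
  have eN: "e + g \<in> Us" if g: "g \<in> N" for g
  proof -
    have "un t (e + g)" if t: "t \<in> P" for t
    proof (rule ccontr)
      assume "\<not> un t (e + g)"
      then have "un t g" using un_add[OF t un_e[OF t]] by blast
      then obtain y where y: "ep t * g * y = ep t" by (auto simp: un_def)
      have "ep t \<in> N" using NI(5)[OF NI(4)[OF g, of "ep t"], of y] y by simp
      then show False using ep_not_J0[OF t] N(2) AJ by blast
    qed
    then show ?thesis using NI(8)[OF g] by (simp add: Us_iff)
  qed
  have VN: "V = N"
  proof (rule ccontr)
    assume "V \<noteq> N"
    then obtain g0 where g0: "g0 \<in> N" "e + g0 \<notin> X0" by (auto simp: V_def)
    \<comment> \<open>Multiplication by a unit \<open>e + g0\<close> outside \<open>X0\<close>
      carries the part of \<open>e + N\<close> in \<open>X0\<close> injectively into the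
      rest.\<close>
    have "card V \<le> card (N - V)"
    proof (rule card_inj_on_le[of "\<lambda>g. g + g0 * (e + g)"])
      have eq: "e + (g + g0 * (e + g)) = (e + g0) * (e + g)" if "g \<in> N" for g
      proof -
        have "(e + g0) * (e + g) = e * (e + g) + g0 * (e + g)" by (simp only: distrib_right)
        moreover have "e * (e + g) = e + g" using NI(8)[OF that] by simp
        ultimately show ?thesis by (simp add: add.assoc)
      qed
      show "inj_on (\<lambda>g. g + g0 * (e + g)) V"
      proof (rule inj_onI)
        fix g g' assume gg: "g \<in> V" "g' \<in> V" "g + g0 * (e + g) = g' + g0 * (e + g')"
        then have N': "g \<in> N" "g' \<in> N" by (auto simp: V_def)
        have "(e + g0) * (e + g) = (e + g0) * (e + g')" using eq[OF N'(1)] eq[OF N'(2)] gg(3) by metis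
        then have "uinv (e + g0) * ((e + g0) * (e + g)) = uinv (e + g0) * ((e + g0) * (e + g'))" by simp
        then have "e + g = e + g'" using inv_cancel(2)[OF eN[OF g0(1)]] Us_C[OF eN[OF N'(1)]] Us_C[OF eN[OF N'(2)]] by simp
        then show "g = g'" by simp
      qed
      show "(\<lambda>g. g + g0 * (e + g)) ` V \<subseteq> N - V"
      proof
        fix z assume "z \<in> (\<lambda>g. g + g0 * (e + g)) ` V"
        then obtain g where g: "g \<in> N" "e + g \<in> X0" "z = g + g0 * (e + g)" by (auto simp: V_def)
        have "z \<in> N" using g NI(3,5) g0(1) by simp
        moreover have "e + z \<notin> X0" unfolding g(3) eq[OF g(1)] using X0_unit_iff[OF eN[OF g0(1)] g(2)] g0(2) by simp
        ultimately show "z \<in> N - V" by (simp add: V_def)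
      qed
      show "finite (N - V)" using NI(9) by simp
    qed
    moreover have "card (N - V) = card N - card V" by (rule card_Diff_subset) (use NI(9) finite_subset in \<open>auto simp: V_def\<close>)
    ultimately show False using gt by simp
  qed
  obtain x r where x: "x \<in> X0" "x + hh s * r \<notin> X0" using pure[OF s(1)] by blast
  have "card {g\<in>N. x + g \<in> X0} = card N"
    using coset_const[OF aset_X0 N(1) e_C, of x] x(1) VN by (simp add: X0_def V_def)
  then have "{g\<in>N. x + g \<in> X0} = N" using NI(9) by (intro card_subset_eq) auto
  then show False using x(2) NI(5)[OF s(2)] by blast
qed

lemma Mp_ep_zero: assumes "p \<in> P" "p \<notin> Q0" "x \<in> Mp p" shows "ep p * x = 0"
proof (rule ccontr)
  assume "ep p * x \<noteq> 0"
  then have "ep p * (ep p * x) \<noteq> 0" using assms by simp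
  then have "hh p \<in> J0" using ideal_has_hh[OF J0_ideal assms(1) Mp_ep[OF assms(3)]] by simp
  then show False using hh_not_J0 assms by blast
qed

section \<open>The sets \<open>D p\<close> for primes outside \<open>Q0\<close>\<close>

lemma Mp_props: assumes "p \<in> P" "p \<notin> Q0" shows "aideal (Mp p)" "is_ideal (Mp p)" "U0 \<inter> Mp p = {}"
    "y \<in> C \<Longrightarrow> y \<notin> Mp p \<Longrightarrow> \<exists>x\<in>U0. \<exists>m\<in>Mp p. y = x + m"
  using Mp_aideal[OF assms(1)] aidealD U0_Mp[OF assms(1) ep_not_J0[OF assms(1)]] Mp_cover[OF assms(1) ep_not_J0[OF assms(1)]]
  by blast+

lemma D_P: "D p \<subseteq> P" by (auto simp: D_def)
lemma p_D: "p \<in> P \<Longrightarrow> p \<notin> Q0 \<Longrightarrow> p \<in> D p"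
  using Mp_ep_zero[of p "ep p"] ep_nz[of p] by (auto simp: D_def idem)

lemma Mp_Lv: assumes p: "p \<in> P" "p \<notin> Q0" and t: "t \<in> D p" shows "Mp p \<subseteq> Lv t 1"
proof
  fix x assume x: "x \<in> Mp p"
  note MI = is_idealD[OF Mp_props(2)[OF p]]
  have tP: "t \<in> P" using t D_P by blast
  have "\<not> un t x"
  proof
    assume "un t x"
    then obtain y where y: "ep t * x * y = ep t" by (auto simp: un_def)
    then have "ep t \<in> Mp p" using MI(5)[OF MI(4)[OF x, of "ep t"], of y] by simp
    then show False using t by (simp add: D_def)
  qed
  then show "x \<in> Lv t 1" using not_un_Lv[OF tP MI(8)[OF x]] by simp
qed

text \<open>\<open>ep p\<close> vanishes at \<open>t\<close> and is not in \<open>Mp p\<close>, so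
  it is \<open>x + m\<close> with \<open>x\<close> in \<open>U0\<close> and \<open>m\<close> in
  \<open>Mp p\<close>. As \<open>m\<close> is a nonunit at \<open>t\<close>, so is \<open>x\<close>,
  which is impossible for \<open>t\<close> in \<open>Q0\<close>.\<close>

lemma D_Q0: assumes p: "p \<in> P" "p \<notin> Q0" and t: "t \<in> D p" shows "t \<notin> Q0"
proof
  assume tQ: "t \<in> Q0"
  have tP: "t \<in> P" using t D_P by blast
  have "ep t * ep p = 0" using orth[OF tP p(1)] tQ p(2) by blast
  then have L: "ep p \<in> Lv t 1" using p by (auto simp: Lv_def intro!: exI[of _ 0])
  have "ep p \<notin> Mp p" using p_D[OF p] by (simp add: D_def)
  then obtain x m where x: "x \<in> U0" "m \<in> Mp p" "ep p = x + m" using Mp_props(4)[OF p, of "ep p"] p by auto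
  have "x = ep p - m" using x(3) by simp
  then have "x \<in> Lv t 1" using is_idealD(7)[OF ideal_Lv[OF tP] L] x(2) Mp_Lv[OF p t] by blast
  then show False using U0_Lv[OF tP, of 1] tQ x(1) by (auto simp: Q0_def)
qed

lemma un_Lv1: "t \<in> P \<Longrightarrow> e \<notin> Lv t 1" using not_un_Lv[of t e] by simp

text \<open>If \<open>Mp t\<close> failed to contain \<open>Mp p\<close>, the sum of the two
  A-ideals would meet \<open>U0\<close> and hence contain \<open>e\<close>; but both lie in the
  maximal ideal \<open>Lv t 1\<close>.\<close>

lemma Mp_D_sub: assumes p: "p \<in> P" "p \<notin> Q0" and t: "t \<in> D p" shows "Mp p \<subseteq> Mp t"
proof
  fix y assume y: "y \<in> Mp p"
  have tP: "t \<in> P" using t D_P by blast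
  have tQ: "t \<notin> Q0" using D_Q0[OF p t] .
  show "y \<in> Mp t"
  proof (rule ccontr)
    assume "y \<notin> Mp t"
    then obtain x m where x: "x \<in> U0" "m \<in> Mp t" "y = x + m"
      using Mp_props(4)[OF tP tQ] is_idealD(8)[OF Mp_props(2)[OF p] y] by blast
    define S where "S = {x + y | x y. x \<in> Mp p \<and> y \<in> Mp t}"
    have S: "aideal S" unfolding S_def by (rule aideal_sum[OF Mp_props(1)[OF p] Mp_props(1)[OF tP tQ]])
    have "x = y + - m" using x(3) by simp
    then have "x \<in> S" unfolding S_def using y is_idealD(6)[OF Mp_props(2)[OF tP tQ] x(2)] by blast
    then have "e \<in> S" using aideal_U0[OF S] x(1) by blast
    moreover have "Mp t \<subseteq> Lv t 1" by (rule Mp_Lv[OF tP tQ p_D[OF tP tQ]])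
    then have "S \<subseteq> Lv t 1" using Mp_Lv[OF p t] is_idealD(3)[OF ideal_Lv[OF tP]] unfolding S_def by blast
    ultimately show False using un_Lv1 tP by blast
  qed
qed

text \<open>The second inclusion is maximality of \<open>Mp p\<close>: a point of
  \<open>Mp t\<close> outside it would give, after subtracting an element of \<open>Mp p\<close>, a
  point of \<open>U0\<close> in \<open>Mp t\<close>.\<close>

lemma Mp_D_eq: assumes p: "p \<in> P" "p \<notin> Q0" and t: "t \<in> D p" shows "Mp t = Mp p"
proof
  have tP: "t \<in> P" using t D_P by blast
  have tQ: "t \<notin> Q0" using D_Q0[OF p t] .
  show "Mp p \<subseteq> Mp t" by (rule Mp_D_sub[OF p t])
  show "Mp t \<subseteq> Mp p"
  proof
    fix y assume y: "y \<in> Mp t"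
    show "y \<in> Mp p"
    proof (rule ccontr)
      assume "y \<notin> Mp p"
      then obtain x m where x: "x \<in> U0" "m \<in> Mp p" "y = x + m"
        using Mp_props(4)[OF p] is_idealD(8)[OF Mp_props(2)[OF tP tQ] y] by blast
      have "x = y - m" using x(3) by simp
      then have "x \<in> Mp t" using is_idealD(7)[OF Mp_props(2)[OF tP tQ] y] x(2) \<open>Mp p \<subseteq> Mp t\<close> by blast
      then show False using Mp_props(3)[OF tP tQ] x(1) by blast
    qed
  qed
qed

lemma D_eq: assumes p: "p \<in> P" "p \<notin> Q0" and t: "t \<in> D p" shows "D t = D p"
  using Mp_D_eq[OF assms] by (simp add: D_def)

text \<open>At each \<open>t\<close> in \<open>D p\<close> the elements of
  \<open>Mp p = Mp t\<close> vanish by \<open>Mp_ep_zero\<close>; at every other prime the whole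
  component lies in \<open>Mp p\<close> by definition of \<open>D p\<close>.\<close>

lemma Mp_RS: assumes p: "p \<in> P" "p \<notin> Q0" shows "Mp p = RS (P - D p)"
proof
  note MI = is_idealD[OF Mp_props(2)[OF p]]
  show "Mp p \<subseteq> RS (P - D p)"
  proof
    fix x assume x: "x \<in> Mp p"
    have "ep t * x = 0" if t: "t \<in> D p" for t
    proof -
      have "t \<in> P" using t D_P by blast
      moreover have "x \<in> Mp t" using Mp_D_sub[OF p t] x by blast
      ultimately show ?thesis by (rule Mp_ep_zero[OF _ D_Q0[OF p t]])
    qed
    then show "x \<in> RS (P - D p)" using RS_iff[of "P - D p" x] MI(8)[OF x] by blast
  qed
  show "RS (P - D p) \<subseteq> Mp p"
  proof
    fix x assume "x \<in> RS (P - D p)"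
    then have x: "x \<in> C" "\<And>t. t \<in> D p \<Longrightarrow> ep t * x = 0" using RS_iff[of "P - D p" x] D_P by auto
    show "x \<in> Mp p"
    proof (rule ideal_comps[OF Mp_props(2)[OF p] x(1)])
      fix t assume t: "t \<in> P"
      show "ep t * x \<in> Mp p"
      proof (cases "t \<in> D p")
        case True then show ?thesis using x(2) MI(2) by simp
      next
        case False
        then have "ep t \<in> Mp p" using t by (simp add: D_def)
        then show ?thesis using MI(5) by blast
      qed
    qed
  qed
qed

lemma RS_single: assumes p: "p \<in> P" shows "RS (P - {p}) = {x\<in>C. ep p * x = 0}"
proof -
  have "P - (P - {p}) = {p}" using p by blast
  then show ?thesis using RS_iff[of "P - {p}"] by auto
qed

text \<open>If the part on \<open>D p\<close> were a field, \<open>Mp p\<close> would be the maximal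
  ideal \<open>Lv p 1\<close>, which \<open>X0\<close> meets because \<open>p\<close> is outside
  \<open>Q0\<close>.\<close>

lemma D_nonfield: assumes p: "p \<in> P" "p \<notin> Q0" shows "(\<exists>t\<in>D p. t \<noteq> p) \<or> 2 \<le> nn p"
proof (rule ccontr)
  assume "\<not> ?thesis"
  then have Dp: "D p = {p}" and n: "nn p = 1" using p_D[OF p] nn_pos[OF p(1)] by force+
  have "Mp p = Lv p 1"
  proof -
    have "of_nat p * ep p = 0" using nil[OF p(1)] n by simp
    then have "x \<in> Lv p 1 \<longleftrightarrow> x \<in> C \<and> ep p * x = 0" for x by (auto simp: Lv_def)
    then have "Lv p 1 = RS (P - D p)" unfolding Dp RS_single[OF p(1)] by auto
    then show ?thesis using Mp_RS[OF p] by simp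
  qed
  then show False using Mp_props(3)[OF p] X0_U0 p by (auto simp: Q0_def)
qed

lemma RS_D_split: assumes "p \<in> P" "p \<notin> Q0" "x \<in> C"
  shows "x = E (D p) * x + E (P - D p) * x" "E (D p) * x \<in> RS (D p)" "E (P - D p) * x \<in> RS (P - D p)"
proof -
  have "E (D p) + E (P - D p) = e" unfolding E_def using D_P finP by (metis sum.subset_diff add.commute)
  then show "x = E (D p) * x + E (P - D p) * x" using assms by (simp add: distrib_right[symmetric])
  show "E (D p) * x \<in> RS (D p)" "E (P - D p) * x \<in> RS (P - D p)"
    unfolding RS_def mem_Collect_eq mult.assoc[symmetric]
    using E_E[OF D_P D_P, of p p] E_E[of "P - D p" "P - D p"] by simp_all
qed

lemma E_D_zero: assumes "p \<in> P" "p \<notin> Q0" "m \<in> Mp p" shows "E (D p) * m = 0"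
proof -
  have "E (P - D p) * m = m" using assms Mp_RS by (simp add: RS_def)
  then have "E (D p) * m = E (D p) * E (P - D p) * m" by (simp add: mult.assoc)
  also have "E (D p) * E (P - D p) = 0" using E_E[of "D p" "P - D p"] D_P by (simp add: E_def)
  finally show ?thesis by simp
qed

lemma in_Mp_iff: assumes "p \<in> P" "p \<notin> Q0" "x \<in> C" shows "x \<in> Mp p \<longleftrightarrow> E (D p) * x = 0"
  using E_D_zero[OF assms(1,2)] RS_D_split[OF assms] Mp_RS[OF assms(1,2)] by auto

lemma ep_E_D: "t \<in> D p \<Longrightarrow> ep t * (E (D p) * x) = ep t * x" using ep_E_left[of t "D p" x] D_P by auto

text \<open>For \<open>D p = {p}\<close> the ideal \<open>Mp p\<close> is \<open>Lv p (nn p)\<close>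
  and \<open>X0_loss\<close> applies. Otherwise \<open>ep t\<close> with another \<open>t\<close> in
  \<open>D p\<close> leads to a point of \<open>X0\<close> vanishing at \<open>p\<close>, so
  \<open>X0\<close> is stable at \<open>p\<close>. The lost points then have the form
  \<open>x' - hh p\<close> with \<open>x'\<close> vanishing at \<open>p\<close>, and adding
  \<open>2 * hh p\<close> maps them injectively to points that are not lost.\<close>

lemma X0_loss_half: assumes p: "p \<in> P" "p \<notin> Q0" shows "2 * ls X0 (hh p) \<le> card X0"
proof (cases "\<exists>t\<in>D p. t \<noteq> p")
  case False
  then have Dp: "D p = {p}" using p_D[OF p] by blast
  have "of_nat p ^ nn p * ep p = 0" using nil p by blast
  then have "x \<in> Lv p (nn p) \<longleftrightarrow> x \<in> C \<and> ep p * x = 0" for x by (auto simp: Lv_def)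
  then have "Lv p (nn p) = RS (P - D p)" unfolding Dp RS_single[OF p(1)] by auto
  then have "Mp p = Lv p (nn p)" using Mp_RS[OF p] by simp
  then show ?thesis using X0_loss[OF p order_refl, of 1] by simp
next
  case True
  then obtain t where t: "t \<in> D p" "t \<noteq> p" by blast
  have tP: "t \<in> P" using t D_P by blast
  have "ep t \<notin> Mp p" using t by (simp add: D_def)
  then obtain x m where x: "x \<in> U0" "m \<in> Mp p" "ep t = x + m" using Mp_props(4)[OF p, of "ep t"] tP by auto
  have "ep p * x = ep p * ep t - ep p * m" by (simp add: x(3) distrib_left)
  then have "ep p * x = 0" using orth[OF p(1) tP] t Mp_ep_zero[OF p x(2)] by simp
  then obtain y where y: "y \<in> X0" "ep p * y = 0" using U0_ep_zero x(1) by blast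
  have st: "stable p X0" unfolding X0_def by (rule stable_bl[OF p(1) e_C y(1)[unfolded X0_def] y(2)])
  note * = TT_zero[OF aset_X0 p(1) st]
  define B where "B = {x\<in>X0. x + hh p \<notin> X0}"
  have lift_act: "lift p v * (z + hh p * w) = z + hh p * (v * w)" if "z \<in> C" "ep p * z = 0" for v z w
  proof -
    have "lift p v * (z + hh p * w) = ep p * v * (z + hh p * w) + ((z + hh p * w) - ep p * (z + hh p * w))"
      using lift_mult[OF p(1), of "z + hh p * w"] that p by simp
    also have "ep p * (z + hh p * w) = hh p * w" using that(2) ep_hh[OF p(1)] by (simp add: distrib_left mult.assoc[symmetric])
    also have "ep p * v * (z + hh p * w) = v * (ep p * (z + hh p * w))" by (simp only: mult_ac)
    also have "ep p * (z + hh p * w) = hh p * w" using that(2) ep_hh[OF p(1)] by (simp add: distrib_left mult.assoc[symmetric])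
    finally show ?thesis by (simp add: mult_ac)
  qed
  have B: "\<exists>x'\<in>C. ep p * x' = 0 \<and> x = x' - hh p \<and> x' + hh p \<in> X0" if x: "x \<in> B" for x
  proof -
    have x0: "x \<in> X0" "x + hh p * 1 \<notin> X0" using x by (auto simp: B_def)
    obtain y where y: "ep p * x = hh p * y" using *(2)[OF x0] by blast
    define x' where "x' = x - ep p * x"
    have xC: "x \<in> C" using x0 X0_C by blast
    have x': "x' \<in> C" "ep p * x' = 0" using xC p by (auto simp: x'_def right_diff_distrib)
    have n: "(x' \<in> X0) \<noteq> (x' + hh p \<in> X0)" using *(3)[OF x0] by (simp add: x'_def)
    \<comment> \<open>Otherwise the boundary meets \<open>U0\<close> and contains a unit, although
      its points vanish at \<open>p\<close>.\<close>
    have "x' \<notin> X0"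
    proof
      assume a: "x' \<in> X0"
      have "x' \<in> {x\<in>C. ep p * x = 0 \<and> (x \<in> X0) \<noteq> (x + hh p \<in> X0)}" using n x' by simp
      then obtain u where "u \<in> Us" "ep p * u = 0" using U0_meets[OF *(1), of x'] a X0_U0 by blast
      then show False using no_unit_zero p by blast
    qed
    then have x'h: "x' + hh p \<in> X0" using n by blast
    have xe: "x = x' + hh p * y" by (simp add: x'_def y)
    have sth: "x' + hh p * v \<in> X0" if "un p v" for v
    proof -
      have "lift p v * (x' + hh p * 1) \<in> X0"
        using st x'h lift_Us[OF p(1) that] lift_other[OF p(1)] unfolding stable_def by simp
      then show ?thesis using lift_act[OF x', of v 1] by simp
    qed
    \<comment> \<open>By stability \<open>x' + hh p * v\<close> is in \<open>X0\<close> for every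
      unit \<open>v\<close> at \<open>p\<close>; so a loss forces \<open>y + 1\<close> to be a
      nonunit, that is, \<open>hh p * y = - hh p\<close>.\<close>
    have "\<not> un p (y + 1)"
    proof
      assume "un p (y + 1)"
      from sth[OF this] have "x + hh p * 1 \<in> X0" by (simp add: xe distrib_left add.assoc)
      then show False using x0(2) by simp
    qed
    then have "hh p * (y + 1) = 0" using hh_not_un p by blast
    then have "x = x' - hh p" using xe by (simp add: distrib_left eq_diff_eq add.assoc)
    then show ?thesis using x'h x' by blast
  qed
  have "card B \<le> card (X0 - B)"
  proof (rule card_inj_on_le[of "\<lambda>x. x + hh p + hh p"])
    show "(\<lambda>x. x + hh p + hh p) ` B \<subseteq> X0 - B"
    proof
      fix z assume "z \<in> (\<lambda>x. x + hh p + hh p) ` B"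
      then obtain x where x: "x \<in> B" "z = x + hh p + hh p" by blast
      obtain x' where x': "x = x' - hh p" "x' + hh p \<in> X0" "x' \<in> C" "ep p * x' = 0" using B[OF x(1)] by blast
      have z: "z = x' + hh p" by (simp add: x(2) x'(1))
      have "lift p 2 * (x' + hh p * 1) \<in> X0"
        using st x'(2) lift_Us[OF p(1) un_two[OF p(1)]] lift_other[OF p(1)] unfolding stable_def by simp
      then have "x' + hh p * 2 \<in> X0" using lift_act[OF x'(3,4), of 2 1] by simp
      then have "z + hh p \<in> X0" by (simp add: z mult_2_right add.assoc)
      then have "z \<notin> B" by (simp add: B_def)
      then show "z \<in> X0 - B" using z x'(2) by simp
    qed
    show "finite (X0 - B)" using aset_finite[OF aset_X0] by simp
  qed (auto simp: inj_on_def)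
  moreover have "card (X0 - B) = card X0 - card B"
    by (rule card_Diff_subset) (use aset_finite[OF aset_X0] finite_subset in \<open>auto simp: B_def\<close>)
  moreover have "card B \<le> card X0" using aset_finite[OF aset_X0] by (intro card_mono) (auto simp: B_def)
  ultimately show ?thesis unfolding ls_def B_def[symmetric] by simp
qed

text \<open>This part of the ring is the hull of \<open>hh p\<close>. The hull reaches no prime
  \<open>t\<close> outside \<open>D p\<close>: for \<open>t\<close> in \<open>Q0\<close> this is
  \<open>hull_avoids\<close>, and otherwise \<open>p\<close> is not in \<open>D t\<close>, so the
  hull lies in \<open>Mp t\<close>, which vanishes at \<open>t\<close>. Conversely the sum of the
  hull and \<open>Mp p\<close> meets \<open>U0\<close> and contains \<open>e\<close>; multiplication
  by \<open>E (D p)\<close> kills the part in \<open>Mp p\<close>.\<close>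

lemma RS_D_aideal: assumes p: "p \<in> P" "p \<notin> Q0" shows "aideal (RS (D p))"
proof -
  define A where "A = ahull (hh p)"
  have A: "aideal A" using ahull_aideal p by (simp add: A_def)
  note AI = is_idealD[OF aidealD(1)[OF A]]
  have hA: "hh p \<in> A" using ahull_in by (simp add: A_def)
  have "A \<subseteq> RS (D p)"
  proof
    fix x assume x: "x \<in> A"
    have "ep t * x = 0" if t: "t \<in> P - D p" for t
    proof (rule ccontr)
      assume n: "ep t * x \<noteq> 0"
      have tP: "t \<in> P" using t by blast
      have ht: "hh t \<in> A" using ideal_has_hh[OF aidealD(1)[OF A] tP x n] .
      have tp: "t \<noteq> p" using t p_D[OF p] by blast
      show False
      proof (cases "t \<in> Q0")
        case True
        then show False using hull_avoids[OF p(1) X0_loss_half[OF p] tP tp _ pure[OF tP]] ht by (auto simp: Q0_def A_def)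
      next
        case False
        have "p \<notin> D t" using D_eq[OF tP False, of p] t p_D[OF tP False] by blast
        then have "ep p \<in> Mp t" using p by (simp add: D_def)
        then have "hh p \<in> Mp t" using is_idealD(4)[OF Mp_props(2)[OF tP False]] by (simp add: hh_def)
        then have "hh t \<in> Mp t" using ahull_min[OF Mp_props(1)[OF tP False]] ht by (auto simp: A_def)
        then have "ep t * hh t = 0" using Mp_ep_zero[OF tP False] by blast
        then show False using hh_nz tP by simp
      qed
    qed
    then show "x \<in> RS (D p)" using RS_iff[OF D_P] AI(8)[OF x] by blast
  qed
  moreover have "RS (D p) \<subseteq> A"
  proof
    fix x assume x: "x \<in> RS (D p)"
    define S where "S = {x + y | x y. x \<in> A \<and> y \<in> Mp p}"
    have S: "aideal S" unfolding S_def by (rule aideal_sum[OF A Mp_props(1)[OF p]])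
    have "hh p \<notin> Mp p" using Mp_ep_zero[OF p, of "hh p"] hh_nz[OF p(1)] p by auto
    then obtain y m where y: "y \<in> U0" "m \<in> Mp p" "hh p = y + m" using Mp_props(4)[OF p, of "hh p"] p by auto
    have "y = hh p + - m" using y(3) by simp
    then have "y \<in> S" unfolding S_def using hA is_idealD(6)[OF Mp_props(2)[OF p] y(2)] by blast
    then have "e \<in> S" using aideal_U0[OF S] y(1) by blast
    then obtain a m' where am: "a \<in> A" "m' \<in> Mp p" "e = a + m'" by (auto simp: S_def)
    have "E (D p) * e = E (D p) * a + E (D p) * m'" by (simp only: am(3) distrib_left)
    then have "E (D p) * e \<in> A" using E_D_zero[OF p am(2)] AI(4)[OF am(1)] by simp
    moreover have "E (D p) * e = E (D p)" using E_E[of "D p" P] D_P by (simp add: Int_absorb2)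
    ultimately have "E (D p) * x \<in> A" using AI(5) by simp
    then show "x \<in> A" using x by (simp add: RS_def)
  qed
  ultimately show ?thesis using A by simp
qed

end

section \<open>Basic sets as products along the set \<open>D p\<close>\<close>

context sr_pure begin

context
  fixes p :: nat
  assumes p: "p \<in> P" "p \<notin> Q0"
begin

abbreviation "F \<equiv> E (D p)"
abbreviation "F' \<equiv> E (P - D p)"

lemma MI: "is_ideal (Mp p)" "aideal (Mp p)" "aset (Mp p)" using Mp_props(1,2)[OF p] aidealD by auto
lemma ep_F: "ep p * (F * x) = ep p * x" by (rule ep_E_D[OF p_D[OF p]])
lemma F_zero: "m \<in> Mp p \<Longrightarrow> F * m = 0" by (rule E_D_zero[OF p])
lemma ep_Mp: "m \<in> Mp p \<Longrightarrow> ep p * m = 0" by (rule Mp_ep_zero[OF p])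
lemma F'_Mp: "x \<in> C \<Longrightarrow> F' * x \<in> Mp p" using RS_D_split(3)[OF p] Mp_RS[OF p] by simp
lemma split: "x \<in> C \<Longrightarrow> x = F * x + F' * x" by (rule RS_D_split(1)[OF p])
lemma F'_id: "m \<in> Mp p \<Longrightarrow> F' * m = m" using Mp_RS[OF p] by (simp add: RS_def)
lemma F'_RS: assumes "g \<in> RS (D p)" shows "F' * g = 0"
proof -
  have "F' * g = F' * (F * g)" using assms by (simp add: RS_def)
  also have "\<dots> = F' * F * g" by (simp add: mult.assoc)
  also have "F' * F = 0" using E_E[of "P - D p" "D p"] D_P by (simp add: E_def Int_commute)
  finally show ?thesis by simp
qed
lemma RS_C: "g \<in> RS (D p) \<Longrightarrow> g \<in> C" using RS_iff[OF D_P] by blast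
lemma F_RS: "g \<in> RS (D p) \<Longrightarrow> F * g = g" by (simp add: RS_def)
lemma in_Mp: "x \<in> C \<Longrightarrow> x \<in> Mp p \<longleftrightarrow> F * x = 0" by (rule in_Mp_iff[OF p])
lemma F_hh: "F * hh p = hh p"
proof -
  have "F * hh p = of_nat p ^ (nn p - 1) * (ep p * F)" by (simp only: hh_def mult_ac)
  also have "ep p * F = ep p" using ep_E[OF p(1) D_P] p_D[OF p] by simp
  finally show ?thesis by (simp add: hh_def)
qed
lemma hh_RS: "hh p \<in> RS (D p)" using F_hh by (simp add: RS_def)

lemma bl_off: assumes b: "b \<in> C" "F * b \<noteq> 0" shows "bl b \<inter> Mp p = {}"
proof -
  have False if "x \<in> bl b" "x \<in> Mp p" for x
  proof -
    have "bl x \<subseteq> Mp p" using asetD[OF MI(3) that(2)] .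
    then have "b \<in> Mp p" using bl_sym[OF b(1) that(1)] by blast
    then show False using F_zero b(2) by blast
  qed
  then show ?thesis by blast
qed

text \<open>Modulo \<open>Mp p\<close>, both \<open>F * b\<close> and \<open>w\<close> are unit
  multiples of elements of the single basic set \<open>X0\<close>. Exchanging one element of
  \<open>X0\<close> for the other does not leave \<open>bl b + Mp p\<close>, and \<open>F\<close>
  kills \<open>Mp p\<close>.\<close>

lemma bl_hits:
  assumes b: "b \<in> C" "F * b \<noteq> 0" and w: "w \<in> RS (D p)" "w \<noteq> 0"
  shows "\<exists>u\<in>Us. \<exists>b1\<in>bl b. F * b1 = u * w"
proof -
  define y where "y = F * b"
  have yC: "y \<in> C" using b by (simp add: y_def)
  have yD: "y \<in> RS (D p)" using RS_D_split(2)[OF p b(1)] by (simp add: y_def)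
  have "y \<notin> Mp p" using in_Mp[OF yC] F_RS[OF yD] b(2) by (simp add: y_def)
  then obtain a m1 where a: "a \<in> U0" "m1 \<in> Mp p" "y = a + m1" using Mp_props(4)[OF p yC] by blast
  then obtain u1 x1 where x1: "u1 \<in> Us" "x1 \<in> X0" "a = u1 * x1" by (auto simp: U0_def)
  have "w \<notin> Mp p" using in_Mp[OF RS_C[OF w(1)]] F_RS[OF w(1)] w(2) by simp
  then obtain a' m2 where a': "a' \<in> U0" "m2 \<in> Mp p" "w = a' + m2" using Mp_props(4)[OF p RS_C[OF w(1)]] by blast
  then obtain u2 x2 where x2: "u2 \<in> Us" "x2 \<in> X0" "a' = u2 * x2" by (auto simp: U0_def)
  define S where "S = {x + m | x m. x \<in> bl b \<and> m \<in> Mp p}"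
  have S: "aset S" unfolding S_def by (rule aset_sum[OF aset_bl[OF b(1)] MI(3)])
  have "a = b + (- (F' * b) + - m1)"
    using split[OF b(1)] a(3) by (simp add: y_def algebra_simps)
  then have "a \<in> S" unfolding S_def
    using bl_in[OF b(1)] is_idealD(3)[OF MI(1) is_idealD(6)[OF MI(1) F'_Mp[OF b(1)]] is_idealD(6)[OF MI(1) a(2)]] by blast
  then have "bl (u1 * x1) \<subseteq> S" using asetD[OF S] x1(3) by simp
  moreover have "u1 * x2 \<in> bl (u1 * x1)"
  proof -
    have "x1 \<in> C" using x1(2) X0_C by blast
    moreover have "x2 \<in> bl x1" using x1(2) x2(2) bl_same[of e x1] by (simp add: X0_def)
    ultimately show ?thesis using bl_unit[OF x1(1)] by blast
  qed
  ultimately obtain b1 m3 where b1: "b1 \<in> bl b" "m3 \<in> Mp p" "u1 * x2 = b1 + m3" by (auto simp: S_def)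
  have x2C: "x2 \<in> C" using x2(2) X0_C by blast
  have "F * (u1 * x2) = F * b1" unfolding b1(3) distrib_left using F_zero[OF b1(2)] by simp
  moreover have "F * (u2 * x2) = w"
  proof -
    have "F * w = F * (u2 * x2) + F * m2" using a'(3) x2(3) by (simp add: distrib_left)
    then show ?thesis using F_zero[OF a'(2)] F_RS[OF w(1)] by simp
  qed
  moreover have "F * (u1 * x2) = u1 * uinv u2 * (F * (u2 * x2))"
  proof -
    have "u1 * uinv u2 * (F * (u2 * x2)) = F * (u1 * (uinv u2 * (u2 * x2)))" by (simp only: mult_ac)
    then show ?thesis using inv_cancel(2)[OF x2(1) x2C] by simp
  qed
  ultimately have "F * b1 = u1 * uinv u2 * w" by simp
  moreover have "u1 * uinv u2 \<in> Us" using x1(1) uinv(1)[OF x2(1)] by simp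
  ultimately show ?thesis using b1(1) by blast
qed

text \<open>\<open>bl_hits\<close> for \<open>w = hh p\<close>; the point found stays in the A-ideal
  \<open>RS (D p)\<close>, so it is its own \<open>F\<close>-part.\<close>

lemma bl_RS: assumes g: "g \<in> RS (D p)" "g \<noteq> 0" shows "\<exists>u\<in>Us. u * hh p \<in> bl g"
proof -
  have "F * g \<noteq> 0" using F_RS g by simp
  then obtain u b1 where u: "u \<in> Us" "b1 \<in> bl g" "F * b1 = u * hh p"
    using bl_hits[OF RS_C[OF g(1)] _ hh_RS hh_nz[OF p(1)]] by blast
  have "b1 \<in> RS (D p)" using asetD[OF aidealD(2)[OF RS_D_aideal[OF p]] g(1)] u(2) by blast
  then show ?thesis using u F_RS by auto
qed

text \<open>If \<open>D p\<close> contains a second prime \<open>t\<close>, \<open>bl_hits\<close>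
  for \<open>ep t\<close> yields a point of \<open>bl b\<close> vanishing at \<open>p\<close>. If
  \<open>D p = {p}\<close> no such point exists and a count replaces it: all losses at points of
  \<open>RS (D p)\<close> are at most one half, so \<open>bl b\<close> contains more than half of
  the coset \<open>b + RS (D p)\<close>. A unit trivial off \<open>p\<close> maps this coset to
  itself, and the two large subsets overlap.\<close>

lemma bl_stable: assumes b: "b \<in> C" "F * b \<noteq> 0" shows "stable p (bl b)"
proof (cases "\<exists>t\<in>D p. t \<noteq> p")
  case True
  then obtain t where t: "t \<in> D p" "t \<noteq> p" by blast
  have tP: "t \<in> P" using t D_P by blast
  have "F * ep t = ep t" using ep_E[OF tP D_P] t by (simp add: mult.commute)
  then have "ep t \<in> RS (D p)" by (simp add: RS_def)
  then obtain u b1 where u: "u \<in> Us" "b1 \<in> bl b" "F * b1 = u * ep t" using bl_hits[OF b _ ep_nz[OF tP]] by blast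
  have "ep p * b1 = ep p * (F * b1)" by (rule ep_F[symmetric])
  also have "\<dots> = u * (ep p * ep t)" unfolding u(3) by (simp only: mult_ac)
  finally have "ep p * b1 = 0" using orth[OF p(1) tP] t by simp
  then show ?thesis using stable_bl[OF p(1) b(1) u(2)] by blast
next
  case False
  then have Dp: "D p = {p}" and n2: "2 \<le> nn p" using p_D[OF p] D_nonfield[OF p] by blast+
  have Fp: "F = ep p" by (simp add: Dp E_def)
  have "of_nat p ^ nn p * ep p = 0" using nil p by blast
  then have MLv: "Mp p = Lv p (nn p)" unfolding Mp_RS[OF p] Dp RS_single[OF p(1)] by (auto simp: Lv_def)
  have loss: "2 * ls (bl c) (hh p * r) \<le> card (bl c)" if c: "c \<in> C" "F * c \<noteq> 0" for c r
  proof (rule loss_le_half[OF p(1) n2 order_refl])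
    show "aideal (Lv p (nn p))" using MI(2) MLv by simp
    show "bl c \<inter> Lv p (nn p) = {}" using bl_off[OF c] MLv by simp
    fix y assume y: "y \<in> C" "y \<notin> Lv p (nn p)"
    have Fy: "F * y \<noteq> 0" using in_Mp[OF y(1)] y(2) MLv by simp
    obtain u b1 where u: "u \<in> Us" "b1 \<in> bl c" "F * b1 = u * (F * y)"
      using bl_hits[OF c RS_D_split(2)[OF p y(1)] Fy] by blast
    have b1C: "b1 \<in> C" using bl_C[OF c(1) u(2)] .
    have eq: "y = uinv u * b1 + (y - uinv u * b1)" by simp
    have "F * (y - uinv u * b1) = F * y - uinv u * (F * b1)" by (simp only: right_diff_distrib mult_ac)
    also have "\<dots> = 0" unfolding u(3) using inv_cancel(2)[OF u(1), of "F * y"] y(1) by simp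
    finally have "y - uinv u * b1 \<in> Lv p (nn p)" using in_Mp[of "y - uinv u * b1"] y(1) b1C MLv by simp
    then show "\<exists>u\<in>Us. \<exists>x\<in>bl c. \<exists>m\<in>Lv p (nn p). y = u * x + m" using eq uinv(1)[OF u(1)] u(2) by blast
  qed (use c in auto)
  define B where "B = bl b"
  have fB: "finite B" and asB: "aset B" using finite_bl[OF b(1)] aset_bl[OF b(1)] by (auto simp: B_def)
  have DI: "aideal (RS (D p))" by (rule RS_D_aideal[OF p])
  note DD = is_idealD[OF aidealD(1)[OF DI]]
  have ac2: "card B \<le> 2 * ac B B g" if g: "g \<in> RS (D p)" for g
  proof (cases "g = 0")
    case False
    obtain u where u: "u \<in> Us" "u * hh p \<in> bl g" using bl_RS[OF g False] by blast
    have "ls B g = ls B (hh p * u)" using ls_const[OF asB DD(8)[OF g] u(2)] by (simp add: mult.commute)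
    then have "2 * ls B g \<le> card B" using loss[OF b, of u] by (simp add: B_def)
    then show ?thesis using ac_ls[OF fB, of g] by simp
  qed (simp add: ac_zero)
  define A1 where "A1 = {g\<in>RS (D p). b + g \<in> B}"
  have sum: "(\<Sum>g\<in>RS (D p). ac B B g) = card B * card A1"
  proof -
    have "(\<Sum>g\<in>RS (D p). ac B B g) = (\<Sum>x\<in>B. card {g\<in>RS (D p). x + g \<in> B})" by (rule ac_sum[OF fB DD(9)])
    also have "\<dots> = (\<Sum>x\<in>B. card A1)"
      unfolding A1_def using coset_const[OF asB DI b(1)] by (intro sum.cong) (auto simp: B_def)
    finally show ?thesis by simp
  qed
  have "card B * card (RS (D p)) < 2 * (card B * card A1)"
  proof -
    have "(\<Sum>g\<in>RS (D p). card B) < (\<Sum>g\<in>RS (D p). 2 * ac B B g)"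
    proof (rule sum_strict_mono_ex1)
      have "card B > 0" using fB bl_in[OF b(1)] by (auto simp: card_gt_0_iff B_def)
      then show "\<exists>a\<in>RS (D p). card B < 2 * ac B B a" using DD(2) by (intro bexI[of _ 0]) (auto simp: ac_zero)
    qed (use ac2 DD(9) in auto)
    then show ?thesis using sum by (simp add: sum_distrib_left[symmetric] mult.commute)
  qed
  then have gt: "card (RS (D p)) < 2 * card A1" by (metis mult.left_commute mult_less_cancel1)
  show ?thesis unfolding stable_def
  proof (intro ballI impI)
    fix u s assume u: "u \<in> Us" "\<forall>q\<in>P. q \<noteq> p \<longrightarrow> ep q * u = ep q" and s: "s \<in> bl b"
    \<comment> \<open>The offsets from \<open>b\<close> of the images under \<open>u\<close> of the
      points of \<open>bl b\<close> in the coset.\<close>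
    define A2 where "A2 = (\<lambda>g. u * (b + g) - b) ` A1"
    have fixm: "u * m = m" if "m \<in> Mp p" for m
      using unit_off[OF p(1) u(1) _ is_idealD(8)[OF MI(1) that] ep_Mp[OF that]] u(2) by blast
    have A2D: "A2 \<subseteq> RS (D p)"
    proof
      fix h assume "h \<in> A2"
      then obtain g where g: "g \<in> RS (D p)" "b + g \<in> B" "h = u * (b + g) - b" by (auto simp: A2_def A1_def)
      have hC: "h \<in> C" unfolding g(3) using b(1) RS_C[OF g(1)] by simp
      have "F' * h = u * (F' * (b + g)) - F' * b" unfolding g(3) right_diff_distrib mult.left_commute[of F' u] ..
      also have "F' * (b + g) = F' * b" using F'_RS[OF g(1)] by (simp add: distrib_left)
      also have "u * (F' * b) = F' * b" by (rule fixm[OF F'_Mp[OF b(1)]])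
      finally have "h = F * h" using split[OF hC] by simp
      then show "h \<in> RS (D p)" by (simp add: RS_def)
    qed
    have "card A2 = card A1" unfolding A2_def
    proof (rule card_image, rule inj_onI)
      fix g g' assume g: "g \<in> A1" "g' \<in> A1" "u * (b + g) - b = u * (b + g') - b"
      have gC: "b + g \<in> C" "b + g' \<in> C" using g b(1) RS_C by (auto simp: A1_def)
      have eq: "u * (b + g) = u * (b + g')" using g(3) by simp
      have "b + g = uinv u * (u * (b + g))" using inv_cancel(2)[OF u(1) gC(1)] by simp
      also have "\<dots> = b + g'" unfolding eq using inv_cancel(2)[OF u(1) gC(2)] by simp
      finally show "g = g'" by simp
    qed
    moreover have "A1 \<subseteq> RS (D p)" by (auto simp: A1_def)
    ultimately have "A1 \<inter> A2 \<noteq> {}"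
    proof -
      assume c: "card A2 = card A1" and s: "A1 \<subseteq> RS (D p)"
      have fin: "finite A1" "finite A2" using s A2D DD(9) finite_subset by blast+
      have "card (A1 \<union> A2) \<le> card (RS (D p))" using s A2D DD(9) by (intro card_mono) auto
      then have "card (A1 \<inter> A2) \<noteq> 0" using card_Un_Int[OF fin] c gt by linarith
      then show ?thesis by auto
    qed
    then obtain h where h: "h \<in> A1" "h \<in> A2" by blast
    then obtain g where g: "g \<in> A1" "h = u * (b + g) - b" unfolding A2_def by blast
    have "b + h \<in> B" using h(1) by (simp add: A1_def)
    then have "b + (u * (b + g) - b) \<in> B" using g(2) by simp
    with g(1) have "u * (b + g) \<in> bl b" "b + g \<in> bl b" by (auto simp: A1_def B_def)
    then show "u * s \<in> bl b" using stab_mem[OF u(1) b(1) _ _ s] by blast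
  qed
qed

lemma lift_hh: assumes "m \<in> Mp p" shows "lift p v * (m + u * hh p) = m + v * (u * hh p)"
proof -
  have mC: "m \<in> C" using is_idealD(8)[OF MI(1) assms] .
  have e1: "ep p * (m + u * hh p) = u * hh p"
  proof -
    have "ep p * (m + u * hh p) = ep p * m + u * (ep p * hh p)" by (simp only: distrib_left mult_ac)
    then show ?thesis using ep_Mp[OF assms] p by simp
  qed
  have "lift p v * (m + u * hh p) = ep p * v * (m + u * hh p) + ((m + u * hh p) - ep p * (m + u * hh p))"
    using lift_mult[OF p(1), of "m + u * hh p"] mC p by simp
  also have "ep p * v * (m + u * hh p) = v * (ep p * (m + u * hh p))" by (simp only: mult_ac)
  finally show ?thesis unfolding e1 by simp
qed

lemma stable_lift: assumes "stable p S" "s \<in> S" "un p v" shows "lift p v * s \<in> S"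
  using assms lift_Us[OF p(1)] lift_other[OF p(1)] unfolding stable_def by blast

text \<open>A point \<open>z1 + u * hh p\<close> of \<open>bl b\<close> makes \<open>z1\<close> a
  boundary point at \<open>p\<close>, since points of \<open>Mp p\<close> are not in
  \<open>bl b\<close>. Then all of \<open>bl z1\<close> is boundary, and stability gives
  \<open>z + v * hh p\<close> in \<open>bl b\<close> for every \<open>z\<close> in
  \<open>bl z1\<close> and every unit \<open>v\<close>. Each nonzero \<open>g\<close> in
  \<open>RS (D p)\<close> shares its basic set with some \<open>v * hh p\<close>, so constancy of
  translation counts replaces \<open>v * hh p\<close> by \<open>g\<close>.\<close>

lemma bl_product:
  assumes b: "b \<in> C" "F * b \<noteq> 0"
  shows "bl b = {x\<in>C. F * x \<noteq> 0 \<and> F' * x \<in> bl (F' * b)}"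
proof -
  have st: "stable p (bl b)" by (rule bl_stable[OF b])
  note TT = TT_zero[OF aset_bl[OF b(1)] p(1) st]
  define Y where "Y = {x\<in>C. ep p * x = 0 \<and> (x \<in> bl b) \<noteq> (x + hh p \<in> bl b)}"
  obtain u b1 where u: "u \<in> Us" "b1 \<in> bl b" "F * b1 = u * hh p"
    using bl_hits[OF b hh_RS hh_nz[OF p(1)]] by blast
  have b1C: "b1 \<in> C" using bl_C[OF b(1) u(2)] .
  define z1 where "z1 = F' * b1"
  have z1M: "z1 \<in> Mp p" unfolding z1_def by (rule F'_Mp[OF b1C])
  have z1C: "z1 \<in> C" using is_idealD(8)[OF MI(1) z1M] .
  have b1: "b1 = z1 + u * hh p" using split[OF b1C] u(3) by (simp add: z1_def add.commute)
  have off: "x \<notin> bl b" if "x \<in> Mp p" for x using bl_off[OF b] that by blast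
  have "z1 + hh p \<in> bl b"
  proof -
    have "lift p (uinv u) * b1 \<in> bl b" using stable_lift[OF st u(2)] un_unit uinv(1)[OF u(1)] p by blast
    then have "z1 + uinv u * (u * hh p) \<in> bl b" using lift_hh[OF z1M] b1 by simp
    then show ?thesis using inv_cancel(2)[OF u(1), of "hh p"] p by simp
  qed
  then have "z1 \<in> Y" using off[OF z1M] z1C ep_Mp[OF z1M] by (simp add: Y_def)
  then have z1Y: "bl z1 \<subseteq> Y" using asetD TT(1) by (simp add: Y_def)
  have z1bl: "bl z1 \<subseteq> Mp p" using asetD[OF MI(3) z1M] .
  \<comment> \<open>The sum of two unions of basic sets, which bounds \<open>bl b\<close> from
    above: the \<open>F'\<close>-parts of its points stay in \<open>bl z1\<close>.\<close>
  define S where "S = {x + m | x m. x \<in> RS (D p) \<and> m \<in> bl z1}"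
  have S: "aset S" unfolding S_def by (rule aset_sum[OF aidealD(2)[OF RS_D_aideal[OF p]] aset_bl[OF z1C]])
  have "b1 \<in> S"
  proof -
    have "b1 = F * b1 + z1" using split[OF b1C] by (simp add: z1_def)
    then show ?thesis unfolding S_def using RS_D_split(2)[OF p b1C] bl_in[OF z1C] by blast
  qed
  then have "bl b1 \<subseteq> S" by (rule asetD[OF S])
  then have blS: "bl b \<subseteq> S" using bl_same[OF b(1) u(2)] by simp
  have inS: "F' * x \<in> bl z1" if x: "x \<in> bl b" for x
  proof -
    obtain g m where g: "g \<in> RS (D p)" "m \<in> bl z1" "x = g + m" using blS x by (auto simp: S_def)
    have "F' * x = m" unfolding g(3) distrib_left using F'_RS[OF g(1)] F'_id z1bl g(2) by auto
    then show ?thesis using g(2) by simp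
  qed
  have eqz: "bl (F' * b) = bl z1" using inS[OF bl_in[OF b(1)]] bl_same[OF z1C] by blast
  have shift: "z + v * hh p \<in> bl b" if z: "z \<in> bl z1" and v: "v \<in> Us" for z v
  proof -
    have zM: "z \<in> Mp p" using z z1bl by blast
    have "z + hh p \<in> bl b" using z z1Y off[OF zM] by (auto simp: Y_def)
    then have "lift p v * (z + e * hh p) \<in> bl b" using stable_lift[OF st] un_unit[OF v p(1)] p by simp
    then show ?thesis using lift_hh[OF zM, of v e] p by simp
  qed
  have full: "z + g \<in> bl b" if z: "z \<in> bl z1" and g: "g \<in> RS (D p)" "g \<noteq> 0" for z g
  proof -
    obtain v where v: "v \<in> Us" "v * hh p \<in> bl g" using bl_RS[OF g] by blast
    have "ac (bl z1) (bl b) g = ac (bl z1) (bl b) (v * hh p)"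
      using ac_const[OF aset_bl[OF z1C] aset_bl[OF b(1)] RS_C[OF g(1)] v(2)] by simp
    also have "{z\<in>bl z1. z + v * hh p \<in> bl b} = bl z1" using shift v(1) by blast
    then have "ac (bl z1) (bl b) (v * hh p) = card (bl z1)" by (simp add: ac_def)
    finally have "card {z\<in>bl z1. z + g \<in> bl b} = card (bl z1)" by (simp add: ac_def)
    then have "{z\<in>bl z1. z + g \<in> bl b} = bl z1" using finite_bl[OF z1C] by (intro card_subset_eq) auto
    then show ?thesis using z by blast
  qed
  show ?thesis
  proof (intro equalityI subsetI)
    fix x assume x: "x \<in> bl b"
    have xC: "x \<in> C" using bl_C[OF b(1) x] .
    have "F * x \<noteq> 0" using in_Mp[OF xC] off x by blast
    then show "x \<in> {x\<in>C. F * x \<noteq> 0 \<and> F' * x \<in> bl (F' * b)}" using inS[OF x] xC eqz by simp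
  next
    fix x assume x: "x \<in> {x\<in>C. F * x \<noteq> 0 \<and> F' * x \<in> bl (F' * b)}"
    then have "F' * x + F * x \<in> bl b" using full[of "F' * x" "F * x"] RS_D_split(2)[OF p] eqz by simp
    then show "x \<in> bl b" using split[of x] x by (simp add: add.commute)
  qed
qed

end

end

section \<open>Powers of elements congruent to 1 modulo \<open>p\<close>\<close>

lemma one_add_power3:
  fixes w :: "'a::comm_ring_1"
  shows "\<exists>z. (1 + w) ^ n = 1 + of_nat n * w + of_nat (n choose 2) * w\<^sup>2 + w ^ 3 * z"
proof (induction n)
  case 0
  show ?case by (intro exI[of _ 0]) (simp add: numeral_2_eq_2)
next
  case (Suc n)
  then obtain z where z: "(1 + w) ^ n = 1 + of_nat n * w + of_nat (n choose 2) * w\<^sup>2 + w ^ 3 * z" by blast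
  have "Suc n choose 2 = n + (n choose 2)" by (simp add: numeral_2_eq_2)
  then have "(1 + w) ^ Suc n = 1 + of_nat (Suc n) * w + of_nat (Suc n choose 2) * w\<^sup>2 + w ^ 3 * (of_nat (n choose 2) + z + w * z)"
    by (simp add: z algebra_simps power2_eq_square power3_eq_cube)
  then show ?case by blast
qed

text \<open>For odd \<open>p\<close> the coefficient \<open>p choose 2\<close> is a multiple of
  \<open>p\<close>, so the quadratic term is divisible by \<open>p^(l+2)\<close>; the cubic
  remainder is too because \<open>3 l \<ge> l + 2\<close>. Thus a \<open>p\<close>-th power raises
  the level by exactly one and keeps the leading coefficient modulo \<open>p\<close>.\<close>

lemma one_unit_power_prime:
  fixes x :: "'a::comm_ring_1"
  assumes p: "odd p" and l: "1 \<le> l"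
  shows "\<exists>z. (1 + of_nat p ^ l * x) ^ p = 1 + of_nat p ^ Suc l * (x * (1 + of_nat p * z))"
proof -
  obtain z where z: "(1 + of_nat p ^ l * x) ^ p = 1 + of_nat p * (of_nat p ^ l * x)
      + of_nat (p choose 2) * (of_nat p ^ l * x)\<^sup>2 + (of_nat p ^ l * x) ^ 3 * z" using one_add_power3 by blast
  obtain l' where l': "l = Suc l'" using l by (cases l) auto
  obtain k where k: "p = 2 * k + 1" using p by (auto elim: oddE)
  have ch: "p choose 2 = p * k" unfolding choose_two by (simp add: k)
  have "(1 + of_nat p ^ l * x) ^ p = 1 + of_nat p ^ Suc l * (x * (1 + of_nat p *
     (of_nat k * of_nat p ^ l' * x + of_nat p ^ l' * of_nat p ^ l' * x * x * z)))"
    by (subst z) (simp add: ch l' power2_eq_square power3_eq_cube algebra_simps)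
  then show ?thesis by blast
qed

lemma one_unit_power_prime_power:
  fixes x :: "'a::comm_ring_1"
  assumes p: "odd p" and l: "1 \<le> l"
  shows "\<exists>z. (1 + of_nat p ^ l * x) ^ (p ^ m) = 1 + of_nat p ^ (l + m) * (x * (1 + of_nat p * z))"
proof (induction m)
  case 0 show ?case by (intro exI[of _ 0]) simp
next
  case (Suc m)
  then obtain z where z: "(1 + of_nat p ^ l * x) ^ (p ^ m) = 1 + of_nat p ^ (l + m) * (x * (1 + of_nat p * z))" by blast
  obtain z' where z': "(1 + of_nat p ^ (l + m) * (x * (1 + of_nat p * z))) ^ p =
     1 + of_nat p ^ Suc (l + m) * ((x * (1 + of_nat p * z)) * (1 + of_nat p * z'))"
    using one_unit_power_prime[OF p, of "l + m" "x * (1 + of_nat p * z)"] l by auto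
  have "(1 + of_nat p ^ l * x) ^ (p ^ Suc m) = ((1 + of_nat p ^ l * x) ^ (p ^ m)) ^ p"
    by (simp add: power_mult[symmetric] mult.commute)
  also have "\<dots> = 1 + of_nat p ^ (l + Suc m) * (x * (1 + of_nat p * (z + z' + of_nat p * z * z')))"
    unfolding z z' by (simp add: algebra_simps)
  finally show ?case by blast
qed

section \<open>Density\<close>

text \<open>The case in which \<open>X0\<close> consists of units. The general case is reduced to it
  by restricting the S-ring to the component on \<open>Q0\<close>.\<close>

locale sr_dense = sr_pure +
  assumes all_Q0: "Q0 = P"
begin

lemma X0_Lv: "p \<in> P \<Longrightarrow> X0 \<inter> Lv p 1 = {}" using all_Q0 by (auto simp: Q0_def)

lemma X0_Us: "X0 \<subseteq> Us"
proof
  fix x assume x: "x \<in> X0"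
  have "\<forall>p\<in>P. un p x" using X0_un[OF X0_Lv _ x] by blast
  moreover have "x \<in> C" using x X0_C by blast
  ultimately show "x \<in> Us" by (simp add: Us_iff)
qed

definition Ip :: "nat \<Rightarrow> nat \<Rightarrow> 'a set" where "Ip p i = range (\<lambda>r. of_nat p ^ i * ep p * r)"

lemma Ip_ideal: assumes p: "p \<in> P" shows "is_ideal (Ip p i)"
  unfolding is_ideal_def
proof (intro conjI ballI allI)
  show "Ip p i \<subseteq> C" using p by (auto simp: Ip_def)
  show "0 \<in> Ip p i" unfolding Ip_def by (metis mult_zero_right rangeI)
  show "x + y \<in> Ip p i" if "x \<in> Ip p i" "y \<in> Ip p i" for x y using that unfolding Ip_def by (auto simp: distrib_left[symmetric])
  show "r * x \<in> Ip p i" if "x \<in> Ip p i" for x r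
  proof -
    obtain w where "x = of_nat p ^ i * ep p * w" using \<open>x \<in> Ip p i\<close> by (auto simp: Ip_def)
    then have "r * x = of_nat p ^ i * ep p * (r * w)" by (simp only: mult_ac)
    then show ?thesis unfolding Ip_def by blast
  qed
qed

lemma IpI: "of_nat p ^ i * ep p * r \<in> Ip p i" by (auto simp: Ip_def)
lemma IpI1: "of_nat p ^ i * ep p \<in> Ip p i" using IpI[of p i 1] by simp
lemma Ip_anti: assumes "i \<le> j" shows "Ip p j \<subseteq> Ip p i"
proof
  fix x assume "x \<in> Ip p j"
  then obtain r where r: "x = of_nat p ^ j * ep p * r" by (auto simp: Ip_def)
  have "of_nat p ^ j = (of_nat p ^ i * of_nat p ^ (j - i) :: 'a)" using assms by (simp add: power_add[symmetric])
  then have "x = of_nat p ^ i * ep p * (of_nat p ^ (j - i) * r)" unfolding r by (simp only: mult_ac)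
  then show "x \<in> Ip p i" unfolding Ip_def by blast
qed

lemma pe_not_Ip: assumes p: "p \<in> P" "j < nn p" shows "of_nat p ^ j * ep p \<notin> Ip p (Suc j)"
proof
  assume "of_nat p ^ j * ep p \<in> Ip p (Suc j)"
  then obtain r where r: "of_nat p ^ j * ep p = of_nat p ^ Suc j * ep p * r" by (auto simp: Ip_def)
  have "of_nat p ^ (nn p - 1) * ep p = of_nat p ^ (nn p - 1 - j) * (of_nat p ^ j * ep p)"
  proof -
    have "nn p - 1 = (nn p - 1 - j) + j" using p by simp
    then have "of_nat p ^ (nn p - 1) = (of_nat p ^ (nn p - 1 - j) * of_nat p ^ j :: 'a)" by (metis power_add)
    then show ?thesis by (simp only: mult.assoc)
  qed
  also have "\<dots> = of_nat p ^ (nn p - 1 - j) * of_nat p ^ Suc j * ep p * r" unfolding r by (simp only: mult.assoc)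
  also have "\<dots> = of_nat p ^ (nn p - 1 - j + Suc j) * ep p * r" by (simp only: power_add)
  also have "nn p - 1 - j + Suc j = nn p" using p by simp
  finally show False using nil[OF p(1)] not_nil[OF p(1)] by simp
qed

section \<open>The basic set of the identity as a group of units\<close>

lemma X0_mult: "x \<in> X0 \<Longrightarrow> y \<in> X0 \<Longrightarrow> x * y \<in> X0" using X0_unit_iff X0_Us by blast
lemma X0_uinv: assumes "x \<in> X0" shows "uinv x \<in> X0"
  using X0_unit_iff[OF uinv(1) assms] uinv(3) X0_Us assms e_X0 by (metis subsetD)
lemma X0_power: "x \<in> X0 \<Longrightarrow> e * x ^ k \<in> X0"
  by (induction k) (auto simp: e_X0 mult.left_commute intro: X0_mult)
lemma X0_left: assumes x: "x \<in> X0" and y: "y \<in> C" shows "x * y \<in> X0 \<longleftrightarrow> y \<in> X0"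
proof
  assume "x * y \<in> X0"
  then have "uinv x * (x * y) \<in> X0" using X0_mult X0_uinv[OF x] by blast
  then show "y \<in> X0" using inv_cancel(2)[of x y] x y X0_Us by auto
qed (use X0_mult x in blast)

text \<open>\<open>X0\<close> is a group, so a failure of invariance at \<open>x\<close> moves to
  the identity after multiplication by \<open>uinv x\<close>.\<close>

lemma pure_e: assumes p: "p \<in> P" shows "\<exists>g\<in>It p. e + g \<notin> X0"
proof -
  obtain x r where x: "x \<in> X0" "x + hh p * r \<notin> X0" using pure[OF p] by blast
  have u: "x \<in> Us" "x \<in> C" using x X0_Us X0_C by auto
  define g where "g = hh p * (uinv x * r)"
  have g: "g \<in> It p" by (simp add: g_def It_def)
  have gC: "g \<in> C" using p by (simp add: g_def)
  have "x * (e + g) = x + hh p * r"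
  proof -
    have "x * g = (x * uinv x) * hh p * r" by (simp only: g_def mult_ac)
    then show ?thesis using uinv(2)[OF u(1)] u(2) p by (simp add: distrib_left)
  qed
  then have "e + g \<notin> X0" using X0_mult[OF x(1)] x(2) by metis
  then show ?thesis using g by blast
qed

lemma one_add_It_power: assumes t: "t \<in> P" "2 \<le> nn t" "g \<in> It t" shows "e * (e + g) ^ k = e + of_nat k * g"
proof (induction k)
  case (Suc k)
  have gC: "g \<in> C" using is_idealD(8)[OF It_ideal[OF t(1)] t(3)] .
  have gg: "g * g = 0" using It_sq[OF t(1,2,3,3)] .
  have "e * (e + g) ^ Suc k = (e + g) * (e * (e + g) ^ k)" by (simp only: power_Suc mult_ac)
  also have "\<dots> = (e + g) * (e + of_nat k * g)" by (simp only: Suc)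
  also have "\<dots> = e * e + of_nat k * (e * g) + g * e + of_nat k * (g * g)" by (simp add: algebra_simps)
  also have "\<dots> = e + of_nat (Suc k) * g" using gg gC by (simp add: algebra_simps)
  finally show ?case .
qed simp

text \<open>The power \<open>p^nn p\<close> makes the factor at \<open>p\<close> trivial and turns
  \<open>e + g\<close> into \<open>e + p^nn p * g\<close>. As \<open>p^nn p\<close> is invertible
  modulo \<open>t\<close> and \<open>t * g = 0\<close>, a further power restores
  \<open>e + g\<close>.\<close>

lemma remove_one_unit:
  assumes p: "p \<in> P" and t: "t \<in> P" "t \<noteq> p" "2 \<le> nn t" "g \<in> It t"
    and a: "(e + of_nat p * ep p * w) * (e + g) \<in> X0"
  shows "e + g \<in> X0"
proof -
  define N where "N = p ^ nn p"
  define a where "a = e + of_nat p * ep p * w"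
  have gC: "g \<in> C" using is_idealD(8)[OF It_ideal[OF t(1)] t(4)] .
  have "e * a ^ N = e"
  proof -
    obtain z where z: "(1 + of_nat p ^ 1 * (ep p * w)) ^ (p ^ nn p) = 1 + of_nat p ^ (1 + nn p) * (ep p * w * (1 + of_nat p * z))"
      using one_unit_power_prime_power[OF odd_P[OF p], of 1 "ep p * w" "nn p"] by auto
    have "of_nat p ^ (1 + nn p) * (ep p * w * (1 + of_nat p * z)) = of_nat p * (of_nat p ^ nn p * ep p) * (w * (1 + of_nat p * z))"
      by (simp add: mult.assoc)
    then have z1: "(1 + of_nat p ^ 1 * (ep p * w)) ^ N = 1" using z nil[OF p] by (simp add: N_def)
    have "a = e * (1 + of_nat p ^ 1 * (ep p * w))"
    proof -
      have "e * (of_nat p * (ep p * w)) = of_nat p * (ep p * w)" using p by simp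
      then show ?thesis by (simp add: a_def distrib_left mult.assoc)
    qed
    then have "a ^ N = e ^ N * 1" using z1 by (simp add: power_mult_distrib)
    moreover have "e * e ^ k = e" for k by (induction k) (simp_all add: mult.left_commute[of e])
    ultimately show ?thesis by simp
  qed
  moreover have "e * (a * (e + g)) ^ N \<in> X0" using X0_power a by (simp add: a_def)
  moreover have "e * (a * (e + g)) ^ N = (e * a ^ N) * (e * (e + g) ^ N)"
  proof -
    have "(e * a ^ N) * (e * (e + g) ^ N) = (e * e) * (a ^ N * (e + g) ^ N)" by (simp only: mult_ac)
    then show ?thesis by (simp add: power_mult_distrib)
  qed
  ultimately have 1: "e + of_nat N * g \<in> X0" using one_add_It_power[OF t(1,3,4), of N] gC by simp
  have "coprime N t"
  proof -
    have "coprime p t" using prime_P p t by (metis primes_coprime)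
    then show ?thesis by (simp add: N_def)
  qed
  moreover have "t \<noteq> 0" using prime_P t(1) by (metis not_prime_0)
  ultimately obtain m y where m: "N * m = t * y + 1"
    using bezout_nat[of N t] prime_P[OF p] by (auto simp: N_def coprime_iff_gcd_eq_1 dest: prime_gt_0_nat)
  have NgI: "of_nat N * g \<in> It t" using is_idealD(4)[OF It_ideal[OF t(1)] t(4)] .
  have "e + of_nat m * (of_nat N * g) \<in> X0" using X0_power[OF 1, of m] one_add_It_power[OF t(1,3) NgI, of m] by simp
  moreover have "of_nat m * (of_nat N * g) = of_nat (N * m) * g" by (simp add: mult_ac)
  moreover have "of_nat (N * m) * g = g" unfolding m using It_p[OF t(1,4)] by (simp add: distrib_right mult.commute[of "of_nat t"] mult.assoc)
  ultimately show ?thesis by simp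
qed

lemma card_swap:
  assumes "finite A" "finite B"
  shows "(\<Sum>y\<in>A. card {x\<in>B. R x y}) = (\<Sum>x\<in>B. card {y\<in>A. R x y})"
proof -
  have c: "card {x\<in>A. Q x} = (\<Sum>x\<in>A. of_bool (Q x))" if "finite A" for A and Q :: "'c \<Rightarrow> bool"
    unfolding card_eq_sum using that by (intro sum.mono_neutral_cong_left) auto
  have c': "card {x\<in>A. Q x} = (\<Sum>x\<in>A. of_bool (Q x))" if "finite A" for A and Q :: "'d \<Rightarrow> bool"
    unfolding card_eq_sum using that by (intro sum.mono_neutral_cong_left) auto
  show ?thesis unfolding c[OF assms(2)] c'[OF assms(1)] by (rule sum.swap)
qed

lemma Us_bij: assumes u: "u \<in> Us" shows "bij_betw ((*) u) Us Us"
proof (rule bij_betw_imageI)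
  show "inj_on ((*) u) Us"
  proof (rule inj_onI)
    fix x x' assume x: "x \<in> Us" "x' \<in> Us" "u * x = u * x'"
    have "x = uinv u * (u * x)" using inv_cancel(2)[OF u Us_C[OF x(1)]] by (rule sym)
    also have "\<dots> = x'" unfolding x(3) by (rule inv_cancel(2)[OF u Us_C[OF x(2)]])
    finally show "x = x'" .
  qed
  show "(*) u ` Us = Us"
  proof (intro equalityI subsetI)
    fix x assume x: "x \<in> Us"
    have "x = u * (uinv u * x)" using inv_cancel(1)[OF u Us_C[OF x]] by (rule sym)
    moreover have "uinv u * x \<in> Us" using uinv(1)[OF u] x by simp
    ultimately show "x \<in> (*) u ` Us" by blast
  qed (use u in auto)
qed

lemma finite_Us: "finite Us"
proof -
  have "Us \<subseteq> C" by (intro subsetI Us_C)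
  then show ?thesis by (rule finite_subset) simp
qed

lemma unit_coset: assumes "u \<in> Us" "x \<in> C" shows "x \<in> (*) u ` X0 \<longleftrightarrow> uinv u * x \<in> X0"
proof
  assume "x \<in> (*) u ` X0"
  then obtain y where "y \<in> X0" "x = u * y" by blast
  then show "uinv u * x \<in> X0" using inv_cancel(2)[OF assms(1), of y] X0_C by auto
next
  assume "uinv u * x \<in> X0"
  moreover have "x = u * (uinv u * x)" using inv_cancel(1)[OF assms] by simp
  ultimately show "x \<in> (*) u ` X0" by blast
qed

end

section \<open>The hull of an element at one prime does not reach another prime\<close>

context sr_dense begin

context
  fixes p t i :: nat
  assumes p: "p \<in> P" and t: "t \<in> P" "t \<noteq> p" and i: "i < nn p"
    and hA: "hh t \<in> ahull (of_nat p ^ i * ep p)"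
begin

abbreviation "zz \<equiv> of_nat p ^ i * ep p"
definition Yi :: "'a set" where "Yi = (\<lambda>v. v * zz) ` Us"
text \<open>The number of points of \<open>e + Yi\<close> in the coset of the group
  \<open>X0\<close> determined by \<open>u\<close>.\<close>

definition cn :: "'a \<Rightarrow> nat" where "cn u = card {y\<in>Yi. e + y \<in> (*) u ` X0}"

lemma zzC: "zz \<in> C" using p by simp
lemma et_zz: "ep t * zz = 0"
  unfolding mult.left_commute[of "ep t"] using orth[OF t(1) p t(2)] by simp
lemma n2: "2 \<le> nn t"
proof -
  have "zz \<in> Lv t 1" using et_zz zzC by (auto simp: Lv_def intro!: exI[of _ 0])
  then have "hh t \<in> Lv t 1" using ahull_min[OF Lv_aideal[OF t(1) X0_Lv[OF t(1)]]] hA by blast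
  then show ?thesis using nn_ge_2 t by blast
qed
lemma tI: "is_ideal (It t)" by (rule It_ideal[OF t(1)])
lemma It_C: "g \<in> It t \<Longrightarrow> g \<in> C" by (rule is_idealD(8)[OF tI])

lemma zz_translate: assumes "g \<in> It t" shows "zz + g \<in> bl zz"
proof -
  have nb: "\<not> bl zz \<subseteq> {x\<in>C. ep t * x = 0}"
  proof
    assume "bl zz \<subseteq> {x\<in>C. ep t * x = 0}"
    then have "zz \<in> core {x\<in>C. ep t * x = 0}" using zzC by (simp add: core_def)
    then have "hh t \<in> core {x\<in>C. ep t * x = 0}" using ahull_min[OF core_aideal[OF ideal_vanish[OF t(1)]]] hA by blast
    then have "ep t * hh t = 0" using core_sub by blast
    then show False using hh_nz t by simp
  qed
  obtain r where "g = hh t * r" using assms by (auto simp: It_def)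
  then show ?thesis using translate_bl[OF t(1) zzC et_zz nb] by simp
qed

lemma Yi_translate: assumes y: "y \<in> Yi" and g: "g \<in> It t" shows "y + g \<in> bl y"
proof -
  obtain v where v: "v \<in> Us" "y = v * zz" using y by (auto simp: Yi_def)
  have "zz + uinv v * g \<in> bl zz" using zz_translate is_idealD(4)[OF tI g] by blast
  then have "v * (zz + uinv v * g) \<in> bl y" using bl_unit[OF v(1) zzC] v(2) by blast
  then show ?thesis using inv_cancel(1)[OF v(1) It_C[OF g]] v(2) by (simp add: distrib_left)
qed
lemma Yi_C: "y \<in> Yi \<Longrightarrow> y \<in> C" using zzC by (auto simp: Yi_def)
lemma Yi_ep: assumes "y \<in> Yi" "q \<in> P" "q \<noteq> p" shows "ep q * y = 0"
proof -
  obtain v where "y = v * zz" using assms by (auto simp: Yi_def)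
  then have "ep q * y = v * of_nat p ^ i * (ep q * ep p)" by (simp only: mult_ac)
  then show ?thesis using orth assms p by simp
qed
lemma Yi_It: assumes "y \<in> Yi" "g \<in> It t" shows "y * g = 0"
proof -
  have "y * g = y * (ep t * g)" using It_ep[OF t(1) assms(2)] by simp
  also have "\<dots> = (ep t * y) * g" by (simp only: mult_ac)
  finally show ?thesis using Yi_ep[OF assms(1) t] by simp
qed
lemma Yi_Us: assumes "u \<in> Us" "y \<in> Yi" shows "u * y \<in> Yi"
proof -
  obtain v where v: "v \<in> Us" "y = v * zz" using assms(2) by (auto simp: Yi_def)
  then have "u * y = (u * v) * zz" by (simp only: mult.assoc)
  moreover have "u * v \<in> Us" using assms(1) v(1) by (rule Us_mult)
  ultimately show ?thesis unfolding Yi_def by (rule image_eqI)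
qed
lemma finite_Yi: "finite Yi" using finite_Us by (simp add: Yi_def)
lemma eg_Us: "g \<in> It t \<Longrightarrow> e + g \<in> Us" by (rule It_Us[OF t(1) n2])
lemma eg_mult: assumes "g \<in> It t" "g' \<in> It t" shows "(e + g) * (e + g') = e + (g + g')"
  using It_sq[OF t(1) n2 assms] It_C[OF assms(1)] It_C[OF assms(2)] by (simp add: algebra_simps)

text \<open>Since \<open>y + g\<close> lies in the basic set of \<open>y\<close>, the number of
  \<open>x\<close> in \<open>X0\<close> with \<open>x + y + g\<close> in the coset of
  \<open>u\<close> does not depend on \<open>g\<close>. The substitution \<open>y = x * y'\<close>
  and the identity \<open>(e - g') * (e + y' + g') = e + y'\<close> with
  \<open>g' = uinv x * g\<close> rewrite the sum of these numbers over \<open>y\<close> as a sum of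
  values of \<open>cn\<close>.\<close>

lemma cn_sum: assumes u: "u \<in> Us" and g: "g \<in> It t"
  shows "(\<Sum>x\<in>X0. cn (u * (e + - (uinv x * g)))) = card X0 * cn u"
proof -
  have S: "(\<Sum>y\<in>Yi. card {x\<in>X0. x + (y + g) \<in> (*) u ` X0}) = (\<Sum>x\<in>X0. cn (u * (e + - (uinv x * g))))" if g: "g \<in> It t" for g
  proof -
    have "(\<Sum>y\<in>Yi. card {x\<in>X0. x + (y + g) \<in> (*) u ` X0}) = (\<Sum>x\<in>X0. card {y\<in>Yi. x + (y + g) \<in> (*) u ` X0})"
      by (rule card_swap[OF finite_Yi aset_finite[OF aset_X0]])
    also have "\<dots> = (\<Sum>x\<in>X0. cn (u * (e + - (uinv x * g))))"
    proof (rule sum.cong[OF refl])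
      fix x assume x: "x \<in> X0"
      have xU: "x \<in> Us" using x X0_Us by blast
      note ix = uinv[OF xU]
      define g' where "g' = uinv x * g"
      have g': "g' \<in> It t" using is_idealD(4)[OF tI g] by (simp add: g'_def)
      have mg': "- g' \<in> It t" by (rule is_idealD(6)[OF tI g'])
      have key: "x + (x * y + g) \<in> (*) u ` X0 \<longleftrightarrow> e + y \<in> (*) (u * (e + - g')) ` X0" if y: "y \<in> Yi" for y
      proof -
        have yC: "y \<in> C" by (rule Yi_C[OF y])
        have g_eq: "g = x * g'" using inv_cancel(1)[OF xU It_C[OF g]] by (simp add: g'_def)
        have xC: "x \<in> C" using xU by simp
        have "x + (x * y + g) = x * (e + y + g')" using xC by (simp add: g_eq distrib_left)
        moreover have C1: "e + y + g' \<in> C" using yC It_C[OF g'] by simp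
        ultimately have "x + (x * y + g) \<in> (*) u ` X0 \<longleftrightarrow> uinv u * (x * (e + y + g')) \<in> X0"
          using unit_coset[OF u, of "x * (e + y + g')"] xC by simp
        also have "uinv u * (x * (e + y + g')) = x * (uinv u * (e + y + g'))" by (simp only: mult_ac)
        also have "\<dots> \<in> X0 \<longleftrightarrow> uinv u * (e + y + g') \<in> X0" by (rule X0_left[OF x]) (use C1 in simp)
        also have "\<dots> \<longleftrightarrow> e + y + g' \<in> (*) u ` X0" using unit_coset[OF u C1] by simp
        also have "\<dots> \<longleftrightarrow> e + y \<in> (*) (u * (e + - g')) ` X0"
        proof -
          have f: "(e + - g') * (e + y + g') = e + y"
          proof -
            have "(e + - g') * (e + y + g') = e * (e + y) + (e * g' - g' * e) - y * g' - g' * g'" by (simp add: algebra_simps)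
            then show ?thesis using Yi_It[OF y g'] It_sq[OF t(1) n2 g' g'] yC by (simp add: mult.commute)
          qed
          have UU: "e + - g' \<in> Us" by (rule eg_Us[OF mg'])
          have "(*) (u * (e + - g')) ` X0 = (*) (e + - g') ` ((*) u ` X0)" by (simp add: image_image mult_ac)
          moreover have sub: "(*) u ` X0 \<subseteq> C" using X0_C by (auto intro!: multr_C)
          ultimately show ?thesis using unit_img_iff[OF UU sub C1] unfolding f by simp
        qed
        finally show ?thesis .
      qed
      have "{y\<in>Yi. x + (y + g) \<in> (*) u ` X0} = (*) x ` {y\<in>Yi. e + y \<in> (*) (u * (e + - g')) ` X0}"
      proof (intro equalityI subsetI)
        fix y assume y: "y \<in> {y\<in>Yi. x + (y + g) \<in> (*) u ` X0}"
        have y': "y = x * (uinv x * y)" using inv_cancel(1)[OF xU] Yi_C y by auto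
        have "uinv x * y \<in> Yi" using Yi_Us[OF ix(1)] y by blast
        moreover have "e + uinv x * y \<in> (*) (u * (e + - g')) ` X0" using key[OF calculation] y y' by simp
        ultimately show "y \<in> (*) x ` {y\<in>Yi. e + y \<in> (*) (u * (e + - g')) ` X0}" using y' by blast
      next
        fix y assume "y \<in> (*) x ` {y\<in>Yi. e + y \<in> (*) (u * (e + - g')) ` X0}"
        then obtain w where w: "w \<in> Yi" "e + w \<in> (*) (u * (e + - g')) ` X0" "y = x * w" by blast
        then show "y \<in> {y\<in>Yi. x + (y + g) \<in> (*) u ` X0}" using key[OF w(1)] Yi_Us[OF xU w(1)] by simp
      qed
      then show "card {y\<in>Yi. x + (y + g) \<in> (*) u ` X0} = cn (u * (e + - (uinv x * g)))"
        using unit_img_card[OF xU, of "{y\<in>Yi. e + y \<in> (*) (u * (e + - g')) ` X0}"] Yi_C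
        unfolding cn_def g'_def by auto
    qed
    finally show ?thesis .
  qed
  have "(\<Sum>x\<in>X0. cn (u * (e + - (uinv x * g)))) = (\<Sum>y\<in>Yi. card {x\<in>X0. x + (y + g) \<in> (*) u ` X0})" using S[OF g] by simp
  also have "\<dots> = (\<Sum>y\<in>Yi. card {x\<in>X0. x + (y + 0) \<in> (*) u ` X0})"
  proof (rule sum.cong[OF refl])
    fix y assume y: "y \<in> Yi"
    show "card {x\<in>X0. x + (y + g) \<in> (*) u ` X0} = card {x\<in>X0. x + (y + 0) \<in> (*) u ` X0}"
      using ac_const[OF aset_X0 aset_img[OF u aset_X0] Yi_C[OF y] Yi_translate[OF y g]] by (simp add: ac_def)
  qed
  also have "\<dots> = (\<Sum>x\<in>X0. cn (u * (e + - (uinv x * 0))))" by (rule S) (rule is_idealD(2)[OF tI])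
  also have "\<dots> = card X0 * cn u" using u by simp
  finally show ?thesis .
qed

text \<open>By \<open>cn_sum\<close> the value of \<open>cn\<close> is an average of its values on the coset, so a maximum forces constancy.\<close>

lemma cn_const: assumes u: "u \<in> Us" and g: "g \<in> It t" shows "cn (u * (e + g)) = cn u"
proof -
  define f where "f g = cn (u * (e + g))" for g
  have fin: "finite (It t)" "It t \<noteq> {}" using is_idealD(2,9)[OF tI] by auto
  obtain gm where gm: "gm \<in> It t" "\<And>g. g \<in> It t \<Longrightarrow> f g \<le> f gm"
  proof -
    have "Max (f ` It t) \<in> f ` It t" using fin by (intro Max_in) auto
    then obtain gm where "gm \<in> It t" "f gm = Max (f ` It t)" by (metis imageE)
    then have "gm \<in> It t" "\<And>g. g \<in> It t \<Longrightarrow> f g \<le> f gm" using fin by auto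
    then show ?thesis using that by blast
  qed
  define um where "um = u * (e + gm)"
  have um: "um \<in> Us" using u eg_Us[OF gm(1)] by (simp add: um_def)
  have shift: "cn (um * (e + - k)) = f (gm + - k)" if "k \<in> It t" for k
  proof -
    have "um * (e + - k) = u * ((e + gm) * (e + - k))" by (simp only: um_def mult.assoc)
    then show ?thesis using eg_mult[OF gm(1) is_idealD(6)[OF tI that]] by (simp add: f_def)
  qed
  have fum: "cn um = f gm" by (simp add: f_def um_def)
  have const: "f (gm + - k) = f gm" if k: "k \<in> It t" for k
  proof (rule ccontr)
    assume n: "f (gm + - k) \<noteq> f gm"
    have xk: "uinv x * k \<in> It t" for x using is_idealD(4)[OF tI k] .
    have le: "cn (um * (e + - (uinv x * k))) \<le> cn um" for x
      unfolding shift[OF xk] fum by (rule gm(2)) (rule is_idealD(3)[OF tI gm(1) is_idealD(6)[OF tI xk]])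
    have "uinv e * k = k"
    proof -
      have "e * (uinv e * k) = k" using inv_cancel(1)[OF e_Un It_C[OF k]] .
      then show ?thesis using It_C[OF k] by simp
    qed
    then have "cn (um * (e + - (uinv e * k))) < cn um"
      using le[of e] n shift[OF k] fum by simp
    then have "(\<Sum>x\<in>X0. cn (um * (e + - (uinv x * k)))) < (\<Sum>x\<in>X0. cn um)"
      using e_X0 le aset_finite[OF aset_X0] by (intro sum_strict_mono_ex1) auto
    then show False using cn_sum[OF um k] by simp
  qed
  have all: "f k = f gm" if "k \<in> It t" for k
    using const[of "gm - k"] is_idealD(7)[OF tI gm(1) that] by simp
  have "f g = f 0" using all[OF g] all[OF is_idealD(2)[OF tI]] by simp
  then show ?thesis using u by (simp add: f_def)
qed

text \<open>Choose \<open>g0\<close> in \<open>It t\<close> with \<open>e + g0\<close> outside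
  \<open>X0\<close>. By \<open>cn_const\<close> the points \<open>e + Yi\<close> meet the cosets of
  \<open>u\<close> and of \<open>u * (e + g0)\<close> equally often. From this a unit
  \<open>a\<close>, trivial off \<open>p\<close> and congruent to 1 modulo \<open>p\<close>, is
  found with \<open>a * (e + g0)\<close> in \<open>X0\<close>, and \<open>remove_one_unit\<close>
  gives the contradiction.\<close>

lemma hull_contra: False
proof -
  \<comment> \<open>This coset is known to contain a point of \<open>e + Yi\<close>, namely
    \<open>e + zz\<close>.\<close>
  define u0 where "u0 = e + zz"
  have u0: "u0 \<in> Us"
  proof (cases "i = 0")
    case True
    have "lift p 2 = u0" by (simp add: lift_def u0_def True mult_2_right)
    then show ?thesis using lift_Us[OF p un_two[OF p]] by simp
  next
    case False
    then show ?thesis using Us_add_nil[OF p, of i 1] by (simp add: u0_def)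
  qed
  have epq_u0: "ep q * u0 = ep q" if "q \<in> P" "q \<noteq> p" for q
  proof -
    have "ep q * zz = of_nat p ^ i * (ep q * ep p)" by (simp only: mult_ac)
    then show ?thesis using that p orth by (simp add: u0_def distrib_left)
  qed
  have zY: "zz \<in> Yi"
  proof -
    have "zz = e * zz" using zzC by simp
    then show ?thesis unfolding Yi_def using e_Un by blast
  qed
  obtain g0 where g0: "g0 \<in> It t" "e + g0 \<notin> X0" using pure_e[OF t(1)] by blast
  have "e + zz \<in> (*) u0 ` X0" using unit_coset[OF u0, of "e + zz"] uinv(3)[OF u0] e_X0 zzC by (simp add: u0_def)
  then have "cn u0 \<noteq> 0" unfolding cn_def using zY finite_Yi by (auto simp: card_eq_0_iff)
  then have "cn (u0 * (e + g0)) \<noteq> 0" using cn_const[OF u0 g0(1)] by simp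
  then obtain y where y: "y \<in> Yi" "e + y \<in> (*) (u0 * (e + g0)) ` X0"
    unfolding cn_def using finite_Yi by (auto simp: card_eq_0_iff)
  then obtain k where k: "k \<in> X0" "e + y = u0 * (e + g0) * k" by blast
  have kU: "k \<in> Us" using k X0_Us by blast
  have eyU: "e + y \<in> Us" unfolding k(2) using u0 eg_Us[OF g0(1)] kU by simp
  \<comment> \<open>Both \<open>u0\<close> and the point \<open>e + y\<close> found in the shifted
    coset are trivial off \<open>p\<close>, hence so is their quotient \<open>lam\<close>; by
    construction \<open>lam * (e + g0)\<close> is the inverse of an element of
    \<open>X0\<close>.\<close>
  define lam where "lam = uinv (e + y) * u0"
  have lamU: "lam \<in> Us" using uinv(1)[OF eyU] u0 by (simp add: lam_def)
  have lamX: "lam * (e + g0) \<in> X0"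
  proof -
    have "lam * (e + g0) * k = e"
    proof -
      have "lam * (e + g0) * k = uinv (e + y) * (u0 * (e + g0) * k)" by (simp only: lam_def mult_ac)
      then show ?thesis using uinv(3)[OF eyU] unfolding k(2)[symmetric] by simp
    qed
    then have "uinv k = lam * (e + g0) * (k * uinv k)"
      by (metis e_mult mult.assoc uinv(1)[OF kU] Us_C)
    then have "uinv k = lam * (e + g0)" using uinv(2)[OF kU] lamU eg_Us[OF g0(1)] by simp
    then show ?thesis using X0_uinv[OF k(1)] by simp
  qed
  obtain a w where aw: "a \<in> Us" "a = e + of_nat p * ep p * w" "a * (e + g0) \<in> X0"
  proof (cases "i = 0")
    case False
    obtain v where v: "y = v * zz" using y(1) by (auto simp: Yi_def)
    have "lam = e + of_nat p * ep p * (of_nat p ^ (i - 1) * (uinv (e + y) * (1 - v)))"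
    proof -
      have "lam - e = uinv (e + y) * (u0 - (e + y))" using uinv(3)[OF eyU] by (simp add: lam_def right_diff_distrib)
      also have "\<dots> = uinv (e + y) * ((1 - v) * zz)" by (simp add: u0_def v algebra_simps)
      also have "\<dots> = of_nat p * ep p * (of_nat p ^ (i - 1) * (uinv (e + y) * (1 - v)))"
        using False by (cases i) (simp_all add: mult_ac)
      finally show ?thesis by (simp add: algebra_simps)
    qed
    then show ?thesis using that lamU lamX by blast
  next
    case True
    have zz0: "zz = ep p" using True by simp
    \<comment> \<open>For \<open>i = 0\<close> the unit \<open>lam\<close> need not be 1 modulo
      \<open>p\<close>. \<open>A1\<close> and \<open>A2\<close> are the parts in \<open>Gp\<close>
      of \<open>X0\<close> and of its coset through \<open>uinv lam\<close>; they have equal size.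
      Here \<open>cn\<close> counts the elements whose difference from \<open>e\<close> is a unit at
      \<open>p\<close>; in \<open>A1\<close> it misses \<open>e\<close>, so in \<open>A2\<close> it
      misses some \<open>a\<close> too, and that \<open>a\<close> is 1 modulo
      \<open>p\<close>.\<close>
    define Gp where "Gp = {a\<in>Us. \<forall>q\<in>P. q \<noteq> p \<longrightarrow> ep q * a = ep q}"
    define A1 where "A1 = {a\<in>Gp. a \<in> X0}"
    define A2 where "A2 = {a\<in>Gp. lam * a \<in> X0}"
    have finG: "finite Gp" using finite_Us by (simp add: Gp_def)
    have ey_q: "ep q * (e + y) = ep q" if "q \<in> P" "q \<noteq> p" for q
      using Yi_ep[OF y(1) that] that by (simp add: distrib_left)
    have Gp_mult: "a * b \<in> Gp" if "a \<in> Gp" "b \<in> Gp" for a b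
    proof -
      have "ep q * (a * b) = ep q" if "q \<in> P" "q \<noteq> p" for q
        using \<open>a \<in> Gp\<close> \<open>b \<in> Gp\<close> that by (auto simp: Gp_def mult.assoc[symmetric])
      then show ?thesis using that by (auto simp: Gp_def)
    qed
    have Gp_inv: "uinv a \<in> Gp" if "a \<in> Gp" for a
    proof -
      have aU: "a \<in> Us" using that by (simp add: Gp_def)
      have "ep q * uinv a = ep q" if q: "q \<in> P" "q \<noteq> p" for q
      proof -
        have "ep q * uinv a = (ep q * a) * uinv a" using \<open>a \<in> Gp\<close> q by (simp add: Gp_def)
        also have "\<dots> = ep q * (a * uinv a)" by (rule mult.assoc)
        also have "\<dots> = ep q" unfolding uinv(2)[OF aU] using q by simp
        finally show ?thesis .
      qed
      then show ?thesis using uinv(1)[OF aU] by (simp add: Gp_def)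
    qed
    have "e + y \<in> Gp" "u0 \<in> Gp" using eyU u0 ey_q epq_u0 by (auto simp: Gp_def)
    then have lamG: "lam \<in> Gp" unfolding lam_def using Gp_mult Gp_inv by blast
    have cA: "card A2 = card A1"
    proof -
      have "A1 = (*) lam ` A2"
      proof (intro equalityI subsetI)
        fix a assume a: "a \<in> A1"
        then have aG: "a \<in> Gp" "a \<in> C" by (auto simp: A1_def Gp_def)
        have "a = lam * (uinv lam * a)" using inv_cancel(1)[OF lamU aG(2)] by simp
        moreover from this have "uinv lam * a \<in> A2" using a Gp_mult[OF Gp_inv[OF lamG] aG(1)] by (simp add: A1_def A2_def)
        ultimately show "a \<in> (*) lam ` A2" by blast
      next
        fix a assume "a \<in> (*) lam ` A2"
        then show "a \<in> A1" using Gp_mult lamG by (auto simp: A1_def A2_def)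
      qed
      moreover have "A2 \<subseteq> C" by (auto simp: A2_def Gp_def)
      ultimately show ?thesis using unit_img_card[OF lamU] by simp
    qed
    have lamg: "(*) (e * (e + g0)) ` X0 = (*) (uinv lam) ` X0"
    proof -
      have sub: "x \<in> (*) (e + g0) ` X0 \<longleftrightarrow> x \<in> (*) (uinv lam) ` X0" if xC: "x \<in> C" for x
      proof -
        have il: "uinv lam \<in> Us" by (rule uinv(1)[OF lamU])
        have lam_ii: "uinv (uinv lam) = lam"
        proof -
          have "uinv (uinv lam) = (lam * uinv lam) * uinv (uinv lam)" using uinv(2)[OF lamU] uinv(1)[OF il] by simp
          also have "\<dots> = lam * (uinv lam * uinv (uinv lam))" by (rule mult.assoc)
          finally show ?thesis using uinv(2)[OF il] lamU by simp
        qed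
        have egU: "e + g0 \<in> Us" by (rule eg_Us[OF g0(1)])
        have "x \<in> (*) (uinv lam) ` X0 \<longleftrightarrow> lam * x \<in> X0" using unit_coset[OF il xC] lam_ii by simp
        also have "lam * x = (lam * (e + g0)) * (uinv (e + g0) * x)"
        proof -
          have "(lam * (e + g0)) * (uinv (e + g0) * x) = lam * ((e + g0) * (uinv (e + g0) * x))" by (simp only: mult_ac)
          then show ?thesis using inv_cancel(1)[OF egU xC] by simp
        qed
        also have "\<dots> \<in> X0 \<longleftrightarrow> uinv (e + g0) * x \<in> X0" by (rule X0_left[OF lamX]) (use xC in simp)
        also have "\<dots> \<longleftrightarrow> x \<in> (*) (e + g0) ` X0" using unit_coset[OF egU xC] by simp
        finally show ?thesis by simp
      qed
      have "(*) (e * (e + g0)) ` X0 = (*) (e + g0) ` X0" using It_C[OF g0(1)] by simp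
      also have "\<dots> = (*) (uinv lam) ` X0"
      proof -
        have "(*) v ` X0 \<subseteq> C" for v using X0_C by (auto intro!: multr_C)
        then show ?thesis using sub by blast
      qed
      finally show ?thesis .
    qed
    have Yi_iff: "a - e \<in> Yi \<longleftrightarrow> un p (a - e)" if "a \<in> Gp" for a
    proof
      assume "a - e \<in> Yi"
      then obtain v where v: "v \<in> Us" "a - e = v * ep p" unfolding Yi_def zz0 by blast
      have "ep p * (a - e) = ep p * v" unfolding v(2) using p by (simp add: mult.left_commute mult.commute[of v])
      then show "un p (a - e)" using un_ep_cong un_unit[OF v(1) p] by metis
    next
      assume u: "un p (a - e)"
      have aC: "a \<in> C" using that by (simp add: Gp_def)
      have "a - e = lift p (a - e) * ep p"
      proof (rule C_eqI)
        fix q assume q: "q \<in> P"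
        show "ep q * (a - e) = ep q * (lift p (a - e) * ep p)"
        proof (cases "q = p")
          case True
          have "ep p * (lift p (a - e) * ep p) = (ep p * lift p (a - e)) * ep p" by (simp only: mult_ac)
          also have "\<dots> = (ep p * ep p) * (a - e)" unfolding lift_ep[OF p] by (simp only: mult_ac)
          finally show ?thesis using True idem[OF p] by simp
        next
          case False
          have "ep q * (lift p (a - e) * ep p) = lift p (a - e) * (ep q * ep p)" by (simp only: mult_ac)
          then show ?thesis using orth[OF q p False] that q False by (simp add: Gp_def right_diff_distrib)
        qed
      qed (use aC p in auto)
      then show "a - e \<in> Yi" unfolding Yi_def zz0 using lift_Us[OF p u] by blast
    qed
    have Y_Gp: "e + v \<in> Gp" if "v \<in> Yi" "e + v \<in> Us" for v
      using that Yi_ep[OF that(1)] by (auto simp: Gp_def distrib_left)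
    have card1: "card {y\<in>Yi. R (e + y)} = card {a\<in>Gp. R a \<and> un p (a - e)}" if R: "\<And>y. y \<in> Yi \<Longrightarrow> R (e + y) \<Longrightarrow> e + y \<in> Us" for R
    proof (rule bij_betw_same_card)
      have un: "un p y" if "y \<in> Yi" "R (e + y)" for y
        using Yi_iff[OF Y_Gp[OF that(1) R[OF that]]] that(1) by simp
      show "bij_betw (\<lambda>y. e + y) {y\<in>Yi. R (e + y)} {a\<in>Gp. R a \<and> un p (a - e)}"
        by (rule bij_betw_byWitness[of _ "\<lambda>a. a - e"]) (use Y_Gp R Yi_iff un in auto)
    qed
    have "cn (e * (e + g0)) = cn e" by (rule cn_const[OF e_Un g0(1)])
    moreover have "cn e = card {a\<in>A1. un p (a - e)}"
    proof -
      have "(*) e ` X0 = (\<lambda>x. x) ` X0" using X0_C by (intro image_cong) auto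
      then have "(*) e ` X0 = X0" by simp
      then have "cn e = card {y\<in>Yi. e + y \<in> X0}" by (simp add: cn_def)
      also have "\<dots> = card {a\<in>Gp. a \<in> X0 \<and> un p (a - e)}" by (rule card1[of "\<lambda>a. a \<in> X0"]) (use X0_Us in blast)
      also have "{a\<in>Gp. a \<in> X0 \<and> un p (a - e)} = {a\<in>A1. un p (a - e)}" by (auto simp: A1_def)
      finally show ?thesis .
    qed
    moreover have "cn (e * (e + g0)) = card {a\<in>A2. un p (a - e)}"
    proof -
      have il: "uinv lam \<in> Us" by (rule uinv(1)[OF lamU])
      have iff: "x \<in> (*) (uinv lam) ` X0 \<longleftrightarrow> lam * x \<in> X0" if "x \<in> C" for x
      proof
        assume "x \<in> (*) (uinv lam) ` X0"
        then obtain w where "w \<in> X0" "x = uinv lam * w" by blast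
        then show "lam * x \<in> X0" using inv_cancel(1)[OF lamU, of w] X0_C by auto
      next
        assume "lam * x \<in> X0"
        moreover have "x = uinv lam * (lam * x)" using inv_cancel(2)[OF lamU that] by simp
        ultimately show "x \<in> (*) (uinv lam) ` X0" by blast
      qed
      have "cn (e * (e + g0)) = card {y\<in>Yi. e + y \<in> (*) (uinv lam) ` X0}" unfolding cn_def lamg ..
      also have "\<dots> = card {a\<in>Gp. a \<in> (*) (uinv lam) ` X0 \<and> un p (a - e)}"
        by (rule card1[of "\<lambda>a. a \<in> (*) (uinv lam) ` X0"]) (use X0_Us il in auto)
      also have "{a\<in>Gp. a \<in> (*) (uinv lam) ` X0 \<and> un p (a - e)} = {a\<in>A2. un p (a - e)}"
      proof -
        have "a \<in> C" if "a \<in> Gp" for a using that by (simp add: Gp_def)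
        then show ?thesis using iff unfolding A2_def by blast
      qed
      finally show ?thesis .
    qed
    moreover have "card {a\<in>A1. un p (a - e)} < card A1"
    proof (rule psubset_card_mono)
      have "e \<in> A1" using e_X0 by (auto simp: A1_def Gp_def)
      moreover have "\<not> un p (e - e)" using ep_nz[OF p] by (auto simp: un_def)
      ultimately show "{a\<in>A1. un p (a - e)} \<subset> A1" by blast
    qed (use finG in \<open>auto simp: A1_def\<close>)
    ultimately have "card {a\<in>A2. un p (a - e)} < card A2" using cA by simp
    then have "{a\<in>A2. un p (a - e)} \<noteq> A2" by auto
    then obtain a where a: "a \<in> A2" "\<not> un p (a - e)" by blast
    have aU: "a \<in> Us" "a \<in> Gp" using a by (auto simp: A2_def Gp_def)
    obtain w where w: "ep p * (a - e) = of_nat p * ep p * w" using a(2) not_un_iff[OF p] by blast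
    have ae: "a - e = of_nat p * ep p * w"
    proof -
      have "ep p * (a - e) = a - e"
      proof (rule C_eqI)
        fix q assume q: "q \<in> P"
        show "ep q * (ep p * (a - e)) = ep q * (a - e)"
          using q aU(2) orth_left[OF q p] p idem orth by (cases "q = p") (auto simp: Gp_def right_diff_distrib)
      qed (use aU p in auto)
      then show ?thesis using w by simp
    qed
    have "uinv (lam * a) \<in> X0" using X0_uinv a by (simp add: A2_def)
    then have "lam * (e + g0) * uinv (lam * a) \<in> X0" using X0_mult lamX by blast
    moreover have "lam * (e + g0) * uinv (lam * a) = uinv a * (e + g0)"
    proof -
      have laU: "lam * a \<in> Us" using lamU aU by simp
      have "lam * (e + g0) * uinv (lam * a) = (uinv a * a) * (lam * (e + g0) * uinv (lam * a))"
        using uinv(3)[OF aU(1)] lamU eg_Us[OF g0(1)] uinv(1)[OF laU] by simp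
      also have "\<dots> = uinv a * (e + g0) * ((lam * a) * uinv (lam * a))" by (simp only: mult_ac)
      also have "\<dots> = uinv a * (e + g0)" unfolding uinv(2)[OF laU] using uinv(1)[OF aU(1)] eg_Us[OF g0(1)] by simp
      finally show ?thesis .
    qed
    moreover have "uinv a = e + of_nat p * ep p * (- (uinv a * w))"
    proof -
      have "uinv a * (a - e) = e - uinv a" using uinv[OF aU(1)] by (simp add: right_diff_distrib)
      then have "uinv a = e - uinv a * (of_nat p * ep p * w)" unfolding ae by simp
      moreover have "uinv a * (of_nat p * ep p * w) = of_nat p * ep p * (uinv a * w)" by (simp only: mult_ac)
      ultimately show ?thesis by simp
    qed
    ultimately show ?thesis using that[OF uinv(1)[OF aU(1)]] by metis
  qed
  have "e + g0 \<in> X0" by (rule remove_one_unit[OF p t n2 g0(1)]) (use aw in simp)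
  then show False using g0(2) by simp
qed

end

section \<open>The powers of \<open>p\<close> inside one component\<close>

lemma hull_level_sub: assumes p: "p \<in> P" and i: "i < nn p" shows "ahull (of_nat p ^ i * ep p) \<subseteq> Ip p 0"
proof
  have zC: "of_nat p ^ i * ep p \<in> C" using p by simp
  note I = aidealD(1)[OF ahull_aideal[OF zC]]
  fix x assume x: "x \<in> ahull (of_nat p ^ i * ep p)"
  have "ep p * x = x"
  proof (rule C_eqI)
    fix t assume t: "t \<in> P"
    show "ep t * (ep p * x) = ep t * x"
    proof (cases "t = p")
      case False
      have "ep t * x = 0"
      proof (rule ccontr)
        assume "ep t * x \<noteq> 0"
        then have "hh t \<in> ahull (of_nat p ^ i * ep p)" using ideal_has_hh[OF I t x] by simp
        then show False by (rule hull_contra[OF p t False i])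
      qed
      then show ?thesis using orth_left[OF t p False] by simp
    qed (use p in simp)
  qed (use is_idealD(8)[OF I x] p in auto)
  then show "x \<in> Ip p 0" using IpI[of p 0 x] by simp
qed

text \<open>If the hull \<open>A\<close> were larger, it would contain \<open>z l\<close> with
  \<open>l = i - 1\<close>, and \<open>z i\<close> would share a basic set with some
  \<open>c * z l\<close>. Translation counts for the group \<open>K = X0 + La\<close> then agree at
  the levels \<open>l\<close> and \<open>i\<close>, while \<open>p\<close>-th powers in
  \<open>K\<close> lead from level \<open>l\<close> to level \<open>i\<close>. Hence the same unit
  coefficients occur at both levels. If there are any, \<open>K\<close> contains all
  \<open>e + r * z i\<close>, which contradicts purity; that there are some follows from a second
  translation count.\<close>

lemma level_step:
  assumes p: "p \<in> P" and i: "1 \<le> i" "i < nn p" and LA: "aideal (Ip p (Suc i))"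
  shows "ahull (of_nat p ^ i * ep p) = Ip p i"
proof (rule ccontr)
  assume neq: "ahull (of_nat p ^ i * ep p) \<noteq> Ip p i"
  define z where "z k = of_nat p ^ k * ep p" for k
  have zC: "z k \<in> C" for k using p by (simp add: z_def)
  define A where "A = ahull (z i)"
  have AA: "aideal A" unfolding A_def by (rule ahull_aideal[OF zC])
  note AI = is_idealD[OF aidealD(1)[OF AA]]
  have zA: "z i \<in> A" by (simp add: A_def ahull_in)
  have A0: "A \<subseteq> Ip p 0" using hull_level_sub[OF p i(2)] by (simp add: A_def z_def)
  have zmult: "z j = of_nat p ^ (j - k) * z k" if "k \<le> j" for j k
  proof -
    have "of_nat p ^ j = (of_nat p ^ (j - k) * of_nat p ^ k :: 'a)" using that by (simp add: power_add[symmetric])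
    then show ?thesis by (simp only: z_def mult.assoc)
  qed
  have lev: "\<exists>j<nn p. \<exists>v\<in>Us. x = v * z j" if x: "x \<in> Ip p 0" "x \<noteq> 0" for x
  proof -
    obtain r where r: "x = ep p * r" using x(1) by (auto simp: Ip_def)
    then have ex: "ep p * x = x" using p by simp
    then obtain j v where "j < nn p" "v \<in> Us" "ep p * x = of_nat p ^ j * ep p * v" using level[OF p, of x] x(2) by auto
    then show ?thesis using ex by (auto simp: z_def mult.commute)
  qed
  have lev_in: "z j \<in> A" if "v \<in> Us" "v * z j \<in> A" for j v
    using AI(4)[OF that(2), of "uinv v"] inv_cancel(2)[OF that(1) zC] by simp
  define l where "l = i - 1"
  have il: "i = Suc l" using i by (simp add: l_def)
  have IpiA: "Ip p i \<subseteq> A" using AI(5)[OF zA] by (auto simp: Ip_def z_def)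
  obtain x where x: "x \<in> A" "x \<notin> Ip p i" using neq IpiA by (auto simp: A_def z_def)
  have "x \<noteq> 0" using x(2) is_idealD(2)[OF Ip_ideal[OF p]] by auto
  then obtain j v where jv: "j < nn p" "v \<in> Us" "x = v * z j" using lev x(1) A0 by blast
  have "j < i"
  proof (rule ccontr)
    assume "\<not> j < i"
    then have "Ip p j \<subseteq> Ip p i" by (intro Ip_anti) simp
    then have "z j \<in> Ip p i" using IpI1[of p j] by (auto simp: z_def)
    then show False using x(2) jv(3) is_idealD(4)[OF Ip_ideal[OF p]] by blast
  qed
  then have zlA: "z l \<in> A" using zmult[of j l] AI(4)[OF lev_in[OF jv(2)], of j "of_nat p ^ (l - j)"] jv(3) x(1) il by simp
  \<comment> \<open>The maximal ideal \<open>Lv p 1\<close> is an A-ideal containing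
    \<open>z i\<close>, so \<open>ep p\<close> is not in its hull. The power formula for level
    \<open>l\<close> needs \<open>l \<ge> 1\<close>.\<close>
  have l1: "1 \<le> l"
  proof (rule ccontr)
    assume "\<not> 1 \<le> l"
    then have "l = 0" by simp
    then have "ep p \<in> A" using zlA by (simp add: z_def)
    moreover have "z i \<in> Lv p 1"
    proof -
      have "ep p * z i = of_nat p ^ 1 * ep p * (of_nat p ^ l)"
      proof -
        have "ep p * z i = of_nat p ^ i * (ep p * ep p)" by (simp only: z_def mult_ac)
        then show ?thesis using p by (simp add: idem il mult_ac)
      qed
      then show ?thesis using zC unfolding Lv_def by blast
    qed
    then have "A \<subseteq> Lv p 1" unfolding A_def by (rule ahull_min[OF Lv_aideal[OF p X0_Lv[OF p]]])
    ultimately show False using ep_not_Lv1[OF p] by blast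
  qed
  obtain c where c: "c \<in> Us" "c * z l \<in> bl (z i)"
  \<comment> \<open>\<open>j0\<close> is the lowest level in \<open>A\<close>. Neither
    \<open>z i\<close> nor \<open>z l\<close> lies in the core of the next level, so both of their
    basic sets contain a unit multiple of \<open>z j0\<close>; \<open>c\<close> is the quotient of
    the two units.\<close>
  proof -
    define Q where "Q k \<longleftrightarrow> z k \<in> A" for k
    define j0 where "j0 = (LEAST k. Q k)"
    have "Q i" using zA by (simp add: Q_def)
    then have Q0: "Q j0" and least: "\<And>k. Q k \<Longrightarrow> j0 \<le> k" unfolding j0_def using LeastI Least_le by blast+
    have j0n: "j0 < nn p" using least[OF \<open>Q i\<close>] i by simp
    define L where "L = Ip p (Suc j0)"
    have LI: "is_ideal L" unfolding L_def by (rule Ip_ideal[OF p])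
    have nL: "z i \<notin> core L"
    proof
      assume "z i \<in> core L"
      then have "A \<subseteq> core L" unfolding A_def by (rule ahull_min[OF core_aideal[OF LI]])
      then have "z j0 \<in> L" using Q0 core_sub[of L] by (auto simp: Q_def)
      then show False using pe_not_Ip[OF p j0n] by (simp add: L_def z_def)
    qed
    have nL': "z l \<notin> core L"
    proof
      assume "z l \<in> core L"
      then have "of_nat p * z l \<in> core L" using is_idealD(4)[OF aidealD(1)[OF core_aideal[OF LI]]] by blast
      moreover have "of_nat p * z l = z i" by (simp add: z_def il mult.assoc)
      ultimately show False using nL by simp
    qed
    have ex: "\<exists>v\<in>Us. v * z j0 \<in> bl (z k)" if k: "z k \<in> A" "z k \<notin> core L" for k
    proof -
      have blA: "bl (z k) \<subseteq> A" using asetD[OF aidealD(2)[OF AA] k(1)] .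
      obtain x where x: "x \<in> bl (z k)" "x \<notin> L" using k(2) zC by (auto simp: core_def)
      have "x \<noteq> 0" using x(2) is_idealD(2)[OF LI] by auto
      moreover have "x \<in> Ip p 0" using x(1) blA A0 by blast
      ultimately obtain j v where jv: "j < nn p" "v \<in> Us" "x = v * z j" using lev by blast
      have "j0 \<le> j" using least lev_in[OF jv(2)] jv(3) x(1) blA by (auto simp: Q_def)
      moreover have "\<not> Suc j0 \<le> j"
      proof
        assume "Suc j0 \<le> j"
        then have "Ip p j \<subseteq> L" unfolding L_def by (rule Ip_anti)
        then have "z j \<in> L" using IpI1[of p j] by (auto simp: z_def)
        then show False using x(2) jv(3) is_idealD(4)[OF LI] by blast
      qed
      ultimately have "j = j0" by simp
      then show ?thesis using jv x(1) by blast
    qed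
    obtain v where v: "v \<in> Us" "v * z j0 \<in> bl (z i)" using ex[OF zA nL] by blast
    obtain v' where v': "v' \<in> Us" "v' * z j0 \<in> bl (z l)" using ex[OF zlA nL'] by blast
    define c where "c = v * uinv v'"
    have cU: "c \<in> Us" using v(1) uinv(1)[OF v'(1)] by (simp add: c_def)
    have "c * (v' * z j0) = v * (uinv v' * (v' * z j0))" by (simp only: c_def mult_ac)
    also have "\<dots> = v * z j0" using inv_cancel(2)[OF v'(1) zC] by simp
    finally have "c * (v' * z j0) = v * z j0" .
    moreover have "c * (v' * z j0) \<in> bl (c * z l)" using bl_unit[OF cU zC] v'(2) by blast
    ultimately have "bl (c * z l) = bl (z i)" using bl_meet[of "c * z l" "z i" "v * z j0"] v(2) zC by simp
    then have "c * z l \<in> bl (z i)" using bl_in[of "c * z l"] zC by simp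
    then show ?thesis using that cU by blast
  qed
  define La where "La = Ip p (Suc i)"
  note LI = is_idealD[OF Ip_ideal[OF p, of "Suc i"], folded La_def]
  \<comment> \<open>Adding \<open>La\<close> makes changes beyond level \<open>i\<close> invisible;
    since \<open>La\<close> is an A-ideal, \<open>K\<close> is still a union of basic sets, and it
    is a group of units.\<close>
  define K where "K = {x + m | x m. x \<in> X0 \<and> m \<in> La}"
  have asK: "aset K" unfolding K_def La_def by (rule aset_sum[OF aset_X0 aidealD(2)[OF LA]])
  have KL: "x + m \<in> K" if "x \<in> K" "m \<in> La" for x m
  proof -
    obtain x0 m0 where x0: "x0 \<in> X0" "m0 \<in> La" "x = x0 + m0" using \<open>x \<in> K\<close> by (auto simp: K_def)
    have eq: "x + m = x0 + (m0 + m)" by (simp add: x0(3) add.assoc)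
    show ?thesis unfolding eq K_def using x0(1) LI(3)[OF x0(2) that(2)] by blast
  qed
  have KL': "y \<in> K" if "x \<in> K" "y - x \<in> La" for x y using KL[OF that] by simp
  have X0K: "x \<in> K" if "x \<in> X0" for x unfolding K_def using that LI(2) by force
  have eK: "e \<in> K" using X0K e_X0 .
  have K_Us: "x \<in> Us" if "x \<in> K" for x
  proof -
    obtain x0 m0 where x0: "x0 \<in> X0" "m0 \<in> La" "x = x0 + m0" using \<open>x \<in> K\<close> by (auto simp: K_def)
    obtain r where r: "m0 = of_nat p ^ Suc i * ep p * r" using x0(2) by (auto simp: La_def Ip_def)
    have x0U: "x0 \<in> Us" using x0(1) X0_Us by blast
    have "x0 * (e + of_nat p ^ Suc i * ep p * (uinv x0 * r)) = x0 + (x0 * uinv x0) * m0"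
      using x0U unfolding r by (simp add: distrib_left mult_ac)
    also have "\<dots> = x" using uinv(2)[OF x0U] LI(8)[OF x0(2)] x0(3) by simp
    finally show ?thesis using Us_mult[OF x0U Us_add_nil[OF p, of "Suc i" "uinv x0 * r"]] by simp
  qed
  have K_mult: "x * y \<in> K" if "x \<in> K" "y \<in> K" for x y
  proof -
    obtain x0 m0 where x0: "x0 \<in> X0" "m0 \<in> La" "x = x0 + m0" using \<open>x \<in> K\<close> by (auto simp: K_def)
    obtain y0 m1 where y0: "y0 \<in> X0" "m1 \<in> La" "y = y0 + m1" using \<open>y \<in> K\<close> by (auto simp: K_def)
    have "x * y - x0 * y0 = x0 * m1 + m0 * y" by (simp add: x0(3) y0(3) algebra_simps)
    then have "x * y - x0 * y0 \<in> La" using LI(3)[OF LI(4)[OF y0(2)] LI(5)[OF x0(2)]] by simp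
    then show ?thesis using KL'[OF X0K[OF X0_mult[OF x0(1) y0(1)]]] by blast
  qed
  have K_inv: "uinv x \<in> K" if "x \<in> K" for x
  proof -
    obtain x0 m0 where x0: "x0 \<in> X0" "m0 \<in> La" "x = x0 + m0" using \<open>x \<in> K\<close> by (auto simp: K_def)
    have xU: "x \<in> Us" using K_Us that by blast
    have x0U: "x0 \<in> Us" using x0(1) X0_Us by blast
    have "uinv x - uinv x0 = uinv x * (x0 * uinv x0) - uinv x0 * (x * uinv x)"
      using uinv(1)[OF xU] uinv(1)[OF x0U] uinv(2)[OF xU] uinv(2)[OF x0U] by simp
    also have "\<dots> = (uinv x * uinv x0) * (- m0)" by (simp add: x0(3) algebra_simps)
    finally have "uinv x - uinv x0 \<in> La" using LI(4)[OF LI(6)[OF x0(2)]] by simp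
    then show ?thesis using KL'[OF X0K[OF X0_uinv[OF x0(1)]]] by blast
  qed
  have K_left: "x * y \<in> K \<longleftrightarrow> y \<in> K" if "x \<in> K" "y \<in> C" for x y
    using K_mult[OF K_inv[OF that(1)], of "x * y"] K_mult[OF that(1), of y] inv_cancel(2)[OF K_Us[OF that(1)] that(2)] by auto
  have K_power: "e * x ^ k \<in> K" if "x \<in> K" for x k
    by (induction k) (use that eK K_mult in \<open>auto simp: mult.left_commute\<close>)
  have finK: "finite K" using aset_finite[OF asK] .
  have K_C: "K \<subseteq> C" using aset_sub[OF asK] .
  define AA' where "AA' k = {v\<in>Us. e + v * z k \<in> K}" for k
  have sumN: "(\<Sum>v\<in>Us. ac K K (v * z k)) = card K * card (AA' k)" for k
  proof -
    have "(\<Sum>v\<in>Us. ac K K (v * z k)) = (\<Sum>x\<in>K. card {v\<in>Us. x + v * z k \<in> K})"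
      unfolding ac_def by (rule card_swap[OF finite_Us finK])
    also have "\<dots> = (\<Sum>x\<in>K. card (AA' k))"
    proof (rule sum.cong[OF refl])
      fix x assume x: "x \<in> K"
      have xU: "x \<in> Us" using K_Us[OF x] .
      have iff: "x + x * v * z k \<in> K \<longleftrightarrow> e + v * z k \<in> K" if "v \<in> Us" for v
      proof -
        have "x + x * v * z k = x * (e + v * z k)" using xU by (simp add: distrib_left mult.assoc)
        then show ?thesis using K_left[OF x, of "e + v * z k"] zC by simp
      qed
      have "{v\<in>Us. x + v * z k \<in> K} = (*) x ` AA' k"
      proof (intro equalityI subsetI)
        fix v assume v: "v \<in> {v\<in>Us. x + v * z k \<in> K}"
        have v': "v = x * (uinv x * v)" using inv_cancel(1)[OF xU, of v] v by simp
        have "uinv x * v \<in> Us" using uinv(1)[OF xU] v by simp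
        moreover have "uinv x * v \<in> AA' k" using iff[OF calculation] v v' calculation by (simp add: AA'_def)
        ultimately show "v \<in> (*) x ` AA' k" using v' by blast
      next
        fix v assume "v \<in> (*) x ` AA' k"
        then obtain w where w: "w \<in> Us" "e + w * z k \<in> K" "v = x * w" by (auto simp: AA'_def)
        then show "v \<in> {v\<in>Us. x + v * z k \<in> K}" using iff[OF w(1)] xU by simp
      qed
      moreover have "AA' k \<subseteq> C" using Us_C by (intro subsetI) (simp add: AA'_def)
      ultimately show "card {v\<in>Us. x + v * z k \<in> K} = card (AA' k)"
        using unit_img_card[OF xU, of "AA' k"] by simp
    qed
    finally show ?thesis by simp
  qed
  \<comment> \<open>\<open>v * z i\<close> and \<open>c * v * z l\<close> share a basic set and
    multiplication by \<open>c\<close> permutes the units, so both levels have the same sum of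
    translation counts.\<close>
  have cardA: "card (AA' i) = card (AA' l)"
  proof -
    have "(\<Sum>v\<in>Us. ac K K (v * z i)) = (\<Sum>v\<in>Us. ac K K (c * v * z l))"
    proof (rule sum.cong[OF refl])
      fix v assume v: "v \<in> Us"
      have "v * (c * z l) \<in> bl (v * z i)" using bl_unit[OF v zC] c(2) by blast
      moreover have "v * (c * z l) = c * v * z l" by (simp only: mult_ac)
      ultimately have "c * v * z l \<in> bl (v * z i)" by simp
      then show "ac K K (v * z i) = ac K K (c * v * z l)" using ac_const[OF asK asK, of "v * z i"] zC by simp
    qed
    also have "\<dots> = (\<Sum>v\<in>Us. ac K K (v * z l))"
      using sum.reindex_bij_betw[OF Us_bij[OF c(1)], of "\<lambda>v. ac K K (v * z l)"] by simp
    finally have "card K * card (AA' i) = card K * card (AA' l)" using sumN by simp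
    moreover have "card K \<noteq> 0" using finK eK by auto
    ultimately show ?thesis by simp
  qed
  have ezp: "e * (1 + of_nat p ^ k * (ep p * v)) = e + v * z k" for k v
  proof -
    have "e * (of_nat p ^ k * (ep p * v)) = v * of_nat p ^ k * (e * ep p)" by (simp only: mult_ac)
    then show ?thesis using p by (simp add: distrib_left z_def mult_ac)
  qed
  have ee: "e * e ^ k = e" for k by (induction k) (simp_all add: mult.left_commute[of e])
  have epow: "e * (e * w) ^ k = e * w ^ k" for k w
  proof -
    have "e * (e * w) ^ k = (e * e ^ k) * w ^ k" by (simp add: power_mult_distrib mult.assoc)
    then show ?thesis by (simp only: ee)
  qed
  \<comment> \<open>The \<open>p\<close>-th power of \<open>e + v * z l\<close> is
    \<open>e + v * z i\<close> up to an element of \<open>La\<close>.\<close>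
  have sub: "AA' l \<subseteq> AA' i"
  proof
    fix v assume v: "v \<in> AA' l"
    obtain w where w: "(1 + of_nat p ^ l * (ep p * v)) ^ p = 1 + of_nat p ^ Suc l * (ep p * v * (1 + of_nat p * w))"
      using one_unit_power_prime[OF odd_P[OF p] l1] by blast
    have "e * (e + v * z l) ^ p \<in> K" using K_power v by (simp add: AA'_def)
    moreover have "e * (e + v * z l) ^ p = e + (v * (1 + of_nat p * w)) * z i"
      unfolding ezp[symmetric] epow w il by (simp only: mult_ac)
    ultimately have "e + (v * (1 + of_nat p * w)) * z i \<in> K" by simp
    moreover have "e + v * z i - (e + (v * (1 + of_nat p * w)) * z i) = of_nat p ^ Suc i * ep p * (- (v * w))"
      by (simp add: z_def algebra_simps)
    ultimately have "e + v * z i \<in> K" using KL' IpI[of p "Suc i"] unfolding La_def by metis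
    then show "v \<in> AA' i" using v by (simp add: AA'_def)
  qed
  have fA: "finite (AA' k)" for k using finite_Us by (simp add: AA'_def)
  have eqA: "AA' l = AA' i" using card_subset_eq[OF fA sub] cardA by simp
  have p_shift: "of_nat p * z l = z i" by (simp add: z_def il mult.assoc)
  have pepz: "of_nat p * ep p * s * z k = of_nat p ^ Suc k * ep p * s" for s k
  proof -
    have "of_nat p * ep p * s * z k = of_nat p ^ Suc k * (ep p * ep p) * s" by (simp only: z_def power_Suc mult_ac)
    then show ?thesis by (simp only: idem[OF p])
  qed
  have un_shift: "v + of_nat p * ep p * s \<in> Us" if v: "v \<in> Us" for v s
  proof -
    have "un q (v + of_nat p * ep p * s)" if q: "q \<in> P" for q
    proof (cases "q = p")
      case True
      have "ep p * (of_nat p * ep p * s) = of_nat p * (ep p * ep p) * s" by (simp only: mult_ac)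
      then have "ep p * (of_nat p * ep p * s) = of_nat p * ep p * s" by (simp only: idem[OF p])
      then have "\<not> un p (of_nat p * ep p * s)" using not_un_iff[OF p] by metis
      then show ?thesis using un_add[OF p un_unit[OF v p]] True by simp
    next
      case False
      have "ep q * (of_nat p * ep p * s) = of_nat p * (ep q * ep p) * s" by (simp only: mult_ac)
      then have "ep q * (v + of_nat p * ep p * s) = ep q * v" using orth[OF q p False] by (simp add: distrib_left)
      then show ?thesis using un_ep_cong un_unit[OF v q] by metis
    qed
    moreover have "v + of_nat p * ep p * s \<in> C" using v p by simp
    ultimately show ?thesis by (simp add: Us_iff)
  qed
  show False
  proof (cases "AA' l = {}")
    case False
    then obtain v where v: "v \<in> AA' l" by blast
    define y0 where "y0 = e + v * z l"
    have y0: "y0 \<in> K" "y0 \<in> Us" using v K_Us by (auto simp: y0_def AA'_def)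
    \<comment> \<open>At level \<open>i\<close> only \<open>v\<close> modulo \<open>p\<close>
      matters, as the difference falls into \<open>La\<close>. Since both levels have the same
      coefficients, this holds at level \<open>l\<close> too, and dividing two elements of
      \<open>K\<close> at level \<open>l\<close> gives every \<open>e + r * z i\<close>.\<close>
    have all: "e + r * z i \<in> K" for r
    proof -
      define s where "s = y0 * r"
      define v2 where "v2 = v + of_nat p * ep p * s"
      have v2: "v2 \<in> Us" unfolding v2_def by (rule un_shift) (use v in \<open>simp add: AA'_def\<close>)
      have "v \<in> AA' i" using v eqA by simp
      then have "e + v * z i \<in> K" by (simp add: AA'_def)
      moreover have "e + v2 * z i - (e + v * z i) \<in> La"
        using pepz[of s i] IpI[of p "Suc i" s] unfolding v2_def La_def by (simp add: distrib_right)
      ultimately have "e + v2 * z i \<in> K" by (rule KL')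
      then have "v2 \<in> AA' l" using v2 eqA by (simp add: AA'_def)
      then have k2: "e + v2 * z l \<in> K" by (simp add: AA'_def)
      have "e + v2 * z l = y0 * (e + r * z i)"
      proof -
        have "y0 * (e + r * z i) = y0 * e + y0 * r * z i" by (simp add: distrib_left mult.assoc)
        also have "y0 * e = y0" using y0(2) by simp
        also have "y0 * r * z i = of_nat p ^ Suc l * ep p * s" by (simp only: s_def z_def il mult_ac)
        also have "y0 + of_nat p ^ Suc l * ep p * s = e + v2 * z l" using pepz[of s l] by (simp add: v2_def y0_def distrib_right)
        finally show ?thesis by simp
      qed
      then show ?thesis using k2 K_left[OF y0(1), of "e + r * z i"] zC by simp
    qed
    obtain g where g: "g \<in> It p" "e + g \<notin> X0" using pure_e[OF p] by blast
    obtain r where r: "g = hh p * r" using g(1) by (auto simp: It_def)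
    obtain x m where xm: "x \<in> X0" "m \<in> La" "e + r * z i = x + m" using all[of r] by (auto simp: K_def)
    obtain s where s: "m = of_nat p ^ Suc i * ep p * s" using xm(2) by (auto simp: La_def Ip_def)
    \<comment> \<open>Dropping the part in \<open>La\<close> changes \<open>r\<close> by a multiple
      of \<open>p\<close>. The following power lifts level \<open>i\<close> to
      \<open>nn p - 1\<close>, where such multiples vanish, so \<open>e + g\<close> itself appears
      in \<open>X0\<close>.\<close>
    define r1 where "r1 = r - of_nat p * s"
    have "m = of_nat p * s * z i" unfolding s z_def by (simp only: power_Suc mult_ac)
    then have "x = e + r1 * z i" using xm(3) by (simp add: r1_def algebra_simps)
    moreover obtain w where w: "(1 + of_nat p ^ i * (ep p * r1)) ^ (p ^ (nn p - 1 - i)) =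
        1 + of_nat p ^ (i + (nn p - 1 - i)) * (ep p * r1 * (1 + of_nat p * w))"
      using one_unit_power_prime_power[OF odd_P[OF p] i(1)] by blast
    ultimately have "e * x ^ (p ^ (nn p - 1 - i)) = e + (r1 * (1 + of_nat p * w)) * z (i + (nn p - 1 - i))"
      unfolding ezp[symmetric] by (simp only: epow) (simp only: mult_ac)
    moreover have "i + (nn p - 1 - i) = nn p - 1" using i by simp
    ultimately have "e + (r1 * (1 + of_nat p * w)) * z (nn p - 1) \<in> X0" using X0_power[OF xm(1), of "p ^ (nn p - 1 - i)"] by metis
    then have "e + (r1 * (1 + of_nat p * w)) * hh p \<in> X0" by (simp only: z_def hh_def)
    moreover have "(r1 * (1 + of_nat p * w)) * hh p = g"
    proof -
      have "(r1 * (1 + of_nat p * w)) * hh p = r * hh p + (r1 * w - s) * (of_nat p * hh p)"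
        by (simp add: r1_def algebra_simps)
      then show ?thesis using p_hh[OF p] by (simp add: r mult.commute)
    qed
    ultimately show False using g(2) by simp
  next
    case True
    \<comment> \<open>Translation by \<open>z i\<close> takes \<open>e\<close> from \<open>K\<close>
      into the coset of \<open>u\<close>; as the count is constant on the basic set of
      \<open>z i\<close>, translation by \<open>c * z l\<close> also takes some element of
      \<open>K\<close> into that coset.\<close>
    define u where "u = e + z i"
    have u: "u \<in> Us" using Us_add_nil[OF p i(1), of 1] by (simp add: u_def z_def)
    have uK: "(*) u ` K \<subseteq> C" using K_C by (auto intro!: multr_C)
    have "u * e \<in> (*) u ` K" using eK by (rule imageI)
    then have "u \<in> (*) u ` K" using u by simp
    then have "e \<in> {x\<in>K. x + z i \<in> (*) u ` K}" using eK by (simp add: u_def)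
    then have "ac K ((*) u ` K) (z i) \<noteq> 0" using finK by (auto simp: ac_def card_eq_0_iff)
    then have "ac K ((*) u ` K) (c * z l) \<noteq> 0" using ac_const[OF asK aset_img[OF u asK] zC c(2)] by simp
    then obtain x where x: "x \<in> K" "x + c * z l \<in> (*) u ` K" unfolding ac_def
      by (metis (mono_tags, lifting) card.empty empty_Collect_eq)
    then obtain k where k: "k \<in> K" "x + c * z l = u * k" by blast
    have xU: "x \<in> Us" using K_Us[OF x(1)] .
    define w where "w = uinv x * c"
    have wU: "w \<in> Us" using uinv(1)[OF xU] c(1) by (simp add: w_def)
    have "uinv x * (x + c * z l) = e + w * z l" using uinv(3)[OF xU] by (simp add: distrib_left w_def mult.assoc)
    then have "e + w * z l = u * (uinv x * k)" unfolding k(2) by (simp add: mult.left_commute)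
    moreover have "uinv x * k \<in> K" by (rule K_mult[OF K_inv[OF x(1)] k(1)])
    ultimately have k': "uinv u * (e + w * z l) \<in> K" using inv_cancel(2)[OF u, of "uinv x * k"] K_C by auto
    \<comment> \<open>Modulo \<open>La\<close>, division by \<open>u = e + z i\<close> subtracts
      \<open>z i\<close>, which is \<open>p * ep p * z l\<close>. So it replaces the coefficient
      \<open>w\<close> by \<open>w - p * ep p\<close>, again a unit, and a coefficient at level
      \<open>l\<close> exists.\<close>
    define v3 where "v3 = w - of_nat p * ep p"
    have v3: "v3 \<in> Us" using un_shift[OF wU, of "-1"] by (simp add: v3_def)
    have zz: "z i * z k = of_nat p ^ (i + k) * ep p" for k
    proof -
      have "z i * z k = of_nat p ^ (i + k) * (ep p * ep p)" unfolding z_def power_add by (simp only: mult_ac)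
      then show ?thesis by (simp only: idem[OF p])
    qed
    have zLa: "of_nat p ^ k * ep p * s \<in> La" if "Suc i \<le> k" for k s
      using Ip_anti[OF that, of p] IpI[of p k s] by (auto simp: La_def)
    have v3z: "v3 * z l = w * z l - z i"
    proof -
      have "of_nat p * ep p * z l = z i" using pepz[of 1 l] by (simp add: z_def il)
      then show ?thesis by (simp add: v3_def left_diff_distrib)
    qed
    have "u * (e + v3 * z l) - (e + w * z l) \<in> La"
    proof -
      have "u * (e + v3 * z l) = e * e + e * (w * z l) - e * z i + z i * e + w * (z i * z l) - z i * z i"
        unfolding v3z u_def by (simp add: algebra_simps)
      also have "\<dots> = e + w * z l + w * (z i * z l) - z i * z i" using zC wU by simp
      finally have "u * (e + v3 * z l) - (e + w * z l) = of_nat p ^ (i + l) * ep p * w - of_nat p ^ (i + i) * ep p * 1"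
        unfolding zz by (simp add: mult.commute)
      then show ?thesis using LI(7)[OF zLa zLa, of "i + l" "i + i" w 1] i l1 by simp
    qed
    then have "uinv u * (u * (e + v3 * z l) - (e + w * z l)) \<in> La" by (rule LI(4))
    then have "(e + v3 * z l) - uinv u * (e + w * z l) \<in> La"
      using inv_cancel(2)[OF u, of "e + v3 * z l"] zC by (simp add: right_diff_distrib)
    then have "e + v3 * z l \<in> K" by (rule KL'[OF k'])
    then have "v3 \<in> AA' l" using v3 by (simp add: AA'_def)
    then show False using True by blast
  qed
qed

text \<open>Level 0 needs no \<open>level_step\<close>: the hull of \<open>ep p\<close> contains the
  whole component and by \<open>hull_level_sub\<close> nothing else.\<close>

lemma Ip_aideal: assumes p: "p \<in> P" shows "i \<le> nn p \<Longrightarrow> aideal (Ip p i)"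
proof (induction "nn p - i" arbitrary: i)
  case 0
  then have "i = nn p" by simp
  then have "Ip p i = {0}" using nil[OF p] by (auto simp: Ip_def)
  then show ?case using aideal_zero by simp
next
  case (Suc k)
  then have i: "i < nn p" by simp
  have zC: "of_nat p ^ i * ep p \<in> C" using p by simp
  have "ahull (of_nat p ^ i * ep p) = Ip p i"
  proof (cases "i = 0")
    case True
    have I: "is_ideal (ahull (of_nat p ^ i * ep p))" using ahull_aideal[OF zC] aidealD by blast
    have "Ip p i \<subseteq> ahull (of_nat p ^ i * ep p)"
      using is_idealD(5)[OF I ahull_in] by (auto simp: Ip_def)
    then show ?thesis using hull_level_sub[OF p i] True by simp
  next
    case False
    then show ?thesis using level_step[OF p _ i] Suc by simp
  qed
  then show ?case using ahull_aideal[OF zC] by simp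
qed

text \<open>Each nonzero component of an element of \<open>I\<close> generates some
  \<open>Ip p i\<close> inside \<open>I\<close>. These are A-ideals, so they lie in the core of
  \<open>I\<close>.\<close>

theorem dense: assumes I: "is_ideal I" shows "aset I"
proof -
  have "x \<in> core I" if x: "x \<in> I" for x
  proof (rule ideal_comps[OF aidealD(1)[OF core_aideal[OF I]]])
    show "x \<in> C" using is_idealD(8)[OF I x] .
    fix p assume p: "p \<in> P"
    show "ep p * x \<in> core I"
    proof (cases "ep p * x = 0")
      case True
      then show ?thesis using is_idealD(2)[OF aidealD(1)[OF core_aideal[OF I]]] by simp
    next
      case False
      obtain i v where iv: "i < nn p" "v \<in> Us" "ep p * x = of_nat p ^ i * ep p * v" using level[OF p False] by blast
      have "of_nat p ^ i * ep p * v \<in> I" using is_idealD(4)[OF I x] iv(3) by metis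
      then have "Ip p i \<subseteq> I" using ideal_level[OF I p _ un_unit[OF iv(2) p]] by (auto simp: Ip_def)
      moreover have "aset (Ip p i)" using Ip_aideal[OF p, of i] iv(1) aidealD by simp
      ultimately have "Ip p i \<subseteq> core I" by (intro core_max)
      then show ?thesis using iv(3) by (auto simp: Ip_def)
    qed
  qed
  then have "core I = I" using core_sub[of I] by blast
  then show ?thesis using aidealD(2)[OF core_aideal[OF I]] by simp
qed

end

context sr_pure begin

section \<open>The shape of the basic sets\<close>

definition DD :: "nat set set" where "DD = D ` (P - Q0)"

lemma DD_union: "\<Union>DD = P - Q0" using p_D D_Q0 D_P unfolding DD_def by blast
lemma DD_sub: "d \<in> DD \<Longrightarrow> d \<subseteq> P" using D_P unfolding DD_def by blast
lemma DD_disj: assumes "d \<in> DD" "d' \<in> DD" "d \<noteq> d'" shows "d \<inter> d' = {}"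
proof -
  obtain p p' where p: "p \<in> P" "p \<notin> Q0" "d = D p" and p': "p' \<in> P" "p' \<notin> Q0" "d' = D p'"
    using assms by (auto simp: DD_def)
  have "d = d'" if "t \<in> d" "t \<in> d'" for t using D_eq[OF p(1,2), of t] D_eq[OF p'(1,2), of t] that p(3) p'(3) by simp
  then show ?thesis using assms(3) by blast
qed
lemma DD_ne: "d \<in> DD \<Longrightarrow> d \<noteq> {}" using p_D by (auto simp: DD_def)
lemma DD_finite: "finite DD" using finP by (simp add: DD_def)

lemma aset_DD: "d \<in> DD \<Longrightarrow> aset (RS d)" using RS_D_aideal aidealD by (auto simp: DD_def)

lemma ep_nonzero_DD: assumes "d \<in> DD" "p \<in> d" shows "ep p \<in> RS d"
  using ep_E[of p d] DD_sub[OF assms(1)] assms(2) by (auto simp: RS_def mult.commute)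

text \<open>With two primes in \<open>d\<close> the idempotent \<open>ep p\<close> is a zero
  divisor; with one prime there are at least two levels, and \<open>p * ep p\<close> is a nonzero
  nonunit.\<close>

lemma DD_nonfield: assumes d: "d \<in> DD" shows "\<exists>y\<in>RS d. y \<noteq> 0 \<and> \<not> (\<exists>z. y * z = E d)"
proof -
  obtain p where p: "p \<in> P" "p \<notin> Q0" "d = D p" using d by (auto simp: DD_def)
  have pd: "p \<in> d" using p_D p by simp
  have ep_d: "ep t * E d = ep t" if "t \<in> d" for t using ep_E[of t d] DD_sub[OF d] that by auto
  show ?thesis
  proof (cases "\<exists>t\<in>d. t \<noteq> p")
    case True
    then obtain t where t: "t \<in> d" "t \<noteq> p" by blast
    have tP: "t \<in> P" using t DD_sub[OF d] by blast
    have "ep p * z \<noteq> E d" for z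
    proof
      assume "ep p * z = E d"
      then have "ep t * (ep p * z) = ep t" using ep_d[OF t(1)] by simp
      then show False using orth_left[OF tP p(1) t(2)] ep_nz[OF tP] by simp
    qed
    then show ?thesis using ep_nonzero_DD[OF d pd] ep_nz[OF p(1)] by blast
  next
    case False
    then have n2: "2 \<le> nn p" using D_nonfield[OF p(1,2)] p(3) by blast
    have "of_nat p * ep p \<noteq> 0"
    proof
      assume z: "of_nat p * ep p = 0"
      have "of_nat p ^ (nn p - 1) * ep p = of_nat p ^ (nn p - 2) * (of_nat p * ep p)"
      proof -
        have "nn p - 1 = Suc (nn p - 2)" using n2 by simp
        then show ?thesis by (simp add: mult_ac)
      qed
      then show False using not_nil[OF p(1)] z by simp
    qed
    moreover have "of_nat p * ep p \<in> RS d"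
    proof -
      have "E d * (of_nat p * ep p) = of_nat p * (ep p * E d)" by (simp only: mult_ac)
      then show ?thesis using ep_d[OF pd] by (simp add: RS_def)
    qed
    moreover have "of_nat p * ep p * z \<noteq> E d" for z
    proof
      assume "of_nat p * ep p * z = E d"
      then have "ep p * (of_nat p * ep p * z) = ep p" using ep_d[OF pd] by simp
      moreover have "ep p * (of_nat p * ep p * z) = of_nat p * (ep p * ep p) * z" by (simp only: mult_ac)
      ultimately have "ep p * 1 = of_nat p * ep p * z" using p by (simp add: idem)
      then have "\<not> un p 1" using not_un_iff[OF p(1)] by blast
      then show False by simp
    qed
    ultimately show ?thesis by blast
  qed
qed

lemma bl_two_factors: assumes d: "d \<in> DD" and b: "b \<in> C"
  shows "x \<in> bl b \<longleftrightarrow> x \<in> C \<and> (E d * x = 0 \<longleftrightarrow> E d * b = 0) \<and> E (P - d) * x \<in> bl (E (P - d) * b)"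
proof -
  obtain p where p: "p \<in> P" "p \<notin> Q0" "d = D p" using d by (auto simp: DD_def)
  show ?thesis
  proof (cases "E d * b = 0")
    case False
    then show ?thesis using bl_product[OF p(1,2) b] p(3) by auto
  next
    case True
    then have bM: "b \<in> Mp p" using in_Mp[OF p(1,2) b] p(3) by simp
    have blM: "bl b \<subseteq> Mp p" using asetD[OF MI(3)[OF p(1,2)] bM] .
    have b': "E (P - d) * b = b" using F'_id[OF p(1,2) bM] p(3) by simp
    show ?thesis
    proof
      assume x: "x \<in> bl b"
      then have "x \<in> Mp p" using blM by blast
      then show "x \<in> C \<and> (E d * x = 0 \<longleftrightarrow> E d * b = 0) \<and> E (P - d) * x \<in> bl (E (P - d) * b)"
        using x True b' F'_id[OF p(1,2)] F_zero[OF p(1,2)] bl_C[OF b x] p(3) by simp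
    next
      assume x: "x \<in> C \<and> (E d * x = 0 \<longleftrightarrow> E d * b = 0) \<and> E (P - d) * x \<in> bl (E (P - d) * b)"
      then have "x \<in> Mp p" using in_Mp[OF p(1,2)] True p(3) by simp
      then show "x \<in> bl b" using x b' F'_id[OF p(1,2)] p(3) by simp
    qed
  qed
qed

text \<open>\<open>bl_two_factors\<close> splits off one block at a time; the blocks are disjoint,
  so a projection to the remaining primes leaves the other conditions unchanged.\<close>

lemma bl_box: assumes b: "b \<in> C"
  shows "x \<in> bl b \<longleftrightarrow> x \<in> C \<and> (\<forall>d\<in>DD. E d * x = 0 \<longleftrightarrow> E d * b = 0) \<and> E Q0 * x \<in> bl (E Q0 * b)"
proof -
  have "x \<in> bl b \<longleftrightarrow> x \<in> C \<and> (\<forall>d\<in>S. E d * x = 0 \<longleftrightarrow> E d * b = 0) \<and> E (P - \<Union>S) * x \<in> bl (E (P - \<Union>S) * b)"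
    if "finite S" "S \<subseteq> DD" for S
    using that
  proof (induction S rule: finite_induct)
    case empty
    then show ?case using bl_C[OF b] b by auto
  next
    case (insert d S)
    define T where "T = P - \<Union>S"
    have d: "d \<in> DD" using insert by simp
    have dT: "d \<inter> T = d" using insert DD_disj[OF d] DD_sub[OF d] by (fastforce simp: T_def)
    have TC: "E T * y \<in> C" if "y \<in> C" for y using that by simp
    have TP: "T \<subseteq> P" by (auto simp: T_def)
    have Ed: "E d * (E T * y) = E d * y" for y
      using E_E[OF DD_sub[OF d] TP] dT by (simp add: mult.assoc[symmetric])
    have "(P - d) \<inter> T = P - \<Union>(insert d S)" by (auto simp: T_def)
    then have Ed': "E (P - d) * (E T * y) = E (P - \<Union>(insert d S)) * y" for y
      using E_E[of "P - d" T] TP by (simp add: mult.assoc[symmetric])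
    have "x \<in> bl b \<longleftrightarrow> x \<in> C \<and> (\<forall>d\<in>S. E d * x = 0 \<longleftrightarrow> E d * b = 0) \<and> E T * x \<in> bl (E T * b)"
      using insert by (simp add: T_def)
    also have "\<dots> \<longleftrightarrow> x \<in> C \<and> (\<forall>d\<in>S. E d * x = 0 \<longleftrightarrow> E d * b = 0) \<and>
       (E d * x = 0 \<longleftrightarrow> E d * b = 0) \<and> E (P - \<Union>(insert d S)) * x \<in> bl (E (P - \<Union>(insert d S)) * b)"
      using bl_two_factors[OF d TC[OF b], of "E T * x"] TC[of x] unfolding Ed Ed' by blast
    finally show ?case by auto
  qed
  from this[OF DD_finite order_refl] show ?thesis using DD_union Q0_P by (simp add: double_diff)
qed

text \<open>The part on \<open>Q0\<close> is the intersection of the A-ideals \<open>Mp p\<close>,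
  each of which is the part on the complement of one block.\<close>

lemma aideal_Q0: "aideal (RS Q0)"
proof -
  have "RS Q0 = C \<inter> (\<Inter>d\<in>DD. RS (P - d))"
  proof (rule Set.set_eqI)
    fix x
    have "P - (P - d) = d" if "d \<in> DD" for d using DD_sub[OF that] by blast
    then have "x \<in> RS (P - d) \<longleftrightarrow> x \<in> C \<and> (\<forall>p\<in>d. ep p * x = 0)" if "d \<in> DD" for d
      using RS_iff[of "P - d" x] that by auto
    moreover have "x \<in> RS Q0 \<longleftrightarrow> x \<in> C \<and> (\<forall>p\<in>\<Union>DD. ep p * x = 0)" using RS_iff[OF Q0_P] DD_union by simp
    ultimately show "x \<in> RS Q0 \<longleftrightarrow> x \<in> C \<inter> (\<Inter>d\<in>DD. RS (P - d))" by auto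
  qed
  moreover have "aideal (C \<inter> (\<Inter>d\<in>S. RS (P - d)))" if "finite S" "S \<subseteq> DD" for S
    using that
  proof (induction S rule: finite_induct)
    case empty
    then show ?case using aideal_C by simp
  next
    case (insert d S)
    obtain p where p: "p \<in> P" "p \<notin> Q0" "d = D p" using insert by (auto simp: DD_def)
    have "aideal (RS (P - d))" using Mp_props(1)[OF p(1,2)] Mp_RS[OF p(1,2)] p(3) by simp
    then have "aideal (RS (P - d) \<inter> (C \<inter> (\<Inter>d\<in>S. RS (P - d))))" using insert.prems insert.IH aideal_Int by blast
    moreover have "RS (P - d) \<inter> (C \<inter> (\<Inter>d\<in>S. RS (P - d))) = C \<inter> (\<Inter>d\<in>insert d S. RS (P - d))" by auto
    ultimately show ?case by simp
  qed
  ultimately show ?thesis using DD_finite by simp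
qed

lemma RS_Q0_C: "x \<in> RS Q0 \<Longrightarrow> x \<in> C" using RS_iff[OF Q0_P] by blast

text \<open>\<open>ep\<close>, \<open>nn\<close> and \<open>bl\<close> stay the same and only the
  set of primes shrinks, so the component on \<open>Q0\<close> is treated inside the same ambient
  ring.\<close>

lemma dense_sub: "sr_dense Q0 ep nn bl"
proof -
  have cg: "cg_data Q0 ep nn"
  proof
    show "finite Q0" using finP Q0_P finite_subset by blast
    have "RS Q0 \<subseteq> C" using RS_Q0_C by blast
    then have "finite (RS Q0)" by (rule finite_subset) simp
    then show "finite {x. (\<Sum>p\<in>Q0. ep p) * x = x}" by (simp add: RS_def E_def)
    fix p x assume "p \<in> Q0"
    then have p: "p \<in> P" using Q0_P by blast
    show "prime p" "odd p" "ep p * ep p = ep p" "0 < nn p" "of_nat p ^ nn p * ep p = 0"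
      "of_nat p ^ (nn p - 1) * ep p \<noteq> 0"
      using prime_P[OF p] odd_P[OF p] idem[OF p] nn_pos[OF p] nil[OF p] not_nil[OF p] by auto
    show "(\<exists>y. ep p * x * y = ep p) \<or> (\<exists>y. ep p * x = of_nat p * ep p * y)" by (rule loc[OF p])
    show "ep p * ep q = 0" if "q \<in> Q0" "p \<noteq> q" for q using orth[OF p _ that(2)] that(1) Q0_P by blast
  qed
  interpret s: cg_data Q0 ep nn by (rule cg)
  have sC: "s.C = RS Q0" unfolding s.C_def RS_def ..
  \<comment> \<open>Adding \<open>e - E Q0\<close> extends a unit of the component to one of the
    whole ring with the same action on the component.\<close>
  have sUs: "\<exists>v\<in>Us. \<forall>x\<in>RS Q0. v * x = u * x" if u: "u \<in> s.Us" for u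
  proof -
    obtain w where w: "u \<in> RS Q0" "w \<in> RS Q0" "u * w = E Q0" using u unfolding s.Us_def sC by blast
    define v where "v = u + (e - E Q0)"
    have eQ: "e * E Q0 = E Q0" using Q0_P by simp
    have QQ: "E Q0 * E Q0 = E Q0" using E_E[OF Q0_P Q0_P] by simp
    have uE: "u * E Q0 = u" "E Q0 * w = w" "u * e = u" "e * w = w"
      using w RS_Q0_C by (auto simp: RS_def mult.commute)
    have "v * (w + (e - E Q0)) = u * w + (u * e - u * E Q0) + (e * w - E Q0 * w) + (e * e - e * E Q0 - E Q0 * e + E Q0 * E Q0)"
      by (simp add: v_def algebra_simps)
    also have "\<dots> = e" unfolding uE w(3) QQ eQ using eQ by (simp add: mult.commute)
    finally have "v * (w + (e - E Q0)) = e" .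
    then have "v \<in> Us" unfolding Us_def using w RS_Q0_C Q0_P by (auto simp: v_def)
    moreover have "v * x = u * x" if "x \<in> RS Q0" for x
      using that RS_Q0_C[OF that] by (simp add: v_def RS_def distrib_right left_diff_distrib)
    ultimately show ?thesis by blast
  qed
  have sr: "sr_data Q0 ep nn bl"
  proof (intro sr_data.intro cg sr_data_axioms.intro)
    fix x assume "x \<in> s.C"
    then have x: "x \<in> RS Q0" "x \<in> C" using RS_Q0_C by (auto simp: sC)
    show "x \<in> bl x" using bl_in x by blast
    show "bl x \<subseteq> s.C" using asetD[OF aidealD(2)[OF aideal_Q0] x(1)] by (simp add: sC)
    show "y \<in> bl x \<Longrightarrow> bl y = bl x" for y using bl_same x by blast
    show "u \<in> s.Us \<Longrightarrow> bl (u * x) = (*) u ` bl x" for u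
    proof -
      assume "u \<in> s.Us"
      then obtain v where v: "v \<in> Us" "\<forall>x\<in>RS Q0. v * x = u * x" using sUs by blast
      have "bl (v * x) = (*) v ` bl x" by (rule bl_unit[OF v(1) x(2)])
      moreover have "(*) v ` bl x = (*) u ` bl x"
        using v(2) asetD[OF aidealD(2)[OF aideal_Q0] x(1)] by (intro image_cong) auto
      ultimately show ?thesis using v(2) x(1) by simp
    qed
  next
    show "bl 0 = {0}" by (rule bl_zero)
  next
    fix f g :: "'a \<Rightarrow> int" and x y
    assume f: "\<And>x y. x \<in> s.C \<Longrightarrow> y \<in> bl x \<Longrightarrow> f x = f y" and g: "\<And>x y. x \<in> s.C \<Longrightarrow> y \<in> bl x \<Longrightarrow> g x = g y"
      and x: "x \<in> s.C" and y: "y \<in> bl x"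
    note I = is_idealD[OF aidealD(1)[OF aideal_Q0]]
    have asQ: "aset (RS Q0)" using aideal_Q0 aidealD by blast
    \<comment> \<open>Extension by zero. It preserves constancy on basic sets because
      \<open>RS Q0\<close> is a union of them, and it identifies the two convolutions.\<close>
    define h where "h f x = (if x \<in> RS Q0 then f x else 0)" for f :: "'a \<Rightarrow> int" and x
    have h: "h f x = h f y" if "\<And>x y. x \<in> s.C \<Longrightarrow> y \<in> bl x \<Longrightarrow> f x = f y" "x \<in> C" "y \<in> bl x" for f x y
      using that aset_iff[OF asQ that(2,3)] by (simp add: h_def sC)
    have S: "(\<Sum>s\<in>s.C. f s * g (z - s)) = (\<Sum>s\<in>C. h f s * h g (z - s))" if "z \<in> RS Q0" for z
      unfolding sC using I(7)[OF that] RS_Q0_C by (intro sum.mono_neutral_cong_left) (auto simp: h_def)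
    have "y \<in> RS Q0" using asetD[OF asQ, of x] x y by (auto simp: sC)
    then show "(\<Sum>s\<in>s.C. f s * g (x - s)) = (\<Sum>s\<in>s.C. f s * g (y - s))"
      using S x conv[of "h f" "h g" x y, OF h[OF f] h[OF g]] RS_Q0_C[of x] y by (simp add: sC)
  qed
  interpret s: sr_data Q0 ep nn bl by (rule sr)
  have sX: "s.X0 = bl (E Q0)" by (simp add: s.X0_def)
  have Ee: "E d * e = E d" if "d \<subseteq> P" for d using that by simp
  have bx: "x \<in> X0 \<longleftrightarrow> x \<in> C \<and> (\<forall>d\<in>DD. E d * x \<noteq> 0) \<and> E Q0 * x \<in> bl (E Q0)" for x
  proof -
    have "E d \<noteq> 0" if "d \<in> DD" for d
    proof -
      obtain p where "p \<in> d" using DD_ne[OF \<open>d \<in> DD\<close>] by blast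
      then have "ep p * E d = ep p" "p \<in> P" using ep_E[of p d] DD_sub[OF \<open>d \<in> DD\<close>] by auto
      then show ?thesis using ep_nz[of p] by auto
    qed
    then show ?thesis unfolding X0_def bl_box[OF e_C] using Ee[OF DD_sub] Ee[OF Q0_P] by auto
  qed
  have sp: "sr_pure Q0 ep nn bl"
  proof (intro sr_pure.intro sr sr_pure_axioms.intro)
    fix p assume p: "p \<in> Q0"
    have pP: "p \<in> P" using p Q0_P by blast
    obtain x r where x: "x \<in> X0" "x + hh p * r \<notin> X0" using pure[OF pP] by blast
    \<comment> \<open>Translation at a prime of \<open>Q0\<close> does not affect the block
      conditions of \<open>bl_box\<close>, so a failure of invariance of \<open>X0\<close> must show
      in the \<open>Q0\<close>-part.\<close>
    have Eh: "E d * (x + hh p * r) = E d * x + (if p \<in> d then hh p * r else 0)" if "d \<subseteq> P" for d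
    proof -
      have "E d * (hh p * r) = of_nat p ^ (nn p - 1) * (ep p * E d) * r" by (simp only: hh_def mult_ac)
      then show ?thesis using ep_E[OF pP that] by (simp add: distrib_left hh_def)
    qed
    have "E d * (x + hh p * r) = E d * x" if "d \<in> DD" for d
    proof -
      have "p \<notin> d" using DD_union that p by blast
      then show ?thesis using Eh[OF DD_sub[OF that]] by simp
    qed
    moreover have "x + hh p * r \<in> C" using x(1) X0_C pP by auto
    ultimately have "E Q0 * (x + hh p * r) \<notin> bl (E Q0)" using x bx by auto
    then have "E Q0 * x + hh p * r \<notin> bl (E Q0)" using Eh[OF Q0_P] p by simp
    moreover have "E Q0 * x \<in> bl (E Q0)" using x(1) bx by blast
    ultimately show "\<exists>x\<in>s.X0. \<exists>r. x + hh p * r \<notin> s.X0" unfolding sX by blast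
  qed
  interpret s: sr_pure Q0 ep nn bl by (rule sp)
  have "s.Q0 = Q0"
  proof -
    \<comment> \<open>The maximal ideal at \<open>p\<close> is an A-ideal; a point of
      \<open>bl (E Q0)\<close> in it would bring in \<open>E Q0\<close>, a unit at
      \<open>p\<close>.\<close>
    have "bl (E Q0) \<inter> s.Lv p 1 = {}" if p: "p \<in> Q0" for p
    proof (rule ccontr)
      assume "bl (E Q0) \<inter> s.Lv p 1 \<noteq> {}"
      then obtain x where x: "x \<in> bl (E Q0)" "x \<in> s.Lv p 1" by blast
      have pP: "p \<in> P" using p Q0_P by blast
      have QC: "E Q0 \<in> C" using Q0_P by simp
      have xC: "x \<in> C" using bl_C[OF QC x(1)] .
      then have "x \<in> Lv p 1" using x(2) by (auto simp: s.Lv_def Lv_def)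
      moreover have "aideal (Lv p 1)" using Lv_aideal[OF pP] p by (simp add: Q0_def)
      ultimately have "bl x \<subseteq> Lv p 1" using asetD aidealD(2) by blast
      then have "E Q0 \<in> Lv p 1" using bl_sym[OF QC x(1)] by blast
      then have "\<not> un p (E Q0)" using not_un_Lv[OF pP QC] by simp
      moreover have "ep p * E Q0 = ep p * e" using ep_E[OF pP Q0_P] p pP by simp
      ultimately show False using un_ep_cong un_e[OF pP] by metis
    qed
    then show ?thesis by (auto simp: s.Q0_def sX)
  qed
  then show ?thesis by (intro sr_dense.intro sp sr_dense_axioms.intro)
qed

lemma dense_Q0: assumes I: "is_ideal I" "I \<subseteq> RS Q0" shows "aset I"
proof -
  interpret s: sr_dense Q0 ep nn bl by (rule dense_sub)
  have sC: "s.C = RS Q0" unfolding s.C_def RS_def ..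
  have "s.is_ideal I" using I unfolding s.is_ideal_def is_ideal_def sC by blast
  then have "s.aset I" by (rule s.dense)
  then show ?thesis using I(2) RS_Q0_C unfolding s.aset_def aset_def by blast
qed

lemma pure_Q0: assumes I: "is_ideal I" "I \<subseteq> RS Q0" "x \<in> I" "x \<noteq> 0"
  shows "\<exists>x\<in>bl (E Q0). \<exists>y\<in>I. x + y \<notin> bl (E Q0)"
proof -
  interpret s: sr_dense Q0 ep nn bl by (rule dense_sub)
  have sX: "s.X0 = bl (E Q0)" by (simp add: s.X0_def)
  have sC: "s.C = RS Q0" unfolding s.C_def RS_def ..
  have sI: "s.is_ideal I" using I unfolding s.is_ideal_def is_ideal_def sC by blast
  obtain p where p: "p \<in> Q0" "hh p \<in> I" using s.ideal_nonzero_hh[OF sI I(3,4)] by blast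
  obtain y r where "y \<in> s.X0" "y + hh p * r \<notin> s.X0" using s.pure[OF p(1)] by blast
  then show ?thesis using s.is_idealD(5)[OF sI p(2)] unfolding sX by blast
qed

end

section \<open>Finite commutative rings as ideals of a commutative ring type\<close>

text \<open>
  The carrier of \<open>R\<close> is not a type, so \<open>R\<close> is embedded as an ideal in the product of all commutative rings
  with the same element type; the factor \<open>int\<close> ensures \<open>0 \<noteq> 1\<close>.
\<close>

typedef ('a, 'm) uring = "{f :: ('a, 'm) ring_scheme \<Rightarrow> 'a.
    \<forall>S. if cring S then f S \<in> carrier S else f S = undefined} \<times> (UNIV :: int set)"
proof
  show "(\<lambda>S. if cring S then \<zero>\<^bsub>S\<^esub> else undefined, 0) \<in> {f :: ('a, 'm) ring_scheme \<Rightarrow> 'a.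
    \<forall>S. if cring S then f S \<in> carrier S else f S = undefined} \<times> (UNIV :: int set)"
    by (auto simp: cring.cring_simprules)
qed

definition uval :: "('a, 'm) uring \<Rightarrow> ('a, 'm) ring_scheme \<Rightarrow> 'a" where "uval t = fst (Rep_uring t)"
definition unum :: "('a, 'm) uring \<Rightarrow> int" where "unum t = snd (Rep_uring t)"
definition umake :: "(('a, 'm) ring_scheme \<Rightarrow> 'a) \<Rightarrow> int \<Rightarrow> ('a, 'm) uring" where
  "umake f k = Abs_uring (\<lambda>S. if cring S then f S else undefined, k)"

lemma uval_carrier: "cring S \<Longrightarrow> uval t S \<in> carrier S"
  using Rep_uring[of t] by (auto simp: uval_def split: if_splits)

lemma uval_umake: assumes "\<And>S. cring S \<Longrightarrow> f S \<in> carrier S" "cring S" shows "uval (umake f k) S = f S"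
proof -
  have "(\<lambda>S. if cring S then f S else undefined, k) \<in> {f :: ('a, 'b) ring_scheme \<Rightarrow> 'a.
    \<forall>S. if cring S then f S \<in> carrier S else f S = undefined} \<times> (UNIV :: int set)"
    using assms(1) by auto
  from Abs_uring_inverse[OF this] show ?thesis using assms(2) by (simp add: uval_def umake_def)
qed

lemma unum_umake: assumes "\<And>S. cring S \<Longrightarrow> f S \<in> carrier S" shows "unum (umake f k) = k"
proof -
  have "(\<lambda>S. if cring S then f S else undefined, k) \<in> {f :: ('a, 'b) ring_scheme \<Rightarrow> 'a.
    \<forall>S. if cring S then f S \<in> carrier S else f S = undefined} \<times> (UNIV :: int set)"
    using assms(1) by auto
  from Abs_uring_inverse[OF this] show ?thesis by (simp add: unum_def umake_def)
qed

lemma uring_eqI: assumes "\<And>S. cring S \<Longrightarrow> uval t S = uval u S" "unum t = unum u" shows "t = u"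
proof -
  have "uval t S = uval u S" for S
    using assms(1)[of S] Rep_uring[of t] Rep_uring[of u] by (cases "cring S") (auto simp: uval_def)
  then have "Rep_uring t = Rep_uring u" using assms(2)
    by (auto simp: uval_def unum_def prod_eq_iff fun_eq_iff)
  then show ?thesis by (simp add: Rep_uring_inject)
qed

instantiation uring :: (type, type) comm_ring_1
begin
definition "0 = umake (\<lambda>S. \<zero>\<^bsub>S\<^esub>) 0"
definition "1 = umake (\<lambda>S. \<one>\<^bsub>S\<^esub>) 1"
definition "x + y = umake (\<lambda>S. uval x S \<oplus>\<^bsub>S\<^esub> uval y S) (unum x + unum y)"
definition "x * y = umake (\<lambda>S. uval x S \<otimes>\<^bsub>S\<^esub> uval y S) (unum x * unum y)"
definition "x - y = umake (\<lambda>S. uval x S \<ominus>\<^bsub>S\<^esub> uval y S) (unum x - unum y)"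
definition "- x = umake (\<lambda>S. \<ominus>\<^bsub>S\<^esub> uval x S) (- unum x)"

lemma uval_simps [simp]:
  assumes "cring S"
  shows "uval 0 S = \<zero>\<^bsub>S\<^esub>" "uval 1 S = \<one>\<^bsub>S\<^esub>" "uval (x + y) S = uval x S \<oplus>\<^bsub>S\<^esub> uval y S"
    "uval (x * y) S = uval x S \<otimes>\<^bsub>S\<^esub> uval y S" "uval (x - y) S = uval x S \<ominus>\<^bsub>S\<^esub> uval y S"
    "uval (- x) S = \<ominus>\<^bsub>S\<^esub> uval x S"
  unfolding zero_uring_def one_uring_def plus_uring_def times_uring_def minus_uring_def uminus_uring_def
  by (subst uval_umake; simp add: assms cring.cring_simprules uval_carrier)+

lemma unum_simps [simp]: "unum 0 = 0" "unum 1 = 1" "unum (x + y) = unum x + unum y"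
    "unum (x * y) = unum x * unum y" "unum (x - y) = unum x - unum y" "unum (- x) = - unum x"
  unfolding zero_uring_def one_uring_def plus_uring_def times_uring_def minus_uring_def uminus_uring_def
  by (subst unum_umake; simp add: cring.cring_simprules uval_carrier)+

instance
proof
  fix a b c :: "('a, 'b) uring"
  show "a * b * c = a * (b * c)" by (rule uring_eqI) (simp_all add: cring.cring_simprules uval_carrier)
  show "a * b = b * a" by (rule uring_eqI) (simp_all add: cring.cring_simprules(14) uval_carrier mult.commute)
  show "1 * a = a" by (rule uring_eqI) (simp_all add: cring.cring_simprules uval_carrier)
  show "a + b + c = a + (b + c)" by (rule uring_eqI) (simp_all add: cring.cring_simprules uval_carrier)
  show "a + b = b + a" by (rule uring_eqI) (simp_all add: cring.cring_simprules(10) uval_carrier add.commute)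
  show "0 + a = a" by (rule uring_eqI) (simp_all add: cring.cring_simprules uval_carrier)
  show "- a + a = 0" by (rule uring_eqI) (simp_all add: cring.cring_simprules uval_carrier)
  show "a - b = a + - b" by (rule uring_eqI) (simp_all add: cring.cring_simprules uval_carrier)
  show "(a + b) * c = a * c + b * c"
    by (rule uring_eqI) (simp_all add: cring.cring_simprules uval_carrier distrib_right)
  show "(0 :: ('a, 'b) uring) \<noteq> 1" by (metis unum_simps(1,2) zero_neq_one)
qed
end

text \<open>The element with coordinate \<open>x\<close> at \<open>R\<close> and zero at all other
  coordinates. \<open>em R\<close> preserves sums and products, but the image of the identity is
  only an idempotent, which is why \<open>C\<close> is cut out by an idempotent.\<close>

definition em :: "('a, 'm) ring_scheme \<Rightarrow> 'a \<Rightarrow> ('a, 'm) uring" where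
  "em R x = umake (\<lambda>S. if S = R then x else \<zero>\<^bsub>S\<^esub>) 0"

context cring
begin

lemma uval_em: "x \<in> carrier R \<Longrightarrow> cring S \<Longrightarrow> uval (em R x) S = (if S = R then x else \<zero>\<^bsub>S\<^esub>)"
  unfolding em_def by (subst uval_umake) (auto simp: cring.cring_simprules)

lemma unum_em: "x \<in> carrier R \<Longrightarrow> unum (em R x) = 0"
  unfolding em_def by (subst unum_umake) (auto simp: cring.cring_simprules)

lemma uval_em_self [simp]: "x \<in> carrier R \<Longrightarrow> uval (em R x) R = x"
  by (simp add: uval_em is_cring)

lemma em_inj: "inj_on (em R) (carrier R)"
  by (metis inj_onI uval_em_self)

lemma em_zero [simp]: "em R \<zero> = 0"
  by (rule uring_eqI) (auto simp: uval_em unum_em)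

lemma em_add: "x \<in> carrier R \<Longrightarrow> y \<in> carrier R \<Longrightarrow> em R (x \<oplus> y) = em R x + em R y"
  by (rule uring_eqI) (auto simp: uval_em unum_em cring.cring_simprules)

lemma em_mult: "x \<in> carrier R \<Longrightarrow> y \<in> carrier R \<Longrightarrow> em R (x \<otimes> y) = em R x * em R y"
  by (rule uring_eqI) (auto simp: uval_em unum_em cring.cring_simprules)

lemma em_minus: "x \<in> carrier R \<Longrightarrow> em R (\<ominus> x) = - em R x"
  by (rule uring_eqI) (auto simp: uval_em unum_em cring.cring_simprules)

lemma em_range: "{t. em R \<one> * t = t} = em R ` carrier R"
proof (intro Set.set_eqI iffI)
  fix t assume "t \<in> {t. em R \<one> * t = t}"
  then have t: "em R \<one> * t = t" by simp
  have "t = em R (uval t R)"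
  proof (rule uring_eqI)
    fix S :: "('a, 'b) ring_scheme" assume S: "cring S"
    have "uval t S = uval (em R \<one> * t) S" using t by simp
    also have "\<dots> = (if S = R then uval t R else \<zero>\<^bsub>S\<^esub>)"
      using S by (auto simp: uval_em uval_carrier cring.cring_simprules)
    finally show "uval t S = uval (em R (uval t R)) S" using S by (simp add: uval_em uval_carrier is_cring)
    next
    show "unum t = unum (em R (uval t R))" using arg_cong[OF t, of unum]
      by (simp add: unum_em uval_carrier is_cring)
  qed
  then show "t \<in> em R ` carrier R" using uval_carrier is_cring by blast
next
  fix t assume "t \<in> em R ` carrier R"
  then obtain x where "x \<in> carrier R" "t = em R x" by blast
  then show "t \<in> {t. em R \<one> * t = t}" by (simp add: em_mult[symmetric])
qed

lemma em_sum: assumes "finite A" "f \<in> A \<rightarrow> carrier R" shows "em R (\<Oplus>i\<in>A. f i) = (\<Sum>i\<in>A. em R (f i))"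
  using assms by (induction A) (auto simp: em_add Pi_iff intro!: em_add finsum_closed)

lemma em_nat: "x \<in> carrier R \<Longrightarrow> em R ([k] \<cdot> x) = of_nat k * em R x"
  by (induction k) (auto simp: em_add algebra_simps)

end

section \<open>Components of finite commutative rings\<close>

lemma subgroup_pow_card:
  fixes G (structure)
  assumes "group G" "subgroup H G" "x \<in> H"
  shows "x [^] card H = \<one>"
proof -
  interpret group G by fact
  interpret H: group "G\<lparr>carrier := H\<rparr>" using assms(2) by (rule subgroup.subgroup_is_group[OF _ assms(1)])
  have "x [^]\<^bsub>G\<lparr>carrier := H\<rparr>\<^esub> order (G\<lparr>carrier := H\<rparr>) = \<one>\<^bsub>G\<lparr>carrier := H\<rparr>\<^esub>"
    using assms(3) by (intro H.pow_order_eq_1) simp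
  then show ?thesis by (simp add: order_def nat_pow_def)
qed

text \<open>A nontrivial element of a Sylow subgroup; an element of \<open>q\<close>-power order
  suffices for the annihilator arguments below.\<close>

lemma Cauchy_power:
  fixes G (structure)
  assumes "group G" "finite (carrier G)" "prime q" "q dvd order G"
  shows "\<exists>x\<in>carrier G. x \<noteq> \<one> \<and> (\<exists>b. x [^] (q ^ b :: nat) = \<one>)"
proof -
  interpret group G by fact
  have ne: "order G \<noteq> 0" using assms(2) by (metis order_gt_0_iff_finite gr_implies_not0)
  have "q ^ multiplicity q (order G) dvd order G" by (rule multiplicity_dvd)
  then obtain m where m: "order G = q ^ multiplicity q (order G) * m" by blast
  from sylow_thm[OF assms(3,1) m assms(2)] obtain H where H: "subgroup H G" "card H = q ^ multiplicity q (order G)"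
    by blast
  have "multiplicity q (order G) > 0" using assms(3,4) ne by (simp add: prime_multiplicity_gt_zero_iff)
  then have "card H > 1" using H(2) assms(3) prime_gt_1_nat by (metis one_less_power)
  then have "H \<noteq> {\<one>}" by auto
  then obtain x where x: "x \<in> H" "x \<noteq> \<one>" using subgroup.one_closed[OF H(1)] by blast
  have "x [^] (q ^ multiplicity q (order G)) = \<one>" using subgroup_pow_card[OF assms(1) H(1) x(1)] H(2) by simp
  then show ?thesis using x subgroup.mem_carrier[OF H(1)] by blast
qed

lemma coprime_annihilators:
  fixes t :: "'a::comm_ring_1"
  assumes "of_nat a * t = 0" "of_nat b * t = 0" "coprime a b"
  shows "t = 0"
proof -
  obtain u v where uv: "u * int a + v * int b = 1"
    using bezout_int[of "int a" "int b"] assms(3) by auto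
  have "t = of_int (u * int a + v * int b) * t" by (simp add: uv)
  also have "\<dots> = of_int u * (of_nat a * t) + of_int v * (of_nat b * t)" by (simp add: algebra_simps)
  finally show ?thesis using assms by simp
qed

text \<open>A proper ideal of largest cardinality containing \<open>x\<close> is maximal, hence it
  is the unique maximal ideal.\<close>

lemma local_ring_nonunit:
  fixes R (structure)
  assumes "local_ring R" "finite (carrier R)" "x \<in> carrier R" "x \<notin> Units R"
  shows "x \<in> jacobson_radical R"
proof -
  interpret cring R using assms(1) by (simp add: local_ring_def)
  define F where "F = {I. ideal I R \<and> x \<in> I \<and> I \<noteq> carrier R}"
  have "PIdl x \<noteq> carrier R"
  proof
    assume "PIdl x = carrier R"
    then obtain y where "y \<in> carrier R" "\<one> = y \<otimes> x" unfolding cgenideal_def using one_closed by blast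
    then show False using assms(3,4) Units_def m_comm by fastforce
  qed
  then have ne: "PIdl x \<in> F" unfolding F_def using cgenideal_ideal cgenideal_self assms(3) by simp
  have sub: "F \<subseteq> Pow (carrier R)"
    unfolding F_def using additive_subgroup.a_subset ideal.axioms(1) by blast
  then have "finite F" using assms(2) by (metis finite_Pow_iff finite_subset)
  then have "Max (card ` F) \<in> card ` F" using ne by (intro Max_in) auto
  then obtain M where M: "M \<in> F" "card M = Max (card ` F)" by auto
  have max: "card I \<le> card M" if "I \<in> F" for I using M(2) that \<open>finite F\<close> by simp
  have "maximalideal M R"
  proof (rule maximalidealI)
    show "ideal M R" "carrier R \<noteq> M" using M(1) by (auto simp: F_def)
    fix J assume J: "ideal J R" "M \<subseteq> J" "J \<subseteq> carrier R"
    show "J = M \<or> J = carrier R"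
    proof (rule disjCI)
      assume "J \<noteq> carrier R"
      then have "J \<in> F" using J M(1) by (auto simp: F_def)
      then have "M = J" using max J(2,3) assms(2) by (meson card_seteq finite_subset)
      then show "J = M" by simp
    qed
  qed
  then have "{M. maximalideal M R} = {M}" using assms(1) by (auto simp: local_ring_def)
  then show ?thesis using M(1) assms(3) by (simp add: jacobson_radical_def F_def)
qed

locale cg_ring = cring R for R (structure) +
  assumes CG: "CG_ring R" and odd_char: "odd (ring_characteristic R)"
begin

definition nR :: nat where "nR = card (carrier R)"
definition mu :: "nat \<Rightarrow> nat" where "mu p = multiplicity p nR"
text \<open>The Chinese remainder solution for 1 modulo \<open>p^mu p\<close> and 0 modulo the
  cofactor of \<open>nR\<close>; its multiple of the identity is the idempotent of the
  \<open>p\<close>-component.\<close>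

definition cc :: "nat \<Rightarrow> nat" where
  "cc p = (SOME c. [c = 1] (mod p ^ mu p) \<and> nR div p ^ mu p dvd c)"
definition ep :: "nat \<Rightarrow> ('a, 'b) uring" where "ep p = of_nat (cc p) * em R \<one>"
text \<open>\<open>p^nn p\<close> is the characteristic of the \<open>p\<close>-component and can be
  smaller than its order \<open>p^mu p\<close>.\<close>

definition nn :: "nat \<Rightarrow> nat" where "nn p = (LEAST k. of_nat p ^ k * ep p = 0)"
definition w :: "nat \<Rightarrow> 'a" where "w p = [cc p] \<cdot> \<one>"
definition K :: "nat \<Rightarrow> 'a set" where "K p = {x\<in>carrier R. ep p * em R x = em R x}"
abbreviation PP :: "nat set" where "PP \<equiv> ring_primes R"

lemma fin: "finite (carrier R)" using CG by (simp add: CG_ring_def)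
lemma nR_pos: "nR > 0" using fin zero_closed by (auto simp: nR_def card_gt_0_iff)
lemma PP_iff: "p \<in> PP \<longleftrightarrow> prime p \<and> p dvd nR" by (auto simp: ring_primes_def nR_def)
lemma PP_prime_factors: "PP = prime_factors nR"
  using nR_pos by (auto simp: PP_iff prime_factors_dvd)
lemma em_one [simp]: "em R \<one> * em R \<one> = em R \<one>" by (simp add: em_mult[symmetric])
lemma em_one_mult [simp]: "x \<in> carrier R \<Longrightarrow> em R \<one> * em R x = em R x" by (simp add: em_mult[symmetric])

lemma em_eq_iff: "x \<in> carrier R \<Longrightarrow> y \<in> carrier R \<Longrightarrow> em R x = em R y \<longleftrightarrow> x = y"
  using em_inj by (auto simp: inj_on_def)

lemma em_eq0: "x \<in> carrier R \<Longrightarrow> em R x = 0 \<longleftrightarrow> x = \<zero>" using em_eq_iff[of x \<zero>] by simp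

lemma group_add: "group (add_monoid R)" by (rule a_group)

lemma nR_kills: assumes "nR dvd k" shows "of_nat k * em R \<one> = 0"
proof -
  have "[nR] \<cdot> \<one> = \<zero>" using group.pow_order_eq_1[OF group_add, of \<one>]
    by (simp add: add_pow_def order_def nR_def)
  then have 0: "of_nat nR * em R \<one> = 0" using em_nat[of \<one> nR] by simp
  from assms obtain j where "k = j * nR" by (metis dvdE mult.commute)
  then show ?thesis using 0 by (simp add: mult.assoc)
qed

lemma cong_of_nat: assumes "[k = l] (mod nR)" shows "of_nat k * em R \<one> = of_nat l * em R \<one>"
proof -
  from assms obtain a b where "l + a * nR = k + b * nR" by (auto simp: cong_iff_lin_nat)
  then have "of_nat (l + a * nR) * em R \<one> = of_nat (k + b * nR) * em R \<one>" by simp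
  moreover have "of_nat (a * nR) * em R \<one> = 0" "of_nat (b * nR) * em R \<one> = 0"
    by (rule nR_kills; simp)+
  ultimately show ?thesis by (simp only: of_nat_add distrib_right) simp
qed

lemma nR_split: assumes "p \<in> PP"
  shows "nR = p ^ mu p * (nR div p ^ mu p)" "coprime (p ^ mu p) (nR div p ^ mu p)" "0 < mu p"
proof -
  show 1: "nR = p ^ mu p * (nR div p ^ mu p)" by (simp add: mu_def multiplicity_dvd)
  have p: "prime p" using assms by (simp add: PP_iff)
  have "\<not> p dvd nR div p ^ mu p"
    using multiplicity_decompose[of nR p] nR_pos p prime_gt_1_nat[of p] by (auto simp: mu_def)
  then show "coprime (p ^ mu p) (nR div p ^ mu p)" using p by (simp add: prime_imp_coprime)
  show "0 < mu p" using assms nR_pos by (simp add: PP_iff mu_def prime_multiplicity_gt_zero_iff)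
qed

lemma cc: assumes "p \<in> PP" shows "[cc p = 1] (mod p ^ mu p)" "nR div p ^ mu p dvd cc p"
proof -
  obtain c where "[c = 1] (mod p ^ mu p)" "[c = 0] (mod (nR div p ^ mu p))"
    using binary_chinese_remainder_nat[OF nR_split(2)[OF assms]] by blast
  then have "[c = 1] (mod p ^ mu p) \<and> nR div p ^ mu p dvd c" by (simp add: cong_0_iff)
  from someI[of "\<lambda>c. [c = 1] (mod p ^ mu p) \<and> nR div p ^ mu p dvd c", OF this]
  show "[cc p = 1] (mod p ^ mu p)" "nR div p ^ mu p dvd cc p" by (auto simp: cc_def)
qed

lemma cong_nR: assumes "\<And>p. p \<in> PP \<Longrightarrow> [x = y] (mod p ^ mu p)" shows "[x = y] (mod nR)"
proof -
  have "nR = (\<Prod>p\<in>PP. p ^ mu p)"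
    unfolding PP_prime_factors mu_def using prime_factorization_nat[OF nR_pos] .
  moreover have "[x = y] (mod (\<Prod>p\<in>PP. p ^ mu p))"
    using assms by (intro coprime_cong_prod_nat) (auto simp: PP_iff primes_coprime)
  ultimately show ?thesis by simp
qed

lemma cc_other: assumes "p \<in> PP" "q \<in> PP" "p \<noteq> q" shows "[cc p = 0] (mod q ^ mu q)"
proof -
  have "coprime (q ^ mu q) (p ^ mu p)" using assms by (auto simp: PP_iff primes_coprime)
  moreover have "q ^ mu q dvd p ^ mu p * (nR div p ^ mu p)"
    using nR_split(1)[OF assms(1)] multiplicity_dvd[of q nR] by (simp add: mu_def)
  ultimately have "q ^ mu q dvd nR div p ^ mu p" by (simp add: coprime_dvd_mult_right_iff)
  then show ?thesis using cc(2)[OF assms(1)] by (auto simp: cong_0_iff intro: dvd_trans)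
qed

lemma cc_ite: "p \<in> PP \<Longrightarrow> q \<in> PP \<Longrightarrow> [cc p = (if p = q then 1 else 0)] (mod q ^ mu q)"
  using cc cc_other by auto

lemma finite_PP: "finite PP" by (simp add: PP_prime_factors)

lemma ep_idem: assumes "p \<in> PP" shows "ep p * ep p = ep p"
proof -
  have "[cc p * cc p = cc p] (mod nR)"
  proof (rule cong_nR)
    fix q assume "q \<in> PP"
    from cc_ite[OF assms this] have "[cc p * cc p = (if p = q then 1 else 0) * cc p] (mod q ^ mu q)"
      by (intro cong_mult) auto
    then show "[cc p * cc p = cc p] (mod q ^ mu q)"
      using cc_ite[OF assms \<open>q \<in> PP\<close>] by (auto intro: cong_trans cong_sym split: if_splits)
  qed
  from cong_of_nat[OF this] have "of_nat (cc p) * of_nat (cc p) * em R \<one> = ep p" by (simp add: ep_def)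
  moreover have "ep p * ep p = of_nat (cc p) * of_nat (cc p) * (em R \<one> * em R \<one>)"
    by (simp only: ep_def mult_ac)
  ultimately show ?thesis by simp
qed

lemma ep_orth: assumes "p \<in> PP" "q \<in> PP" "p \<noteq> q" shows "ep p * ep q = 0"
proof -
  have "[cc p * cc q = 0] (mod nR)"
  proof (rule cong_nR)
    fix r assume r: "r \<in> PP"
    have "[cc p * cc q = (if p = r then 1 else 0) * (if q = r then 1 else 0)] (mod r ^ mu r)"
      by (intro cong_mult cc_ite assms r)
    then show "[cc p * cc q = 0] (mod r ^ mu r)" using assms(3) by (auto split: if_splits)
  qed
  from cong_of_nat[OF this] have "of_nat (cc p) * of_nat (cc q) * em R \<one> = 0" by simp
  moreover have "ep p * ep q = of_nat (cc p) * of_nat (cc q) * (em R \<one> * em R \<one>)"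
    by (simp only: ep_def mult_ac)
  ultimately show ?thesis by simp
qed

lemma sum_ep_one: "(\<Sum>p\<in>PP. ep p) = em R \<one>"
proof -
  have "[(\<Sum>p\<in>PP. cc p) = 1] (mod nR)"
  proof (rule cong_nR)
    fix q assume q: "q \<in> PP"
    have "[(\<Sum>p\<in>PP. cc p) = (\<Sum>p\<in>PP. if p = q then 1 else 0)] (mod q ^ mu q)"
      using cc_ite q by (intro cong_sum) auto
    then show "[(\<Sum>p\<in>PP. cc p) = 1] (mod q ^ mu q)" using q finite_PP by (simp add: sum.delta)
  qed
  from cong_of_nat[OF this] show ?thesis by (simp add: ep_def sum_distrib_right)
qed

lemma ep_pow_mu: assumes "p \<in> PP" shows "of_nat p ^ mu p * ep p = 0"
proof -
  have "nR dvd p ^ mu p * cc p" using nR_split(1)[OF assms] cc(2)[OF assms] by (metis mult_dvd_mono dvd_refl)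
  from nR_kills[OF this] show ?thesis by (simp add: ep_def mult.assoc)
qed

lemma ep_fix: assumes "p \<in> PP" "x \<in> carrier R" "of_nat p ^ mu p * em R x = 0" shows "ep p * em R x = em R x"
proof -
  from cc(1)[OF assms(1)] obtain a b where "1 + a * p ^ mu p = cc p + b * p ^ mu p"
    by (auto simp: cong_iff_lin_nat)
  then have "of_nat (1 + a * p ^ mu p) * em R x = of_nat (cc p + b * p ^ mu p) * em R x" by simp
  then have "em R x + of_nat a * (of_nat p ^ mu p * em R x) = of_nat (cc p) * em R x + of_nat b * (of_nat p ^ mu p * em R x)"
    by (simp add: algebra_simps)
  then have "em R x = of_nat (cc p) * em R x" by (simp only: assms(3)) simp
  then show ?thesis using assms(2) by (simp add: ep_def mult.assoc)
qed

lemma K_iff: assumes "p \<in> PP" shows "x \<in> K p \<longleftrightarrow> x \<in> carrier R \<and> of_nat p ^ mu p * em R x = 0"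
  unfolding K_def using ep_fix[OF assms] ep_pow_mu[OF assms] 
  by auto (metis mult.assoc mult_zero_left)

lemma pow_kill: "x \<in> carrier R \<Longrightarrow> [k] \<cdot> x = \<zero> \<longleftrightarrow> of_nat k * em R x = 0"
  by (metis add.nat_pow_closed em_eq0 em_nat)

lemma K_subgroup: assumes "p \<in> PP" shows "subgroup (K p) (add_monoid R)"
proof (rule group.subgroupI[OF group_add])
  show "K p \<subseteq> carrier (add_monoid R)" by (auto simp: K_def)
  show "K p \<noteq> {}" by (auto simp: K_def intro!: exI[of _ \<zero>])
  show "inv\<^bsub>add_monoid R\<^esub> a \<in> K p" if "a \<in> K p" for a
    using that by (auto simp: K_def em_minus a_inv_def[symmetric])
  show "a \<otimes>\<^bsub>add_monoid R\<^esub> b \<in> K p" if "a \<in> K p" "b \<in> K p" for a b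
    using that by (auto simp: K_def em_add distrib_left)
qed

text \<open>A prime divisor of the order of \<open>K p\<close> other than \<open>p\<close> would
  give a nonzero element annihilated by two coprime numbers.\<close>

lemma card_K_dvd: assumes p: "p \<in> PP" shows "card (K p) dvd p ^ mu p"
proof -
  have sg: "subgroup (K p) (add_monoid R)" by (rule K_subgroup[OF p])
  have "card (K p) dvd order (add_monoid R)" using group.lagrange[OF group_add sg] by (metis dvd_triv_right)
  then have "card (K p) dvd p ^ mu p * (nR div p ^ mu p)"
    using nR_split(1)[OF p] by (simp add: order_def nR_def)
  moreover have "coprime (card (K p)) (nR div p ^ mu p)"
  proof (rule ccontr)
    assume "\<not> coprime (card (K p)) (nR div p ^ mu p)"
    then have "gcd (card (K p)) (nR div p ^ mu p) \<noteq> 1" by (simp add: coprime_iff_gcd_eq_1)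
    from prime_factor_nat[OF this] obtain q where "prime q" "q dvd gcd (card (K p)) (nR div p ^ mu p)" by blast
    then have q: "prime q" "q dvd card (K p)" "q dvd nR div p ^ mu p" by simp_all
    let ?K = "add_monoid R\<lparr>carrier := K p\<rparr>"
    have "group ?K" by (rule subgroup.subgroup_is_group[OF sg group_add])
    moreover have "finite (carrier ?K)" using fin by (auto simp: K_def)
    ultimately obtain x b where x: "x \<in> K p" "x \<noteq> \<zero>" "x [^]\<^bsub>?K\<^esub> (q ^ b) = \<zero>"
      using Cauchy_power[of ?K q] q(1,2) by (auto simp: order_def)
    then have xR: "x \<in> carrier R" by (simp add: K_def)
    have "[(q ^ b)] \<cdot> x = \<zero>" using x(3) by (simp add: add_pow_def nat_pow_def)
    then have "of_nat (q ^ b) * em R x = 0" using pow_kill xR by blast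
    moreover have "of_nat (p ^ mu p) * em R x = 0" using x(1) K_iff[OF p] by simp
    moreover have "coprime (q ^ b) (p ^ mu p)"
    proof -
      have "q \<noteq> p"
      proof
        assume "q = p"
        then have "q dvd p ^ mu p" using nR_split(3)[OF p] by (simp add: dvd_power)
        then have "is_unit q" using q(3) nR_split(2)[OF p] coprime_common_divisor by blast
        then show False using q(1) not_prime_unit by blast
      qed
      then show ?thesis using q(1) p by (auto simp: PP_iff primes_coprime)
    qed
    ultimately have "em R x = 0" by (rule coprime_annihilators)
    then show False using em_eq0 xR x(2) by simp
  qed
  ultimately show ?thesis by (simp add: coprime_dvd_mult_left_iff)
qed

text \<open>A subgroup of order \<open>p^mu p\<close> is annihilated by that number, so it lies in
  \<open>K p\<close>, and by size it equals \<open>K p\<close>. This justifies the definite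
  description.\<close>

lemma sylow_part: assumes p: "p \<in> PP" shows "sylow_part R p = K p"
proof -
  have eq: "H = K p" if H: "subgroup H (add_monoid R)" "card H = p ^ mu p" for H
  proof -
    have "H \<subseteq> K p"
    proof
      fix x assume x: "x \<in> H"
      then have "[card H] \<cdot> x = \<zero>" using subgroup_pow_card[OF group_add H(1)] by (simp add: add_pow_def)
      moreover have "x \<in> carrier R" using x subgroup.subset[OF H(1)] by auto
      ultimately show "x \<in> K p" using pow_kill H(2) K_iff[OF p] by (metis of_nat_power)
    qed
    moreover have "finite (K p)" using fin by (simp add: K_def)
    moreover have "card (K p) \<le> card H" using card_K_dvd[OF p] H(2) p prime_gt_0_nat
      by (auto simp: PP_iff intro!: dvd_imp_le)
    ultimately show ?thesis by (metis card_seteq)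
  qed
  have "order (add_monoid R) = p ^ mu p * (nR div p ^ mu p)"
    using nR_split(1)[OF p] by (simp add: order_def nR_def)
  from sylow_thm[OF _ group_add this] obtain H where H: "subgroup H (add_monoid R)" "card H = p ^ mu p"
    using p fin by (auto simp: PP_iff)
  show ?thesis unfolding sylow_part_def nR_def[symmetric] mu_def[symmetric]
    by (rule the_equality) (use H eq in auto)
qed

text \<open>Otherwise the other idempotents sum to the identity and the cofactor of
  \<open>p^mu p\<close> in \<open>nR\<close> annihilates the ring, contrary to an element of
  \<open>p\<close>-power order.\<close>

lemma ep_nonzero: assumes p: "p \<in> PP" shows "ep p \<noteq> 0"
proof
  assume "ep p = 0"
  obtain x b where x: "x \<in> carrier R" "x \<noteq> \<zero>" "[(p ^ b)] \<cdot> x = \<zero>"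
    using Cauchy_power[OF group_add, of p] p fin by (auto simp: PP_iff order_def nR_def add_pow_def)
  have "of_nat (nR div p ^ mu p) * em R \<one> = 0 \<Longrightarrow> False"
  proof -
    assume a: "of_nat (nR div p ^ mu p) * em R \<one> = 0"
    then have "of_nat (nR div p ^ mu p) * em R x = 0"
      using x(1) by (metis em_one_mult mult.assoc mult_zero_left)
    moreover have "of_nat (p ^ b) * em R x = 0" using pow_kill x(1,3) by blast
    moreover have "coprime (nR div p ^ mu p) (p ^ b)" using nR_split[OF p]
      by (metis coprime_commute coprime_power_left_iff coprime_power_right_iff neq0_conv)
    ultimately show False using coprime_annihilators em_eq0 x(1,2) by blast
  qed
  moreover have "of_nat (nR div p ^ mu p) * em R \<one> = 0"
  proof -
    have "ep q * of_nat (nR div p ^ mu p) = 0" if q: "q \<in> PP" for q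
    proof (cases "q = p")
      case True then show ?thesis using \<open>ep p = 0\<close> by simp
    next
      case False
      have "coprime (q ^ mu q) (p ^ mu p)" using p q False by (auto simp: PP_iff primes_coprime)
      moreover have "q ^ mu q dvd p ^ mu p * (nR div p ^ mu p)"
        using nR_split(1)[OF p] multiplicity_dvd[of q nR] by (simp add: mu_def)
      ultimately have "q ^ mu q dvd nR div p ^ mu p" by (simp add: coprime_dvd_mult_right_iff)
      then obtain j where "nR div p ^ mu p = q ^ mu q * j" by blast
      then have "ep q * of_nat (nR div p ^ mu p) = (of_nat q ^ mu q * ep q) * of_nat j" by (simp add: mult_ac)
      then show ?thesis using ep_pow_mu[OF q] by simp
    qed
    then have "(\<Sum>q\<in>PP. ep q * of_nat (nR div p ^ mu p)) = 0" by simp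
    then show ?thesis by (simp add: sum_distrib_right[symmetric] sum_ep_one mult.commute)
  qed
  ultimately show False by blast
qed

lemma w_carrier [simp]: "w p \<in> carrier R" by (simp add: w_def)
lemma em_w: "em R (w p) = ep p" by (simp add: w_def ep_def em_nat)

lemma component_one:
  assumes "v \<in> S" "S \<subseteq> carrier R" "\<And>x. x \<in> S \<Longrightarrow> v \<otimes> x = x"
  shows "one (component_ring R S) = v"
proof -
  have "(THE e. e \<in> S \<and> (\<forall>x\<in>S. e \<otimes> x = x)) = v"
  proof (rule the_equality)
    fix e assume e: "e \<in> S \<and> (\<forall>x\<in>S. e \<otimes> x = x)"
    then have "e = v \<otimes> e" "v = e \<otimes> v" using assms by auto
    then show "e = v" using e assms m_comm by (metis subsetD)
  qed (use assms in auto)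
  then show ?thesis by (simp add: component_ring_def)
qed

lemma component_simps [simp]: "carrier (component_ring R S) = S" "monoid.mult (component_ring R S) = monoid.mult R"
   "add (component_ring R S) = add R" "zero (component_ring R S) = zero R"
  by (simp_all add: component_ring_def)

lemma K_one: assumes p: "p \<in> PP" shows "one (ring_component R p) = w p"
  unfolding ring_component_def sylow_part[OF p]
proof (rule component_one)
  show "w p \<in> K p" using p by (simp add: K_def em_w ep_idem)
  show "K p \<subseteq> carrier R" by (auto simp: K_def)
  show "w p \<otimes> x = x" if "x \<in> K p" for x
  proof -
    have "em R (w p \<otimes> x) = em R x" using that by (simp add: em_mult em_w K_def)
    then show ?thesis using that em_eq_iff by (simp add: K_def)
  qed
qed

lemma comp_add_pow: fixes k :: nat shows "[k] \<cdot>\<^bsub>component_ring R S\<^esub> x = [k] \<cdot> x"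
  by (simp add: add_pow_def nat_pow_def component_ring_def)

text \<open>The Galois ring condition says that a nonunit of the \<open>p\<close>-component is
  \<open>p\<close> times an element. An arbitrary \<open>t\<close> of the ambient ring is first cut
  down to that component.\<close>

lemma cg_loc: assumes p: "p \<in> PP"
  shows "(\<exists>y. ep p * t * y = ep p) \<or> (\<exists>y. ep p * t = of_nat p * ep p * y)"
proof -
  have "em R \<one> * t \<in> {t. em R \<one> * t = t}" by (simp add: mult.assoc[symmetric])
  then obtain x0 where x0: "x0 \<in> carrier R" "em R \<one> * t = em R x0" unfolding em_range by blast
  define x where "x = w p \<otimes> x0"
  have xK: "x \<in> carrier R" using x0 by (simp add: x_def)
  have emx: "em R x = ep p * t"
  proof -
    have "em R x = ep p * (em R \<one> * t)" using x0 by (simp add: x_def em_mult em_w)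
    then show ?thesis by (simp add: ep_def mult.assoc[symmetric])
      (metis (no_types, lifting) em_one mult.assoc mult.commute)
  qed
  have "x \<in> K p" using xK emx ep_idem[OF p] by (simp add: K_def mult.assoc[symmetric])
  let ?R = "ring_component R p"
  have gr: "galois_ring p ?R" using CG p by (simp add: CG_ring_def)
  have car: "carrier ?R = K p" by (simp add: ring_component_def sylow_part[OF p])
  show ?thesis
  proof (cases "x \<in> Units ?R")
    case True
    then obtain y where y: "y \<in> K p" "x \<otimes> y = w p"
      unfolding Units_def car K_one[OF p] by (auto simp: ring_component_def)
    then have "em R x * em R y = ep p" using xK by (simp add: em_mult[symmetric] em_w K_def)
    then show ?thesis unfolding emx by blast
  next
    case False
    have "x \<in> jacobson_radical ?R"
      using gr False \<open>x \<in> K p\<close> fin by (intro local_ring_nonunit) (auto simp: galois_ring_def car K_def)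
    then obtain y where y: "y \<in> K p" "x = [p] \<cdot>\<^bsub>?R\<^esub> y" using gr by (auto simp: galois_ring_def car)
    then have "x = [p] \<cdot> y" by (simp add: ring_component_def comp_add_pow)
    then have "em R x = of_nat p * em R y" using y(1) by (simp add: em_nat K_def)
    also have "\<dots> = of_nat p * ep p * em R y" using y(1) by (simp add: K_def mult.assoc)
    finally show ?thesis unfolding emx by blast
  qed
qed

text \<open>The idempotent of a 2-component would be annihilated both by a power of 2 and by the odd
  characteristic.\<close>

lemma PP_odd: assumes p: "p \<in> PP" shows "odd p"
proof
  assume "even p"
  then have p2: "p = 2" using p by (simp add: PP_iff prime_nat_iff) (metis primes_dvd_imp_eq two_is_prime_nat p PP_iff)
  let ?k = "ring_characteristic R"
  have "[?k] \<cdot> \<one> = \<zero>" using group.pow_ord_eq_1[OF group_add, of \<one>]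
    by (simp add: ring_characteristic_def add_pow_def)
  then have "of_nat ?k * em R \<one> = 0" using pow_kill by blast
  then have "of_nat ?k * ep p = 0" by (metis ep_def mult.left_commute mult_zero_right)
  moreover have "of_nat (2 ^ mu p) * ep p = 0" using ep_pow_mu[OF p] p2 by simp
  moreover have "coprime ?k (2 ^ mu p)" using odd_char by simp
  ultimately show False using coprime_annihilators ep_nonzero[OF p] by blast
qed

lemma nn: assumes p: "p \<in> PP"
  shows "0 < nn p" "of_nat p ^ nn p * ep p = 0" "of_nat p ^ (nn p - 1) * ep p \<noteq> 0"
proof -
  show 1: "of_nat p ^ nn p * ep p = 0" unfolding nn_def by (rule LeastI[of _ "mu p"]) (rule ep_pow_mu[OF p])
  show 2: "0 < nn p" using 1 ep_nonzero[OF p] by (cases "nn p") auto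
  have "nn p - 1 < nn p" using 2 by simp
  from not_less_Least[OF this[unfolded nn_def]] show "of_nat p ^ (nn p - 1) * ep p \<noteq> 0"
    unfolding nn_def by blast
qed

lemma cg_data: "cg_data PP ep nn"
proof
  fix p assume p: "p \<in> PP"
  show "prime p" using p by (simp add: PP_iff)
  show "odd p" by (rule PP_odd[OF p])
  show "ep p * ep p = ep p" by (rule ep_idem[OF p])
  show "ep p * ep q = 0" if "q \<in> PP" "p \<noteq> q" for q using ep_orth p that by blast
  show "(\<exists>y. ep p * x * y = ep p) \<or> (\<exists>y. ep p * x = of_nat p * ep p * y)" for x by (rule cg_loc[OF p])
qed (use finite_PP nn fin in \<open>simp_all add: sum_ep_one em_range\<close>)

end

section \<open>From S-rings to basic sets\<close>

lemma int_lincomb_at: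
  assumes "finite S" "disjoint S" "X \<in> S" "x \<in> X"
  shows "int_lincomb (indicator ` S) c x = c (indicator X)"
proof -
  have "c b * b x = (if b = indicator X then c b else 0)" if b: "b \<in> indicator ` S" for b :: "'a \<Rightarrow> int"
  proof -
    from b obtain Z where Z: "Z \<in> S" "b = indicator Z" by blast
    show ?thesis
    proof (cases "Z = X")
      case True then show ?thesis using Z assms(4) by simp
    next
      case False
      then have "x \<notin> Z" using Z assms by (auto simp: disjoint_def)
      then have "b x = 0" using Z by simp
      moreover have "b \<noteq> indicator X" using \<open>b x = 0\<close> assms(4) by auto
      ultimately show ?thesis by simp
    qed
  qed
  then have "int_lincomb (indicator ` S) c x = (\<Sum>b\<in>indicator ` S. if b = indicator X then c b else 0)"
    unfolding int_lincomb_def by (rule sum.cong[OF refl])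
  also have "\<dots> = c (indicator X)" using assms(1,3) by (simp add: sum.delta)
  finally show ?thesis .
qed

lemma int_lincomb_outside: assumes "x \<notin> \<Union>S" shows "int_lincomb (indicator ` S) c x = 0"
  unfolding int_lincomb_def using assms by (intro sum.neutral) (auto simp: indicator_def)

text \<open>The coefficient of a block is the value of the function at any of its points, so the
  span consists of the functions constant on blocks; all closure properties are checked in this
  form.\<close>

lemma int_span_indicator:
  assumes "finite S" "disjoint S"
  shows "int_span (indicator ` S) =
    {f. (\<forall>x. x \<notin> \<Union>S \<longrightarrow> f x = 0) \<and> (\<forall>X\<in>S. \<forall>x\<in>X. \<forall>y\<in>X. f x = f y)}" (is "?L = ?F")
proof (intro Set.set_eqI iffI)
  fix f :: "'a \<Rightarrow> int" assume f: "f \<in> ?L"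
  then obtain c where "f = int_lincomb (indicator ` S) c" by (auto simp: int_span_def)
  then have "f x = 0" if "x \<notin> \<Union>S" for x using int_lincomb_outside[OF that] by simp
  moreover have "f x = f y" if "X \<in> S" "x \<in> X" "y \<in> X" for X x y
    using int_span_indicator_const[OF f assms(2) that] .
  ultimately show "f \<in> ?F" by (intro CollectI conjI allI ballI impI)
next
  fix f :: "'a \<Rightarrow> int" assume f: "f \<in> ?F"
  define c where "c = restrict (\<lambda>b. f (SOME x. b x = (1::int))) (indicator ` S)"
  have "f = int_lincomb (indicator ` S) c"
  proof
    fix x
    show "f x = int_lincomb (indicator ` S) c x"
    proof (cases "x \<in> \<Union>S")
      case False
      then have "f x = 0" using f by blast
      then show ?thesis using int_lincomb_outside[OF False] by simp
    next
      case True
      then obtain X where X: "X \<in> S" "x \<in> X" by blast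
      have "indicator X (SOME y. indicator X y = (1::int)) = (1::int)"
        by (rule someI[of _ x]) (simp add: X)
      then have "(SOME y. indicator X y = (1::int)) \<in> X" by (auto simp: indicator_def split: if_splits)
      then have "f (SOME y. indicator X y = (1::int)) = f x" using f X by blast
      then have "c (indicator X) = f x" using X(1) by (simp add: c_def)
      then show ?thesis using int_lincomb_at[OF assms X] by simp
    qed
  qed
  then show "f \<in> ?L" unfolding int_span_def by (auto simp: c_def)
qed

lemma int_lincomb_inj:
  assumes "finite S" "disjoint S" "{} \<notin> S"
  shows "inj_on (int_lincomb (indicator ` S)) (indicator ` S \<rightarrow>\<^sub>E UNIV)"
proof (rule inj_onI)
  fix c d assume c: "c \<in> indicator ` S \<rightarrow>\<^sub>E UNIV" and d: "d \<in> indicator ` S \<rightarrow>\<^sub>E UNIV"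
    and eq: "int_lincomb (indicator ` S) c = int_lincomb (indicator ` S) d"
  show "c = d"
  proof (rule PiE_ext[OF c d])
    fix b :: "'a \<Rightarrow> int" assume "b \<in> indicator ` S"
    then obtain X where X: "X \<in> S" "b = indicator X" by blast
    then obtain x where "x \<in> X" using assms(3) by (metis all_not_in_conv)
    then show "c b = d b" using int_lincomb_at[OF assms(1,2) X(1)] X(2) eq by metis
  qed
qed

lemma int_basis_indicator:
  assumes "finite S" "disjoint S" "{} \<notin> S"
  shows "int_basis (int_span (indicator ` S)) (indicator ` S)"
  using assms int_lincomb_inj by (simp add: int_basis_def)

lemma partition_blocks_eq: "partition_on U S \<Longrightarrow> X \<in> S \<Longrightarrow> Y \<in> S \<Longrightarrow> x \<in> X \<Longrightarrow> x \<in> Y \<Longrightarrow> X = Y"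
  by (auto simp: partition_on_def disjoint_def)

text \<open>The elements all of whose multiples translate \<open>X\<close> into itself form an ideal
  with \<open>X + I = X\<close>, and any other such ideal consists of such elements. So the greatest
  ideal exists and is explicit.\<close>

lemma (in cring) ideal_stabilizer_eq:
  assumes X: "X \<subseteq> carrier R"
  shows "ideal_stabilizer R X = {a\<in>carrier R. \<forall>b\<in>carrier R. \<forall>x\<in>X. x \<oplus> b \<otimes> a \<in> X}" (is "_ = ?J")
  unfolding ideal_stabilizer_def
proof (rule Greatest_equality)
  have J: "ideal ?J R"
  proof (rule idealI[OF ring_axioms])
    show "subgroup ?J (add_monoid R)"
    proof (rule group.subgroupI[OF a_group])
      show "?J \<subseteq> carrier (add_monoid R)" by auto
      show "?J \<noteq> {}" using X by (auto intro!: exI[of _ \<zero>])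
      show "inv\<^bsub>add_monoid R\<^esub> a \<in> ?J" if a: "a \<in> ?J" for a
      proof -
        have "x \<oplus> b \<otimes> \<ominus> a \<in> X" if "b \<in> carrier R" "x \<in> X" for b x
        proof -
          have "x \<oplus> \<ominus> b \<otimes> a \<in> X" using a that by simp
          then show ?thesis using a that by (simp add: l_minus r_minus)
        qed
        then show ?thesis using a by (simp add: a_inv_def[symmetric])
      qed
      show "a \<otimes>\<^bsub>add_monoid R\<^esub> a' \<in> ?J" if a: "a \<in> ?J" "a' \<in> ?J" for a a'
      proof -
        have "x \<oplus> b \<otimes> (a \<oplus> a') \<in> X" if b: "b \<in> carrier R" "x \<in> X" for b x
        proof -
          have "x \<oplus> b \<otimes> a \<in> X" using a b by simp
          then have "(x \<oplus> b \<otimes> a) \<oplus> b \<otimes> a' \<in> X" using a b by simp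
          moreover have "x \<in> carrier R" using X b by auto
          ultimately show ?thesis using a b by (simp add: r_distr a_assoc)
        qed
        then show ?thesis using a by simp
      qed
    qed
    show "c \<otimes> a \<in> ?J" if a: "a \<in> ?J" "c \<in> carrier R" for a c
    proof -
      have "x \<oplus> b \<otimes> (c \<otimes> a) \<in> X" if b: "b \<in> carrier R" "x \<in> X" for b x
      proof -
        have "x \<oplus> (b \<otimes> c) \<otimes> a \<in> X" using a b by blast
        then show ?thesis using a b by (simp add: m_assoc)
      qed
      then show ?thesis using a by simp
    qed
    then show "a \<otimes> c \<in> ?J" if a: "a \<in> ?J" "c \<in> carrier R" for a c
      using that m_comm[of a c] by fastforce
  qed
  moreover have "X <+>\<^bsub>R\<^esub> ?J = X"
  proof (intro Set.set_eqI iffI)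
    fix y assume "y \<in> X <+>\<^bsub>R\<^esub> ?J"
    then obtain x a where xa: "x \<in> X" "a \<in> ?J" "y = x \<oplus> a" by (auto simp: set_add_def')
    then have "x \<oplus> \<one> \<otimes> a \<in> X" by blast
    then show "y \<in> X" using xa by simp
  next
    fix y assume y: "y \<in> X"
    have "\<zero> \<in> ?J" by (intro additive_subgroup.zero_closed ideal.axioms(1) J)
    moreover have "y \<oplus> \<zero> = y" using y X by auto
    ultimately show "y \<in> X <+>\<^bsub>R\<^esub> ?J" using y unfolding set_add_def' by (metis (no_types, lifting) UN_iff insertI1)
  qed
  ultimately show "ideal ?J R \<and> X <+>\<^bsub>R\<^esub> ?J = X" by blast
  show "I \<le> ?J" if I: "ideal I R \<and> X <+>\<^bsub>R\<^esub> I = X" for I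
  proof
    fix a assume a: "a \<in> I"
    have "a \<in> carrier R" using I a by (meson ideal.Icarr)
    moreover have "x \<oplus> b \<otimes> a \<in> X" if "b \<in> carrier R" "x \<in> X" for b x
    proof -
      have "b \<otimes> a \<in> I" using I a that by (meson ideal.I_l_closed)
      then have "x \<oplus> b \<otimes> a \<in> X <+>\<^bsub>R\<^esub> I" using that by (auto simp: set_add_def')
      then show ?thesis using I by simp
    qed
    ultimately show "a \<in> ?J" by simp
  qed
qed

locale cg_S_ring = cg_ring R for R (structure) +
  fixes A :: "('a \<Rightarrow> int) set"
  assumes ringS: "ring_S_ring R A" and pureS: "pure_S_ring R A"
begin

definition BS :: "'a set set" where "BS = basic_sets (add_monoid R) A"
definition blk :: "'a \<Rightarrow> 'a set" where "blk x = (THE X. X \<in> BS \<and> x \<in> X)"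
definition bl :: "('a, 'b) uring \<Rightarrow> ('a, 'b) uring set" where "bl t = em R ` blk (uval t R)"

lemma BS_basic: "is_basic_partition (add_monoid R) A BS"
  using ringS basic_sets_eq by (metis BS_def S_ring_def ring_S_ring_def)

lemma BS_part: "partition_on (carrier R) BS" using BS_basic by (simp add: is_basic_partition_def)
lemma BS_zero: "{\<zero>} \<in> BS" using BS_basic by (simp add: is_basic_partition_def)
lemma BS_Union: "\<Union>BS = carrier R" using BS_part by (auto simp: partition_on_def)
lemma BS_disj: "disjoint BS" using BS_part by (simp add: partition_on_def)
lemma BS_ne: "{} \<notin> BS" using BS_part by (auto simp: partition_on_def)
lemma BS_fin: "finite BS" using BS_part fin by (metis BS_Union finite_UnionD)
lemma BS_sub: "X \<in> BS \<Longrightarrow> X \<subseteq> carrier R" using BS_Union by blast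
lemma BS_inv: "X \<in> BS \<Longrightarrow> set_inv\<^bsub>add_monoid R\<^esub> X \<in> BS" using BS_basic by (simp add: is_basic_partition_def)
lemma BS_unit: "X \<in> BS \<Longrightarrow> u \<in> Units R \<Longrightarrow> u <# X \<in> BS" using ringS by (simp add: ring_S_ring_def BS_def)

lemma A_eq: "A = {f. (\<forall>x. x \<notin> carrier R \<longrightarrow> f x = 0) \<and> (\<forall>X\<in>BS. \<forall>x\<in>X. \<forall>y\<in>X. f x = f y)}"
  using BS_basic int_span_indicator[OF BS_fin BS_disj] BS_Union
  by (simp add: is_basic_partition_def int_basis_def)

lemma blk: assumes "x \<in> carrier R" shows "blk x \<in> BS" "x \<in> blk x"
proof -
  obtain X where "X \<in> BS" "x \<in> X" using assms BS_Union by blast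
  then have "\<exists>!X. X \<in> BS \<and> x \<in> X" using partition_blocks_eq[OF BS_part] by blast
  from theI'[OF this] show "blk x \<in> BS" "x \<in> blk x" by (simp_all add: blk_def)
qed

lemma blk_eqI: "X \<in> BS \<Longrightarrow> x \<in> X \<Longrightarrow> blk x = X"
  using partition_blocks_eq[OF BS_part, of "blk x" X x] blk[of x] BS_sub[of X] by blast

lemma blk_sub: "x \<in> carrier R \<Longrightarrow> blk x \<subseteq> carrier R" using blk BS_sub by blast

lemma blk_same: "x \<in> carrier R \<Longrightarrow> y \<in> blk x \<Longrightarrow> blk y = blk x" using blk blk_eqI by blast

lemma bl_em: "x \<in> carrier R \<Longrightarrow> bl (em R x) = em R ` blk x" by (simp add: bl_def)

lemma bl_em_iff: "x \<in> carrier R \<Longrightarrow> y \<in> carrier R \<Longrightarrow> em R y \<in> bl (em R x) \<longleftrightarrow> y \<in> blk x"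
  using blk_sub[of x] em_eq_iff[of y] by (auto simp: bl_em)

lemma A_iff: "f \<in> A \<longleftrightarrow> (\<forall>x. x \<notin> carrier R \<longrightarrow> f x = 0) \<and> (\<forall>X\<in>BS. \<forall>x\<in>X. \<forall>y\<in>X. f x = f y)"
  using arg_cong[OF A_eq, of "\<lambda>S. f \<in> S"] by simp

lemma A_const: assumes "f \<in> A" "x \<in> carrier R" "y \<in> blk x" shows "f x = f y"
proof -
  have "\<forall>X\<in>BS. \<forall>x\<in>X. \<forall>y\<in>X. f x = f y" using assms(1) A_iff by blast
  then show ?thesis using blk[OF assms(2)] assms(3) by blast
qed

lemma A_mult: assumes "f \<in> A" "g \<in> A"
  shows "(\<lambda>x. if x \<in> carrier R then \<Sum>y\<in>carrier R. f y * g (\<ominus> y \<oplus> x) else 0) \<in> A"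
proof -
  have "subring A (group_ring (add_monoid R))" using ringS by (simp add: ring_S_ring_def S_ring_def)
  from subringE(6)[OF this assms] show ?thesis by (simp add: group_ring_def a_inv_def cong: if_cong)
qed

end

sublocale cg_ring \<subseteq> D: cg_data PP ep nn by (rule cg_data)

context cg_ring
begin

lemma E_PP: "D.E PP = em R \<one>" by (simp add: D.E_def sum_ep_one)
lemma D_C: "D.C = em R ` carrier R" by (simp add: D.C_def E_PP em_range)
lemma em_C [simp]: "x \<in> carrier R \<Longrightarrow> em R x \<in> D.C" by (simp add: D_C)

lemma Units_em: "x \<in> carrier R \<Longrightarrow> em R x \<in> D.Us \<longleftrightarrow> x \<in> Units R"
proof
  assume x: "x \<in> carrier R" and "em R x \<in> D.Us"
  then obtain y where y: "y \<in> carrier R" "em R x * em R y = em R \<one>" by (auto simp: D.Us_def D_C E_PP)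
  then have "x \<otimes> y = \<one>" using x em_eq_iff by (metis em_mult m_closed one_closed)
  moreover have "y \<otimes> x = x \<otimes> y" using m_comm x y by blast
  ultimately show "x \<in> Units R" using x y by (auto simp: Units_def)
next
  assume x: "x \<in> carrier R" and "x \<in> Units R"
  then obtain y where y: "y \<in> carrier R" "x \<otimes> y = \<one>" by (auto simp: Units_def)
  then have "em R x * em R y = em R \<one>" using x by (metis em_mult)
  then show "em R x \<in> D.Us" using x y by (auto simp: D.Us_def D_C E_PP)
qed

lemma mult_em_C: assumes "x \<in> carrier R" shows "\<exists>b\<in>carrier R. t * em R x = em R (b \<otimes> x)"
proof -
  have "t * em R \<one> \<in> D.C" by simp
  then obtain b where b: "b \<in> carrier R" "t * em R \<one> = em R b" unfolding D_C by blast
  have "t * em R x = t * em R \<one> * em R x" using assms by (simp add: mult.assoc)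
  also have "\<dots> = em R (b \<otimes> x)" using b assms by (simp add: em_mult)
  finally show ?thesis using b by blast
qed

end

context cg_S_ring
begin

lemma bl_unit: assumes u: "u \<in> D.Us" and x: "x \<in> D.C" shows "bl (u * x) = (*) u ` bl x"
proof -
  obtain u' where u': "u' \<in> carrier R" "u = em R u'" using D.Us_C[OF u] by (auto simp: D_C)
  obtain x' where x': "x' \<in> carrier R" "x = em R x'" using x by (auto simp: D_C)
  have U: "u' \<in> Units R" using u u' Units_em by simp
  have lc: "u' <# blk x' = (\<lambda>y. u' \<otimes> y) ` blk x'" by (auto simp: l_coset_def)
  have "u' <# blk x' \<in> BS" by (rule BS_unit[OF blk(1)[OF x'(1)] U])
  moreover have "u' \<otimes> x' \<in> u' <# blk x'" unfolding lc using blk(2)[OF x'(1)] by blast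
  ultimately have "blk (u' \<otimes> x') = u' <# blk x'" by (rule blk_eqI)
  then have "bl (u * x) = (\<lambda>y. em R (u' \<otimes> y)) ` blk x'"
    using u' x' by (simp add: em_mult[symmetric] bl_em lc image_image)
  also have "\<dots> = (\<lambda>y. u * em R y) ` blk x'"
    using u' subsetD[OF blk_sub[OF x'(1)]] by (intro image_cong) (auto simp: em_mult)
  also have "\<dots> = (*) u ` bl x" using x' by (simp add: bl_em image_image)
  finally show ?thesis .
qed

lemma bl_conv:
  fixes f g :: "('a, 'b) uring \<Rightarrow> int"
  assumes f: "\<And>x y. x \<in> D.C \<Longrightarrow> y \<in> bl x \<Longrightarrow> f x = f y"
    and g: "\<And>x y. x \<in> D.C \<Longrightarrow> y \<in> bl x \<Longrightarrow> g x = g y"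
    and x: "x \<in> D.C" and y: "y \<in> bl x"
  shows "(\<Sum>s\<in>D.C. f s * g (x - s)) = (\<Sum>s\<in>D.C. f s * g (y - s))"
proof -
  define r where "r h = (\<lambda>x. if x \<in> carrier R then h (em R x) else 0)" for h :: "('a, 'b) uring \<Rightarrow> int"
  have A: "r h \<in> A" if h: "\<And>x y. x \<in> D.C \<Longrightarrow> y \<in> bl x \<Longrightarrow> h x = h y" for h
  proof -
    have "r h x = r h y" if X: "X \<in> BS" "x \<in> X" "y \<in> X" for X x y
    proof -
      have xy: "x \<in> carrier R" "y \<in> carrier R" using X BS_sub by auto
      have "y \<in> blk x" using blk_eqI X by simp
      then have "h (em R x) = h (em R y)" using h xy bl_em_iff by simp
      then show ?thesis using xy by (simp add: r_def)
    qed
    moreover have "r h x = 0" if "x \<notin> carrier R" for x using that by (simp add: r_def)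
    ultimately show ?thesis unfolding A_iff by blast
  qed
  have sum: "(\<Sum>s\<in>D.C. f s * g (em R x - s)) = (\<Sum>s\<in>carrier R. r f s * r g (\<ominus> s \<oplus> x))"
    if "x \<in> carrier R" for x
  proof -
    have "(\<Sum>s\<in>D.C. f s * g (em R x - s)) = (\<Sum>s\<in>carrier R. f (em R s) * g (em R x - em R s))"
      unfolding D_C by (subst sum.reindex[OF em_inj]) simp
    also have "\<dots> = (\<Sum>s\<in>carrier R. r f s * r g (\<ominus> s \<oplus> x))"
      using that by (intro sum.cong) (auto simp: r_def em_add em_minus)
    finally show ?thesis .
  qed
  obtain x' where x': "x' \<in> carrier R" "x = em R x'" using x by (auto simp: D_C)
  obtain y' where y': "y' \<in> blk x'" "y = em R y'" using y x' by (auto simp: bl_em)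
  have yc: "y' \<in> carrier R" using y' x' blk_sub by blast
  have "(\<lambda>x. if x \<in> carrier R then \<Sum>y\<in>carrier R. r f y * r g (\<ominus> y \<oplus> x) else 0) \<in> A"
    by (rule A_mult[OF A[OF f] A[OF g]])
  from A_const[OF this x'(1) y'(1)] show ?thesis
    unfolding x'(2) y'(2) sum[OF x'(1)] sum[OF yc] using x'(1) yc by simp
qed

lemma sr_data: "sr_data PP ep nn bl"
proof (unfold_locales)
  fix x assume x: "x \<in> D.C"
  then obtain x' where x': "x' \<in> carrier R" "x = em R x'" by (auto simp: D_C)
  show "x \<in> bl x" using x' blk(2) by (auto simp: bl_em)
  show "bl x \<subseteq> D.C" unfolding D_C using x' blk_sub by (auto simp: bl_em)
  show "bl y = bl x" if y: "y \<in> bl x" for y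
  proof -
    obtain y' where y': "y' \<in> blk x'" "y = em R y'" using y x' by (auto simp: bl_em)
    then have "y' \<in> carrier R" using x' blk_sub by blast
    then show ?thesis unfolding y'(2) x'(2) using x'(1) by (simp add: bl_em blk_same[OF x'(1) y'(1)])
  qed
  show "bl (u * x) = (*) u ` bl x" if "u \<in> D.Us" for u using bl_unit that x .
next
  have "blk \<zero> = {\<zero>}" by (rule blk_eqI[OF BS_zero]) simp
  then show "bl 0 = {0}" using bl_em[of \<zero>] by simp
qed (rule bl_conv)

lemma sr_pure: "sr_pure PP ep nn bl"
proof -
  interpret s: sr_data PP ep nn bl by (rule sr_data)
  show ?thesis
  proof (intro sr_pure.intro sr_data sr_pure_axioms.intro)
    fix p assume p: "p \<in> PP"
    show "\<exists>x\<in>s.X0. \<exists>r. x + D.hh p * r \<notin> s.X0"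
    proof (rule ccontr)
      assume "\<not> ?thesis"
      then have inv: "x + D.hh p * r \<in> s.X0" if "x \<in> s.X0" for x r using that by blast
      \<comment> \<open>Purity is given at some basic set containing a unit \<open>u\<close>. It is
        \<open>u\<close> times the basic set of the identity, so invariance under
        \<open>hh p\<close> would carry over and put \<open>h\<close> into its stabiliser.\<close>
      obtain X u where X: "X \<in> BS" "u \<in> X" "u \<in> Units R" "ideal_stabilizer R X = {\<zero>}"
        using pureS by (auto simp: pure_S_ring_def BS_def)
      have uc: "u \<in> carrier R" using X by blast
      have uU: "em R u \<in> D.Us" using Units_em X(3) uc by simp
      have XB: "X = blk u" using blk_eqI X by simp
      have bu: "bl (em R u) = (*) (em R u) ` s.X0"
        using bl_unit[OF uU, of "D.E PP"] by (simp add: s.X0_def uc)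
      have "D.hh p \<in> D.C" using p by (simp add: D.hh_def)
      then obtain h where h: "h \<in> carrier R" "D.hh p = em R h" by (auto simp: D_C)
      have "h \<in> ideal_stabilizer R X"
      proof -
        have "x \<oplus> b \<otimes> h \<in> X" if b: "b \<in> carrier R" "x \<in> X" for b x
        proof -
          have xc: "x \<in> carrier R" using b X(1) BS_sub by blast
          have "em R x \<in> bl (em R u)" using b xc uc by (simp add: bl_em_iff XB)
          then obtain z where z: "z \<in> s.X0" "em R x = em R u * z" unfolding bu by blast
          obtain v where v: "em R u * v = D.E PP" using uU unfolding D.Us_def by blast
          have "em R u * (z + D.hh p * (v * em R b)) = em R x + D.hh p * ((em R u * v) * em R b)"
            by (simp only: z(2) distrib_left mult_ac)
          also have "\<dots> = em R x + em R h * (em R \<one> * em R b)" unfolding v h(2) E_PP ..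
          also have "\<dots> = em R (x \<oplus> b \<otimes> h)"
            using xc b(1) h(1) by (simp add: em_add em_mult)
          finally have "em R (x \<oplus> b \<otimes> h) \<in> bl (em R u)" unfolding bu using inv[OF z(1)] by (metis image_eqI)
          then show ?thesis using xc b h uc by (simp add: bl_em_iff XB)
        qed
        then show ?thesis using h X(1) BS_sub by (simp add: ideal_stabilizer_eq)
      qed
      then have "D.hh p = 0" using X(4) h by simp
      then show False using nn(3)[OF p] by (simp add: D.hh_def)
    qed
  qed
qed

end

sublocale cg_S_ring \<subseteq> s: sr_pure PP ep nn bl by (rule sr_pure)

section \<open>S-rings over the components\<close>

context cg_ring
begin

definition KS :: "nat set \<Rightarrow> 'a set" where "KS Q = {x\<in>carrier R. D.E Q * em R x = em R x}"
definition wS :: "nat set \<Rightarrow> 'a" where "wS Q = uval (D.E Q) R"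
abbreviation RC :: "nat set \<Rightarrow> ('a, 'b) ring_scheme" where "RC Q \<equiv> ring_components R Q"

lemma KS_sub: "KS Q \<subseteq> carrier R" by (auto simp: KS_def)
lemma KS_carrier: "x \<in> KS Q \<Longrightarrow> x \<in> carrier R" by (simp add: KS_def)
lemma KS_em: "x \<in> KS Q \<Longrightarrow> D.E Q * em R x = em R x" by (simp add: KS_def)

lemma wS: assumes "Q \<subseteq> PP" shows "wS Q \<in> carrier R" "em R (wS Q) = D.E Q"
proof -
  obtain x where x: "x \<in> carrier R" "D.E Q = em R x" using D.E_C[OF assms] unfolding D_C by blast
  show "wS Q \<in> carrier R" unfolding wS_def x(2) using x(1) by simp
  show "em R (wS Q) = D.E Q" unfolding wS_def x(2) using x(1) by simp
qed

lemma KS_closed: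
  assumes "Q \<subseteq> PP"
  shows "\<zero> \<in> KS Q" "wS Q \<in> KS Q" "x \<in> KS Q \<Longrightarrow> y \<in> KS Q \<Longrightarrow> x \<oplus> y \<in> KS Q" "x \<in> KS Q \<Longrightarrow> \<ominus> x \<in> KS Q"
    "x \<in> KS Q \<Longrightarrow> y \<in> carrier R \<Longrightarrow> x \<otimes> y \<in> KS Q" "x \<in> KS Q \<Longrightarrow> y \<in> carrier R \<Longrightarrow> y \<otimes> x \<in> KS Q"
    "x \<in> KS Q \<Longrightarrow> wS Q \<otimes> x = x"
proof -
  show "\<zero> \<in> KS Q" by (simp add: KS_def)
  have "D.E Q * D.E Q = D.E Q" using D.E_E[OF assms assms] by simp
  then show "wS Q \<in> KS Q" unfolding KS_def mem_Collect_eq wS(2)[OF assms] using wS(1)[OF assms] by blast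
  show "x \<in> KS Q \<Longrightarrow> y \<in> KS Q \<Longrightarrow> x \<oplus> y \<in> KS Q" by (simp add: KS_def em_add distrib_left)
  show "x \<in> KS Q \<Longrightarrow> \<ominus> x \<in> KS Q" by (simp add: KS_def em_minus)
  show 1: "x \<otimes> y \<in> KS Q" if "x \<in> KS Q" "y \<in> carrier R"
    using that by (simp add: KS_def em_mult mult.assoc[symmetric])
  show "y \<otimes> x \<in> KS Q" if "x \<in> KS Q" "y \<in> carrier R" using 1[OF that] m_comm[OF KS_carrier[OF that(1)] that(2)] by simp
  show "wS Q \<otimes> x = x" if "x \<in> KS Q"
  proof -
    have x: "x \<in> carrier R" using that by (rule KS_carrier)
    have "em R (wS Q \<otimes> x) = em R x" using x KS_em[OF that] wS[OF assms] by (simp add: em_mult)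
    then show ?thesis using x wS[OF assms] em_eq_iff by simp
  qed
qed

text \<open>The internal sum of the Sylow parts is the part of \<open>R\<close> on which the
  idempotent of \<open>Q\<close> acts as the identity; the summands of \<open>y\<close> are its
  projections \<open>w p \<otimes> y\<close>.\<close>

lemma ring_components_eq: assumes Q: "Q \<subseteq> PP" shows "RC Q = component_ring R (KS Q)"
proof -
  have fQ: "finite Q" using Q finite_PP finite_subset by blast
  have car: "carrier (ring_component R p) = K p" if "p \<in> Q" for p
    using sylow_part that Q by (simp add: ring_component_def subset_iff)
  have "{(\<Oplus>p\<in>Q. x p) | x. \<forall>p\<in>Q. x p \<in> carrier (ring_component R p)} = KS Q"
  proof (intro Set.set_eqI iffI)
    fix y assume "y \<in> {(\<Oplus>p\<in>Q. x p) | x. \<forall>p\<in>Q. x p \<in> carrier (ring_component R p)}"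
    then obtain x where x: "y = (\<Oplus>p\<in>Q. x p)" "\<And>p. p \<in> Q \<Longrightarrow> x p \<in> K p" using car by auto
    then have xR: "x \<in> Q \<rightarrow> carrier R" by (auto simp: K_def)
    have "em R y = (\<Sum>p\<in>Q. em R (x p))" unfolding x(1) by (rule em_sum[OF fQ xR])
    moreover have "D.E Q * em R (x p) = em R (x p)" if p: "p \<in> Q" for p
    proof -
      have "ep p * em R (x p) = em R (x p)" using x(2)[OF p] by (simp add: K_def)
      moreover have "D.E Q * ep p = ep p" using D.ep_E[of p Q] p Q by (auto simp: mult.commute)
      ultimately show ?thesis by (metis mult.assoc)
    qed
    ultimately have "D.E Q * em R y = em R y" by (simp add: sum_distrib_left)
    then show "y \<in> KS Q" unfolding KS_def x(1) using finsum_closed[OF xR] by simp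
  next
    fix y assume yK: "y \<in> KS Q"
    then have y: "y \<in> carrier R" by (rule KS_carrier)
    have xR: "(\<lambda>p. w p \<otimes> y) \<in> Q \<rightarrow> carrier R" using y by auto
    have "em R (\<Oplus>p\<in>Q. w p \<otimes> y) = (\<Sum>p\<in>Q. ep p * em R y)"
      using em_sum[OF fQ xR] y by (simp add: em_mult em_w)
    also have "\<dots> = em R y" using KS_em[OF yK] by (simp add: D.E_def sum_distrib_right)
    finally have "y = (\<Oplus>p\<in>Q. w p \<otimes> y)" using em_eq_iff finsum_closed[OF xR] y by simp
    moreover have "w p \<otimes> y \<in> carrier (ring_component R p)" if "p \<in> Q" for p
    proof -
      have "p \<in> PP" using that Q by blast
      then have "ep p * (ep p * em R y) = ep p * em R y" by (simp add: mult.assoc[symmetric] ep_idem)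
      then show ?thesis using y car[OF that] by (simp add: K_def em_mult em_w)
    qed
    ultimately show "y \<in> {(\<Oplus>p\<in>Q. x p) | x. \<forall>p\<in>Q. x p \<in> carrier (ring_component R p)}" by blast
  qed
  then show ?thesis by (simp add: ring_components_def)
qed

lemma RC_simps [simp]:
  assumes "Q \<subseteq> PP"
  shows "carrier (RC Q) = KS Q" "monoid.mult (RC Q) = monoid.mult R" "add (RC Q) = add R" "zero (RC Q) = zero R"
    "one (RC Q) = wS Q"
  unfolding ring_components_eq[OF assms] using component_one[OF KS_closed(2)[OF assms] KS_sub KS_closed(7)[OF assms]]
  by simp_all

lemma RC_cring: assumes Q: "Q \<subseteq> PP" shows "cring (RC Q)"
proof (rule cringI)
  note c = KS_closed[OF Q]
  show "abelian_group (RC Q)"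
  proof (rule abelian_groupI)
    show "\<exists>y\<in>carrier (RC Q). y \<oplus>\<^bsub>RC Q\<^esub> x = \<zero>\<^bsub>RC Q\<^esub>" if "x \<in> carrier (RC Q)" for x
    proof (rule bexI[of _ "\<ominus> x"])
      have x: "x \<in> KS Q" using that Q by simp
      show "\<ominus> x \<in> carrier (RC Q)" using c(4)[OF x] Q by simp
      show "\<ominus> x \<oplus>\<^bsub>RC Q\<^esub> x = \<zero>\<^bsub>RC Q\<^esub>" using l_neg[OF KS_carrier[OF x]] Q by simp
    qed
  qed (use Q c in \<open>auto simp: a_assoc a_comm a_lcomm KS_carrier[of _ Q]\<close>)
  show "comm_monoid (RC Q)"
    by (rule comm_monoidI) (use Q c in \<open>auto simp: m_assoc m_comm m_lcomm KS_carrier[of _ Q]\<close>)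
qed (use Q in \<open>auto simp: l_distr KS_carrier[of _ Q]\<close>)

lemma RC_inv: assumes Q: "Q \<subseteq> PP" and x: "x \<in> KS Q" shows "inv\<^bsub>add_monoid (RC Q)\<^esub> x = \<ominus> x"
proof -
  interpret q: cring "RC Q" by (rule RC_cring[OF Q])
  show ?thesis
    by (rule group.inv_equality[OF q.a_group]) (use Q x KS_closed[OF Q] l_neg[OF KS_carrier[OF x]] in auto)
qed

text \<open>Adding the identity of the complementary component,
  \<open>\<one> \<oplus> \<ominus> wS Q\<close>, extends a unit of the component without changing
  its action there.\<close>

lemma RC_unit:
  assumes Q: "Q \<subseteq> PP" and u: "u \<in> Units (RC Q)"
  obtains v where "v \<in> Units R" "\<And>x. x \<in> KS Q \<Longrightarrow> v \<otimes> x = u \<otimes> x"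
proof -
  obtain u' where u': "u \<in> KS Q" "u' \<in> KS Q" "u \<otimes> u' = wS Q" using u Q by (auto simp: Units_def)
  then have uc: "u \<in> carrier R" "u' \<in> carrier R" by (auto intro: KS_carrier)
  let ?c = "\<one> \<oplus> \<ominus> wS Q"
  note w = wS[OF Q]
  have E: "D.E Q * D.E Q = D.E Q" using D.E_E[OF Q Q] by simp
  have P: "em R \<one> * t = t" if "D.E Q * t = t" for t
  proof -
    have "em R \<one> * D.E Q = D.E Q" using w by (metis em_one_mult)
    then show ?thesis using that by (metis mult.assoc)
  qed
  have k: "em R u * em R u' = D.E Q" using u'(3) uc w by (metis em_mult)
  have a: "D.E Q * em R u = em R u" "D.E Q * em R u' = em R u'" using u'(1,2) KS_em by auto
  have a': "em R u * D.E Q = em R u" "em R \<one> * D.E Q = D.E Q" "em R \<one> * em R u' = em R u'" "em R u * em R \<one> = em R u"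
    "D.E Q * em R \<one> = D.E Q" "em R u' * em R \<one> = em R u'" "em R u' * D.E Q = em R u'"
    using a P[OF a(2)] P[OF a(1)] P[OF E] by (simp_all add: mult.commute)
  have "em R ((u \<oplus> ?c) \<otimes> (u' \<oplus> ?c)) = (em R u + (em R \<one> - D.E Q)) * (em R u' + (em R \<one> - D.E Q))"
    using uc w by (simp add: em_mult em_add em_minus)
  also have "\<dots> = em R \<one>"
    by (simp add: algebra_simps k a a' E)
  finally have 1: "(u \<oplus> ?c) \<otimes> (u' \<oplus> ?c) = \<one>" using em_eq_iff uc w by simp
  have "u \<oplus> ?c \<in> Units R"
    using 1 uc w m_comm[of "u \<oplus> ?c" "u' \<oplus> ?c"] unfolding Units_def by fastforce
  moreover have "(u \<oplus> ?c) \<otimes> x = u \<otimes> x" if x: "x \<in> KS Q" for x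
  proof -
    have "em R ((u \<oplus> ?c) \<otimes> x) = em R u * em R x + (em R \<one> * em R x - D.E Q * em R x)"
      using uc w KS_carrier[OF x] by (simp add: em_mult em_add em_minus algebra_simps)
    also have "\<dots> = em R (u \<otimes> x)" using uc KS_carrier[OF x] KS_em[OF x] by (simp add: em_mult)
    finally show ?thesis using em_eq_iff uc w KS_carrier[OF x] by simp
  qed
  ultimately show ?thesis using that by blast
qed

lemma em_KS: assumes "Q \<subseteq> PP" shows "em R ` KS Q = D.RS Q"
proof
  show "em R ` KS Q \<subseteq> D.RS Q" by (auto simp: KS_def D.RS_def)
  show "D.RS Q \<subseteq> em R ` KS Q"
  proof
    fix t assume t: "t \<in> D.RS Q"
    then have "t \<in> D.C" using D.RS_iff[OF assms] by blast
    then obtain x where "x \<in> carrier R" "t = em R x" by (auto simp: D_C)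
    then show "t \<in> em R ` KS Q" using t by (auto simp: KS_def D.RS_def)
  qed
qed

lemma ideal_em:
  assumes Q: "Q \<subseteq> PP" and I: "ideal I (RC Q)"
  shows "D.is_ideal (em R ` I)" "I \<subseteq> KS Q"
proof -
  interpret q: cring "RC Q" by (rule RC_cring[OF Q])
  interpret i: ideal I "RC Q" by (rule I)
  show sub: "I \<subseteq> KS Q" using i.a_subset Q by simp
  have "r * em R x \<in> em R ` I" if x: "x \<in> I" for r x
  proof -
    have xK: "x \<in> KS Q" using sub x by blast
    have xc: "x \<in> carrier R" using xK by (rule KS_carrier)
    obtain b where b: "b \<in> carrier R" "r * em R x = em R (b \<otimes> x)" using mult_em_C xc by blast
    have "b \<otimes> x = (b \<otimes> wS Q) \<otimes> x" using b xc KS_closed(7)[OF Q xK] wS(1)[OF Q] by (simp add: m_assoc)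
    moreover have "b \<otimes> wS Q \<in> KS Q" using KS_closed[OF Q] b by simp
    ultimately have "b \<otimes> x \<in> I" using i.I_l_closed[OF x, of "b \<otimes> wS Q"] Q by simp
    then show ?thesis using b by simp
  qed
  moreover have "em R x + em R y \<in> em R ` I" if "x \<in> I" "y \<in> I" for x y
  proof -
    have "x \<oplus> y \<in> I" using i.a_closed[OF that] Q by simp
    then show ?thesis using that sub by (metis KS_carrier em_add imageI subsetD)
  qed
  moreover have "0 \<in> em R ` I" using i.zero_closed Q by (metis RC_simps(4) em_zero imageI)
  moreover have "em R ` I \<subseteq> D.C" using sub KS_sub unfolding D_C by blast
  ultimately show "D.is_ideal (em R ` I)" unfolding D.is_ideal_def by blast
qed

end

lemma group_ring_inv:
  assumes "f \<in> carrier (group_ring G)"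
  shows "inv\<^bsub>add_monoid (group_ring G)\<^esub> f = (\<lambda>x. - f x)"
  unfolding m_inv_def
proof (rule the_equality)
  show "(\<lambda>x. - f x) \<in> carrier (add_monoid (group_ring G)) \<and>
    f \<otimes>\<^bsub>add_monoid (group_ring G)\<^esub> (\<lambda>x. - f x) = \<one>\<^bsub>add_monoid (group_ring G)\<^esub> \<and>
    (\<lambda>x. - f x) \<otimes>\<^bsub>add_monoid (group_ring G)\<^esub> f = \<one>\<^bsub>add_monoid (group_ring G)\<^esub>"
    using assms by (simp add: group_ring_def)
  fix g assume "g \<in> carrier (add_monoid (group_ring G)) \<and>
    f \<otimes>\<^bsub>add_monoid (group_ring G)\<^esub> g = \<one>\<^bsub>add_monoid (group_ring G)\<^esub> \<and>
    g \<otimes>\<^bsub>add_monoid (group_ring G)\<^esub> f = \<one>\<^bsub>add_monoid (group_ring G)\<^esub>"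
  then have "(\<lambda>x. f x + g x) = (\<lambda>x. 0)" by (simp add: group_ring_def)
  then have "f x + g x = 0" for x by metis
  then show "g = (\<lambda>x. - f x)" by (simp add: fun_eq_iff eq_neg_iff_add_eq_0 add.commute)
qed

lemma subring_group_ringI:
  assumes "A \<subseteq> carrier (group_ring G)"
    and "\<And>f g. f \<in> A \<Longrightarrow> g \<in> A \<Longrightarrow> (\<lambda>x. f x + g x) \<in> A"
    and "(\<lambda>x. 0) \<in> A" and "\<And>f. f \<in> A \<Longrightarrow> (\<lambda>x. - f x) \<in> A"
    and "indicator {\<one>\<^bsub>G\<^esub>} \<in> A"
    and "\<And>f g. f \<in> A \<Longrightarrow> g \<in> A \<Longrightarrow> f \<otimes>\<^bsub>group_ring G\<^esub> g \<in> A"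
  shows "subring A (group_ring G)"
proof (intro subring.intro subgroup.intro submonoid.intro)
  show "inv\<^bsub>add_monoid (group_ring G)\<^esub> f \<in> A" if "f \<in> A" for f
    using assms(1,4) that group_ring_inv[of f G] by (metis subsetD)
qed (use assms in \<open>simp_all add: group_ring_def\<close>)

context cg_S_ring
begin

definition closed_comp :: "nat set \<Rightarrow> bool" where
  "closed_comp Q \<longleftrightarrow> Q \<subseteq> PP \<and> (\<forall>x\<in>KS Q. blk x \<subseteq> KS Q)"
definition BSS :: "nat set \<Rightarrow> 'a set set" where "BSS Q = {X\<in>BS. X \<subseteq> KS Q}"
text \<open>The S-ring that \<open>A\<close> induces on the component: its basic sets are those of
  \<open>A\<close> contained in it.\<close>

definition BB :: "nat set \<Rightarrow> ('a \<Rightarrow> int) set" where "BB Q = int_span (indicator ` BSS Q)"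

lemma closed_compI: assumes "Q \<subseteq> PP" "s.aset (D.RS Q)" shows "closed_comp Q"
proof -
  have "blk x \<subseteq> KS Q" if x: "x \<in> KS Q" for x
  proof
    fix y assume y: "y \<in> blk x"
    have xc: "x \<in> carrier R" using x by (rule KS_carrier)
    have yc: "y \<in> carrier R" using y xc blk_sub by blast
    have "em R x \<in> D.RS Q" using x em_KS[OF assms(1)] by blast
    then have "bl (em R x) \<subseteq> D.RS Q" using assms(2) by (rule s.asetD[rotated])
    then have "em R y \<in> D.RS Q" using y xc yc bl_em_iff by blast
    then show "y \<in> KS Q" using yc by (simp add: KS_def D.RS_def)
  qed
  then show ?thesis using assms(1) by (simp add: closed_comp_def)
qed

lemma BSS_BS: "X \<in> BSS Q \<Longrightarrow> X \<in> BS" by (simp add: BSS_def)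
lemma BSS_fin: "finite (BSS Q)" using BS_fin by (simp add: BSS_def)
lemma BSS_disj: "disjoint (BSS Q)" using BS_disj by (auto simp: BSS_def disjoint_def)
lemma BSS_ne: "{} \<notin> BSS Q" using BS_ne by (simp add: BSS_def)

context
  fixes Q assumes cl: "closed_comp Q"
begin

lemma QP: "Q \<subseteq> PP" using cl by (simp add: closed_comp_def)

lemma blk_BSS: "x \<in> KS Q \<Longrightarrow> blk x \<in> BSS Q"
  using cl blk(1)[OF KS_carrier, of x Q] by (simp add: closed_comp_def BSS_def)

lemma BSS_Union: "\<Union>(BSS Q) = KS Q"
  using blk_BSS blk(2)[OF KS_carrier] by (fastforce simp: BSS_def)

lemma BSS_part: "partition_on (KS Q) (BSS Q)"
  using BSS_Union BSS_disj BSS_ne by (simp add: partition_on_def)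

lemma BB_iff: "f \<in> BB Q \<longleftrightarrow> (\<forall>x. x \<notin> KS Q \<longrightarrow> f x = 0) \<and> (\<forall>X\<in>BSS Q. \<forall>x\<in>X. \<forall>y\<in>X. f x = f y)"
  unfolding BB_def int_span_indicator[OF BSS_fin BSS_disj] BSS_Union by simp

lemma BB_I: "(\<And>x. x \<notin> KS Q \<Longrightarrow> f x = 0) \<Longrightarrow> (\<And>X x y. X \<in> BSS Q \<Longrightarrow> x \<in> X \<Longrightarrow> y \<in> X \<Longrightarrow> f x = f y) \<Longrightarrow> f \<in> BB Q"
  unfolding BB_iff by (intro conjI allI impI ballI)
lemma BB_out: "f \<in> BB Q \<Longrightarrow> x \<notin> KS Q \<Longrightarrow> f x = 0" using BB_iff[of f] by blast
lemma BB_const: "f \<in> BB Q \<Longrightarrow> X \<in> BSS Q \<Longrightarrow> x \<in> X \<Longrightarrow> y \<in> X \<Longrightarrow> f x = f y"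
  using BB_iff[of f] by blast

lemma BB_pointwise:
  assumes "f \<in> BB Q" "g \<in> BB Q" "\<And>x y. f x = f y \<Longrightarrow> g x = g y \<Longrightarrow> h x = h y"
    "\<And>x. f x = 0 \<Longrightarrow> g x = 0 \<Longrightarrow> h x = 0"
  shows "h \<in> BB Q"
  using assms(3)[OF BB_const[OF assms(1)] BB_const[OF assms(2)]] assms(4)[OF BB_out[OF assms(1)] BB_out[OF assms(2)]]
  by (intro BB_I)

lemma BB_A: assumes "f \<in> BB Q" shows "f \<in> A"
proof -
  note f = BB_out[OF assms] BB_const[OF assms]
  have "f x = f y" if X: "X \<in> BS" "x \<in> X" "y \<in> X" for X x y
  proof (cases "x \<in> KS Q")
    case True
    then have "X \<in> BSS Q" using blk_BSS blk_eqI[OF X(1,2)] by metis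
    then show ?thesis using f(2) X by blast
  next
    case False
    have "y \<notin> KS Q"
    proof
      assume "y \<in> KS Q"
      then have "blk y \<subseteq> KS Q" using cl by (simp add: closed_comp_def)
      then show False using False blk_eqI[OF X(1,3)] X by blast
    qed
    then show ?thesis using False f(1) by simp
  qed
  moreover have "f x = 0" if "x \<notin> carrier R" for x using that f(1) KS_carrier by blast
  ultimately show ?thesis unfolding A_iff by blast
qed

text \<open>Both functions vanish off the component, so their product there is the restriction of
  the product formed over all of \<open>R\<close>.\<close>

lemma BB_mult: assumes f: "f \<in> BB Q" and g: "g \<in> BB Q"
  shows "f \<otimes>\<^bsub>group_ring (add_monoid (RC Q))\<^esub> g \<in> BB Q"
proof -
  define m where "m x = (if x \<in> carrier R then \<Sum>y\<in>carrier R. f y * g (\<ominus> y \<oplus> x) else 0)" for x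
  have mA: "m \<in> A" unfolding m_def by (rule A_mult[OF BB_A[OF f] BB_A[OF g]])
  have eq: "(f \<otimes>\<^bsub>group_ring (add_monoid (RC Q))\<^esub> g) x = (if x \<in> KS Q then m x else 0)" for x
  proof (cases "x \<in> KS Q")
    case True
    have "(f \<otimes>\<^bsub>group_ring (add_monoid (RC Q))\<^esub> g) x = (\<Sum>y\<in>KS Q. f y * g (inv\<^bsub>add_monoid (RC Q)\<^esub> y \<oplus> x))"
      using True QP by (simp add: group_ring_def)
    also have "\<dots> = (\<Sum>y\<in>KS Q. f y * g (\<ominus> y \<oplus> x))" using RC_inv[OF QP] by (intro sum.cong) auto
    also have "\<dots> = (\<Sum>y\<in>carrier R. f y * g (\<ominus> y \<oplus> x))"
      using fin KS_sub f[unfolded BB_iff] by (intro sum.mono_neutral_left) auto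
    finally show ?thesis using True KS_carrier by (simp add: m_def)
  next
    case False then show ?thesis using QP by (simp add: group_ring_def)
  qed
  show ?thesis unfolding BB_iff eq
  proof (intro conjI allI impI ballI)
    fix X x y assume X: "X \<in> BSS Q" "x \<in> X" "y \<in> X"
    have "\<forall>X\<in>BS. \<forall>x\<in>X. \<forall>y\<in>X. m x = m y" using mA A_iff[of m] by blast
    then have "m x = m y" using BSS_BS X by blast
    moreover have "x \<in> KS Q" "y \<in> KS Q" using X BSS_Union by blast+
    ultimately show "(if x \<in> KS Q then m x else 0) = (if y \<in> KS Q then m y else 0)" by simp
  qed simp
qed

lemma BB_basic: "is_basic_partition (add_monoid (RC Q)) (BB Q) (BSS Q)"
proof -
  have "set_inv\<^bsub>add_monoid (RC Q)\<^esub> X \<in> BSS Q" if X: "X \<in> BSS Q" for X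
  proof -
    have sub: "X \<subseteq> KS Q" using X by (simp add: BSS_def)
    have "set_inv\<^bsub>add_monoid (RC Q)\<^esub> X = set_inv\<^bsub>add_monoid R\<^esub> X"
      unfolding SET_INV_def by (rule SUP_cong[OF refl]) (use RC_inv[OF QP] sub in \<open>auto simp: a_inv_def\<close>)
    moreover have "set_inv\<^bsub>add_monoid R\<^esub> X \<subseteq> KS Q"
      unfolding SET_INV_def using KS_closed(4)[OF QP] sub by (auto simp: a_inv_def[symmetric])
    ultimately show ?thesis using BS_inv[OF BSS_BS[OF X]] by (simp add: BSS_def)
  qed
  moreover have "{\<zero>} \<in> BSS Q" using BS_zero KS_closed(1)[OF QP] by (simp add: BSS_def)
  ultimately show ?thesis
    unfolding is_basic_partition_def BB_def
    using BSS_part int_basis_indicator[OF BSS_fin BSS_disj BSS_ne] QP by simp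
qed

lemma BB_basic_sets: "basic_sets (add_monoid (RC Q)) (BB Q) = BSS Q"
  by (rule basic_sets_eq[OF BB_basic])

lemma BB_S_ring: "S_ring (add_monoid (RC Q)) (BB Q)"
  unfolding S_ring_def
proof (intro conjI)
  interpret q: cring "RC Q" by (rule RC_cring[OF QP])
  show "group (add_monoid (RC Q))" by (rule q.a_group)
  show "finite (carrier (add_monoid (RC Q)))" using QP finite_subset[OF KS_sub fin] by simp
  show "\<exists>S. is_basic_partition (add_monoid (RC Q)) (BB Q) S" using BB_basic by blast
  show "subring (BB Q) (group_ring (add_monoid (RC Q)))"
  proof (rule subring_group_ringI)
    show "BB Q \<subseteq> carrier (group_ring (add_monoid (RC Q)))"
      using QP BB_iff by (auto simp: group_ring_def)
    show "indicator {\<one>\<^bsub>add_monoid (RC Q)\<^esub>} \<in> BB Q"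
    proof -
      have z: "{\<zero>} \<in> BSS Q" using BS_zero KS_closed(1)[OF QP] by (simp add: BSS_def)
      have *: "indicator {\<zero>} x = (indicator {\<zero>} y :: int)" if "X \<in> BSS Q" "x \<in> X" "y \<in> X" for X x y
      proof (cases "X = {\<zero>}")
        case True then show ?thesis using that by simp
      next
        case False
        then have "\<zero> \<notin> X" using partition_blocks_eq[OF BSS_part that(1) z, of \<zero>] by blast
        then show ?thesis using that by (metis indicator_simps(2) singletonD)
      qed
      have "indicator {\<zero>} x = (0::int)" if "x \<notin> KS Q" for x
        using that KS_closed(1)[OF QP] by (auto simp: indicator_def)
      then have "indicator {\<zero>} \<in> BB Q" using * by (rule BB_I)
      then show ?thesis using QP by simp
    qed
    show "(\<lambda>x. f x + g x) \<in> BB Q" if "f \<in> BB Q" "g \<in> BB Q" for f g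
      using that by (rule BB_pointwise) simp_all
    show "(\<lambda>x. - f x) \<in> BB Q" if "f \<in> BB Q" for f
      using that that by (rule BB_pointwise) simp_all
    show "(\<lambda>x. 0) \<in> BB Q" unfolding BB_iff by simp
  qed (rule BB_mult)
qed

lemma BB_ring_S_ring: "ring_S_ring (RC Q) (BB Q)"
  unfolding ring_S_ring_def BB_basic_sets
proof (intro conjI ballI)
  fix X u assume X: "X \<in> BSS Q" and u: "u \<in> Units (RC Q)"
  have sub: "X \<subseteq> KS Q" using X by (simp add: BSS_def)
  obtain v where v: "v \<in> Units R" "\<And>x. x \<in> KS Q \<Longrightarrow> v \<otimes> x = u \<otimes> x" using RC_unit[OF QP u] by blast
  have eq: "u <#\<^bsub>RC Q\<^esub> X = v <# X" unfolding l_coset_def RC_simps[OF QP]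
    by (rule SUP_cong[OF refl]) (use v(2) sub in auto)
  have "v <# X \<subseteq> KS Q"
    unfolding l_coset_def using v(1) sub KS_closed(6)[OF QP] by auto
  then show "u <#\<^bsub>RC Q\<^esub> X \<in> BSS Q" unfolding eq using BS_unit[OF BSS_BS[OF X] v(1)] by (simp add: BSS_def)
qed (use RC_cring[OF QP] BB_S_ring in auto)

end

section \<open>The factors of the decomposition\<close>

lemma closed_DD: "d \<in> s.DD \<Longrightarrow> closed_comp d" by (intro closed_compI s.DD_sub s.aset_DD)
lemma closed_Q0: "closed_comp s.Q0"
  by (intro closed_compI s.Q0_P) (use s.aideal_Q0 in \<open>simp add: s.aideal_def\<close>)

lemma dense_comp: "dense_S_ring (RC s.Q0) (BB s.Q0)"
  unfolding dense_S_ring_def BB_basic_sets[OF closed_Q0]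
proof (intro allI impI)
  fix I assume I: "ideal I (RC s.Q0)"
  have sub: "I \<subseteq> KS s.Q0" by (rule ideal_em(2)[OF s.Q0_P I])
  have "em R ` I \<subseteq> D.RS s.Q0" using sub em_KS[OF s.Q0_P] by blast
  then have a: "s.aset (em R ` I)" using s.dense_Q0 ideal_em(1)[OF s.Q0_P I] by blast
  have bI: "blk x \<subseteq> I" if x: "x \<in> I" for x
  proof
    fix y assume y: "y \<in> blk x"
    have xc: "x \<in> carrier R" using x sub KS_sub by blast
    have yc: "y \<in> carrier R" using y xc blk_sub by blast
    have "em R y \<in> bl (em R x)" using bl_em_iff[OF xc yc] y by blast
    moreover have "bl (em R x) \<subseteq> em R ` I" using x by (intro s.asetD[OF a]) blast
    ultimately obtain z where z: "z \<in> I" "em R y = em R z" by blast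
    have "z \<in> carrier R" using z(1) sub KS_sub by blast
    then show "y \<in> I" using em_eq_iff[OF yc] z by blast
  qed
  have "x \<in> blk x" if "x \<in> I" for x by (rule blk(2)) (use that sub KS_sub in blast)
  then have "I = \<Union>(blk ` I)" using bI by blast
  moreover have "blk ` I \<subseteq> BSS s.Q0" using blk_BSS[OF closed_Q0] sub by blast
  ultimately show "\<exists>T\<subseteq>BSS s.Q0. I = \<Union>T" by blast
qed

lemma pure_comp: "pure_S_ring (RC s.Q0) (BB s.Q0)"
  unfolding pure_S_ring_def BB_basic_sets[OF closed_Q0]
proof (intro bexI conjI)
  let ?Q = "s.Q0" let ?w = "wS ?Q"
  note Q = s.Q0_P
  interpret q: cring "RC ?Q" by (rule RC_cring[OF Q])
  have wc: "?w \<in> carrier R" "em R ?w = D.E ?Q" "?w \<in> KS ?Q" using wS[OF Q] KS_closed(2)[OF Q] by auto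
  show bw: "blk ?w \<in> BSS ?Q" by (rule blk_BSS[OF closed_Q0 wc(3)])
  have "?w \<in> Units (RC ?Q)" using q.Units_one_closed Q by simp
  then show "blk ?w \<inter> Units (RC ?Q) \<noteq> {}" using blk(2)[OF wc(1)] by blast
  have sub: "blk ?w \<subseteq> KS ?Q" using bw by (simp add: BSS_def)
  have "a = \<zero>" if a: "a \<in> KS ?Q" "\<forall>b\<in>KS ?Q. \<forall>x\<in>blk ?w. x \<oplus> b \<otimes> a \<in> blk ?w" for a
  proof (rule ccontr)
    assume "a \<noteq> \<zero>"
    have ac: "a \<in> carrier R" using a(1) by (rule KS_carrier)
    \<comment> \<open>The ideal generated by a nonzero \<open>a\<close> of the stabiliser.
      \<open>pure_Q0\<close> finds an element of it whose translation leaves the basic set of the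
      identity.\<close>
    let ?J = "{t * em R a | t. True}"
    have "em R a \<in> D.RS ?Q" using a(1) em_KS[OF Q] by blast
    then have Ea: "D.E ?Q * em R a = em R a" by (simp add: D.RS_def)
    have JRS: "?J \<subseteq> D.RS ?Q"
    proof
      fix z assume "z \<in> ?J"
      then obtain t where t: "z = t * em R a" by blast
      have "D.E ?Q * (t * em R a) = t * (D.E ?Q * em R a)" by (simp only: mult_ac)
      then show "z \<in> D.RS ?Q" unfolding t D.RS_def Ea by simp
    qed
    have J: "D.is_ideal ?J"
      unfolding D.is_ideal_def
    proof (intro conjI ballI allI)
      show "?J \<subseteq> D.C" using JRS D.RS_iff[OF Q] by blast
      show "0 \<in> ?J" by (auto intro: exI[of _ 0])
      fix x assume "x \<in> ?J"
      then obtain t where t: "x = t * em R a" by blast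
      show "x + y \<in> ?J" if y: "y \<in> ?J" for y
      proof -
        obtain u where "y = u * em R a" using y by blast
        then have "x + y = (t + u) * em R a" using t by (simp add: distrib_right)
        then show ?thesis by blast
      qed
      show "r * x \<in> ?J" for r
      proof -
        have "r * x = (r * t) * em R a" using t by (simp add: mult.assoc)
        then show ?thesis by blast
      qed
    qed
    have "em R a \<in> ?J" using mult_1_left[of "em R a"] by (metis (mono_tags, lifting) mem_Collect_eq)
    moreover have "em R a \<noteq> 0" using \<open>a \<noteq> \<zero>\<close> ac em_eq0 by blast
    ultimately obtain x y where xy: "x \<in> bl (D.E ?Q)" "y \<in> ?J" "x + y \<notin> bl (D.E ?Q)"
      using s.pure_Q0[OF J JRS] by blast
    have blw: "bl (D.E ?Q) = em R ` blk ?w" using bl_em[OF wc(1)] wc(2) by simp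
    obtain x' where x': "x' \<in> blk ?w" "x = em R x'" using xy(1) unfolding blw by blast
    obtain t where t: "y = t * em R a" using xy(2) by blast
    obtain b where b: "b \<in> carrier R" "t * em R a = em R (b \<otimes> a)" using mult_em_C[OF ac] by blast
    have "b \<otimes> a = (b \<otimes> ?w) \<otimes> a" using b ac wc(1) KS_closed(7)[OF Q a(1)] by (simp add: m_assoc)
    moreover have "b \<otimes> ?w \<in> KS ?Q" using KS_closed(6)[OF Q wc(3) b(1)] .
    ultimately have "x' \<oplus> b \<otimes> a \<in> blk ?w" using a(2) x'(1) by simp
    moreover have "x' \<in> carrier R" using x'(1) sub KS_sub by blast
    then have "x + y = em R (x' \<oplus> b \<otimes> a)" using x'(2) t b ac by (simp add: em_add)
    ultimately show False using xy(3) unfolding blw by blast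
  qed
  moreover have "blk ?w \<subseteq> carrier (RC ?Q)" using sub Q by simp
  ultimately have "ideal_stabilizer (RC ?Q) (blk ?w) \<subseteq> {\<zero>\<^bsub>RC ?Q\<^esub>}"
    using Q by (auto simp: q.ideal_stabilizer_eq)
  moreover have "\<zero> \<in> ideal_stabilizer (RC ?Q) (blk ?w)"
    using Q sub KS_closed(1)[OF Q] KS_sub \<open>blk ?w \<subseteq> carrier (RC ?Q)\<close>
    by (auto simp: q.ideal_stabilizer_eq KS_carrier[of _ s.Q0] subset_iff)
  ultimately show "ideal_stabilizer (RC ?Q) (blk ?w) = {\<zero>\<^bsub>RC ?Q\<^esub>}" using Q by auto
qed

lemma bl_comp_iff:
  assumes "a \<in> carrier R" "b \<in> carrier R"
  shows "b \<in> blk a \<longleftrightarrow> (\<forall>d\<in>s.DD. D.E d * em R b = 0 \<longleftrightarrow> D.E d * em R a = 0) \<and>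
    D.E s.Q0 * em R b \<in> bl (D.E s.Q0 * em R a)"
  unfolding bl_em_iff[OF assms, symmetric] using s.bl_box[of "em R a" "em R b"] assms by simp

lemma DD_Q0: "d \<in> s.DD \<Longrightarrow> d \<inter> s.Q0 = {}" using s.DD_union by blast

lemma E_disjoint_em:
  assumes "Q \<subseteq> PP" "Q' \<subseteq> PP" "Q' \<inter> Q = {}" "x \<in> KS Q"
  shows "D.E Q' * em R x = 0"
proof -
  have "D.E Q' * em R x = (D.E Q' * D.E Q) * em R x" using KS_em[OF assms(4)] by (simp add: mult.assoc)
  also have "D.E Q' * D.E Q = 0" using D.E_E[OF assms(2,1)] assms(3) by (simp add: D.E_def)
  finally show ?thesis by simp
qed

text \<open>For elements of one block all other projections vanish, so membership in a common basic
  set only asks whether both elements are zero or both nonzero. This is the rank 2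
  structure.\<close>

lemma blk_DD:
  assumes d: "d \<in> s.DD" and a: "a \<in> KS d" and b: "b \<in> KS d"
  shows "b \<in> blk a \<longleftrightarrow> (b = \<zero> \<longleftrightarrow> a = \<zero>)"
proof -
  have ac: "a \<in> carrier R" "b \<in> carrier R" using a b KS_sub by auto
  have P: "d \<subseteq> PP" by (rule s.DD_sub[OF d])
  have Q0: "D.E s.Q0 * em R x = 0" if "x \<in> KS d" for x
    using E_disjoint_em[OF P s.Q0_P _ that] DD_Q0[OF d] by blast
  have other: "D.E d' * em R x = 0" if "x \<in> KS d" "d' \<in> s.DD" "d' \<noteq> d" for x d'
    using E_disjoint_em[OF P s.DD_sub[OF that(2)] s.DD_disj[OF that(2) d that(3)] that(1)] .
  have "(\<forall>d'\<in>s.DD. D.E d' * em R b = 0 \<longleftrightarrow> D.E d' * em R a = 0) \<longleftrightarrow> (em R b = 0 \<longleftrightarrow> em R a = 0)"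
    using other[OF a] other[OF b] KS_em[OF a] KS_em[OF b] d by metis
  then show ?thesis unfolding bl_comp_iff[OF ac] Q0[OF a] Q0[OF b] using em_eq0 ac s.bl_zero by simp
qed

lemma DD_not_field: assumes d: "d \<in> s.DD" shows "\<not> field (RC d)"
proof
  assume "field (RC d)"
  then interpret f: field "RC d" .
  have P: "d \<subseteq> PP" by (rule s.DD_sub[OF d])
  obtain t where t: "t \<in> D.RS d" "t \<noteq> 0" "\<not> (\<exists>z. t * z = D.E d)" using s.DD_nonfield[OF d] by blast
  obtain y where y: "y \<in> KS d" "t = em R y" using t(1) em_KS[OF P] by blast
  have "y \<noteq> \<zero>" using t(2) y(2) by auto
  then have "y \<in> Units (RC d)" using f.field_Units y(1) P by simp
  then obtain z where "z \<in> KS d" "y \<otimes> z = wS d" using P by (auto simp: Units_def)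
  then have "t * em R z = D.E d" using y KS_carrier wS[OF P] by (metis em_mult)
  then show False using t(3) by blast
qed

lemma DD_rank: assumes d: "d \<in> s.DD" shows "S_ring_rank (add_monoid (RC d)) (BB d) = 2"
proof -
  note cl = closed_DD[OF d]
  have P: "d \<subseteq> PP" by (rule s.DD_sub[OF d])
  obtain t where t: "t \<in> D.RS d" "t \<noteq> 0" using s.DD_nonfield[OF d] by blast
  then obtain y where y: "y \<in> KS d" "t = em R y" using em_KS[OF P] by blast
  have y0: "y \<noteq> \<zero>" using t(2) y(2) by auto
  have b: "blk a = (if a = \<zero> then {\<zero>} else KS d - {\<zero>})" if a: "a \<in> KS d" for a
  proof -
    have "blk a \<subseteq> KS d" using cl a by (simp add: closed_comp_def)
    then have "blk a = {b\<in>KS d. b = \<zero> \<longleftrightarrow> a = \<zero>}" using blk_DD[OF d a] by blast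
    then show ?thesis using KS_closed(1)[OF P] by auto
  qed
  have "BSS d = blk ` KS d"
  proof
    show "BSS d \<subseteq> blk ` KS d"
    proof
      fix X assume X: "X \<in> BSS d"
      then obtain x where x: "x \<in> X" using BSS_ne[of d] by (metis all_not_in_conv)
      then have "x \<in> KS d" using X by (auto simp: BSS_def)
      then show "X \<in> blk ` KS d" using blk_eqI[OF BSS_BS[OF X] x] by blast
    qed
  qed (use blk_BSS[OF cl] in blast)
  also have "\<dots> = {{\<zero>}, KS d - {\<zero>}}"
    using y(1) y0 KS_closed(1)[OF P] by (auto simp: b image_iff split: if_splits)
  finally have "BSS d = {{\<zero>}, KS d - {\<zero>}}" .
  moreover have "{\<zero>} \<noteq> KS d - {\<zero>}" by blast
  ultimately show ?thesis unfolding S_ring_rank_def BB_basic_sets[OF cl] by simp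
qed

end

section \<open>The tensor decomposition\<close>

text \<open>Along an injective map a function is merely transported and extended by zero, so
  constancy on blocks corresponds to constancy on their images.\<close>

lemma group_ring_map_int_span:
  assumes inj: "inj_on \<phi> (carrier G)"
    and T: "finite T" "disjoint T" "\<Union>T = carrier G"
    and S: "finite S" "disjoint S" "S = (\<lambda>X. \<phi> ` X) ` T"
  shows "group_ring_map G \<phi> ` int_span (indicator ` T) = int_span (indicator ` S)"
proof -
  have val: "group_ring_map G \<phi> f (\<phi> x) = f x" if "x \<in> carrier G" for f x
  proof -
    have "{x' \<in> carrier G. \<phi> x' = \<phi> x} = {x}" using inj that by (auto simp: inj_on_def)
    then show ?thesis by (simp add: group_ring_map_def)
  qed
  have out: "group_ring_map G \<phi> f y = 0" if "y \<notin> \<phi> ` carrier G" for f y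
  proof -
    have "{x' \<in> carrier G. \<phi> x' = y} = {}" using that by blast
    then show ?thesis by (simp only: group_ring_map_def sum.empty)
  qed
  have US: "\<Union>S = \<phi> ` carrier G" unfolding S(3) T(3)[symmetric] by blast
  have Tsub: "X \<in> T \<Longrightarrow> x \<in> X \<Longrightarrow> x \<in> carrier G" for X x using T(3) by blast
  show ?thesis
    unfolding int_span_indicator[OF T(1,2)] int_span_indicator[OF S(1,2)] US T(3)
  proof (intro Set.set_eqI iffI)
    fix F assume "F \<in> group_ring_map G \<phi> ` {f. (\<forall>x. x \<notin> carrier G \<longrightarrow> f x = 0) \<and>
      (\<forall>X\<in>T. \<forall>x\<in>X. \<forall>y\<in>X. f x = f y)}"
    then obtain f where F: "F = group_ring_map G \<phi> f" and f: "\<forall>X\<in>T. \<forall>x\<in>X. \<forall>y\<in>X. f x = f y" by blast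
    have "F a = F b" if Y: "Y \<in> S" "a \<in> Y" "b \<in> Y" for Y a b
    proof -
      obtain X x y where "X \<in> T" "x \<in> X" "y \<in> X" "a = \<phi> x" "b = \<phi> y" using Y unfolding S(3) by blast
      then show ?thesis unfolding F using f val Tsub by metis
    qed
    moreover have "F y = 0" if "y \<notin> \<phi> ` carrier G" for y unfolding F by (rule out[OF that])
    ultimately show "F \<in> {f. (\<forall>x. x \<notin> \<phi> ` carrier G \<longrightarrow> f x = 0) \<and> (\<forall>X\<in>S. \<forall>x\<in>X. \<forall>y\<in>X. f x = f y)}"
      by blast
  next
    fix F assume "F \<in> {f. (\<forall>x. x \<notin> \<phi> ` carrier G \<longrightarrow> f x = 0) \<and>
      (\<forall>X\<in>S. \<forall>x\<in>X. \<forall>y\<in>X. f x = (f y :: int))}"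
    then have F: "\<And>y. y \<notin> \<phi> ` carrier G \<Longrightarrow> F y = 0" "\<And>Y a b. Y \<in> S \<Longrightarrow> a \<in> Y \<Longrightarrow> b \<in> Y \<Longrightarrow> F a = F b"
      by blast+
    define f where "f x = (if x \<in> carrier G then F (\<phi> x) else 0)" for x
    have "F y = group_ring_map G \<phi> f y" for y
    proof (cases "y \<in> \<phi> ` carrier G")
      case True
      then obtain x where "x \<in> carrier G" "y = \<phi> x" by blast
      then show ?thesis using val by (simp add: f_def)
    next
      case False then show ?thesis using F(1) out by simp
    qed
    then have "F = group_ring_map G \<phi> f" by blast
    moreover have "f x = f y" if X: "X \<in> T" "x \<in> X" "y \<in> X" for X x y
    proof -
      have "F (\<phi> x) = F (\<phi> y)" by (rule F(2)[of "\<phi> ` X"]) (use X S(3) in blast)+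
      then show ?thesis using Tsub X by (simp add: f_def)
    qed
    moreover have "f x = 0" if "x \<notin> carrier G" for x using that by (simp add: f_def)
    ultimately show "F \<in> group_ring_map G \<phi> ` {f. (\<forall>x. x \<notin> carrier G \<longrightarrow> f x = 0) \<and>
      (\<forall>X\<in>T. \<forall>x\<in>X. \<forall>y\<in>X. f x = f y)}" by blast
  qed
qed

lemma boxes_partition:
  assumes "finite I" "\<And>i. i \<in> I \<Longrightarrow> partition_on (U i) (S i)" "\<And>i. i \<in> I \<Longrightarrow> finite (S i)"
  shows "finite {Pi\<^sub>E I X | X. \<forall>i\<in>I. X i \<in> S i}" "disjoint {Pi\<^sub>E I X | X. \<forall>i\<in>I. X i \<in> S i}"
    "\<Union>{Pi\<^sub>E I X | X. \<forall>i\<in>I. X i \<in> S i} = Pi\<^sub>E I U"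
proof -
  let ?B = "{Pi\<^sub>E I X | X. \<forall>i\<in>I. X i \<in> S i}"
  have eq: "?B = Pi\<^sub>E I ` (Pi\<^sub>E I S)"
  proof (intro Set.set_eqI iffI)
    fix Y assume "Y \<in> ?B"
    then obtain X where X: "Y = Pi\<^sub>E I X" "\<forall>i\<in>I. X i \<in> S i" by blast
    have "Y = Pi\<^sub>E I (restrict X I)" unfolding X(1) by (rule PiE_cong) simp
    then show "Y \<in> Pi\<^sub>E I ` (Pi\<^sub>E I S)" using X(2) by (auto intro!: image_eqI)
  qed blast
  show "finite ?B" unfolding eq using assms(1,3) by (intro finite_imageI finite_PiE)
  show "disjoint ?B"
  proof (rule disjointI)
    fix Y Z assume "Y \<in> ?B" "Z \<in> ?B" "Y \<noteq> Z"
    then obtain X X' where X: "Y = Pi\<^sub>E I X" "\<forall>i\<in>I. X i \<in> S i" and X': "Z = Pi\<^sub>E I X'" "\<forall>i\<in>I. X' i \<in> S i" by blast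
    show "Y \<inter> Z = {}"
    proof (rule ccontr)
      assume "Y \<inter> Z \<noteq> {}"
      then obtain x where x: "\<And>i. i \<in> I \<Longrightarrow> x i \<in> X i" "\<And>i. i \<in> I \<Longrightarrow> x i \<in> X' i" unfolding X(1) X'(1) by blast
      have "X i = X' i" if i: "i \<in> I" for i
        using partition_blocks_eq[OF assms(2)[OF i], of "X i" "X' i" "x i"] X(2) X'(2) x i by blast
      then have "Y = Z" unfolding X(1) X'(1) by (rule PiE_cong)
      then show False using \<open>Y \<noteq> Z\<close> by simp
    qed
  qed
  show "\<Union>?B = Pi\<^sub>E I U"
  proof (intro Set.set_eqI iffI)
    fix x assume "x \<in> \<Union>?B"
    then obtain X where X: "\<forall>i\<in>I. X i \<in> S i" "x \<in> Pi\<^sub>E I X" by blast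
    have "X i \<subseteq> U i" if "i \<in> I" for i using assms(2)[OF that] X(1) that by (auto simp: partition_on_def)
    then show "x \<in> Pi\<^sub>E I U" using X(2) by (fastforce simp: PiE_iff)
  next
    fix x assume x: "x \<in> Pi\<^sub>E I U"
    have "\<forall>i\<in>I. \<exists>Y. Y \<in> S i \<and> x i \<in> Y"
    proof
      fix i assume i: "i \<in> I"
      then have "x i \<in> \<Union>(S i)" using assms(2)[OF i] x by (auto simp: partition_on_def)
      then show "\<exists>Y. Y \<in> S i \<and> x i \<in> Y" by blast
    qed
    then obtain X where X: "\<forall>i\<in>I. X i \<in> S i \<and> x i \<in> X i" by (auto simp: bchoice_iff)
    then have "x \<in> Pi\<^sub>E I X" using x by (auto simp: PiE_iff)
    then show "x \<in> \<Union>?B" using X by blast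
  qed
qed

context cg_S_ring
begin

text \<open>Summation is a bijection from the product of the components to \<open>R\<close>, and
  projecting the sum recovers the coordinates. Under it \<open>bl_comp_iff\<close> becomes
  coordinatewise: for \<open>i \<ge> 1\<close> by \<open>blk_DD\<close>, at index 0 by the basic set
  of the \<open>Q0\<close>-part. So boxes of basic sets correspond to basic sets of
  \<open>A\<close>.\<close>

lemma tensor_eq:
  fixes Q :: "nat \<Rightarrow> nat set" and k :: nat
  assumes Q0: "Q 0 = s.Q0" and Qk: "Q ` {1..k} = s.DD" and disj: "disjoint_family_on Q {..k}"
  shows "A = group_ring_map (product_group {..k} (\<lambda>i. add_monoid (RC (Q i)))) (\<lambda>x. \<Oplus>i\<in>{..k}. x i) `
    S_ring_tensor {..k} (\<lambda>i. add_monoid (RC (Q i))) (\<lambda>i. BB (Q i))"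
proof -
  let ?G = "product_group {..k} (\<lambda>i. add_monoid (RC (Q i)))"
  let ?\<phi> = "\<lambda>x. \<Oplus>i\<in>{..k}. x i"
  let ?T = "{Pi\<^sub>E {..k} X | X. \<forall>i\<in>{..k}. X i \<in> BSS (Q i)}"
  have cl: "closed_comp (Q i)" if "i \<le> k" for i
  proof (cases "i = 0")
    case True then show ?thesis using Q0 closed_Q0 by simp
  next
    case False
    then have "Q i \<in> s.DD" using that Qk by (metis One_nat_def Suc_leI atLeastAtMost_iff image_eqI neq0_conv)
    then show ?thesis by (rule closed_DD)
  qed
  have QP: "Q i \<subseteq> PP" if "i \<le> k" for i using cl[OF that] by (simp add: closed_comp_def)
  have car: "carrier ?G = Pi\<^sub>E {..k} (\<lambda>i. KS (Q i))"
    using QP by (auto simp: product_group_def intro!: PiE_cong)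
  have xc: "x i \<in> KS (Q i)" "x i \<in> carrier R" if "x \<in> carrier ?G" "i \<le> k" for x i
  proof -
    show "x i \<in> KS (Q i)" using that unfolding car by (auto simp: PiE_iff)
    then show "x i \<in> carrier R" by (rule KS_carrier)
  qed
  have \<phi>_carrier: "?\<phi> x \<in> carrier R" if "x \<in> carrier ?G" for x
    using xc(2)[OF that] by (intro finsum_closed) auto
  have em_\<phi>: "em R (?\<phi> x) = (\<Sum>i\<le>k. em R (x i))" if "x \<in> carrier ?G" for x
    using xc(2)[OF that] by (intro em_sum) auto
  have E_\<phi>: "D.E (Q j) * em R (?\<phi> x) = em R (x j)" if x: "x \<in> carrier ?G" and j: "j \<le> k" for x j
  proof -
    have "D.E (Q j) * em R (x i) = (if i = j then em R (x j) else 0)" if i: "i \<le> k" for i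
    proof (cases "i = j")
      case True then show ?thesis using KS_em xc(1)[OF x j] by simp
    next
      case False
      then have "Q j \<inter> Q i = {}" using disj i j by (auto simp: disjoint_family_on_def)
      then show ?thesis using E_disjoint_em[OF QP[OF i] QP[OF j] _ xc(1)[OF x i]] False by simp
    qed
    then have "D.E (Q j) * em R (?\<phi> x) = (\<Sum>i\<le>k. if i = j then em R (x j) else 0)"
      unfolding em_\<phi>[OF x] sum_distrib_left by (intro sum.cong) auto
    then show ?thesis using j by simp
  qed
  have Qall: "(\<Union>i\<le>k. Q i) = PP"
  proof -
    have "{..k} = insert 0 {1..k}" by auto
    then have "(\<Union>i\<le>k. Q i) = s.Q0 \<union> \<Union>(Q ` {1..k})" using Q0 by simp
    then show ?thesis unfolding Qk s.DD_union using s.Q0_P by blast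
  qed
  have inj: "inj_on ?\<phi> (carrier ?G)"
  proof (rule inj_onI)
    fix x y assume xy: "x \<in> carrier ?G" "y \<in> carrier ?G" "?\<phi> x = ?\<phi> y"
    show "x = y"
    proof (rule PiE_ext[OF xy(1)[unfolded car] xy(2)[unfolded car]])
      fix i assume "i \<in> {..k}"
      then have i: "i \<le> k" by simp
      have "em R (x i) = em R (y i)" using E_\<phi>[OF xy(1) i] E_\<phi>[OF xy(2) i] xy(3) by simp
      then show "x i = y i" using em_eq_iff[OF xc(2)[OF xy(1) i] xc(2)[OF xy(2) i]] by blast
    qed
  qed
  have surj: "\<exists>x\<in>carrier ?G. ?\<phi> x = y" if y: "y \<in> carrier R" for y
  proof -
    define x where "x = (\<lambda>i\<in>{..k}. wS (Q i) \<otimes> y)"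
    have x: "x \<in> carrier ?G"
      unfolding car x_def using KS_closed(2,5)[OF QP] y by (auto simp: PiE_iff)
    have "em R (?\<phi> x) = (\<Sum>i\<le>k. D.E (Q i) * em R y)"
      unfolding em_\<phi>[OF x] using wS[OF QP] y by (intro sum.cong) (auto simp: x_def em_mult)
    also have "\<dots> = (\<Sum>i\<le>k. D.E (Q i)) * em R y" by (simp add: sum_distrib_right)
    also have "(\<Sum>i\<le>k. D.E (Q i)) = D.E PP"
      unfolding D.E_def Qall[symmetric]
      by (rule sum.UNION_disjoint[symmetric])
        (use disj finite_PP finite_subset[OF QP] in \<open>auto simp: disjoint_family_on_def\<close>)
    also have "D.E PP * em R y = em R y" unfolding E_PP using y by simp
    finally have "?\<phi> x = y" using em_eq_iff[OF \<phi>_carrier[OF x] y] by blast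
    then show ?thesis using x by blast
  qed
  have blk_\<phi>: "?\<phi> y \<in> blk (?\<phi> x) \<longleftrightarrow> (\<forall>i\<le>k. y i \<in> blk (x i))" if x: "x \<in> carrier ?G" and y: "y \<in> carrier ?G" for x y
  proof -
    have "?\<phi> y \<in> blk (?\<phi> x) \<longleftrightarrow> (\<forall>d\<in>Q ` {1..k}. D.E d * em R (?\<phi> y) = 0 \<longleftrightarrow> D.E d * em R (?\<phi> x) = 0) \<and>
        D.E (Q 0) * em R (?\<phi> y) \<in> bl (D.E (Q 0) * em R (?\<phi> x))"
      unfolding Qk Q0 by (rule bl_comp_iff[OF \<phi>_carrier[OF x] \<phi>_carrier[OF y]])
    also have "\<dots> \<longleftrightarrow> (\<forall>i\<in>{1..k}. y i \<in> blk (x i)) \<and> y 0 \<in> blk (x 0)"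
    proof (intro conj_cong)
      show "D.E (Q 0) * em R (?\<phi> y) \<in> bl (D.E (Q 0) * em R (?\<phi> x)) \<longleftrightarrow> y 0 \<in> blk (x 0)"
        unfolding E_\<phi>[OF x le0] E_\<phi>[OF y le0] by (rule bl_em_iff[OF xc(2)[OF x le0] xc(2)[OF y le0]])
      have "(D.E (Q i) * em R (?\<phi> y) = 0 \<longleftrightarrow> D.E (Q i) * em R (?\<phi> x) = 0) \<longleftrightarrow> y i \<in> blk (x i)"
        if i: "i \<in> {1..k}" for i
      proof -
        have ik: "i \<le> k" and d: "Q i \<in> s.DD" using i Qk by auto
        show ?thesis
          unfolding E_\<phi>[OF x ik] E_\<phi>[OF y ik] blk_DD[OF d xc(1)[OF x ik] xc(1)[OF y ik]]
            em_eq0[OF xc(2)[OF x ik]] em_eq0[OF xc(2)[OF y ik]] ..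
      qed
      then show "(\<forall>d\<in>Q ` {1..k}. D.E d * em R (?\<phi> y) = 0 \<longleftrightarrow> D.E d * em R (?\<phi> x) = 0) \<longleftrightarrow>
          (\<forall>i\<in>{1..k}. y i \<in> blk (x i))" by simp
    qed
    also have "\<dots> \<longleftrightarrow> (\<forall>i\<le>k. y i \<in> blk (x i))"
      by (metis One_nat_def Suc_leI atLeastAtMost_iff le0 neq0_conv)
    finally show ?thesis .
  qed
  have part: "partition_on (KS (Q i)) (BSS (Q i))" if "i \<in> {..k}" for i using BSS_part cl that by simp
  note boxes = boxes_partition[OF finite_atMost part BSS_fin]
  have box: "?\<phi> ` Pi\<^sub>E {..k} (\<lambda>i. blk (x i)) = blk (?\<phi> x)" if x: "x \<in> carrier ?G" for x
  proof (intro Set.set_eqI iffI)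
    have sub: "y \<in> carrier ?G" if y: "y \<in> Pi\<^sub>E {..k} (\<lambda>i. blk (x i))" for y
    proof -
      have "blk (x i) \<subseteq> KS (Q i)" if "i \<le> k" for i using cl[OF that] xc(1)[OF x that] by (simp add: closed_comp_def)
      then show ?thesis unfolding car using y by (fastforce simp: PiE_iff)
    qed
    fix z
    show "z \<in> blk (?\<phi> x)" if "z \<in> ?\<phi> ` Pi\<^sub>E {..k} (\<lambda>i. blk (x i))"
    proof -
      obtain y where y: "y \<in> Pi\<^sub>E {..k} (\<lambda>i. blk (x i))" "z = ?\<phi> y" using \<open>z \<in> ?\<phi> ` Pi\<^sub>E {..k} (\<lambda>i. blk (x i))\<close> by blast
      then show ?thesis using blk_\<phi>[OF x sub[OF y(1)]] by (auto simp: PiE_iff)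
    qed
    show "z \<in> ?\<phi> ` Pi\<^sub>E {..k} (\<lambda>i. blk (x i))" if z: "z \<in> blk (?\<phi> x)"
    proof -
      have "z \<in> carrier R" using z blk_sub[OF \<phi>_carrier[OF x]] by blast
      then obtain y where y: "y \<in> carrier ?G" "?\<phi> y = z" using surj by blast
      then have "\<forall>i\<le>k. y i \<in> blk (x i)" using blk_\<phi>[OF x y(1)] z by simp
      then have "y \<in> Pi\<^sub>E {..k} (\<lambda>i. blk (x i))" using y(1) unfolding car by (auto simp: PiE_iff)
      then show ?thesis using y(2) by blast
    qed
  qed
  have image: "BS = (\<lambda>X. ?\<phi> ` X) ` ?T"
  proof (intro Set.set_eqI iffI)
    fix Y assume Y: "Y \<in> BS"
    obtain z where z: "z \<in> Y" using Y BS_ne by (metis all_not_in_conv)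
    then obtain x where x: "x \<in> carrier ?G" "?\<phi> x = z" using surj Y BS_sub by blast
    have "Pi\<^sub>E {..k} (\<lambda>i. blk (x i)) \<in> ?T" using blk_BSS[OF cl xc(1)[OF x(1)]] by auto
    moreover have "Y = ?\<phi> ` Pi\<^sub>E {..k} (\<lambda>i. blk (x i))" using box[OF x(1)] x(2) blk_eqI[OF Y z] by simp
    ultimately show "Y \<in> (\<lambda>X. ?\<phi> ` X) ` ?T" by blast
  next
    fix Y assume "Y \<in> (\<lambda>X. ?\<phi> ` X) ` ?T"
    then obtain X where X: "\<forall>i\<in>{..k}. X i \<in> BSS (Q i)" "Y = ?\<phi> ` Pi\<^sub>E {..k} X" by blast
    have "\<forall>i\<in>{..k}. \<exists>z. z \<in> X i"
    proof
      fix i assume "i \<in> {..k}"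
      then have "X i \<noteq> {}" using X(1) BSS_ne by metis
      then show "\<exists>z. z \<in> X i" by blast
    qed
    then obtain x0 where x0: "\<forall>i\<in>{..k}. x0 i \<in> X i" by (auto simp: bchoice_iff)
    define x where "x = restrict x0 {..k}"
    have xX: "x i \<in> X i" if "i \<in> {..k}" for i using x0 that by (simp add: x_def)
    have "X i \<subseteq> KS (Q i)" if "i \<in> {..k}" for i using X(1) that by (simp add: BSS_def)
    then have x: "x \<in> carrier ?G" unfolding car using xX by (auto simp: PiE_iff x_def)
    have "Pi\<^sub>E {..k} X = Pi\<^sub>E {..k} (\<lambda>i. blk (x i))"
      using blk_eqI[OF BSS_BS xX] X(1) by (intro PiE_cong) metis
    then have "Y = blk (?\<phi> x)" using X(2) box[OF x] by simp
    then show "Y \<in> BS" using blk(1)[OF \<phi>_carrier[OF x]] by simp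
  qed
  have "S_ring_tensor {..k} (\<lambda>i. add_monoid (RC (Q i))) (\<lambda>i. BB (Q i)) = int_span (indicator ` ?T)"
  proof -
    have "{Pi\<^sub>E {..k} X | X. \<forall>i\<in>{..k}. X i \<in> basic_sets (add_monoid (RC (Q i))) (BB (Q i))} = ?T"
      using BB_basic_sets[OF cl] by auto
    then show ?thesis by (simp only: S_ring_tensor_def)
  qed
  then have "group_ring_map ?G ?\<phi> ` S_ring_tensor {..k} (\<lambda>i. add_monoid (RC (Q i))) (\<lambda>i. BB (Q i)) = int_span (indicator ` BS)"
    using group_ring_map_int_span[OF inj boxes(1,2) _ BS_fin BS_disj image] boxes(3) car by simp
  also have "\<dots> = A" using BS_basic by (simp add: is_basic_partition_def int_basis_def)
  finally show ?thesis by (rule sym)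
qed

end

theorem theorem8p1:
  fixes R :: "('a, 'm) ring_scheme" and A :: "('a \<Rightarrow> int) set"
  assumes "CG_ring R" and "odd (ring_characteristic R)"
    and "ring_S_ring R A" and "pure_S_ring R A"
  shows "\<exists>(k::nat) (Q :: nat \<Rightarrow> nat set) (B :: nat \<Rightarrow> ('a \<Rightarrow> int) set).
           (\<Union>i\<le>k. Q i) = ring_primes R \<and> disjoint_family_on Q {..k} \<and>
           ring_S_ring (ring_components R (Q 0)) (B 0) \<and>
           dense_S_ring (ring_components R (Q 0)) (B 0) \<and>
           pure_S_ring (ring_components R (Q 0)) (B 0) \<and>
           (\<forall>i\<in>{1..k}.
              Q i \<noteq> {} \<and> \<not> field (ring_components R (Q i)) \<and>
              ring_S_ring (ring_components R (Q i)) (B i) \<and>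
              S_ring_rank (add_monoid (ring_components R (Q i))) (B i) = 2) \<and>
           A = group_ring_map
                 (product_group {..k} (\<lambda>i. add_monoid (ring_components R (Q i))))
                 (\<lambda>x. \<Oplus>\<^bsub>R\<^esub>i\<in>{..k}. x i) `
               S_ring_tensor {..k} (\<lambda>i. add_monoid (ring_components R (Q i))) B"
proof -
  interpret cg_S_ring R A
    using assms by (intro cg_S_ring.intro cg_ring.intro cg_ring_axioms.intro cg_S_ring_axioms.intro)
      (auto simp: CG_ring_def)
  \<comment> \<open>The blocks are numbered from 1, as index 0 is reserved for \<open>Q0\<close>,
    which may be empty.\<close>
  obtain h where h: "bij_betw h {1..card s.DD} s.DD" using ex_bij_betw_nat_finite_1[OF s.DD_finite] by blast
  let ?k = "card s.DD"
  define Q where "Q i = (if i = 0 then s.Q0 else h i)" for i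
  have Q0: "Q 0 = s.Q0" by (simp add: Q_def)
  have Qh: "Q i = h i" if "i \<in> {1..?k}" for i using that by (simp add: Q_def)
  have Qk: "Q ` {1..?k} = s.DD" using h Qh by (simp add: bij_betw_def)
  have QD: "Q i \<in> s.DD" if "i \<in> {1..?k}" for i using that Qk by blast
  have disj: "disjoint_family_on Q {..?k}"
    unfolding disjoint_family_on_def
  proof (intro ballI impI)
    fix i j assume ij: "i \<in> {..?k}" "j \<in> {..?k}" "i \<noteq> j"
    consider "i = 0" "j \<in> {1..?k}" | "j = 0" "i \<in> {1..?k}" | "i \<in> {1..?k}" "j \<in> {1..?k}"
      using ij by fastforce
    then show "Q i \<inter> Q j = {}"
    proof cases
      case 1 then show ?thesis using DD_Q0[OF QD] Q0 by blast
    next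
      case 2 then show ?thesis using DD_Q0[OF QD] Q0 by blast
    next
      case 3
      then have "Q i \<noteq> Q j" using h ij(3) Qh by (metis bij_betw_def inj_on_def)
      then show ?thesis using s.DD_disj QD 3 by blast
    qed
  qed
  have union: "(\<Union>i\<le>?k. Q i) = ring_primes R"
  proof -
    have "{..?k} = insert 0 {1..?k}" by auto
    then have "(\<Union>i\<le>?k. Q i) = s.Q0 \<union> \<Union>(Q ` {1..?k})" using Q0 by simp
    then show ?thesis unfolding Qk s.DD_union using s.Q0_P by blast
  qed
  show ?thesis
  proof (intro exI[of _ ?k] exI[of _ Q] exI[of _ "\<lambda>i. BB (Q i)"] conjI ballI)
    fix i assume "i \<in> {1..?k}"
    from QD[OF this] have d: "Q i \<in> s.DD" .
    show "Q i \<noteq> {}" by (rule s.DD_ne[OF d])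
    show "\<not> field (RC (Q i))" by (rule DD_not_field[OF d])
    show "ring_S_ring (RC (Q i)) (BB (Q i))" by (rule BB_ring_S_ring[OF closed_DD[OF d]])
    show "S_ring_rank (add_monoid (RC (Q i))) (BB (Q i)) = 2" by (rule DD_rank[OF d])
  qed (use union disj in \<open>simp_all only: Q0 BB_ring_S_ring[OF closed_Q0] dense_comp pure_comp tensor_eq[OF Q0 Qk disj, symmetric]\<close>)
qed

end
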